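(* Let $n\in\{1,2\}$, $\mathrm g(x,u)=\log|x-u|^{-1}$ and $\vartheta(x)=\log(1+|x|)$ for $x,u\in\mathbb R^n$. Suppose that $V:\mathbb R^n\to(-\infty,+\infty]$ is continuous on $\mathscr S_V=\{V<+\infty\}$ and that for all $\kappa\ge0$, $$\inf_{x\in\mathscr S_V}\{V(x)-\kappa\vartheta(x)\}>-\infty\qquad\text{and}\qquad\int|x|^\kappa e^{-V(x)}dx<+\infty .$$ Consider the Gibbs measure on $(\mathbb R^n)^N$ $$\mathbb P_N[d\mathbf x]=\frac1{\mathrm Z_N^{(V)}}\exp\Big(-\beta\sum_{1\le i<j\le N}\mathrm g(x_i,x_j)-\sum_{j=1}^NV(x_j)\Big)dx_1\cdots dx_N .$$ Then, for any $E\in\mathscr S_V$, under $\mathbb P_N$ the point process $\Xi_N=\sum_{j=1}^N\boldsymbol\delta_{N^{1/n}(x_j-E)}$ converges weakly (in distribution), as $N\to+\infty$ and $N\beta\to\gamma$ with $\gamma\ge0$, to a homogeneous Poisson point process on $\mathbb R^n$.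
   Context: Here $\beta=\beta_N>0$ may depend on $N$, $\mathrm Z_N^{(V)}$ is the normalizing constant, $dx$ is Lebesgue measure, $|\cdot|$ is the Euclidean norm, and $e^{-V}=0$ on $\{V=+\infty\}$. The set $\mathscr S_V$ is assumed open and nonempty. A sequence $\Xi_N$ of point processes on $\mathbb R^n$ converges in distribution to $\Xi$ if $\mathbb E[e^{-\Xi_N(f)}]\to\mathbb E[e^{-\Xi(f)}]$ for every continuous compactly supported $f:\mathbb R^n\to[0,+\infty)$. A homogeneous Poisson point process is one with $\mathbb E[e^{-\Xi(f)}]=\exp\big(\theta\int(e^{-f(x)}-1)dx\big)$ for some constant intensity $\theta>0$. *)

theory Defs
  imports "HOL-Probability.Probability"
begin

text \<open>The Boltzmann factor \<open>e\<^sup>-\<^sup>h\<close> of an extended real, with \<open>e\<^sup>-\<^sup>h = 0\<close> for \<open>h = +\<infinity>\<close>.\<close>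

definition exp_neg :: "ereal \<Rightarrow> ennreal" where
  "exp_neg h = (case h of ereal r \<Rightarrow> ennreal (exp (- r)) | PInfty \<Rightarrow> 0 | MInfty \<Rightarrow> \<infinity>)"

definition finite_region :: "('a \<Rightarrow> ereal) \<Rightarrow> 'a set" where
  "finite_region V = {x. V x < \<infinity>}"

text \<open>The value \<open>+\<infinity>\<close> on the diagonal is written out, because \<open>ln (inverse 0) = 0\<close> in the library.\<close>

definition log_kernel :: "'a::euclidean_space \<Rightarrow> 'a \<Rightarrow> ereal" where
  "log_kernel x u = (if x = u then \<infinity> else ereal (ln (inverse (norm (x - u)))))"

definition log_weight :: "'a::euclidean_space \<Rightarrow> real" where
  "log_weight x = ln (1 + norm x)"

text \<open>Neither \<^const>\<open>log_kernel\<close> nor an admissible potential takes the value \<open>-\<infinity>\<close>, so for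
  \<open>\<beta> > 0\<close> the sums below never involve \<open>\<infinity> - \<infinity>\<close>.\<close>

definition gibbs_energy ::
  "('a::euclidean_space \<Rightarrow> ereal) \<Rightarrow> real \<Rightarrow> nat \<Rightarrow> (nat \<Rightarrow> 'a) \<Rightarrow> ereal" where
  "gibbs_energy V \<beta> N x =
     ereal \<beta> * (\<Sum>j\<in>{1..N}. \<Sum>i\<in>{1..<j}. log_kernel (x i) (x j)) + (\<Sum>j\<in>{1..N}. V (x j))"

definition gibbs_partition :: "('a::euclidean_space \<Rightarrow> ereal) \<Rightarrow> real \<Rightarrow> nat \<Rightarrow> ennreal" where
  "gibbs_partition V \<beta> N =
     (\<integral>\<^sup>+x. exp_neg (gibbs_energy V \<beta> N x) \<partial>(\<Pi>\<^sub>M j\<in>{1..N}. lborel))"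

definition gibbs_measure ::
  "('a::euclidean_space \<Rightarrow> ereal) \<Rightarrow> real \<Rightarrow> nat \<Rightarrow> (nat \<Rightarrow> 'a) measure" where
  "gibbs_measure V \<beta> N =
     density (\<Pi>\<^sub>M j\<in>{1..N}. lborel)
       (\<lambda>x. exp_neg (gibbs_energy V \<beta> N x) / gibbs_partition V \<beta> N)"

text \<open>A point process is a random locally finite integer-valued measure.\<close>

definition point_process ::
  "'w measure \<Rightarrow> ('w \<Rightarrow> 'a::euclidean_space measure) \<Rightarrow> bool" where
  "point_process M \<Xi> \<longleftrightarrow>
     prob_space M \<and>
     (\<forall>\<omega>\<in>space M. sets (\<Xi> \<omega>) = sets borel) \<and>
     (\<forall>\<omega>\<in>space M. \<forall>B\<in>sets borel. bounded B \<longrightarrow> (\<exists>k::nat. emeasure (\<Xi> \<omega>) B = of_nat k)) \<and>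
     (\<forall>B\<in>sets borel. (\<lambda>\<omega>. emeasure (\<Xi> \<omega>) B) \<in> borel_measurable M)"

definition test_functions :: "('a::euclidean_space \<Rightarrow> real) set" where
  "test_functions =
     {f. continuous_on UNIV f \<and> (\<forall>x. 0 \<le> f x) \<and> compact (closure {x. f x \<noteq> 0})}"

definition laplace_functional ::
  "'w measure \<Rightarrow> ('w \<Rightarrow> 'a::euclidean_space measure) \<Rightarrow> ('a \<Rightarrow> real) \<Rightarrow> real" where
  "laplace_functional M \<Xi> f = (\<integral>\<omega>. exp (- (\<integral>x. f x \<partial>(\<Xi> \<omega>))) \<partial>M)"

definition converges_in_distribution ::
  "(nat \<Rightarrow> 'w measure) \<Rightarrow> (nat \<Rightarrow> 'w \<Rightarrow> 'a::euclidean_space measure) \<Rightarrow>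
   'v measure \<Rightarrow> ('v \<Rightarrow> 'a measure) \<Rightarrow> bool" where
  "converges_in_distribution M \<Xi> M' \<Xi>' \<longleftrightarrow>
     (\<forall>N. point_process (M N) (\<Xi> N)) \<and> point_process M' \<Xi>' \<and>
     (\<forall>f\<in>test_functions.
        (\<lambda>N. laplace_functional (M N) (\<Xi> N) f) \<longlonglongrightarrow> laplace_functional M' \<Xi>' f)"

definition homogeneous_poisson_process ::
  "'w measure \<Rightarrow> ('w \<Rightarrow> 'a::euclidean_space measure) \<Rightarrow> bool" where
  "homogeneous_poisson_process M \<Xi> \<longleftrightarrow>
     point_process M \<Xi> \<and>
     (\<exists>\<theta>>0. \<forall>f\<in>test_functions.
        laplace_functional M \<Xi> f = exp (\<theta> * (\<integral>x. (exp (- f x) - 1) \<partial>lborel)))"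

text \<open>The image of the counting measure on \<open>{1..N}\<close> is the sum of the Dirac masses at the rescaled
  points, with multiplicity.\<close>

definition rescaled_process ::
  "'a::euclidean_space \<Rightarrow> nat \<Rightarrow> (nat \<Rightarrow> 'a) \<Rightarrow> 'a measure" where
  "rescaled_process E N x =
     distr (count_space {1..N}) borel (\<lambda>j. (real N powr (1 / real DIM('a))) *\<^sub>R (x j - E))"

end

theory Submission
  imports Defs
begin

text \<open>Let \<open>\<rho>\<close> be an equilibrium density, that is, \<open>\<rho> = e\<^sup>-\<^sup>V exp (\<gamma> \<integral>log \<bar>x - u\<bar> \<rho>(u) du) / Z\<close>; it exists
  as a minimiser of the free energy, which is strictly convex because \<open>log \<bar>x - u\<bar>\<close> is conditionally
  negative definite. The Gibbs measure has a density \<open>w\<close> with respect to \<open>N\<close> independent points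
  distributed according to \<open>\<rho>\<close>, and \<open>w\<close> is the exponential of a pair interaction centred at \<open>\<rho>\<close>. By
  Jensen's inequality its mass is at least \<open>e\<^sup>-\<^sup>o\<^sup>(\<^sup>N\<^sup>)\<close>, and by conditional negative definiteness \<open>w\<close> is at
  most \<open>exp (o(1) \<Sum>(1 + log (1 + \<bar>x\<^sub>i\<bar>)))\<close>. For independent points the field that the other \<open>N - 1\<close> points
  exert at a given place deviates from its mean with exponentially small probability, and the two
  bounds transfer this to the weight \<open>w\<close>. Hence, given the other points, each point is asymptotically
  distributed according to \<open>\<rho>\<close>, so switching on \<open>f\<close> at one point multiplies the mass by
  \<open>1 - (1 + o(1)) \<integral>(1 - e\<^sup>-\<^sup>f\<^sup>(\<^sup>z\<^sup>)) \<rho>(E) dz / N\<close>. The product of these \<open>N\<close> factors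
  tends to the Laplace functional of a Poisson process of intensity \<open>\<rho>(E)\<close>. Uniqueness of
  \<open>\<rho>\<close> is not needed.\<close>

section \<open>Conditional negative definiteness of the logarithm\<close>

text \<open>Both bounds on \<open>w\<close> lose a factor exponential in o(n), whereas a Laplace
  functional is of order one, so the masses with and without f cannot be compared directly. In the
  ratios that arise from switching f on at a single point, the same unknown mass stands above and
  below; the losses then only have to be beaten by a deviation bound of order exp(-cn). Each ratio
  needs relative accuracy o(1), but uniformly in the point and in the points already switched. Hence
  the estimates quantify over arbitrary nonnegative one-point functions of bounded total mean. Two
  features of the logarithm shape the rest. It is unbounded at infinity: the moments of the
  reference measure pay for this, and for a far away point concentration of the field is replaced by
  polynomial domination. It is singular on the diagonal, where an empirical measure has infinite
  self-energy: the kernel is regularised to ln (eps^2 + |x - y|^2) / 2, with an error of order sqrt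
  eps times |x - y|^(-1/2), a singularity that is integrable in every dimension.\<close>

lemma (in prob_space) abs_integral_le:
  fixes g :: "'a \<Rightarrow> real"
  assumes "\<And>y. \<bar>g y\<bar> \<le> c" "g \<in> borel_measurable M"
  shows "\<bar>\<integral>y. g y \<partial>M\<bar> \<le> c"
proof -
  have i: "integrable M g"
    by (rule integrable_const_bound[of _ c]) (auto simp: assms)
  have "\<bar>\<integral>y. g y \<partial>M\<bar> \<le> (\<integral>y. \<bar>g y\<bar> \<partial>M)" using integral_norm_bound[of M g] by simp
  also have "\<dots> \<le> (\<integral>y. c \<partial>M)"
    by (rule integral_mono) (use assms i in auto)
  finally show ?thesis by (simp add: prob_space)
qed

text \<open>Powers of an inner product are positive definite kernels; the expression is their
  quadratic form at the signed measure F (P - Q). One factor of the power is expanded in the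
  orthonormal basis, and its two coordinates are absorbed into \<open>F x\<close> and
  \<open>F y\<close>. The induction therefore carries a weight \<open>F\<close>, although the
  application has \<open>F = 1\<close>.\<close>

lemma inner_power_double_integral_nonneg:
  fixes \<psi> :: "'a::euclidean_space \<Rightarrow> 'b::euclidean_space" and F :: "'a \<Rightarrow> real"
  assumes P: "prob_space P" "sets P = sets borel" and Q: "prob_space Q" "sets Q = sets borel"
    and [measurable]: "\<psi> \<in> borel_measurable borel" "F \<in> borel_measurable borel"
    and bd: "\<And>x. norm (\<psi> x) \<le> 1" "\<And>x. \<bar>F x\<bar> \<le> B"
  shows "0 \<le> (\<integral>x. \<integral>y. F x * F y * (\<psi> x \<bullet> \<psi> y) ^ k \<partial>P \<partial>P) + (\<integral>x. \<integral>y. F x * F y * (\<psi> x \<bullet> \<psi> y) ^ k \<partial>Q \<partial>Q)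
     - 2 * (\<integral>x. \<integral>y. F x * F y * (\<psi> x \<bullet> \<psi> y) ^ k \<partial>Q \<partial>P)"
  using assms(6-)
proof (induction k arbitrary: F)
  case 0
  note [measurable] = 0(1)
  have "0 \<le> ((\<integral>x. F x \<partial>P) - (\<integral>x. F x \<partial>Q))\<^sup>2" by simp
  also have "\<dots> = (\<integral>x. F x \<partial>P) * (\<integral>x. F x \<partial>P) + (\<integral>x. F x \<partial>Q) * (\<integral>x. F x \<partial>Q) - 2 * ((\<integral>x. F x \<partial>P) * (\<integral>x. F x \<partial>Q))"
    unfolding power2_diff by (simp add: power2_eq_square)
  finally show ?case by simp
next
  case (Suc k)
  note [measurable] = Suc.prems(1) assms(5)
  have [measurable_cong]: "sets P = sets borel" "sets Q = sets borel" by fact+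
  have B: "0 \<le> B" using Suc.prems(3)[of undefined] by linarith
  define G where "G b x = F x * (\<psi> x \<bullet> b)" for b x
  have G[measurable]: "G b \<in> borel_measurable borel" for b unfolding G_def by measurable
  have Gb: "\<bar>G b x\<bar> \<le> B" if "b \<in> Basis" for b x
  proof -
    have "\<bar>\<psi> x \<bullet> b\<bar> \<le> 1" using Basis_le_norm[OF that, of "\<psi> x"] Suc.prems(2)[of x] by linarith
    then show ?thesis using Suc.prems(3)[of x] B mult_mono[of "\<bar>F x\<bar>" B "\<bar>\<psi> x \<bullet> b\<bar>" 1] by (simp add: G_def abs_mult)
  qed
  have pw: "\<bar>(\<psi> x \<bullet> \<psi> y) ^ k\<bar> \<le> 1" for x y
  proof -
    have "\<bar>\<psi> x \<bullet> \<psi> y\<bar> \<le> norm (\<psi> x) * norm (\<psi> y)" by (rule Cauchy_Schwarz_ineq2)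
    also have "\<dots> \<le> 1" using Suc.prems(2) by (simp add: mult_le_one)
    finally show ?thesis by (simp add: power_abs power_le_one)
  qed
  have bnd: "\<bar>G b x * G b y * (\<psi> x \<bullet> \<psi> y) ^ k\<bar> \<le> B * B" if "b \<in> Basis" for b x y
  proof -
    have "\<bar>G b x\<bar> * \<bar>G b y\<bar> * \<bar>(\<psi> x \<bullet> \<psi> y) ^ k\<bar> \<le> B * B * 1"
      by (intro mult_mono Gb that pw) (auto simp: B)
    then show ?thesis by (simp add: abs_mult)
  qed
  have split: "(\<integral>x. \<integral>y. F x * F y * (\<psi> x \<bullet> \<psi> y) ^ Suc k \<partial>M2 \<partial>M1)
     = (\<Sum>b\<in>Basis. \<integral>x. \<integral>y. G b x * G b y * (\<psi> x \<bullet> \<psi> y) ^ k \<partial>M2 \<partial>M1)"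
    if "prob_space M1" "prob_space M2" and [measurable_cong]: "sets M1 = sets borel" "sets M2 = sets borel" for M1 M2
  proof -
    interpret M1: prob_space M1 by fact
    interpret M2: prob_space M2 by fact
    interpret MM: pair_prob_space M1 M2 ..
    have eq: "F x * F y * (\<psi> x \<bullet> \<psi> y) ^ Suc k = (\<Sum>b\<in>Basis. G b x * G b y * (\<psi> x \<bullet> \<psi> y) ^ k)" for x y
    proof -
      have "F x * F y * (\<psi> x \<bullet> \<psi> y) ^ Suc k = (\<psi> x \<bullet> \<psi> y) * (F x * F y * (\<psi> x \<bullet> \<psi> y) ^ k)"
        by simp
      also have "\<dots> = (\<Sum>b\<in>Basis. (\<psi> x \<bullet> b) * (\<psi> y \<bullet> b) * (F x * F y * (\<psi> x \<bullet> \<psi> y) ^ k))"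
        by (subst euclidean_inner) (simp only: sum_distrib_right)
      also have "\<dots> = (\<Sum>b\<in>Basis. G b x * G b y * (\<psi> x \<bullet> \<psi> y) ^ k)"
        by (rule sum.cong) (simp_all add: G_def mult_ac)
      finally show ?thesis .
    qed
    have i1: "integrable M2 (\<lambda>y. G b x * G b y * (\<psi> x \<bullet> \<psi> y) ^ k)" if "b \<in> Basis" for b x
      by (rule M2.integrable_const_bound[of _ "B*B"]) (use bnd[OF that] in auto)
    have i2: "integrable M1 (\<lambda>x. \<integral>y. G b x * G b y * (\<psi> x \<bullet> \<psi> y) ^ k \<partial>M2)" if "b \<in> Basis" for b
    proof -
      have "integrable (M1 \<Otimes>\<^sub>M M2) (\<lambda>(x,y). G b x * G b y * (\<psi> x \<bullet> \<psi> y) ^ k)"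
        by (rule MM.P.integrable_const_bound[of _ "B*B"]) (use bnd[OF that] in auto)
      from MM.integrable_fst'[OF this] show ?thesis by simp
    qed
    show ?thesis
      unfolding eq using i1 i2 by (simp add: Bochner_Integration.integral_sum)
  qed
  have *: "0 \<le> (\<integral>x. \<integral>y. G b x * G b y * (\<psi> x \<bullet> \<psi> y) ^ k \<partial>P \<partial>P) + (\<integral>x. \<integral>y. G b x * G b y * (\<psi> x \<bullet> \<psi> y) ^ k \<partial>Q \<partial>Q)
     - 2 * (\<integral>x. \<integral>y. G b x * G b y * (\<psi> x \<bullet> \<psi> y) ^ k \<partial>Q \<partial>P)" if "b \<in> Basis" for b
    by (rule Suc.IH[OF G Suc.prems(2) Gb[OF that]])
  show ?case
    unfolding split[OF P(1) P(1) P(2) P(2)] split[OF Q(1) Q(1) Q(2) Q(2)] split[OF P(1) Q(1) P(2) Q(2)]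
    unfolding sum_distrib_left sum.distrib[symmetric] sum_subtractf[symmetric] by (rule sum_nonneg[OF *])
qed

section \<open>The logarithm regularised at a scale eps\<close>

definition reg_log :: "real \<Rightarrow> 'a::euclidean_space \<Rightarrow> 'a \<Rightarrow> real" where
  "reg_log \<epsilon> x y = ln (\<epsilon>\<^sup>2 + (norm (x - y))\<^sup>2) / 2"

definition reg_weight :: "real \<Rightarrow> 'a::euclidean_space \<Rightarrow> real" where
  "reg_weight \<epsilon> x = (\<epsilon>\<^sup>2 + (norm x)\<^sup>2) / \<epsilon>"

text \<open>With p the weight \<open>reg_weight \<epsilon>\<close>, the product p(x) p(y) is eps^2 +
  |x|^2 + |y|^2 + |x|^2 |y|^2 / eps^2. It exceeds eps^2 + |x - y|^2 by |x|^2 |y|^2 / eps^2 + 2 x.y,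
  which is an inner product of vectors with one extra coordinate. Divided by the weights, these
  vectors lie in the open unit ball, so the regularised logarithm becomes a sum of one-point terms
  and of ln (1 - s) / 2 with |s| < 1.\<close>

definition reg_feature :: "real \<Rightarrow> 'a::euclidean_space \<Rightarrow> real \<times> 'a" where
  "reg_feature \<epsilon> x = ((norm x)\<^sup>2 / \<epsilon> / reg_weight \<epsilon> x, (sqrt 2 / reg_weight \<epsilon> x) *\<^sub>R x)"

lemma reg_weight_pos: "\<epsilon> > 0 \<Longrightarrow> reg_weight \<epsilon> x > 0"
  unfolding reg_weight_def by (simp add: add_pos_nonneg)

lemma reg_feature_inner:
  assumes "\<epsilon> > 0"
  shows "\<epsilon>\<^sup>2 + (norm (x - y))\<^sup>2 = reg_weight \<epsilon> x * reg_weight \<epsilon> y * (1 - reg_feature \<epsilon> x \<bullet> reg_feature \<epsilon> y)"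
proof -
  have p: "reg_weight \<epsilon> x > 0" "reg_weight \<epsilon> y > 0" using assms reg_weight_pos by auto
  have "reg_weight \<epsilon> x * reg_weight \<epsilon> y * (reg_feature \<epsilon> x \<bullet> reg_feature \<epsilon> y)
      = (norm x)\<^sup>2 / \<epsilon> * ((norm y)\<^sup>2 / \<epsilon>) + 2 * (x \<bullet> y)"
    using p by (simp add: reg_feature_def field_simps)
  moreover have "reg_weight \<epsilon> x * reg_weight \<epsilon> y = \<epsilon>\<^sup>2 + (norm x)\<^sup>2 + (norm y)\<^sup>2 + (norm x)\<^sup>2 / \<epsilon> * ((norm y)\<^sup>2 / \<epsilon>)"
    using assms by (simp add: reg_weight_def field_simps power2_eq_square)
  moreover have "(norm (x - y))\<^sup>2 = (norm x)\<^sup>2 + (norm y)\<^sup>2 - 2 * (x \<bullet> y)"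
    by (simp add: power2_norm_eq_inner inner_diff_left inner_diff_right inner_commute)
  ultimately show ?thesis
    unfolding right_diff_distrib by linarith
qed

lemma reg_feature_norm:
  assumes "\<epsilon> > 0"
  shows "(norm (reg_feature \<epsilon> x))\<^sup>2 = 1 - \<epsilon>\<^sup>2 / (reg_weight \<epsilon> x)\<^sup>2"
proof -
  have "\<epsilon>\<^sup>2 = (reg_weight \<epsilon> x)\<^sup>2 * (1 - (norm (reg_feature \<epsilon> x))\<^sup>2)"
    using reg_feature_inner[OF assms, of x x] unfolding power2_norm_eq_inner[of "reg_feature \<epsilon> x"]
    by (simp add: power2_eq_square[of "reg_weight \<epsilon> x"])
  then show ?thesis using reg_weight_pos[OF assms, of x] by (simp add: field_simps)
qed

text \<open>The arithmetic-geometric mean separates the two norms, and that of the vector at y is at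
  most 1. What remains of the gap to 1 depends on x alone, so for fixed x the logarithmic series is
  bounded uniformly in y.\<close>

lemma abs_reg_feature_inner:
  assumes "\<epsilon> > 0"
  shows "\<bar>reg_feature \<epsilon> x \<bullet> reg_feature \<epsilon> y\<bar> \<le> 1 - \<epsilon>\<^sup>2 / (2 * (reg_weight \<epsilon> x)\<^sup>2)"
proof -
  define a where "a = norm (reg_feature \<epsilon> x)"
  define b where "b = norm (reg_feature \<epsilon> y)"
  have "\<bar>reg_feature \<epsilon> x \<bullet> reg_feature \<epsilon> y\<bar> \<le> a * b" unfolding a_def b_def by (rule Cauchy_Schwarz_ineq2)
  also have "\<dots> \<le> (a\<^sup>2 + b\<^sup>2) / 2" using sum_squares_bound[of a b] by (simp add: field_simps)
  also have "b\<^sup>2 \<le> 1" unfolding b_def reg_feature_norm[OF assms] by simp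
  finally show ?thesis unfolding a_def reg_feature_norm[OF assms] by (simp add: field_simps)
qed

lemma norm_reg_feature_le_1:
  assumes "\<epsilon> > 0"
  shows "norm (reg_feature \<epsilon> x) \<le> 1"
proof -
  have "(norm (reg_feature \<epsilon> x))\<^sup>2 \<le> 1\<^sup>2" unfolding reg_feature_norm[OF assms] by simp
  then show ?thesis by (rule power2_le_imp_le) simp
qed

lemma reg_weight_measurable[measurable]: "reg_weight \<epsilon> \<in> borel_measurable borel"
  unfolding reg_weight_def[abs_def] by measurable

lemma reg_feature_measurable[measurable]: "reg_feature \<epsilon> \<in> borel_measurable borel"
  unfolding reg_feature_def[abs_def] by measurable

lemma reg_log_eq:
  assumes "\<epsilon> > 0"
  shows "reg_log \<epsilon> x y = (ln (reg_weight \<epsilon> x) + ln (reg_weight \<epsilon> y) + ln (1 - reg_feature \<epsilon> x \<bullet> reg_feature \<epsilon> y)) / 2"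
proof -
  have p: "reg_weight \<epsilon> x > 0" "reg_weight \<epsilon> y > 0" using assms reg_weight_pos by auto
  have "\<epsilon>\<^sup>2 + (norm (x - y))\<^sup>2 > 0" using assms by (simp add: add_pos_nonneg)
  then have "1 - reg_feature \<epsilon> x \<bullet> reg_feature \<epsilon> y > 0"
    unfolding reg_feature_inner[OF assms] using mult_pos_pos[OF p] zero_less_mult_pos by blast
  then show ?thesis unfolding reg_log_def reg_feature_inner[OF assms] using p by (simp add: ln_mult)
qed

text \<open>The logarithm is expanded as \<open>ln (1 - s) = - (\<Sum>k. s\<^sup>k / k)\<close>, each power of
  \<open>s = reg_feature \<epsilon> x \<bullet> reg_feature \<epsilon> y\<close> being positive definite; the weights cancel because
  the two measures have the same mass.\<close>

lemma reg_log_cond_neg_def: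
  fixes P Q :: "'a::euclidean_space measure"
  assumes eps: "\<epsilon> > 0" and P: "prob_space P" "sets P = sets borel" and Q: "prob_space Q" "sets Q = sets borel"
    and iP: "integrable P (\<lambda>x. ln (reg_weight \<epsilon> x))" and iQ: "integrable Q (\<lambda>x. ln (reg_weight \<epsilon> x))"
  shows "(\<integral>x. \<integral>y. reg_log \<epsilon> x y \<partial>P \<partial>P) + (\<integral>x. \<integral>y. reg_log \<epsilon> x y \<partial>Q \<partial>Q) \<le> 2 * (\<integral>x. \<integral>y. reg_log \<epsilon> x y \<partial>Q \<partial>P)"
proof -
  let ?p = "reg_weight \<epsilon> :: 'a \<Rightarrow> real"
  define s where "s x y = reg_feature \<epsilon> x \<bullet> reg_feature \<epsilon> y" for x y :: 'a
  define S where "S n x y = (\<Sum>k<n. - (s x y ^ Suc k) / real (Suc k))" for n :: nat and x y :: 'a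
  have [measurable]: "(\<lambda>(x, y). s x y) \<in> borel_measurable (borel \<Otimes>\<^sub>M borel)"
    unfolding s_def by measurable
  have [measurable]: "(\<lambda>(x, y). S n x y) \<in> borel_measurable (borel \<Otimes>\<^sub>M borel)" for n
    unfolding S_def by measurable
  \<comment> \<open>\<open>W\<close> is minus the logarithm of the gap in
    \<open>abs_reg_feature_inner\<close>. It bounds all partial sums and their limit; it is constant
    for the inner integral and, being affine in the logarithm of the weight, integrable for the
    outer one.\<close>
  define W where "W x = ln 2 + 2 * ln (?p x) - 2 * ln \<epsilon>" for x
  have s1: "\<bar>s x y\<bar> < 1" for x y
    unfolding s_def using abs_reg_feature_inner[OF eps, of x y] eps reg_weight_pos[OF eps, of x]
    by (smt (verit) divide_pos_pos zero_less_power)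
  have series: "(\<lambda>k. - (s ^ Suc k) / real (Suc k)) sums ln (1 - s)" if "\<bar>s\<bar> < 1" for s :: real
  proof -
    have "(\<lambda>n. - ((- (- s)) ^ n) / real n) sums ln (1 + (- s))"
      using ln_series'[of "- s"] that by simp
    \<comment> \<open>The term of index 0 is a division by zero, hence 0, and the shift of the index
      changes nothing.\<close>
    then show ?thesis by (subst sums_Suc_iff) simp
  qed
  have Sbd: "\<bar>S n x y\<bar> \<le> W x" for n x y
  proof -
    have "\<bar>S n x y\<bar> \<le> (\<Sum>k<n. \<bar>s x y\<bar> ^ Suc k / real (Suc k))"
      unfolding S_def by (rule order_trans[OF sum_abs]) (simp add: abs_mult power_abs del: power_Suc)
    also have "\<dots> \<le> (\<Sum>k. \<bar>s x y\<bar> ^ Suc k / real (Suc k))"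
      using sums_minus[OF series[of "\<bar>s x y\<bar>"]] s1[of x y] by (intro sum_le_suminf) (auto simp: sums_iff)
    also have "\<dots> = - ln (1 - \<bar>s x y\<bar>)"
      using sums_minus[OF series[of "\<bar>s x y\<bar>"]] s1[of x y] by (auto simp: sums_iff)
    also have "\<dots> \<le> - ln (\<epsilon>\<^sup>2 / (2 * (?p x)\<^sup>2))"
      using abs_reg_feature_inner[OF eps, of x y, folded s_def] eps reg_weight_pos[OF eps, of x] s1[of x y]
      by (subst neg_le_iff_le, subst ln_le_cancel_iff) auto
    also have "\<dots> = W x"
      unfolding W_def using eps reg_weight_pos[OF eps, of x] by (simp add: ln_div ln_mult ln_realpow)
    finally show ?thesis .
  qed
  have key: "(\<integral>x. \<integral>y. reg_log \<epsilon> x y \<partial>M2 \<partial>M1) = ((\<integral>x. ln (?p x) \<partial>M1) + (\<integral>x. ln (?p x) \<partial>M2)) / 2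
      + (\<integral>x. \<integral>y. ln (1 - s x y) \<partial>M2 \<partial>M1) / 2"
    and lim: "(\<lambda>n. (\<integral>x. \<integral>y. S n x y \<partial>M2 \<partial>M1)) \<longlonglongrightarrow> (\<integral>x. \<integral>y. ln (1 - s x y) \<partial>M2 \<partial>M1)"
    and spl: "(\<integral>x. \<integral>y. S n x y \<partial>M2 \<partial>M1) = (\<Sum>k<n. - (\<integral>x. \<integral>y. 1 * 1 * (s x y) ^ Suc k \<partial>M2 \<partial>M1) / Suc k)"
    if "prob_space M1" "prob_space M2" and [measurable_cong]: "sets M1 = sets borel" "sets M2 = sets borel"
      and i1: "integrable M1 (\<lambda>x. ln (?p x))" and i2: "integrable M2 (\<lambda>x. ln (?p x))" for M1 M2 :: "'a measure" and n
  proof -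
    interpret M1: prob_space M1 by fact
    interpret M2: prob_space M2 by fact
    have W: "integrable M1 W" unfolding W_def using i1 by simp
    have Wn: "0 \<le> W x" for x using Sbd[of 0 x x] by simp
    have Sl: "(\<lambda>n. S n x y) \<longlonglongrightarrow> ln (1 - s x y)" for x y
      using series[OF s1[of x y]] unfolding sums_def S_def .
    have lnb: "\<bar>ln (1 - s x y)\<bar> \<le> W x" for x y
      using LIMSEQ_le_const2[OF tendsto_rabs[OF Sl[of x y]], of "W x"] Sbd by blast
    have in1: "(\<lambda>n. \<integral>y. S n x y \<partial>M2) \<longlonglongrightarrow> (\<integral>y. ln (1 - s x y) \<partial>M2)" for x
      by (rule integral_dominated_convergence[where w="\<lambda>_. W x"]) (simp_all add: Sbd Sl)
    show "(\<lambda>n. (\<integral>x. \<integral>y. S n x y \<partial>M2 \<partial>M1)) \<longlonglongrightarrow> (\<integral>x. \<integral>y. ln (1 - s x y) \<partial>M2 \<partial>M1)"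
      by (rule integral_dominated_convergence[where w=W]) (simp_all add: in1 W M2.abs_integral_le[OF Sbd])
    have j1: "integrable M2 (\<lambda>y. ln (1 - s x y))" for x
      by (rule M2.integrable_const_bound[of _ "W x"]) (simp_all add: lnb)
    have j2: "integrable M1 (\<lambda>x. \<integral>y. ln (1 - s x y) \<partial>M2)"
      by (rule Bochner_Integration.integrable_bound[OF W]) (simp_all add: M2.abs_integral_le[OF lnb] Wn)
    have inner: "(\<integral>y. reg_log \<epsilon> x y \<partial>M2) = (ln (?p x) + (\<integral>y. ln (?p y) \<partial>M2) + (\<integral>y. ln (1 - s x y) \<partial>M2)) / 2" for x
      unfolding reg_log_eq[OF eps] s_def[symmetric] using i2 j1[of x] by (simp add: M2.prob_space)
    show "(\<integral>x. \<integral>y. reg_log \<epsilon> x y \<partial>M2 \<partial>M1) = ((\<integral>x. ln (?p x) \<partial>M1) + (\<integral>x. ln (?p x) \<partial>M2)) / 2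
      + (\<integral>x. \<integral>y. ln (1 - s x y) \<partial>M2 \<partial>M1) / 2"
      unfolding inner using i1 j2 by (simp add: M1.prob_space add_divide_distrib)
    have pb: "\<bar>s x y ^ Suc k\<bar> \<le> 1" for x y k
      using s1[of x y] by (simp add: power_abs power_le_one del: power_Suc)
    have k1: "integrable M2 (\<lambda>y. s x y ^ Suc k)" for x k
      by (rule M2.integrable_const_bound[of _ 1]) (simp_all add: pb del: power_Suc)
    have k2: "integrable M1 (\<lambda>x. \<integral>y. s x y ^ Suc k \<partial>M2)" for k
      by (rule M1.integrable_const_bound[of _ 1]) (simp_all add: M2.abs_integral_le[OF pb] del: power_Suc)
    show "(\<integral>x. \<integral>y. S n x y \<partial>M2 \<partial>M1) = (\<Sum>k<n. - (\<integral>x. \<integral>y. 1 * 1 * (s x y) ^ Suc k \<partial>M2 \<partial>M1) / Suc k)"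
      unfolding S_def using k1 k2 by (simp add: Bochner_Integration.integral_sum del: power_Suc)
  qed
  have comb: "(\<Sum>k<n. - a k / r k) + (\<Sum>k<n. - b k / r k) - 2 * (\<Sum>k<n. - c k / r k) = - (\<Sum>k<n. (a k + b k - 2 * c k) / r k)"
    for a b c r :: "nat \<Rightarrow> real" and n :: nat
    by (induction n) (simp_all add: diff_divide_distrib add_divide_distrib)
  note PP = key[OF P(1) P(1) P(2) P(2) iP iP] lim[OF P(1) P(1) P(2) P(2) iP iP] spl[OF P(1) P(1) P(2) P(2) iP iP]
  note QQ = key[OF Q(1) Q(1) Q(2) Q(2) iQ iQ] lim[OF Q(1) Q(1) Q(2) Q(2) iQ iQ] spl[OF Q(1) Q(1) Q(2) Q(2) iQ iQ]
  note PQ = key[OF P(1) Q(1) P(2) Q(2) iP iQ] lim[OF P(1) Q(1) P(2) Q(2) iP iQ] spl[OF P(1) Q(1) P(2) Q(2) iP iQ]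
  have "(\<integral>x. \<integral>y. S n x y \<partial>P \<partial>P) + (\<integral>x. \<integral>y. S n x y \<partial>Q \<partial>Q) - 2 * (\<integral>x. \<integral>y. S n x y \<partial>Q \<partial>P) \<le> 0" for n
  proof -
    have "(\<integral>x. \<integral>y. S n x y \<partial>P \<partial>P) + (\<integral>x. \<integral>y. S n x y \<partial>Q \<partial>Q) - 2 * (\<integral>x. \<integral>y. S n x y \<partial>Q \<partial>P)
      = - (\<Sum>k<n. ((\<integral>x. \<integral>y. 1 * 1 * (s x y) ^ Suc k \<partial>P \<partial>P) + (\<integral>x. \<integral>y. 1 * 1 * (s x y) ^ Suc k \<partial>Q \<partial>Q)
           - 2 * (\<integral>x. \<integral>y. 1 * 1 * (s x y) ^ Suc k \<partial>Q \<partial>P)) / Suc k)"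
      unfolding PP(3) QQ(3) PQ(3)
      by (rule comb)
    also have "\<dots> \<le> 0"
      unfolding neg_le_0_iff_le s_def
      by (intro sum_nonneg divide_nonneg_nonneg inner_power_double_integral_nonneg[OF P Q, where B=1] norm_reg_feature_le_1[OF eps]) auto
    finally show ?thesis .
  qed
  then have "(\<integral>x. \<integral>y. ln (1 - s x y) \<partial>P \<partial>P) + (\<integral>x. \<integral>y. ln (1 - s x y) \<partial>Q \<partial>Q)
       - 2 * (\<integral>x. \<integral>y. ln (1 - s x y) \<partial>Q \<partial>P) \<le> 0"
    by (intro LIMSEQ_le_const2[OF tendsto_diff[OF tendsto_add[OF PP(2) QQ(2)] tendsto_mult[OF tendsto_const PQ(2)]]]) auto
  then show ?thesis unfolding PP(1) QQ(1) PQ(1) by argo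
qed

section \<open>Measures with controlled logarithmic potential\<close>

text \<open>On the diagonal both functions take the junk value \<open>0\<close> (\<open>ln 0 = 0\<close> and \<open>0 powr a = 0\<close>);
  measures satisfying \<open>tame_measure\<close> do not see it.\<close>

definition log_dist :: "'a::euclidean_space \<Rightarrow> 'a \<Rightarrow> real" where
  "log_dist x u = ln (norm (x - u))"

definition sing :: "'a::euclidean_space \<Rightarrow> 'a \<Rightarrow> real" where
  "sing x u = norm (x - u) powr (-1/2)"

lemma one_add_norm[simp]: "0 < 1 + norm x" "1 + norm x \<noteq> 0"
  using norm_ge_zero[of x] by linarith+

lemma log_weight_measurable[measurable]: "log_weight \<in> borel_measurable borel"
  unfolding log_weight_def[abs_def] by measurable

lemma log_dist_measurable[measurable]: "(\<lambda>(x, u). log_dist x u) \<in> borel_measurable (borel \<Otimes>\<^sub>M borel)"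
  unfolding log_dist_def[abs_def] by measurable

lemma sing_measurable[measurable]: "(\<lambda>(x, u). sing x u) \<in> borel_measurable (borel \<Otimes>\<^sub>M borel)"
  unfolding sing_def[abs_def] by measurable

lemma reg_log_measurable[measurable]: "(\<lambda>(x, u). reg_log \<epsilon> x u) \<in> borel_measurable (borel \<Otimes>\<^sub>M borel)"
  unfolding reg_log_def[abs_def] by measurable

section \<open>Pointwise bounds on the logarithm and its regularisation\<close>

lemma log_dist_commute: "log_dist x u = log_dist u x"
  by (simp add: log_dist_def norm_minus_commute)

lemma log_weight_nonneg: "0 \<le> log_weight x"
  by (simp add: log_weight_def)

lemma log_weight_le: "log_weight x \<le> norm x"
  by (simp add: log_weight_def ln_add_one_self_le_self)

lemma exp_log_weight: "exp (c * log_weight x) = (1 + norm x) powr c"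
proof -
  have "0 < 1 + norm x" using norm_ge_zero[of x] by linarith
  then show ?thesis by (simp add: log_weight_def powr_def)
qed

lemma sing_nonneg: "0 \<le> sing x u"
  by (simp add: sing_def)

lemma sing_eq: "sing x u = 1 / sqrt (norm (x - u))"
proof -
  have "sing x u = norm (x - u) powr (- (1/2))" by (simp add: sing_def)
  also have "\<dots> = 1 / sqrt (norm (x - u))" unfolding powr_minus by (simp add: powr_half_sqrt inverse_eq_divide)
  finally show ?thesis .
qed

lemma log_dist_le: "log_dist x u \<le> log_weight x + log_weight u"
proof (cases "x = u")
  case False
  have "norm (x - u) \<le> (1 + norm x) * (1 + norm u)"
    using norm_triangle_ineq4[of x u] mult_nonneg_nonneg[OF norm_ge_zero[of x] norm_ge_zero[of u]]
    unfolding distrib_left distrib_right by linarith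
  then have "ln (norm (x - u)) \<le> ln ((1 + norm x) * (1 + norm u))"
    using False by (subst ln_le_cancel_iff) (auto simp: add_pos_nonneg)
  then show ?thesis by (simp add: log_dist_def log_weight_def ln_mult add_pos_nonneg)
qed (simp add: log_dist_def log_weight_def)

text \<open>This is \<open>ln t \<le> t - 1\<close> at \<open>t = sing x u\<close>, whose logarithm
  is half of \<open>- log_dist x u\<close>.\<close>

lemma log_dist_ge: "- 2 * sing x u \<le> log_dist x u"
proof (cases "x = u")
  case False
  then have r: "0 < norm (x - u)" by simp
  have "ln (sing x u) \<le> sing x u - 1" using r by (intro ln_le_minus_one) (simp add: sing_def)
  moreover have "ln (sing x u) = - log_dist x u / 2" using r by (simp add: sing_def log_dist_def ln_powr)
  ultimately show ?thesis by simp
qed (simp add: log_dist_def sing_nonneg)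

lemma abs_log_dist_le: "\<bar>log_dist x u\<bar> \<le> log_weight x + log_weight u + 2 * sing x u"
  using log_dist_le[of x u] log_dist_ge[of x u] log_weight_nonneg[of x] log_weight_nonneg[of u] sing_nonneg[of x u]
  by linarith

lemma log_dist_le_reg_log:
  assumes "x \<noteq> u"
  shows "log_dist x u \<le> reg_log \<epsilon> x u"
proof -
  have r: "0 < norm (x - u)" using assms by simp
  have "2 * log_dist x u = ln ((norm (x - u))\<^sup>2)" using r by (simp add: log_dist_def ln_realpow)
  also have "\<dots> \<le> ln (\<epsilon>\<^sup>2 + (norm (x - u))\<^sup>2)"
    using r by (subst ln_le_cancel_iff) (auto simp: add_nonneg_pos)
  finally show ?thesis by (simp add: reg_log_def)
qed

lemma ln_add_one_le_sqrt: "0 \<le> s \<Longrightarrow> ln (1 + s) \<le> 2 * sqrt (s::real)"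
proof -
  assume s: "0 \<le> s"
  have "ln (1 + s) \<le> ln ((1 + sqrt s)\<^sup>2)"
    using s by (subst ln_le_cancel_iff) (auto simp: power2_eq_square algebra_simps add_pos_nonneg)
  also have "\<dots> = 2 * ln (1 + sqrt s)" using s by (simp add: ln_realpow add_pos_nonneg)
  also have "\<dots> \<le> 2 * sqrt s" using s by (simp add: ln_add_one_self_le_self)
  finally show ?thesis .
qed

text \<open>With r the distance, eps^2 + r^2 is at most r^2 (1 + eps / r)^2, and ln (1 + s) is at
  most 2 sqrt s. The square root turns eps / r into sqrt eps times \<open>sing\<close>, an error
  that becomes uniformly small after integration over u.\<close>

lemma reg_log_le_log_dist:
  assumes "x \<noteq> u" "\<epsilon> > 0"
  shows "reg_log \<epsilon> x u \<le> log_dist x u + 2 * sqrt \<epsilon> * sing x u"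
proof -
  define r where "r = norm (x - u)"
  have r: "0 < r" using assms by (simp add: r_def)
  define s where "s = \<epsilon> / r"
  have s: "s > 0" using r assms by (simp add: s_def)
  have "\<epsilon>\<^sup>2 + r\<^sup>2 \<le> (r * (1 + s))\<^sup>2" using r s assms by (simp add: s_def power2_eq_square field_simps)
  then have "ln (\<epsilon>\<^sup>2 + r\<^sup>2) \<le> ln ((r * (1 + s))\<^sup>2)"
    using r s by (subst ln_le_cancel_iff) (auto simp: add_nonneg_pos)
  also have "\<dots> = 2 * (ln r + ln (1 + s))" using r s by (simp add: ln_realpow ln_mult)
  also have "ln (1 + s) \<le> 2 * sqrt s" using s by (intro ln_add_one_le_sqrt) simp
  also have "sqrt s = sqrt \<epsilon> * sing x u"
    using r by (simp add: s_def real_sqrt_divide sing_eq r_def[symmetric])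
  finally show ?thesis by (simp add: reg_log_def log_dist_def r_def)
qed

lemma reg_log_refl: "\<epsilon> > 0 \<Longrightarrow> reg_log \<epsilon> x x = ln \<epsilon>"
  by (simp add: reg_log_def ln_realpow)

lemma abs_ln_reg_weight_le:
  assumes "\<epsilon> > 0"
  shows "\<bar>ln (reg_weight \<epsilon> x)\<bar> \<le> 2 * \<bar>ln \<epsilon>\<bar> + ln (1 + \<epsilon>\<^sup>2) + 2 * log_weight x"
proof -
  define r where "r = norm x"
  have r: "0 \<le> r" by (simp add: r_def)
  have p: "0 < \<epsilon>\<^sup>2 + r\<^sup>2" using assms by (simp add: add_pos_nonneg)
  have eq: "ln (reg_weight \<epsilon> x) = ln (\<epsilon>\<^sup>2 + r\<^sup>2) - ln \<epsilon>"
    using assms p by (simp add: reg_weight_def r_def ln_div)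
  have "2 * ln \<epsilon> = ln (\<epsilon>\<^sup>2)" using assms by (simp add: ln_realpow)
  also have "\<dots> \<le> ln (\<epsilon>\<^sup>2 + r\<^sup>2)" using assms p by (subst ln_le_cancel_iff) auto
  finally have 1: "2 * ln \<epsilon> \<le> ln (\<epsilon>\<^sup>2 + r\<^sup>2)" .
  have "\<epsilon>\<^sup>2 + r\<^sup>2 \<le> (1 + \<epsilon>\<^sup>2) * (1 + r)\<^sup>2"
  proof -
    have "(1 + \<epsilon>\<^sup>2) * (1 + r)\<^sup>2 = \<epsilon>\<^sup>2 + r\<^sup>2 + (1 + 2 * r + \<epsilon>\<^sup>2 * (2 * r + r\<^sup>2))"
      by (simp add: power2_eq_square algebra_simps)
    then show ?thesis using r by simp
  qed
  then have "ln (\<epsilon>\<^sup>2 + r\<^sup>2) \<le> ln ((1 + \<epsilon>\<^sup>2) * (1 + r)\<^sup>2)"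
    using p r by (subst ln_le_cancel_iff) (auto simp: add_pos_nonneg)
  also have "\<dots> = ln (1 + \<epsilon>\<^sup>2) + 2 * log_weight x"
  proof -
    have "1 + \<epsilon>\<^sup>2 \<noteq> 0" "1 + norm x \<noteq> 0"
      using zero_le_power2[of \<epsilon>] norm_ge_zero[of x] by linarith+
    then show ?thesis using norm_ge_zero[of x] by (simp add: ln_mult ln_realpow log_weight_def r_def)
  qed
  finally have 2: "ln (\<epsilon>\<^sup>2 + r\<^sup>2) \<le> ln (1 + \<epsilon>\<^sup>2) + 2 * log_weight x" .
  have 3: "0 \<le> ln (1 + \<epsilon>\<^sup>2)" by simp
  show ?thesis unfolding eq using 1 2 3 log_weight_nonneg[of x] by linarith
qed

text \<open>The modulus of continuity does not depend on u, so it survives integration over u; this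
  gives the equicontinuity behind \<open>isCont_pot\<close>. The factor 1 / eps comes from 2 b eps
  being at most eps^2 + b^2.\<close>

lemma reg_log_diff_le:
  assumes "\<epsilon> > 0"
  shows "reg_log \<epsilon> x u - reg_log \<epsilon> y u \<le> norm (x - y) / (2 * \<epsilon>) + (norm (x - y))\<^sup>2 / (2 * \<epsilon>\<^sup>2)"
proof -
  define d a b where "d = norm (x - y)" and "a = norm (x - u)" and "b = norm (y - u)"
  have n: "0 \<le> d" "0 \<le> a" "0 \<le> b" by (simp_all add: d_def a_def b_def)
  have ab: "a \<le> b + d" using norm_triangle_ineq[of "x - y" "y - u"] by (simp add: a_def b_def d_def)
  have pb: "0 < \<epsilon>\<^sup>2 + b\<^sup>2" and pa: "0 < \<epsilon>\<^sup>2 + a\<^sup>2" using assms by (simp_all add: add_pos_nonneg)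
  have "ln (\<epsilon>\<^sup>2 + a\<^sup>2) - ln (\<epsilon>\<^sup>2 + b\<^sup>2) = ln ((\<epsilon>\<^sup>2 + a\<^sup>2) / (\<epsilon>\<^sup>2 + b\<^sup>2))" using pa pb by (subst ln_div) auto
  also have "\<dots> \<le> (\<epsilon>\<^sup>2 + a\<^sup>2) / (\<epsilon>\<^sup>2 + b\<^sup>2) - 1" using pa pb by (intro ln_le_minus_one) simp
  also have "\<dots> = (a\<^sup>2 - b\<^sup>2) / (\<epsilon>\<^sup>2 + b\<^sup>2)"
    using pb assms diff_divide_distrib[of "\<epsilon>\<^sup>2 + a\<^sup>2" "\<epsilon>\<^sup>2 + b\<^sup>2" "\<epsilon>\<^sup>2 + b\<^sup>2"] by simp
  also have "\<dots> \<le> (2 * b * d + d\<^sup>2) / (\<epsilon>\<^sup>2 + b\<^sup>2)"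
  proof (rule divide_right_mono)
    have "a\<^sup>2 \<le> (b + d)\<^sup>2" using ab n by (intro power_mono) auto
    then show "a\<^sup>2 - b\<^sup>2 \<le> 2 * b * d + d\<^sup>2" by (simp add: power2_eq_square algebra_simps)
  qed (use pb in simp)
  also have "\<dots> = d * (2 * b / (\<epsilon>\<^sup>2 + b\<^sup>2)) + d\<^sup>2 / (\<epsilon>\<^sup>2 + b\<^sup>2)" by (simp add: add_divide_distrib mult_ac)
  also have "2 * b / (\<epsilon>\<^sup>2 + b\<^sup>2) \<le> 1 / \<epsilon>"
  proof -
    have "2 * b * \<epsilon> \<le> \<epsilon>\<^sup>2 + b\<^sup>2" using sum_squares_bound[of b \<epsilon>] by (simp add: mult_ac)
    then show ?thesis using pb assms by (simp add: field_simps)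
  qed
  also have "d\<^sup>2 / (\<epsilon>\<^sup>2 + b\<^sup>2) \<le> d\<^sup>2 / \<epsilon>\<^sup>2" using assms pb by (intro divide_left_mono) auto
  finally have "ln (\<epsilon>\<^sup>2 + a\<^sup>2) - ln (\<epsilon>\<^sup>2 + b\<^sup>2) \<le> d * (1 / \<epsilon>) + d\<^sup>2 / \<epsilon>\<^sup>2"
    using n by (simp add: mult_left_mono)
  moreover have "d * (1 / \<epsilon>) = 2 * (d / (2 * \<epsilon>))" "d\<^sup>2 / \<epsilon>\<^sup>2 = 2 * (d\<^sup>2 / (2 * \<epsilon>\<^sup>2))" by simp_all
  ultimately show ?thesis
    unfolding reg_log_def a_def[symmetric] b_def[symmetric] d_def[symmetric] by linarith
qed

text \<open>The bound is uniform in the centre x, so replacing the logarithm by its regularisation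
  changes all potentials by at most a multiple of sqrt eps. The exponent -1/2 in \<open>sing\<close>
  makes bounded densities with enough decay tame already in dimension 1, and it still dominates
  exponential moments of the logarithm of small order.\<close>

locale tame_measure = prob_space M for M :: "'a::euclidean_space measure" +
  assumes sets_M[measurable_cong]: "sets M = sets borel"
    and no_atoms: "emeasure M {x} = 0"
    and tame: "0 \<le> \<kappa> \<Longrightarrow> \<exists>A::real. \<forall>x. (\<integral>\<^sup>+u. ennreal ((1 + sing x u) * (1 + norm u) powr \<kappa>) \<partial>M) \<le> ennreal A"
begin

lemma space_M[simp]: "space M = UNIV"
  using sets_eq_imp_space_eq[OF sets_M] by simp

lemma prob_UNIV[simp]: "measure M UNIV = 1"
  using prob_space by simp

lemma AE_neq: "AE u in M. u \<noteq> x"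
  using no_atoms[of x] by (intro AE_I[of _ _ "{x}"]) (auto simp: sets_M)

definition tame_const :: "real \<Rightarrow> real" where
  "tame_const \<kappa> = (SOME A. 0 \<le> A \<and> (\<forall>x. (\<integral>\<^sup>+u. ennreal ((1 + sing x u) * (1 + norm u) powr \<kappa>) \<partial>M) \<le> ennreal A))"

lemma tame_const:
  assumes "0 \<le> \<kappa>"
  shows "0 \<le> tame_const \<kappa>" "(\<integral>\<^sup>+u. ennreal ((1 + sing x u) * (1 + norm u) powr \<kappa>) \<partial>M) \<le> ennreal (tame_const \<kappa>)"
proof -
  obtain A where A: "\<And>x. (\<integral>\<^sup>+u. ennreal ((1 + sing x u) * (1 + norm u) powr \<kappa>) \<partial>M) \<le> ennreal A"
    using tame[OF assms] by blast
  have "\<exists>A. 0 \<le> A \<and> (\<forall>x. (\<integral>\<^sup>+u. ennreal ((1 + sing x u) * (1 + norm u) powr \<kappa>) \<partial>M) \<le> ennreal A)"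
    by (rule exI[of _ "max 0 A"]) (use A in auto)
  from someI_ex[OF this, folded tame_const_def]
  show "0 \<le> tame_const \<kappa>" "(\<integral>\<^sup>+u. ennreal ((1 + sing x u) * (1 + norm u) powr \<kappa>) \<partial>M) \<le> ennreal (tame_const \<kappa>)"
    by auto
qed

lemma tame_integrable:
  assumes "0 \<le> \<kappa>" and [measurable]: "g \<in> borel_measurable borel"
    and g: "\<And>u. \<bar>g u\<bar> \<le> c * ((1 + sing x u) * (1 + norm u) powr \<kappa>)"
  shows "integrable M g" "\<bar>\<integral>u. g u \<partial>M\<bar> \<le> c * tame_const \<kappa>"
proof -
  let ?h = "\<lambda>u. (1 + sing x u) * (1 + norm u) powr \<kappa>"
  have h: "0 \<le> ?h u" for u using sing_nonneg[of x u] by simp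
  have ih: "integrable M ?h"
    using tame_const(2)[OF assms(1), of x] h
    by (intro integrableI_nonneg) (auto intro: le_less_trans)
  then have ich: "integrable M (\<lambda>u. c * ?h u)" by simp
  show ig: "integrable M g"
    by (rule Bochner_Integration.integrable_bound[OF ich]) (use g in \<open>auto intro: order_trans[OF _ abs_ge_self]\<close>)
  \<comment> \<open>The sign of \<open>c\<close> is forced by the assumed bound at a single point,
    where the weight is positive.\<close>
  have c: "0 \<le> c"
  proof (rule ccontr)
    assume "\<not> 0 \<le> c"
    moreover have "0 < ?h x" using sing_nonneg[of x x] norm_ge_zero[of x] by (intro mult_pos_pos) (auto simp del: norm_ge_zero)
    ultimately have "c * ?h x < 0" by (simp add: mult_neg_pos)
    then show False using g[of x] by linarith
  qed
  have "\<bar>\<integral>u. g u \<partial>M\<bar> \<le> (\<integral>u. \<bar>g u\<bar> \<partial>M)" using integral_norm_bound[of M g] by simp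
  also have "\<dots> \<le> (\<integral>u. c * ?h u \<partial>M)" using ig ich g by (intro integral_mono) auto
  also have "\<dots> = c * (\<integral>u. ?h u \<partial>M)" by simp
  also have "(\<integral>u. ?h u \<partial>M) \<le> tame_const \<kappa>"
    using tame_const(2)[OF assms(1), of x] tame_const(1)[OF assms(1)] nn_integral_eq_integral[OF ih] h by simp
  finally show "\<bar>\<integral>u. g u \<partial>M\<bar> \<le> c * tame_const \<kappa>" using c by (simp add: mult_left_mono)
qed

lemma integrable_powr: "0 \<le> \<kappa> \<Longrightarrow> integrable M (\<lambda>u. (1 + norm u) powr \<kappa>)"
  by (rule tame_integrable[where \<kappa>=\<kappa> and x=0 and c=1]) (auto simp: sing_nonneg mult_le_cancel_right1)

lemma integrable_sing: "integrable M (sing x)" "(\<integral>u. sing x u \<partial>M) \<le> tame_const 0"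
proof -
  have m: "sing x \<in> borel_measurable borel" by measurable
  have b: "\<bar>sing x u\<bar> \<le> 1 * ((1 + sing x u) * (1 + norm u) powr 0)" for u
    using norm_ge_zero[of u] by (simp add: sing_nonneg add_nonneg_eq_0_iff)
  show "integrable M (sing x)" "(\<integral>u. sing x u \<partial>M) \<le> tame_const 0"
    using tame_integrable[OF order_refl m b] by auto
qed

lemma integrable_log_weight: "integrable M log_weight"
proof (rule Bochner_Integration.integrable_bound)
  show "integrable M (\<lambda>u. (1 + norm u) powr 1)" by (rule integrable_powr) simp
  show "AE u in M. norm (log_weight u) \<le> norm ((1 + norm u) powr 1)"
  proof (rule AE_I2)
    fix u :: 'a
    show "norm (log_weight u) \<le> norm ((1 + norm u) powr 1)"
      using log_weight_le[of u] log_weight_nonneg[of u] by simp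
  qed
qed measurable

lemma integrable_log_dist: "integrable M (log_dist x)"
proof (rule Bochner_Integration.integrable_bound)
  show "integrable M (\<lambda>u. log_weight x + log_weight u + 2 * sing x u)"
    using integrable_log_weight integrable_sing(1)[of x] by simp
  show "AE u in M. norm (log_dist x u) \<le> norm (log_weight x + log_weight u + 2 * sing x u)"
    using abs_log_dist_le by (auto intro!: AE_I2 order_trans[OF _ abs_ge_self])
qed measurable

lemma integrable_reg_log:
  assumes "\<epsilon> > 0" shows "integrable M (reg_log \<epsilon> x)"
proof (rule Bochner_Integration.integrable_bound)
  show "integrable M (\<lambda>u. \<bar>log_dist x u\<bar> + 2 * sqrt \<epsilon> * sing x u)"
    using integrable_log_dist integrable_sing(1)[of x] by simp
  show "AE u in M. norm (reg_log \<epsilon> x u) \<le> norm (\<bar>log_dist x u\<bar> + 2 * sqrt \<epsilon> * sing x u)"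
    using AE_neq[of x]
  proof eventually_elim
    case (elim u)
    then have "log_dist x u \<le> reg_log \<epsilon> x u" "reg_log \<epsilon> x u \<le> log_dist x u + 2 * sqrt \<epsilon> * sing x u"
      using assms log_dist_le_reg_log[of x u \<epsilon>] reg_log_le_log_dist[of x u \<epsilon>] by auto
    moreover have "0 \<le> 2 * sqrt \<epsilon> * sing x u" using assms by (simp add: sing_nonneg)
    ultimately show ?case by simp
  qed
qed measurable

text \<open>The sign is that of log |x - u|, opposite to the kernel of the Gibbs measure:
  \<open>pot\<close> is bounded from below and grows at most logarithmically.\<close>

definition pot :: "'a \<Rightarrow> real" where "pot x = (\<integral>u. log_dist x u \<partial>M)"
definition pot_energy :: real where "pot_energy = (\<integral>x. pot x \<partial>M)"

lemma pot_measurable[measurable]: "pot \<in> borel_measurable borel"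
  unfolding pot_def[abs_def] by measurable

lemma pot_le: "pot x \<le> log_weight x + (\<integral>u. log_weight u \<partial>M)"
proof -
  have "pot x \<le> (\<integral>u. log_weight x + log_weight u \<partial>M)"
    unfolding pot_def using integrable_log_dist integrable_log_weight log_dist_le by (intro integral_mono) auto
  then show ?thesis using integrable_log_weight by (simp add: prob_space)
qed

lemma pot_ge: "- 2 * tame_const 0 \<le> pot x"
proof -
  have "(\<integral>u. - 2 * sing x u \<partial>M) \<le> pot x"
    unfolding pot_def using integrable_log_dist integrable_sing(1)[of x] log_dist_ge by (intro integral_mono) auto
  then show ?thesis using integrable_sing(2)[of x] by simp
qed

definition pot_const :: real where "pot_const = 1 + (\<integral>u. log_weight u \<partial>M) + 2 * tame_const 0"

lemma pot_const_ge_1: "1 \<le> pot_const"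
proof -
  have "0 \<le> (\<integral>u. log_weight u \<partial>M)" using log_weight_nonneg by (rule Bochner_Integration.integral_nonneg)
  then show ?thesis unfolding pot_const_def using tame_const(1)[of 0] by simp
qed

lemma abs_pot_le: "\<bar>pot x\<bar> \<le> pot_const * (1 + log_weight x)"
proof -
  have w: "0 \<le> (\<integral>u. log_weight u \<partial>M)" using log_weight_nonneg by (rule Bochner_Integration.integral_nonneg)
  have "\<bar>pot x\<bar> \<le> pot_const + log_weight x"
    using pot_le[of x] pot_ge[of x] tame_const(1)[of 0] log_weight_nonneg[of x] w unfolding pot_const_def by linarith
  also have "\<dots> \<le> pot_const * (1 + log_weight x)"
    using mult_right_mono[OF pot_const_ge_1 log_weight_nonneg[of x]] by (simp add: algebra_simps)
  finally show ?thesis .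
qed

lemma integrable_pot: "integrable M pot"
proof (rule Bochner_Integration.integrable_bound)
  show "integrable M (\<lambda>u. pot_const * (1 + log_weight u))" using integrable_log_weight by simp
qed (use abs_pot_le in \<open>auto intro!: AE_I2 order_trans[OF _ abs_ge_self]\<close>)

lemma pot_le_reg: "\<epsilon> > 0 \<Longrightarrow> pot x \<le> (\<integral>u. reg_log \<epsilon> x u \<partial>M)"
  unfolding pot_def using AE_neq[of x] integrable_log_dist[of x] integrable_reg_log[of \<epsilon> x]
  by (intro integral_mono_AE) (auto intro: log_dist_le_reg_log elim!: eventually_mono)

lemma reg_le_pot:
  assumes "\<epsilon> > 0"
  shows "(\<integral>u. reg_log \<epsilon> x u \<partial>M) \<le> pot x + 2 * sqrt \<epsilon> * tame_const 0"
proof -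
  have "(\<integral>u. reg_log \<epsilon> x u \<partial>M) \<le> (\<integral>u. log_dist x u + 2 * sqrt \<epsilon> * sing x u \<partial>M)"
    using AE_neq[of x] integrable_log_dist[of x] integrable_reg_log[of \<epsilon> x] integrable_sing(1)[of x] assms
    by (intro integral_mono_AE) (auto intro: reg_log_le_log_dist elim!: eventually_mono)
  also have "\<dots> = pot x + 2 * sqrt \<epsilon> * (\<integral>u. sing x u \<partial>M)"
    using integrable_log_dist[of x] integrable_sing(1)[of x] by (simp add: pot_def)
  also have "\<dots> \<le> pot x + 2 * sqrt \<epsilon> * tame_const 0"
    using integrable_sing(2)[of x] assms by (simp add: mult_left_mono)
  finally show ?thesis .
qed

lemma integrable_reg_pot:
  assumes "\<epsilon> > 0"
  shows "integrable M (\<lambda>x. \<integral>u. reg_log \<epsilon> x u \<partial>M)"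
proof (rule Bochner_Integration.integrable_bound)
  show "integrable M (\<lambda>x. \<bar>pot x\<bar> + 2 * sqrt \<epsilon> * tame_const 0)" using integrable_pot by simp
  show "AE x in M. norm (\<integral>u. reg_log \<epsilon> x u \<partial>M) \<le> norm (\<bar>pot x\<bar> + 2 * sqrt \<epsilon> * tame_const 0)"
  proof (rule AE_I2)
    fix x
    have "0 \<le> 2 * sqrt \<epsilon> * tame_const 0" using assms tame_const(1)[of 0] by simp
    then show "norm (\<integral>u. reg_log \<epsilon> x u \<partial>M) \<le> norm (\<bar>pot x\<bar> + 2 * sqrt \<epsilon> * tame_const 0)"
      using pot_le_reg[OF assms, of x] reg_le_pot[OF assms, of x] unfolding real_norm_def by linarith
  qed
qed measurable

lemma pot_energy_le_reg: "\<epsilon> > 0 \<Longrightarrow> pot_energy \<le> (\<integral>x. \<integral>u. reg_log \<epsilon> x u \<partial>M \<partial>M)"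
  unfolding pot_energy_def using integrable_pot integrable_reg_pot pot_le_reg by (intro integral_mono) auto

lemma integrable_ln_reg_weight:
  assumes "\<epsilon> > 0"
  shows "integrable M (\<lambda>x. ln (reg_weight \<epsilon> x))"
proof (rule Bochner_Integration.integrable_bound)
  show "integrable M (\<lambda>x. 2 * \<bar>ln \<epsilon>\<bar> + ln (1 + \<epsilon>\<^sup>2) + 2 * log_weight x)" using integrable_log_weight by simp
qed (use abs_ln_reg_weight_le[OF assms] in \<open>auto intro!: AE_I2 order_trans[OF _ abs_ge_self]\<close>)

text \<open>A uniform limit of continuous functions: at a fixed scale the regularised potentials
  have a modulus of continuity, and they differ from \<open>pot\<close> by at most 2 sqrt eps
  \<open>tame_const 0\<close> everywhere. One-sided comparisons suffice, the two points being
  exchanged at the end.\<close>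

lemma isCont_pot: "isCont pot x"
proof -
  have "\<exists>d>0. \<forall>y. norm (y - x) < d \<longrightarrow> \<bar>pot y - pot x\<bar> < e" if e: "e > 0" for e
  proof -
    let ?A = "tame_const 0"
    \<comment> \<open>\<open>q\<close> is the square root of the regularisation scale, sized so that
      the regularisation error is at most e / 4.\<close>
    define q where "q = e / (8 * (1 + ?A))"
    define \<epsilon> where "\<epsilon> = q\<^sup>2"
    have A: "0 \<le> ?A" using tame_const(1)[of 0] by simp
    have q: "0 < q" using e A by (simp add: q_def)
    have eps: "0 < \<epsilon>" using q by (simp add: \<epsilon>_def)
    have small: "2 * sqrt \<epsilon> * ?A \<le> e / 4"
    proof -
      have "2 * q * ?A \<le> 2 * q * (1 + ?A)" using q by simp
      also have "\<dots> = e / 4" using A by (simp add: q_def field_simps)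
      finally show ?thesis using q by (simp add: \<epsilon>_def)
    qed
    have "isCont (\<lambda>t. t / (2 * \<epsilon>) + t\<^sup>2 / (2 * \<epsilon>\<^sup>2)) (0::real)" using eps by (intro continuous_intros) auto
    then obtain d where d: "d > 0" "\<forall>t. t \<noteq> 0 \<and> norm (t - 0) < d \<longrightarrow> norm (t / (2 * \<epsilon>) + t\<^sup>2 / (2 * \<epsilon>\<^sup>2) - (0 / (2 * \<epsilon>) + 0\<^sup>2 / (2 * \<epsilon>\<^sup>2))) < e / 4"
      unfolding isCont_def LIM_eq using e by (meson divide_pos_pos zero_less_numeral)
    have d': "t / (2 * \<epsilon>) + t\<^sup>2 / (2 * \<epsilon>\<^sup>2) < e / 4" if "\<bar>t\<bar> < d" for t
    proof (cases "t = 0")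
      case False
      then have "\<bar>t / (2 * \<epsilon>) + t\<^sup>2 / (2 * \<epsilon>\<^sup>2)\<bar> < e / 4"
        using d(2)[rule_format, of t] that unfolding real_norm_def by simp
      then show ?thesis by linarith
    qed (use e in simp)
    have 1: "pot y - pot z < e" if "norm (y - z) < d" for y z
    proof -
      have "(\<integral>u. reg_log \<epsilon> y u \<partial>M) \<le> (\<integral>u. reg_log \<epsilon> z u + (norm (y - z) / (2 * \<epsilon>) + (norm (y - z))\<^sup>2 / (2 * \<epsilon>\<^sup>2)) \<partial>M)"
        using integrable_reg_log[OF eps] reg_log_diff_le[OF eps, of y _ z]
        by (intro integral_mono) (auto simp: diff_le_eq add.commute)
      also have "\<dots> = (\<integral>u. reg_log \<epsilon> z u \<partial>M) + (norm (y - z) / (2 * \<epsilon>) + (norm (y - z))\<^sup>2 / (2 * \<epsilon>\<^sup>2))"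
        using integrable_reg_log[OF eps] by (simp add: prob_space)
      finally show ?thesis
        using pot_le_reg[OF eps, of y] reg_le_pot[OF eps, of z] small d'[of "norm (y - z)"] that e by simp
    qed
    show ?thesis
      by (rule exI[of _ d]) (use 1 d(1) in \<open>auto simp: abs_less_iff norm_minus_commute\<close>)
  qed
  then have "\<forall>e>0. \<exists>d>0. \<forall>y. y \<noteq> x \<and> norm (y - x) < d \<longrightarrow> norm (pot y - pot x) < e"
    unfolding real_norm_def by blast
  then show ?thesis unfolding isCont_def LIM_eq .
qed

text \<open>Conditional negative definiteness for the empirical measure of the points against
  \<open>M\<close>. Because of its atoms the regularised kernel is used, and removing the diagonal
  costs \<open>ln \<epsilon>\<close> per point. The logarithm lies below its regularisation, which
  is the right direction for the double sum and for \<open>pot_energy\<close>; only the potentials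
  at the points acquire an error.\<close>

lemma empirical_energy_le:
  assumes "finite I" "I \<noteq> {}" "inj_on X I" and eps: "\<epsilon> > 0"
  defines "n \<equiv> real (card I)"
  shows "(\<Sum>i\<in>I. \<Sum>j\<in>I - {i}. log_dist (X i) (X j))
     \<le> 2 * n * (\<Sum>i\<in>I. pot (X i) + 2 * sqrt \<epsilon> * tame_const 0) - n\<^sup>2 * pot_energy - n * ln \<epsilon>"
proof -
  let ?U = "uniform_count_measure I"
  interpret U: prob_space ?U using assms by (intro prob_space_uniform_count_measure)
  define P where "P = distr ?U borel X"
  have X: "X \<in> measurable ?U borel" by (simp add: measurable_def space_uniform_count_measure sets_uniform_count_measure)
  have n: "0 < n" using assms(1,2) by (simp add: n_def card_gt_0_iff)
  have P: "prob_space P" "sets P = sets borel" unfolding P_def by (auto intro!: U.prob_space_distr X)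
  have intP: "(\<integral>x. g x \<partial>P) = (\<Sum>i\<in>I. g (X i)) / n" if [measurable]: "g \<in> borel_measurable borel" for g :: "'a \<Rightarrow> real"
    unfolding P_def using assms(1) by (subst integral_distr[OF X]) (auto simp: integral_uniform_count_measure n_def)
  have iP: "integrable P (\<lambda>x. ln (reg_weight \<epsilon> x))"
    unfolding P_def using assms(1) by (subst integrable_distr_eq[OF X]) (auto simp: uniform_count_measure_def integrable_point_measure_finite)
  have m1: "reg_log \<epsilon> x \<in> borel_measurable borel" for x :: 'a by measurable
  have m2: "(\<lambda>x. (\<Sum>j\<in>I. reg_log \<epsilon> x (X j)) / n) \<in> borel_measurable borel" by measurable
  have m3: "(\<lambda>x. \<integral>y. reg_log \<epsilon> x y \<partial>M) \<in> borel_measurable borel" by measurable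
  have "(\<integral>x. \<integral>y. reg_log \<epsilon> x y \<partial>P \<partial>P) + (\<integral>x. \<integral>y. reg_log \<epsilon> x y \<partial>M \<partial>M) \<le> 2 * (\<integral>x. \<integral>y. reg_log \<epsilon> x y \<partial>M \<partial>P)"
    by (rule reg_log_cond_neg_def[OF eps P prob_space_axioms sets_M iP integrable_ln_reg_weight[OF eps]])
  then have "(\<Sum>i\<in>I. (\<Sum>j\<in>I. reg_log \<epsilon> (X i) (X j)) / n) / n + pot_energy
      \<le> 2 * ((\<Sum>i\<in>I. \<integral>y. reg_log \<epsilon> (X i) y \<partial>M) / n)"
    using pot_energy_le_reg[OF eps] unfolding intP[OF m1] intP[OF m2] intP[OF m3] by simp
  also have "\<dots> \<le> 2 * ((\<Sum>i\<in>I. pot (X i) + 2 * sqrt \<epsilon> * tame_const 0) / n)"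
    using n reg_le_pot[OF eps] by (intro mult_left_mono divide_right_mono sum_mono) auto
  finally have "n\<^sup>2 * ((\<Sum>i\<in>I. (\<Sum>j\<in>I. reg_log \<epsilon> (X i) (X j)) / n) / n + pot_energy)
      \<le> n\<^sup>2 * (2 * ((\<Sum>i\<in>I. pot (X i) + 2 * sqrt \<epsilon> * tame_const 0) / n))" by (rule mult_left_mono) simp
  then have *: "(\<Sum>i\<in>I. \<Sum>j\<in>I. reg_log \<epsilon> (X i) (X j)) + n\<^sup>2 * pot_energy
      \<le> 2 * n * (\<Sum>i\<in>I. pot (X i) + 2 * sqrt \<epsilon> * tame_const 0)"
    using n by (simp add: sum_divide_distrib[symmetric] power2_eq_square distrib_left)
  have "(\<Sum>i\<in>I. \<Sum>j\<in>I - {i}. log_dist (X i) (X j)) \<le> (\<Sum>i\<in>I. \<Sum>j\<in>I - {i}. reg_log \<epsilon> (X i) (X j))"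
    using assms(3) by (intro sum_mono log_dist_le_reg_log) (auto simp: inj_on_def)
  also have "\<dots> = (\<Sum>i\<in>I. (\<Sum>j\<in>I. reg_log \<epsilon> (X i) (X j)) - ln \<epsilon>)"
    using assms(1) reg_log_refl[OF eps] by (intro sum.cong) (simp_all add: sum_diff1)
  also have "\<dots> = (\<Sum>i\<in>I. \<Sum>j\<in>I. reg_log \<epsilon> (X i) (X j)) - n * ln \<epsilon>" by (simp add: sum_subtractf n_def)
  finally show ?thesis using * by linarith
qed

end

section \<open>Exponential moments of the logarithm\<close>

lemma exp_le_quadratic: "exp t \<le> 1 + t + t\<^sup>2 * exp \<bar>t\<bar>" for t :: real
proof -
  have "exp t * (1 - t) \<le> exp t * exp (- t)" using exp_ge_add_one_self[of "-t"] by (intro mult_left_mono) auto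
  also have "\<dots> = 1" by (simp add: exp_minus_inverse)
  finally have 1: "exp t - 1 - t \<le> t * (exp t - 1)" by (simp add: algebra_simps)
  have 2: "t * (exp t - 1) \<le> t\<^sup>2 * exp \<bar>t\<bar>"
  proof (cases "t \<ge> 0")
    case True
    have "exp t - 1 \<le> t * exp t" using \<open>exp t * (1 - t) \<le> exp t * exp (- t)\<close> by (simp add: algebra_simps exp_minus_inverse)
    then have "t * (exp t - 1) \<le> t * (t * exp t)" using True by (intro mult_left_mono) auto
    then show ?thesis using True by (simp add: power2_eq_square mult_ac)
  next
    case False
    have "t \<le> exp t - 1" using exp_ge_add_one_self[of t] by linarith
    then have "t * (exp t - 1) \<le> t * t" using False by (intro mult_left_mono_neg) auto
    also have "\<dots> \<le> t * t * exp \<bar>t\<bar>" by (simp add: mult_le_cancel_left1)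
    finally show ?thesis by (simp add: power2_eq_square)
  qed
  show ?thesis using 1 2 by linarith
qed

lemma exp_abs_log_dist_le:
  "exp (\<bar>log_dist x u\<bar> / 4) \<le> (1 + norm x) powr (1/4) * (1 + norm u) powr (1/4) * (1 + sing x u)"
proof -
  have g: "1 \<le> (1 + norm x) powr (1/4) * (1 + norm u) powr (1/4)" for x u :: 'a
    using mult_mono[of 1 "(1 + norm x) powr (1/4)" 1 "(1 + norm u) powr (1/4)"] by (simp add: ge_one_powr_ge_zero)
  show ?thesis
  proof (cases "log_dist x u \<ge> 0")
    case True
    have "exp (\<bar>log_dist x u\<bar> / 4) \<le> exp ((1/4) * log_weight x + (1/4) * log_weight u)"
      using True log_dist_le[of x u] by simp
    also have "\<dots> = (1 + norm x) powr (1/4) * (1 + norm u) powr (1/4)" by (simp only: exp_add exp_log_weight)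
    also have "\<dots> \<le> (1 + norm x) powr (1/4) * (1 + norm u) powr (1/4) * (1 + sing x u)"
      using mult_left_mono[of 1 "1 + sing x u" "(1 + norm x) powr (1/4) * (1 + norm u) powr (1/4)"] sing_nonneg[of x u] by simp
    finally show ?thesis .
  next
    case False
    then have r: "0 < norm (x - u)" by (auto simp: log_dist_def)
    have "exp (\<bar>log_dist x u\<bar> / 4) = sqrt (sing x u)"
    proof -
      have "sing x u = exp (\<bar>log_dist x u\<bar> / 4 + \<bar>log_dist x u\<bar> / 4)"
        using r False by (simp add: sing_def powr_def log_dist_def)
      then have "sing x u = (exp (\<bar>log_dist x u\<bar> / 4))\<^sup>2" by (simp only: exp_add power2_eq_square)
      then show ?thesis by simp
    qed
    also have "\<dots> \<le> 1 + sing x u"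
      using sing_nonneg[of x u] arith_geo_mean_sqrt[of 1 "sing x u"] by simp
    also have "\<dots> \<le> (1 + norm x) powr (1/4) * (1 + norm u) powr (1/4) * (1 + sing x u)"
      using mult_right_mono[OF g[of x u], of "1 + sing x u"] sing_nonneg[of x u] by simp
    finally show ?thesis .
  qed
qed

context tame_measure
begin

text \<open>A second-order expansion of a moment generating function at 0. The coefficient of
  \<open>b\<close> must be exactly \<open>pot x\<close>, since it is to cancel against the mean
  field; for that of \<open>\<delta>\<close> any constant will do. The quadratic term only has to be
  bounded, as it will compete with a gain that is linear in a small parameter.\<close>

lemma exp_moment_le:
  assumes R: "0 \<le> R"
  obtains C where "0 \<le> C"
    "\<And>x \<delta> b. norm x \<le> R \<Longrightarrow> 0 \<le> \<delta> \<Longrightarrow> \<delta> + \<bar>b\<bar> \<le> 1/8 \<Longrightarrow>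
      (\<integral>\<^sup>+u. ennreal (exp (\<delta> * (1 + log_weight u) + b * log_dist x u)) \<partial>M) \<le> ennreal (exp (\<delta> * C + b * pot x + C * (\<delta> + \<bar>b\<bar>)\<^sup>2))"
proof -
  define c1 where "c1 = (\<integral>u. 1 + log_weight u \<partial>M)"
  define D where "D = exp (1/4) * (1 + R) powr (1/4)"
  define C where "C = max c1 (128 * D * tame_const (1/2))"
  have D: "0 \<le> D" using R by (simp add: D_def)
  have C0: "0 \<le> C" using D tame_const(1)[of "1/2"] by (simp add: C_def le_max_iff_disj)
  have main: "(\<integral>\<^sup>+u. ennreal (exp (\<delta> * (1 + log_weight u) + b * log_dist x u)) \<partial>M) \<le> ennreal (exp (\<delta> * C + b * pot x + C * (\<delta> + \<bar>b\<bar>)\<^sup>2))"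
    if x: "norm x \<le> R" and d: "0 \<le> \<delta>" "\<delta> + \<bar>b\<bar> \<le> 1/8" for x \<delta> b
  proof -
    define t where "t u = \<delta> * (1 + log_weight u) + b * log_dist x u" for u
    define k where "k = \<delta> + \<bar>b\<bar>"
    define h where "h u = (1 + sing x u) * (1 + norm u) powr (1/2)" for u
    have k: "0 \<le> k" "k \<le> 1/8" using d by (auto simp: k_def)
    have [measurable]: "t \<in> borel_measurable borel" unfolding t_def by measurable
    have [measurable]: "h \<in> borel_measurable borel" unfolding h_def by measurable
    have h0: "0 \<le> h u" for u unfolding h_def using sing_nonneg[of x u] by simp
    define s where "s u = 1 + log_weight u + \<bar>log_dist x u\<bar>" for u
    have s0: "0 \<le> s u" for u using log_weight_nonneg[of u] by (simp add: s_def)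
    have ts: "\<bar>t u\<bar> \<le> k * s u" for u
    proof -
      have "\<bar>t u\<bar> \<le> \<delta> * (1 + log_weight u) + \<bar>b\<bar> * \<bar>log_dist x u\<bar>"
        unfolding t_def using d(1) log_weight_nonneg[of u] by (intro order_trans[OF abs_triangle_ineq]) (simp add: abs_mult)
      also have "\<dots> \<le> k * (1 + log_weight u) + k * \<bar>log_dist x u\<bar>"
        unfolding k_def using d(1) log_weight_nonneg[of u] by (intro add_mono mult_right_mono) auto
      finally show ?thesis by (simp add: s_def distrib_left)
    qed
    have es: "exp (s u / 4) \<le> D * h u" for u
    proof -
      have "exp (s u / 4) = exp (1/4) * exp ((1/4) * log_weight u) * exp (\<bar>log_dist x u\<bar> / 4)"
        by (simp add: s_def add_divide_distrib exp_add)
      also have "\<dots> = exp (1/4) * (1 + norm u) powr (1/4) * exp (\<bar>log_dist x u\<bar> / 4)" by (simp only: exp_log_weight)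
      also have "\<dots> \<le> exp (1/4) * (1 + norm u) powr (1/4) * ((1 + norm x) powr (1/4) * (1 + norm u) powr (1/4) * (1 + sing x u))"
        by (intro mult_left_mono exp_abs_log_dist_le) simp
      also have "\<dots> = exp (1/4) * (1 + norm x) powr (1/4) * h u"
        by (simp add: h_def powr_add[symmetric])
      also have "\<dots> \<le> D * h u"
        unfolding D_def using x h0[of u] by (intro mult_right_mono mult_left_mono powr_mono2) auto
      finally show ?thesis .
    qed
    have et: "exp (t u) \<le> D * h u" for u
    proof -
      have "k * s u \<le> (1/8) * s u" using k s0[of u] by (intro mult_right_mono) auto
      then have "t u \<le> s u / 4" using ts[of u] s0[of u] by linarith
      then show ?thesis using es[of u] by (meson exp_le_cancel_iff order_trans)
    qed
    \<comment> \<open>The threshold 1/8 leaves one factor exp (s / 8) for the exponential of |t| and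
      another for s^2, which is at most 128 exp (s / 8). Together they give exp (s / 4), for which
      \<open>D * h u\<close> is an integrable majorant.\<close>
    have quad: "exp (t u) \<le> 1 + t u + 128 * k\<^sup>2 * D * h u" for u
    proof -
      have "exp (t u) \<le> 1 + t u + (t u)\<^sup>2 * exp \<bar>t u\<bar>" by (rule exp_le_quadratic)
      also have "(t u)\<^sup>2 * exp \<bar>t u\<bar> \<le> (k * s u)\<^sup>2 * exp (s u / 8)"
      proof (rule mult_mono)
        show "(t u)\<^sup>2 \<le> (k * s u)\<^sup>2" using ts[of u] abs_le_square_iff[of "t u" "k * s u"] k s0[of u] by simp
        have "k * s u \<le> (1/8) * s u" using k s0[of u] by (intro mult_right_mono) auto
        then show "exp \<bar>t u\<bar> \<le> exp (s u / 8)" using ts[of u] by simp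
      qed auto
      also have "(k * s u)\<^sup>2 * exp (s u / 8) \<le> k\<^sup>2 * (128 * exp (s u / 8)) * exp (s u / 8)"
      proof -
        have "1 + s u / 8 + (s u / 8)\<^sup>2 / 2 \<le> exp (s u / 8)" using s0[of u] by (intro exp_lower_Taylor_quadratic) simp
        then have "(s u)\<^sup>2 \<le> 128 * exp (s u / 8)" using s0[of u] by (simp add: power2_eq_square)
        then show ?thesis unfolding power_mult_distrib by (intro mult_right_mono mult_left_mono) auto
      qed
      also have "\<dots> = 128 * k\<^sup>2 * exp (s u / 4)" by (simp add: exp_add[symmetric] mult_ac)
      also have "\<dots> \<le> 128 * k\<^sup>2 * (D * h u)" by (intro mult_left_mono es) simp
      finally show ?thesis by simp
    qed
    have ih: "integrable M h" "(\<integral>u. h u \<partial>M) \<le> tame_const (1/2)"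
    proof -
      have "\<bar>h u\<bar> \<le> 1 * ((1 + sing x u) * (1 + norm u) powr (1/2))" for u using h0[of u] by (simp add: h_def)
      from tame_integrable[OF _ _ this] show "integrable M h" "(\<integral>u. h u \<partial>M) \<le> tame_const (1/2)" by auto
    qed
    have iexp: "integrable M (\<lambda>u. exp (t u))"
    proof (rule Bochner_Integration.integrable_bound)
      show "integrable M (\<lambda>u. D * h u)" using ih by simp
      show "AE u in M. norm (exp (t u)) \<le> norm (D * h u)" using et h0 D by (intro AE_I2) simp
    qed measurable
    have it: "integrable M t" "(\<integral>u. t u \<partial>M) = \<delta> * c1 + b * pot x"
      unfolding t_def c1_def pot_def using integrable_log_weight integrable_log_dist[of x] by simp_all
    have "(\<integral>u. exp (t u) \<partial>M) \<le> (\<integral>u. 1 + t u + 128 * k\<^sup>2 * D * h u \<partial>M)"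
      using iexp it(1) ih(1) quad by (intro integral_mono) auto
    also have "\<dots> = 1 + (\<delta> * c1 + b * pot x) + 128 * k\<^sup>2 * D * (\<integral>u. h u \<partial>M)"
      using it ih(1) by simp
    also have "\<dots> \<le> 1 + (\<delta> * C + b * pot x + C * k\<^sup>2)"
    proof -
      have "128 * k\<^sup>2 * D * (\<integral>u. h u \<partial>M) \<le> 128 * k\<^sup>2 * D * tame_const (1/2)" using ih(2) D by (intro mult_left_mono) auto
      also have "\<dots> = k\<^sup>2 * (128 * D * tame_const (1/2))" by simp
      also have "\<dots> \<le> k\<^sup>2 * C" by (intro mult_left_mono) (auto simp: C_def)
      finally have a: "128 * k\<^sup>2 * D * (\<integral>u. h u \<partial>M) \<le> k\<^sup>2 * C" .
      have "\<delta> * c1 \<le> \<delta> * C" using d(1) by (intro mult_left_mono) (auto simp: C_def)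
      then show ?thesis using a by (simp add: mult_ac)
    qed
    also have "\<dots> \<le> exp (\<delta> * C + b * pot x + C * k\<^sup>2)" by (rule exp_ge_add_one_self)
    finally have fin: "(\<integral>u. exp (t u) \<partial>M) \<le> exp (\<delta> * C + b * pot x + C * k\<^sup>2)" .
    have "(\<integral>\<^sup>+u. ennreal (exp (t u)) \<partial>M) = ennreal (\<integral>u. exp (t u) \<partial>M)"
      using iexp by (intro nn_integral_eq_integral) auto
    then show ?thesis using fin by (simp add: t_def k_def ennreal_leI)
  qed
  show ?thesis by (rule that[OF C0 main])
qed

lemma tame_density:
  assumes [measurable]: "f \<in> borel_measurable borel" and f: "\<And>u. 0 \<le> f u" "\<And>u. f u \<le> C * (1 + norm u) powr \<kappa>" "0 \<le> \<kappa>"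
    and int1: "(\<integral>u. f u \<partial>M) = 1"
  shows "tame_measure (density M (\<lambda>u. ennreal (f u)))"
proof -
  have C: "0 \<le> C" using f(1)[of 0] f(2)[of 0] by simp
  have ii: "integrable M f" using int1 not_integrable_integral_eq[of M f] by fastforce
  show ?thesis
  proof (intro tame_measure.intro tame_measure_axioms.intro prob_spaceI)
    have "emeasure (density M (\<lambda>u. ennreal (f u))) (space M) = (\<integral>\<^sup>+u. ennreal (f u) \<partial>M)"
      by (subst emeasure_density) (auto intro!: nn_integral_cong)
    also have "\<dots> = 1" using ii f(1) int1 by (subst nn_integral_eq_integral) auto
    finally show "emeasure (density M (\<lambda>u. ennreal (f u))) (space (density M (\<lambda>u. ennreal (f u)))) = 1" by simp
    show "sets (density M (\<lambda>u. ennreal (f u))) = sets borel" by (simp add: sets_M)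
    have "emeasure (density M (\<lambda>u. ennreal (f u))) {x} = (\<integral>\<^sup>+u. ennreal (f u) * indicator {x} u \<partial>M)" for x
      by (subst emeasure_density) (auto simp: sets_M)
    also have "\<dots> x = (\<integral>\<^sup>+u. 0 \<partial>M)" for x
      using AE_neq[of x] by (intro nn_integral_cong_AE) (auto elim!: eventually_mono)
    finally show "emeasure (density M (\<lambda>u. ennreal (f u))) {x} = 0" for x by simp
    show "\<exists>A. \<forall>x. (\<integral>\<^sup>+u. ennreal ((1 + sing x u) * (1 + norm u) powr \<kappa>') \<partial>density M (\<lambda>u. ennreal (f u))) \<le> ennreal A"
      if "0 \<le> \<kappa>'" for \<kappa>'
    proof (intro exI allI)
      fix x
      have "(\<integral>\<^sup>+u. ennreal ((1 + sing x u) * (1 + norm u) powr \<kappa>') \<partial>density M (\<lambda>u. ennreal (f u)))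
         = (\<integral>\<^sup>+u. ennreal (f u) * ennreal ((1 + sing x u) * (1 + norm u) powr \<kappa>') \<partial>M)"
        by (subst nn_integral_density) auto
      also have "\<dots> \<le> (\<integral>\<^sup>+u. ennreal C * ennreal ((1 + sing x u) * (1 + norm u) powr (\<kappa> + \<kappa>')) \<partial>M)"
      proof (rule nn_integral_mono)
        fix u
        have "f u * ((1 + sing x u) * (1 + norm u) powr \<kappa>') \<le> C * (1 + norm u) powr \<kappa> * ((1 + sing x u) * (1 + norm u) powr \<kappa>')"
          using f sing_nonneg[of x u] by (intro mult_right_mono) auto
        also have "\<dots> = C * ((1 + sing x u) * (1 + norm u) powr (\<kappa> + \<kappa>'))" by (simp add: powr_add)
        finally show "ennreal (f u) * ennreal ((1 + sing x u) * (1 + norm u) powr \<kappa>')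
            \<le> ennreal C * ennreal ((1 + sing x u) * (1 + norm u) powr (\<kappa> + \<kappa>'))"
          using f C by (simp add: ennreal_mult'[symmetric] ennreal_leI)
      qed
      also have "\<dots> = ennreal C * (\<integral>\<^sup>+u. ennreal ((1 + sing x u) * (1 + norm u) powr (\<kappa> + \<kappa>')) \<partial>M)"
        by (rule nn_integral_cmult) auto
      also have "\<dots> \<le> ennreal C * ennreal (tame_const (\<kappa> + \<kappa>'))"
        using f(3) that by (intro mult_left_mono tame_const) auto
      also have "\<dots> = ennreal (C * tame_const (\<kappa> + \<kappa>'))" using C by (simp add: ennreal_mult')
      finally show "(\<integral>\<^sup>+u. ennreal ((1 + sing x u) * (1 + norm u) powr \<kappa>') \<partial>density M (\<lambda>u. ennreal (f u))) \<le> ennreal (C * tame_const (\<kappa> + \<kappa>'))" .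
    qed
  qed
qed

end

text \<open>The limit eps to 0 of the regularised inequality. On the left the regularisation only
  increases the energies, so an error appears only on the right, and there only in the potential of
  \<open>Q\<close>.\<close>

lemma log_dist_cond_neg_def:
  fixes P Q :: "'a::euclidean_space measure"
  assumes "tame_measure P" "tame_measure Q"
  shows "(\<integral>x. \<integral>y. log_dist x y \<partial>P \<partial>P) + (\<integral>x. \<integral>y. log_dist x y \<partial>Q \<partial>Q) \<le> 2 * (\<integral>x. \<integral>y. log_dist x y \<partial>Q \<partial>P)"
proof (rule field_le_epsilon)
  interpret P: tame_measure P by fact
  interpret Q: tame_measure Q by fact
  fix e :: real assume e: "0 < e"
  let ?A = "Q.tame_const 0"
  define q where "q = e / (4 * (1 + ?A))"
  define \<epsilon> where "\<epsilon> = q\<^sup>2"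
  have A: "0 \<le> ?A" using Q.tame_const(1)[of 0] by simp
  have q: "0 < q" using e A by (simp add: q_def)
  have eps: "0 < \<epsilon>" using q by (simp add: \<epsilon>_def)
  have "4 * q * ?A \<le> 4 * q * (1 + ?A)" using q by simp
  also have "\<dots> = e" using A by (simp add: q_def field_simps)
  finally have small: "4 * sqrt \<epsilon> * ?A \<le> e" using q by (simp add: \<epsilon>_def)
  have iw: "integrable P (\<lambda>x. Q.pot_const * (1 + log_weight x) + 2 * sqrt \<epsilon> * ?A)" using P.integrable_log_weight by simp
  have ip: "integrable P Q.pot"
  proof (rule Bochner_Integration.integrable_bound)
    show "integrable P (\<lambda>x. Q.pot_const * (1 + log_weight x))" using P.integrable_log_weight by simp
  qed (use Q.abs_pot_le in \<open>auto intro!: AE_I2 order_trans[OF _ abs_ge_self]\<close>)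
  have ir: "integrable P (\<lambda>x. \<integral>y. reg_log \<epsilon> x y \<partial>Q)"
  proof (rule Bochner_Integration.integrable_bound)
    show "integrable P (\<lambda>x. \<bar>Q.pot x\<bar> + 2 * sqrt \<epsilon> * ?A)" using ip by simp
    show "AE x in P. norm (\<integral>y. reg_log \<epsilon> x y \<partial>Q) \<le> norm (\<bar>Q.pot x\<bar> + 2 * sqrt \<epsilon> * ?A)"
    proof (rule AE_I2)
      fix x
      have "0 \<le> 2 * sqrt \<epsilon> * ?A" using eps A by simp
      then show "norm (\<integral>y. reg_log \<epsilon> x y \<partial>Q) \<le> norm (\<bar>Q.pot x\<bar> + 2 * sqrt \<epsilon> * ?A)"
        using Q.pot_le_reg[OF eps, of x] Q.reg_le_pot[OF eps, of x] unfolding real_norm_def by linarith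
    qed
  qed measurable
  have "P.pot_energy + Q.pot_energy \<le> (\<integral>x. \<integral>y. reg_log \<epsilon> x y \<partial>P \<partial>P) + (\<integral>x. \<integral>y. reg_log \<epsilon> x y \<partial>Q \<partial>Q)"
    using P.pot_energy_le_reg[OF eps] Q.pot_energy_le_reg[OF eps] by simp
  also have "\<dots> \<le> 2 * (\<integral>x. \<integral>y. reg_log \<epsilon> x y \<partial>Q \<partial>P)"
    by (rule reg_log_cond_neg_def[OF eps P.prob_space_axioms P.sets_M Q.prob_space_axioms Q.sets_M
          P.integrable_ln_reg_weight[OF eps] Q.integrable_ln_reg_weight[OF eps]])
  also have "\<dots> \<le> 2 * (\<integral>x. Q.pot x + 2 * sqrt \<epsilon> * ?A \<partial>P)"
    using ir ip Q.reg_le_pot[OF eps] by (intro mult_left_mono integral_mono) auto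
  also have "\<dots> = 2 * (\<integral>x. Q.pot x \<partial>P) + 4 * sqrt \<epsilon> * ?A" using ip by simp
  also have "\<dots> \<le> 2 * (\<integral>x. Q.pot x \<partial>P) + e" using small by simp
  finally show "(\<integral>x. \<integral>y. log_dist x y \<partial>P \<partial>P) + (\<integral>x. \<integral>y. log_dist x y \<partial>Q \<partial>Q) \<le> 2 * (\<integral>x. \<integral>y. log_dist x y \<partial>Q \<partial>P) + e"
    unfolding P.pot_energy_def Q.pot_energy_def P.pot_def Q.pot_def .
qed

section \<open>Asymptotic independence under the Gibbs weight\<close>

text \<open>Jensen's inequality from the tangent of exp at the mean. The right side is a nonnegative
  integral, so that nothing need be known beforehand about the integrability of exp T.\<close>

lemma (in prob_space) exp_expectation_le:
  fixes T :: "'a \<Rightarrow> real"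
  assumes T: "integrable M T"
  shows "ennreal (exp (expectation T)) \<le> (\<integral>\<^sup>+x. ennreal (exp (T x)) \<partial>M)"
proof (cases "(\<integral>\<^sup>+x. ennreal (exp (T x)) \<partial>M) = \<infinity>")
  case False
  have [measurable]: "T \<in> borel_measurable M" using T by auto
  have i: "integrable M (\<lambda>x. exp (T x))"
    using False by (intro integrableI_nonneg) (auto simp: top.not_eq_extremum)
  define m where "m = expectation T"
  have "exp m = (\<integral>x. exp m * (1 + (T x - m)) \<partial>M)" using T by (simp add: m_def prob_space)
  also have "\<dots> \<le> (\<integral>x. exp (T x) \<partial>M)"
  proof (rule integral_mono)
    fix x
    have "exp m * (1 + (T x - m)) \<le> exp m * exp (T x - m)" by (intro mult_left_mono exp_ge_add_one_self) simp
    then show "exp m * (1 + (T x - m)) \<le> exp (T x)" by (simp add: exp_diff)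
  qed (use T i in auto)
  also have "ennreal \<dots> = (\<integral>\<^sup>+x. ennreal (exp (T x)) \<partial>M)"
    using i by (intro nn_integral_eq_integral[symmetric]) auto
  finally show ?thesis using i by (simp add: m_def nn_integral_eq_integral ennreal_leI)
qed simp

text \<open>For |S| at most \<open>\<eta>\<close> the first term suffices; beyond that one of the
  two exponentials does. With \<open>p\<close> proportional to the number of points these are the
  exponentials of Chernoff's bound for a deviation of S by \<open>\<eta>\<close>, and their
  integrals decay exponentially.\<close>

lemma abs_exp_minus_one_le:
  fixes S \<eta> p :: real
  assumes "0 < \<eta>" "1 \<le> p"
  shows "\<bar>exp S - 1\<bar> \<le> (exp \<eta> - 1) + exp \<eta> * exp (p * (S - \<eta>)) + exp (p * (- S - \<eta>))"
proof -
  have p: "0 \<le> exp \<eta> * exp (p * (S - \<eta>))" "0 \<le> exp (p * (- S - \<eta>))" "0 \<le> exp \<eta> - 1" using assms by auto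
  consider "S > \<eta>" | "S < - \<eta>" | "\<bar>S\<bar> \<le> \<eta>" by linarith
  then show ?thesis
  proof cases
    case 1
    then have "S - \<eta> \<le> p * (S - \<eta>)" using assms mult_right_mono[of 1 p "S - \<eta>"] by simp
    then have "exp \<eta> * exp (S - \<eta>) \<le> exp \<eta> * exp (p * (S - \<eta>))" by simp
    moreover have "exp \<eta> * exp (S - \<eta>) = exp S" by (simp add: exp_add[symmetric])
    moreover have "1 \<le> exp S" using 1 assms by simp
    ultimately show ?thesis using p by linarith
  next
    case 2
    then have "0 \<le> p * (- S - \<eta>)" using assms by simp
    then have "1 \<le> exp (p * (- S - \<eta>))" by simp
    moreover have "exp S \<le> 1" "0 < exp S" using 2 assms by auto
    ultimately show ?thesis using p by linarith
  next
    case 3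
    have "exp S \<le> exp \<eta>" using 3 by simp
    moreover have "1 - exp S \<le> exp \<eta> - 1"
    proof -
      have "exp (- \<eta>) \<le> exp S" using 3 by simp
      moreover have "2 \<le> exp \<eta> + exp (- \<eta>)"
        using exp_ge_add_one_self[of \<eta>] exp_ge_add_one_self[of "- \<eta>"] by linarith
      ultimately show ?thesis by linarith
    qed
    ultimately show ?thesis using p by linarith
  qed
qed

section \<open>Independent points and their centred interaction\<close>

context tame_measure
begin

abbreviation iid :: "nat set \<Rightarrow> (nat \<Rightarrow> 'a) measure" where
  "iid I \<equiv> PiM I (\<lambda>_. M)"

lemma prob_space_iid: "prob_space (iid I)"
  by (rule prob_space_PiM) (rule prob_space_axioms)

lemma product_sigma_finite_M: "product_sigma_finite (\<lambda>_::nat. M)"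
  by (simp add: product_sigma_finite_def sigma_finite_measure_axioms)

lemma distr_iid_pair:
  assumes I: "finite I" "i \<in> I" "j \<in> I" "i \<noteq> j"
  shows "distr (iid I) (M \<Otimes>\<^sub>M M) (\<lambda>X. (X i, X j)) = M \<Otimes>\<^sub>M M"
proof (rule pair_measure_eqI[symmetric])
  interpret PS: product_sigma_finite "\<lambda>_::nat. M" by (rule product_sigma_finite_M)
  have [measurable]: "(\<lambda>X. X i) \<in> measurable (iid I) M" "(\<lambda>X. X j) \<in> measurable (iid I) M"
    using I by (auto intro: measurable_component_singleton)
  fix A B assume [measurable]: "A \<in> sets M" "B \<in> sets M"
  have "emeasure (distr (iid I) (M \<Otimes>\<^sub>M M) (\<lambda>X. (X i, X j))) (A \<times> B)
      = emeasure (iid I) ((\<lambda>X. (X i, X j)) -` (A \<times> B) \<inter> space (iid I))"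
    by (rule emeasure_distr) auto
  also have "(\<lambda>X. (X i, X j)) -` (A \<times> B) \<inter> space (iid I) = (\<Pi>\<^sub>E k\<in>I. if k = i then A else if k = j then B else space M)"
    using I sets.sets_into_space[of A M] sets.sets_into_space[of B M]
    by (auto simp: space_PiM PiE_iff split: if_splits)
  also have "emeasure (iid I) \<dots> = (\<Prod>k\<in>I. emeasure M (if k = i then A else if k = j then B else space M))"
    using I(1) by (intro PS.emeasure_PiM) auto
  also have "\<dots> = emeasure M A * emeasure M B * (\<Prod>k\<in>I - {i, j}. emeasure M (if k = i then A else if k = j then B else space M))"
    using I by (subst prod.subset_diff[of "{i, j}" I]) (auto simp: mult_ac)
  also have "(\<Prod>k\<in>I - {i, j}. emeasure M (if k = i then A else if k = j then B else space M)) = 1"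
    by (rule prod.neutral) (auto simp: emeasure_space_1[simplified])
  finally show "emeasure M A * emeasure M B = emeasure (distr (iid I) (M \<Otimes>\<^sub>M M) (\<lambda>X. (X i, X j))) (A \<times> B)" by simp
qed (auto simp: sigma_finite_measure_axioms)

lemma integrable_pair_log_dist: "integrable (M \<Otimes>\<^sub>M M) (\<lambda>(x, y). log_dist x y)"
proof -
  interpret MM: pair_prob_space M M ..
  show ?thesis
  proof (rule MM.Fubini_integrable)
    show "integrable M (\<lambda>x. \<integral>y. norm (case (x, y) of (x, y) \<Rightarrow> log_dist x y) \<partial>M)"
    proof (rule Bochner_Integration.integrable_bound)
      show "integrable M (\<lambda>x. log_weight x + (\<integral>u. log_weight u \<partial>M) + 2 * tame_const 0)"
        using integrable_log_weight by simp
      show "AE x in M. norm (\<integral>y. norm (case (x, y) of (x, y) \<Rightarrow> log_dist x y) \<partial>M)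
          \<le> norm (log_weight x + (\<integral>u. log_weight u \<partial>M) + 2 * tame_const 0)"
      proof (rule AE_I2)
        fix x
        have "(\<integral>y. \<bar>log_dist x y\<bar> \<partial>M) \<le> (\<integral>y. log_weight x + log_weight y + 2 * sing x y \<partial>M)"
          using abs_log_dist_le integrable_log_dist[of x] integrable_log_weight integrable_sing(1)[of x]
          by (intro integral_mono) auto
        also have "\<dots> = log_weight x + (\<integral>u. log_weight u \<partial>M) + 2 * (\<integral>y. sing x y \<partial>M)"
          using integrable_log_weight integrable_sing(1)[of x] by simp
        finally have "(\<integral>y. \<bar>log_dist x y\<bar> \<partial>M) \<le> log_weight x + (\<integral>u. log_weight u \<partial>M) + 2 * tame_const 0"
          using integrable_sing(2)[of x] by simp
        moreover have "0 \<le> (\<integral>y. \<bar>log_dist x y\<bar> \<partial>M)" by (rule Bochner_Integration.integral_nonneg) simp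
        ultimately show "norm (\<integral>y. norm (case (x, y) of (x, y) \<Rightarrow> log_dist x y) \<partial>M)
          \<le> norm (log_weight x + (\<integral>u. log_weight u \<partial>M) + 2 * tame_const 0)" by simp
      qed
    qed measurable
    show "AE x in M. integrable M (\<lambda>y. case (x, y) of (x, y) \<Rightarrow> log_dist x y)"
      using integrable_log_dist by simp
  qed measurable
qed

lemma iid_pair_log_dist:
  assumes I: "finite I" "i \<in> I" "j \<in> I" "i \<noteq> j"
  shows "integrable (iid I) (\<lambda>X. log_dist (X i) (X j))" "(\<integral>X. log_dist (X i) (X j) \<partial>iid I) = pot_energy"
proof -
  interpret MM: pair_prob_space M M ..
  have [measurable]: "(\<lambda>X. X i) \<in> measurable (iid I) M" "(\<lambda>X. X j) \<in> measurable (iid I) M"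
    using I by (auto intro: measurable_component_singleton)
  have m: "(\<lambda>X. (X i, X j)) \<in> measurable (iid I) (M \<Otimes>\<^sub>M M)" by measurable
  have m': "(\<lambda>(x, y). log_dist x y) \<in> borel_measurable (M \<Otimes>\<^sub>M M)" by measurable
  show "integrable (iid I) (\<lambda>X. log_dist (X i) (X j))"
    using integrable_pair_log_dist integrable_distr_eq[OF m m'] by (simp add: distr_iid_pair[OF I])
  show "(\<integral>X. log_dist (X i) (X j) \<partial>iid I) = pot_energy"
    using integral_distr[OF m m'] MM.integral_fst'[OF integrable_pair_log_dist]
    by (simp add: distr_iid_pair[OF I] pot_energy_def pot_def)
qed

lemma iid_component:
  assumes "i \<in> I" and g: "integrable M g"
  shows "integrable (iid I) (\<lambda>X. g (X i))" "(\<integral>X. g (X i) \<partial>iid I) = (\<integral>x. g x \<partial>M :: real)"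
proof -
  have m: "(\<lambda>X. X i) \<in> measurable (iid I) M" using assms by (auto intro: measurable_component_singleton)
  have d: "distr (iid I) M (\<lambda>X. X i) = M"
    using assms(1) by (intro distr_PiM_component prob_space_axioms)
  show "integrable (iid I) (\<lambda>X. g (X i))" using integrable_distr_eq[OF m, of g] g d by simp
  show "(\<integral>X. g (X i) \<partial>iid I) = (\<integral>x. g x \<partial>M)" using integral_distr[OF m, of g] g d by simp
qed

text \<open>Any two of the points are independent with a law without atoms. Consequently the default
  value of \<open>log_dist\<close> on the diagonal is met only on a null set.\<close>

lemma AE_iid_inj:
  assumes I: "finite I"
  shows "AE X in iid I. inj_on X I"
proof -
  interpret MM: pair_prob_space M M ..
  have "AE X in iid I. X i \<noteq> X j" if ij: "i \<in> I" "j \<in> I" "i \<noteq> j" for i j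
  proof -
    have m: "(\<lambda>X. (X i, X j)) \<in> measurable (iid I) (M \<Otimes>\<^sub>M M)"
      using ij by (intro measurable_Pair measurable_component_singleton) auto
    have "AE p in M \<Otimes>\<^sub>M M. fst p \<noteq> snd p"
    proof (rule MM.AE_pair_measure)
      have "Measurable.pred (M \<Otimes>\<^sub>M M) (\<lambda>p. fst p \<noteq> snd p)" by measurable
      then show "{x \<in> space (M \<Otimes>\<^sub>M M). fst x \<noteq> snd x} \<in> sets (M \<Otimes>\<^sub>M M)" by simp
      show "AE x in M. AE y in M. fst (x, y) \<noteq> snd (x, y)" proof (rule AE_I2)
        fix x
        show "AE y in M. fst (x, y) \<noteq> snd (x, y)" using AE_neq[of x] by eventually_elim auto
      qed
    qed
    then have "AE p in distr (iid I) (M \<Otimes>\<^sub>M M) (\<lambda>X. (X i, X j)). fst p \<noteq> snd p"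
      by (simp only: distr_iid_pair[OF I ij])
    from AE_distrD[OF m this] show ?thesis by simp
  qed
  then have "AE X in iid I. \<forall>i\<in>I. \<forall>j\<in>I. i \<noteq> j \<longrightarrow> X i \<noteq> X j"
    by (intro AE_ball_countable[THEN iffD2] countable_finite I ballI) (auto intro!: AE_impI)
  then show ?thesis by eventually_elim (auto simp: inj_on_def)
qed

text \<open>When \<open>M\<close> is the equilibrium measure, this is up to a constant the logarithm
  of the density of the Gibbs weight with respect to independent points of law \<open>M\<close>. The
  one-point terms centre the pair interaction, cancelling the mean of the double sum to leading
  order. The double sum runs over ordered pairs, whence \<open>\<beta> / 2\<close>.\<close>

definition gibbs_log :: "real \<Rightarrow> real \<Rightarrow> nat set \<Rightarrow> (nat \<Rightarrow> 'a) \<Rightarrow> real" where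
  "gibbs_log \<beta> \<gamma> I X = \<beta> / 2 * (\<Sum>i\<in>I. \<Sum>j\<in>I - {i}. log_dist (X i) (X j))
     + (\<Sum>i\<in>I. \<gamma> * pot_energy / 2 - \<gamma> * pot (X i))"

text \<open>The field exerted at \<open>z\<close> by the points of \<open>I\<close>, minus its
  mean-field value. Its mean under \<open>iid I\<close> is
  \<open>\<beta> * card I - \<gamma>\<close> times \<open>pot z\<close>, and this tends to 0 in the
  regime considered.\<close>

definition cross :: "real \<Rightarrow> real \<Rightarrow> nat set \<Rightarrow> (nat \<Rightarrow> 'a) \<Rightarrow> 'a \<Rightarrow> real" where
  "cross \<beta> \<gamma> I X z = \<beta> * (\<Sum>j\<in>I. log_dist z (X j)) - \<gamma> * pot z"

lemma gibbs_log_insert: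
  assumes "finite I" "k \<notin> I"
  shows "gibbs_log \<beta> \<gamma> (insert k I) (X(k := z)) = gibbs_log \<beta> \<gamma> I X + cross \<beta> \<gamma> I X z + \<gamma> * pot_energy / 2"
proof -
  let ?Y = "X(k := z)"
  have 1: "(\<Sum>j\<in>insert k I - {i}. log_dist (?Y i) (?Y j)) = log_dist z (X i) + (\<Sum>j\<in>I - {i}. log_dist (X i) (X j))"
    if "i \<in> I" for i
  proof -
    have "insert k I - {i} = insert k (I - {i})" using assms that by auto
    then have "(\<Sum>j\<in>insert k I - {i}. log_dist (?Y i) (?Y j)) = log_dist (?Y i) (?Y k) + (\<Sum>j\<in>I - {i}. log_dist (?Y i) (?Y j))"
      using assms by simp
    also have "(\<Sum>j\<in>I - {i}. log_dist (?Y i) (?Y j)) = (\<Sum>j\<in>I - {i}. log_dist (X i) (X j))"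
      using assms that by (intro sum.cong) auto
    also have "log_dist (?Y i) (?Y k) = log_dist z (X i)" using assms that by (auto simp: log_dist_commute)
    finally show ?thesis .
  qed
  have 2: "insert k I - {k} = I" using assms by auto
  have 3: "(\<Sum>j\<in>I. log_dist (?Y k) (?Y j)) = (\<Sum>j\<in>I. log_dist z (X j))"
    using assms by (intro sum.cong) auto
  have 4: "(\<Sum>i\<in>I. \<gamma> * pot_energy / 2 - \<gamma> * pot (?Y i)) = (\<Sum>i\<in>I. \<gamma> * pot_energy / 2 - \<gamma> * pot (X i))"
    using assms by (intro sum.cong) auto
  show ?thesis
    unfolding gibbs_log_def cross_def sum.insert[OF assms] 2 3 4 using 1
    by (simp add: sum.distrib algebra_simps add_divide_distrib)
qed

lemma gibbs_log_measurable[measurable]: "finite I \<Longrightarrow> gibbs_log \<beta> \<gamma> I \<in> borel_measurable (iid I)"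
  unfolding gibbs_log_def[abs_def] by measurable

lemma cross_measurable[measurable]: "finite I \<Longrightarrow> (\<lambda>(z, X). cross \<beta> \<gamma> I X z) \<in> borel_measurable (borel \<Otimes>\<^sub>M iid I)"
  unfolding cross_def[abs_def] by measurable

lemma integral_gibbs_log:
  assumes "finite I"
  shows "integrable (iid I) (gibbs_log \<beta> \<gamma> I)"
    "(\<integral>X. gibbs_log \<beta> \<gamma> I X \<partial>iid I) = real (card I) * (pot_energy / 2) * (\<beta> * (real (card I) - 1) - \<gamma>)"
proof -
  interpret I: prob_space "iid I" by (rule prob_space_iid)
  have i1: "integrable (iid I) (\<lambda>X. log_dist (X i) (X j))" "(\<integral>X. log_dist (X i) (X j) \<partial>iid I) = pot_energy"
    if "i \<in> I" "j \<in> I - {i}" for i j using iid_pair_log_dist[of I i j] assms that by auto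
  have i2: "integrable (iid I) (\<lambda>X. pot (X i))" "(\<integral>X. pot (X i) \<partial>iid I) = pot_energy" if "i \<in> I" for i
    using iid_component[OF that integrable_pot] by (auto simp: pot_energy_def)
  have s1: "integrable (iid I) (\<lambda>X. \<Sum>i\<in>I. \<Sum>j\<in>I - {i}. log_dist (X i) (X j))"
    using i1 by (intro Bochner_Integration.integrable_sum) auto
  have s2: "integrable (iid I) (\<lambda>X. \<Sum>i\<in>I. \<gamma> * pot_energy / 2 - \<gamma> * pot (X i))"
    using i2 by (intro Bochner_Integration.integrable_sum) auto
  show "integrable (iid I) (gibbs_log \<beta> \<gamma> I)"
    unfolding gibbs_log_def[abs_def] using s1 s2 by simp
  have e1: "(\<integral>X. (\<Sum>i\<in>I. \<Sum>j\<in>I - {i}. log_dist (X i) (X j)) \<partial>iid I) = (\<Sum>i\<in>I. (real (card I) - 1) * pot_energy)"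
  proof -
    have "(\<integral>X. (\<Sum>i\<in>I. \<Sum>j\<in>I - {i}. log_dist (X i) (X j)) \<partial>iid I) = (\<Sum>i\<in>I. \<integral>X. (\<Sum>j\<in>I - {i}. log_dist (X i) (X j)) \<partial>iid I)"
      using i1 by (intro Bochner_Integration.integral_sum Bochner_Integration.integrable_sum) auto
    also have "\<dots> = (\<Sum>i\<in>I. \<Sum>j\<in>I - {i}. \<integral>X. log_dist (X i) (X j) \<partial>iid I)"
      using i1 by (intro sum.cong Bochner_Integration.integral_sum) auto
    also have "\<dots> = (\<Sum>i\<in>I. \<Sum>j\<in>I - {i}. pot_energy)" using i1 by (intro sum.cong) auto
    also have "\<dots> = (\<Sum>i\<in>I. (real (card I) - 1) * pot_energy)"
    proof (rule sum.cong)
      fix i assume "i \<in> I"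
      then have "1 \<le> card I" using assms card_gt_0_iff[of I] by (simp add: Suc_le_eq) blast
      then show "(\<Sum>j\<in>I - {i}. pot_energy) = (real (card I) - 1) * pot_energy"
        using \<open>i \<in> I\<close> assms by (simp add: of_nat_diff)
    qed simp
    finally show ?thesis .
  qed
  have e2: "(\<integral>X. (\<Sum>i\<in>I. \<gamma> * pot_energy / 2 - \<gamma> * pot (X i)) \<partial>iid I) = (\<Sum>i\<in>I. \<gamma> * pot_energy / 2 - \<gamma> * pot_energy)"
    using i2 by (subst Bochner_Integration.integral_sum) (auto intro!: sum.cong simp: I.prob_space)
  show "(\<integral>X. gibbs_log \<beta> \<gamma> I X \<partial>iid I) = real (card I) * (pot_energy / 2) * (\<beta> * (real (card I) - 1) - \<gamma>)"
  proof -
    have "(\<integral>X. gibbs_log \<beta> \<gamma> I X \<partial>iid I) = \<beta> / 2 * (\<integral>X. (\<Sum>i\<in>I. \<Sum>j\<in>I - {i}. log_dist (X i) (X j)) \<partial>iid I)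
       + (\<integral>X. (\<Sum>i\<in>I. \<gamma> * pot_energy / 2 - \<gamma> * pot (X i)) \<partial>iid I)"
      unfolding gibbs_log_def using s1 s2 by (subst Bochner_Integration.integral_add) simp_all
    then show ?thesis unfolding e1 e2 by (simp add: field_simps)
  qed
qed

end

section \<open>The mean-field regime: bounds on the weight and its mass\<close>

locale gibbs_limit = tame_measure M for M :: "'a::euclidean_space measure" +
  fixes b :: "nat \<Rightarrow> real" and \<gamma> :: real
  assumes b_nonneg: "0 \<le> b n" and \<gamma>_nonneg: "0 \<le> \<gamma>"
    and b_lim: "(\<lambda>n. real n * b n) \<longlonglongrightarrow> \<gamma>"
begin

lemma ev_nb: "0 < e \<Longrightarrow> \<forall>\<^sub>F n in sequentially. \<bar>real n * b n - \<gamma>\<bar> < e"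
  using tendstoD[OF b_lim, of e] by (simp add: dist_real_def)

lemma ev_nb_le: "\<forall>\<^sub>F n in sequentially. real n * b n \<le> \<gamma> + 1"
  using ev_nb[of 1] by (auto elim!: eventually_mono)

lemma b_lim_0: "b \<longlonglongrightarrow> 0"
proof -
  have "(\<lambda>n. (real n * b n) * (1 / real n)) \<longlonglongrightarrow> \<gamma> * 0"
    by (intro tendsto_mult b_lim lim_1_over_n)
  moreover have "\<forall>\<^sub>F n in sequentially. (real n * b n) * (1 / real n) = b n"
    using eventually_gt_at_top[of 0] by eventually_elim simp
  ultimately show ?thesis by (auto elim: Lim_transform_eventually)
qed

lemma ev_mult_small: "0 < e \<Longrightarrow> \<forall>\<^sub>F n in sequentially. \<bar>real n * b n - \<gamma>\<bar> * c < e"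
proof -
  assume e: "0 < e"
  have "(\<lambda>n. \<bar>real n * b n - \<gamma>\<bar> * c) \<longlonglongrightarrow> \<bar>\<gamma> - \<gamma>\<bar> * c" by (intro tendsto_intros b_lim)
  then show ?thesis using e by (auto dest: order_tendstoD)
qed

text \<open>After \<open>empirical_energy_le\<close> is inserted, the terms in \<open>pot\<close>
  and \<open>pot_energy\<close> would cancel if n b were equal to \<open>\<gamma>\<close>. Four
  errors per point remain, each given a quarter of \<open>\<delta>\<close>: n b - gamma times
  \<open>pot\<close>, the same times half of \<open>pot_energy\<close>, the regularisation error,
  and the self-energy b ln eps / 2, which vanishes because b tends to 0 at a fixed scale
  eps.\<close>

lemma gibbs_log_le:
  assumes \<delta>: "0 < \<delta>"
  shows "\<forall>\<^sub>F n in sequentially. \<forall>I X. finite I \<and> card I = n \<and> inj_on X I \<longrightarrow>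
     gibbs_log (b n) \<gamma> I X \<le> (\<Sum>i\<in>I. \<delta> * (1 + log_weight (X i)))"
proof -
  let ?A = "tame_const 0"
  have A: "0 \<le> ?A" using tame_const(1)[of 0] by simp
  \<comment> \<open>The factor \<open>1 + \<gamma>\<close> is an eventual bound for n b, which
    multiplies the regularisation error.\<close>
  define q where "q = \<delta> / (8 * (1 + \<gamma>) * (1 + ?A))"
  define \<epsilon> where "\<epsilon> = q\<^sup>2"
  have q: "0 < q" using A \<delta> \<gamma>_nonneg by (simp add: q_def)
  have eps: "0 < \<epsilon>" using q by (simp add: \<epsilon>_def)
  have sq: "sqrt \<epsilon> = q" using q by (simp add: \<epsilon>_def)
  have k2: "(\<gamma> + 1) * (2 * sqrt \<epsilon> * ?A) \<le> \<delta> / 4"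
  proof -
    have "(\<gamma> + 1) * (2 * q * ?A) \<le> (\<gamma> + 1) * (2 * q * (1 + ?A))" using q \<gamma>_nonneg by (intro mult_left_mono) auto
    also have "\<dots> = \<delta> / 4" using A \<gamma>_nonneg by (simp add: q_def divide_simps add_nonneg_eq_0_iff)
    finally show ?thesis by (simp add: sq)
  qed
  have e1: "\<forall>\<^sub>F n in sequentially. \<bar>real n * b n - \<gamma>\<bar> * pot_const < \<delta> / 4" using \<delta> by (intro ev_mult_small) auto
  have e2: "\<forall>\<^sub>F n in sequentially. \<bar>real n * b n - \<gamma>\<bar> * (\<bar>pot_energy\<bar> / 2) < \<delta> / 4" using \<delta> by (intro ev_mult_small) auto
  have "(\<lambda>n. b n * (\<bar>ln \<epsilon>\<bar> / 2)) \<longlonglongrightarrow> 0 * (\<bar>ln \<epsilon>\<bar> / 2)" by (intro tendsto_intros b_lim_0)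
  then have e3: "\<forall>\<^sub>F n in sequentially. b n * (\<bar>ln \<epsilon>\<bar> / 2) < \<delta> / 4" by (rule order_tendstoD(2)) (use \<delta> in simp)
  show ?thesis
    using e1 e2 e3 ev_nb_le eventually_gt_at_top[of 0]
  proof eventually_elim
    case (elim n)
    show ?case
    proof (intro allI impI, elim conjE)
      fix I :: "nat set" and X :: "nat \<Rightarrow> 'a" assume I: "finite I" "card I = n" "inj_on X I"
      have ne: "I \<noteq> {}" using I elim by auto
      let ?b = "b n" and ?n = "real n" and ?k = "2 * sqrt \<epsilon> * ?A"
      have "gibbs_log ?b \<gamma> I X \<le> ?b / 2 * (2 * ?n * (\<Sum>i\<in>I. pot (X i) + ?k) - ?n\<^sup>2 * pot_energy - ?n * ln \<epsilon>)
           + (\<Sum>i\<in>I. \<gamma> * pot_energy / 2 - \<gamma> * pot (X i))"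
        unfolding gibbs_log_def using empirical_energy_le[OF I(1) ne I(3) eps] b_nonneg[of n] I(2)
        by (intro add_right_mono mult_left_mono) auto
      also have "\<dots> = (\<Sum>i\<in>I. (?n * ?b - \<gamma>) * pot (X i) + (?n * ?b) * ?k + (\<gamma> - ?n * ?b) * (pot_energy / 2) - ?b * (ln \<epsilon> / 2))"
      proof -
        have "(\<Sum>i\<in>I. (?n * ?b - \<gamma>) * pot (X i) + (?n * ?b) * ?k + (\<gamma> - ?n * ?b) * (pot_energy / 2) - ?b * (ln \<epsilon> / 2))
          = (?n * ?b - \<gamma>) * (\<Sum>i\<in>I. pot (X i)) + ?n * ((?n * ?b) * ?k + (\<gamma> - ?n * ?b) * (pot_energy / 2) - ?b * (ln \<epsilon> / 2))"
          using I(2) by (simp add: sum.distrib sum_subtractf sum_distrib_left[symmetric] algebra_simps)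
        moreover have "(\<Sum>i\<in>I. pot (X i) + ?k) = (\<Sum>i\<in>I. pot (X i)) + ?n * ?k" using I(2) by (simp add: sum.distrib)
        moreover have "(\<Sum>i\<in>I. \<gamma> * pot_energy / 2 - \<gamma> * pot (X i)) = ?n * (\<gamma> * pot_energy / 2) - \<gamma> * (\<Sum>i\<in>I. pot (X i))"
          using I(2) by (simp add: sum_subtractf sum_distrib_left)
        ultimately show ?thesis by (simp add: power2_eq_square field_simps)
      qed
      also have "\<dots> \<le> (\<Sum>i\<in>I. \<delta> * (1 + log_weight (X i)))"
      proof (rule sum_mono)
        fix i assume "i \<in> I"
        let ?w = "log_weight (X i)"
        have w: "0 \<le> ?w" by (rule log_weight_nonneg)
        have "(?n * ?b - \<gamma>) * pot (X i) \<le> \<bar>?n * ?b - \<gamma>\<bar> * (pot_const * (1 + ?w))"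
          by (rule order_trans[OF abs_ge_self]) (simp add: abs_mult mult_left_mono abs_pot_le)
        also have "\<dots> = (\<bar>?n * ?b - \<gamma>\<bar> * pot_const) * (1 + ?w)" by simp
        also have "\<dots> \<le> \<delta> / 4 * (1 + ?w)" using elim(1) w by (intro mult_right_mono) auto
        finally have 1: "(?n * ?b - \<gamma>) * pot (X i) \<le> \<delta> / 4 * (1 + ?w)" .
        have "(?n * ?b) * ?k \<le> (\<gamma> + 1) * ?k" using elim(4) A eps by (intro mult_right_mono) auto
        then have 2: "(?n * ?b) * ?k \<le> \<delta> / 4" using k2 by linarith
        have "(\<gamma> - ?n * ?b) * (pot_energy / 2) \<le> \<bar>?n * ?b - \<gamma>\<bar> * (\<bar>pot_energy\<bar> / 2)"
          by (rule order_trans[OF abs_ge_self]) (simp add: abs_mult abs_minus_commute)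
        then have 3: "(\<gamma> - ?n * ?b) * (pot_energy / 2) \<le> \<delta> / 4" using elim(2) by linarith
        have "- (?b * (ln \<epsilon> / 2)) \<le> ?b * (\<bar>ln \<epsilon>\<bar> / 2)"
          unfolding mult_minus_right[symmetric] using b_nonneg[of n] by (intro mult_left_mono) auto
        then have 4: "- (?b * (ln \<epsilon> / 2)) \<le> \<delta> / 4" using elim(3) by linarith
        have 5: "\<delta> * (1 + ?w) = \<delta> / 4 * (1 + ?w) + \<delta> / 4 + \<delta> / 4 + \<delta> / 4 + 3 * (\<delta> * ?w) / 4"
          by (simp add: field_simps)
        have 6: "0 \<le> \<delta> * ?w" using w \<delta> by simp
        show "(?n * ?b - \<gamma>) * pot (X i) + (?n * ?b) * ?k + (\<gamma> - ?n * ?b) * (pot_energy / 2) - ?b * (ln \<epsilon> / 2) \<le> \<delta> * (1 + ?w)"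
          using 1 2 3 4 5 6 by linarith
      qed
      finally show "gibbs_log ?b \<gamma> I X \<le> (\<Sum>i\<in>I. \<delta> * (1 + log_weight (X i)))" .
    qed
  qed
qed

text \<open>\<open>s\<close> collects the one-point functions already switched on. Being nonnegative
  they only help in upper bounds; the bound \<open>C\<close> on their total mean, independent of n,
  limits what they cost in Jensen's inequality. The functions may differ from point to point,
  because f is switched on at some points only.\<close>

definition admissible :: "real \<Rightarrow> nat \<Rightarrow> nat set \<Rightarrow> (nat \<Rightarrow> 'a \<Rightarrow> real) \<Rightarrow> bool" where
  "admissible C n I s \<longleftrightarrow> finite I \<and> card I = n \<and>
     (\<forall>j\<in>I. s j \<in> borel_measurable borel \<and> integrable M (s j) \<and> (\<forall>x. 0 \<le> s j x)) \<and> (\<Sum>j\<in>I. \<integral>x. s j x \<partial>M) \<le> C"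

definition weight :: "nat \<Rightarrow> nat set \<Rightarrow> (nat \<Rightarrow> 'a \<Rightarrow> real) \<Rightarrow> (nat \<Rightarrow> 'a) \<Rightarrow> real" where
  "weight n I s X = gibbs_log (b n) \<gamma> I X - (\<Sum>j\<in>I. s j (X j))"

definition mass :: "nat \<Rightarrow> nat set \<Rightarrow> (nat \<Rightarrow> 'a \<Rightarrow> real) \<Rightarrow> ennreal" where
  "mass n I s = (\<integral>\<^sup>+X. ennreal (exp (weight n I s X)) \<partial>iid I)"

text \<open>The mass once a further point has been placed at \<open>z\<close>, apart from the
  factors split off in \<open>gibbs_mass_split\<close>. As a function of \<open>z\<close> it is the
  unnormalised density, relative to \<open>M\<close>, of that point before a one-point function acts
  on it.\<close>

definition tilted_mass :: "nat \<Rightarrow> nat set \<Rightarrow> (nat \<Rightarrow> 'a \<Rightarrow> real) \<Rightarrow> 'a \<Rightarrow> ennreal" where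
  "tilted_mass n I s z = (\<integral>\<^sup>+X. ennreal (exp (weight n I s X + cross (b n) \<gamma> I X z)) \<partial>iid I)"

lemma admissibleD:
  assumes "admissible C n I s"
  shows "finite I" "card I = n" "j \<in> I \<Longrightarrow> s j \<in> borel_measurable borel" "j \<in> I \<Longrightarrow> integrable M (s j)"
    "j \<in> I \<Longrightarrow> 0 \<le> s j x" "(\<Sum>j\<in>I. \<integral>x. s j x \<partial>M) \<le> C"
  using assms by (auto simp: admissible_def)

lemma weight_measurable[measurable]:
  assumes "admissible C n I s"
  shows "weight n I s \<in> borel_measurable (iid I)"
proof -
  note [measurable] = admissibleD(1,3)[OF assms]
  show ?thesis unfolding weight_def[abs_def] by measurable
qed

lemma weight_le: "admissible C n I s \<Longrightarrow> weight n I s X \<le> gibbs_log (b n) \<gamma> I X"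
  unfolding weight_def using admissibleD(5)[of C n I s] by (simp add: sum_nonneg)

text \<open>Jensen's inequality; centring the interaction at \<open>M\<close> makes the mean of the exponent \<open>o(n)\<close>.\<close>

lemma mass_ge:
  assumes \<delta>: "0 < \<delta>"
  shows "\<forall>\<^sub>F n in sequentially. \<forall>I s. admissible C n I s \<longrightarrow> ennreal (exp (- \<delta> * real n)) \<le> mass n I s"
proof -
  have "(\<lambda>n. \<bar>(real n * b n - b n) - \<gamma>\<bar> * (\<bar>pot_energy\<bar> / 2)) \<longlonglongrightarrow> \<bar>(\<gamma> - 0) - \<gamma>\<bar> * (\<bar>pot_energy\<bar> / 2)"
    by (intro tendsto_intros b_lim b_lim_0)
  then have e1: "\<forall>\<^sub>F n in sequentially. \<bar>(real n * b n - b n) - \<gamma>\<bar> * (\<bar>pot_energy\<bar> / 2) < \<delta> / 2"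
    by (rule order_tendstoD(2)) (use \<delta> in simp)
  \<comment> \<open>The switched functions have total mean at most \<open>C\<close>, a bounded cost
    that is absorbed by a linear term of arbitrarily small slope.\<close>
  have e2: "\<forall>\<^sub>F n in sequentially. C \<le> \<delta> / 2 * real n"
  proof -
    have "filterlim (\<lambda>n. \<delta> / 2 * real n) at_top sequentially"
      using \<delta> by (intro filterlim_tendsto_pos_mult_at_top[OF tendsto_const] filterlim_real_sequentially) auto
    then show ?thesis by (simp add: filterlim_at_top)
  qed
  show ?thesis using e1 e2
  proof eventually_elim
    case (elim n)
    show ?case
    proof (intro allI impI)
      fix I s assume adm: "admissible C n I s"
      note [simp] = admissibleD(1,2)[OF adm]
      interpret I: prob_space "iid I" by (rule prob_space_iid)
      note iw = iid_component[OF _ admissibleD(4)[OF adm]]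
      have isum: "integrable (iid I) (\<lambda>X. \<Sum>j\<in>I. s j (X j))" using iw by (intro Bochner_Integration.integrable_sum) auto
      have i: "integrable (iid I) (weight n I s)"
        unfolding weight_def[abs_def] using isum integral_gibbs_log(1)[of I] by simp
      have "(\<integral>X. weight n I s X \<partial>iid I) = real n * (pot_energy / 2) * (b n * (real n - 1) - \<gamma>) - (\<Sum>j\<in>I. \<integral>x. s j x \<partial>M)"
        unfolding weight_def using isum integral_gibbs_log[of I] iw
        by (simp add: Bochner_Integration.integral_sum)
      moreover have "- (real n * (\<delta> / 2)) \<le> real n * (pot_energy / 2) * (b n * (real n - 1) - \<gamma>)"
      proof -
        have "\<bar>(pot_energy / 2) * (b n * (real n - 1) - \<gamma>)\<bar> = \<bar>(real n * b n - b n) - \<gamma>\<bar> * (\<bar>pot_energy\<bar> / 2)"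
        proof -
          have "b n * (real n - 1) - \<gamma> = (real n * b n - b n) - \<gamma>" by (simp add: algebra_simps)
          then show ?thesis by (simp add: abs_mult)
        qed
        then have "- (\<delta> / 2) \<le> (pot_energy / 2) * (b n * (real n - 1) - \<gamma>)" using elim(1) by linarith
        from mult_left_mono[OF this, of "real n"] show ?thesis by (simp add: mult.assoc)
      qed
      ultimately have "- \<delta> * real n \<le> (\<integral>X. weight n I s X \<partial>iid I)"
        using admissibleD(6)[OF adm] elim(2) by (simp add: field_simps)
      then have "ennreal (exp (- \<delta> * real n)) \<le> ennreal (exp (\<integral>X. weight n I s X \<partial>iid I))" by (intro ennreal_leI) simp
      also have "\<dots> \<le> mass n I s" unfolding mass_def by (rule I.exp_expectation_le[OF i])
      finally show "ennreal (exp (- \<delta> * real n)) \<le> mass n I s" .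
    qed
  qed
qed

section \<open>Concentration of the field of the other points\<close>

lemma nn_integral_iid_exp_sum:
  assumes "finite I" and [measurable]: "g \<in> borel_measurable borel"
  shows "(\<integral>\<^sup>+X. ennreal (exp (\<Sum>i\<in>I. g (X i))) \<partial>iid I) = (\<integral>\<^sup>+u. ennreal (exp (g u)) \<partial>M) ^ card I"
proof -
  interpret PS: product_sigma_finite "\<lambda>_::nat. M" by (rule product_sigma_finite_M)
  have m: "(\<lambda>a. ennreal (exp (g a))) \<in> borel_measurable M" by measurable
  have "(\<integral>\<^sup>+X. ennreal (exp (\<Sum>i\<in>I. g (X i))) \<partial>iid I) = (\<integral>\<^sup>+X. (\<Prod>i\<in>I. ennreal (exp (g (X i)))) \<partial>iid I)"
    using assms(1) by (simp add: exp_sum prod_ennreal)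
  also have "\<dots> = (\<Prod>i\<in>I. \<integral>\<^sup>+u. ennreal (exp (g u)) \<partial>M)"
    using assms(1) m by (subst PS.product_nn_integral_prod) auto
  finally show ?thesis by simp
qed

text \<open>The pair interaction in \<open>weight\<close> is first bounded pointwise, which leaves a product over the
  independent points.\<close>

lemma tilt_exp_small:
  assumes R: "0 \<le> R" and \<eta>: "0 < \<eta>"
  obtains \<kappa> where "0 < \<kappa>" "\<forall>\<^sub>F n in sequentially. \<forall>I C s z \<sigma>. admissible C n I s \<and> norm z \<le> R \<and> \<bar>\<sigma>\<bar> = 1 \<longrightarrow>
     (\<integral>\<^sup>+X. ennreal (exp (weight n I s X + real n * \<kappa> * (\<sigma> * cross (b n) \<gamma> I X z - \<eta>))) \<partial>iid I) \<le> ennreal (exp (- (\<kappa> * \<eta> / 2) * real n))"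
proof -
  obtain C where C: "0 \<le> C" "\<And>x \<delta> b. norm x \<le> R \<Longrightarrow> 0 \<le> \<delta> \<Longrightarrow> \<delta> + \<bar>b\<bar> \<le> 1/8 \<Longrightarrow>
      (\<integral>\<^sup>+u. ennreal (exp (\<delta> * (1 + log_weight u) + b * log_dist x u)) \<partial>M) \<le> ennreal (exp (\<delta> * C + b * pot x + C * (\<delta> + \<bar>b\<bar>)\<^sup>2))"
    by (rule exp_moment_le[OF R], rule that, assumption, blast)
  define g where "g = \<gamma> + 1"
  have g: "1 \<le> g" using \<gamma>_nonneg by (simp add: g_def)
  \<comment> \<open>\<open>\<kappa>\<close> is the size of the tilt per point. The first bound keeps
    the coefficient of \<open>log_dist\<close> below 1/16, within the range of the moment bound; the
    second makes the quadratic cost \<open>2 * C * (\<kappa> * g)^2\<close> at most an eighth of the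
    linear gain \<open>\<kappa> * \<eta>\<close>.\<close>
  define \<kappa> where "\<kappa> = min (1 / (16 * g)) (\<eta> / (16 * (1 + C) * g\<^sup>2))"
  \<comment> \<open>\<open>\<delta>\<close> is fixed after \<open>\<kappa>\<close>: the pointwise
    bound on the weight may cost at most another eighth of \<open>\<kappa> * \<eta>\<close> per
    point.\<close>
  define \<delta> where "\<delta> = min (1 / 16) (\<kappa> * \<eta> / (24 * (1 + C)))"
  have l: "0 < \<kappa>" using \<eta> C(1) g by (simp add: \<kappa>_def)
  have d: "0 < \<delta>" using \<eta> l C(1) by (simp add: \<delta>_def)
  have l1: "\<kappa> * g \<le> 1 / 16"
  proof -
    have "\<kappa> * g \<le> 1 / (16 * g) * g" using g by (intro mult_right_mono) (auto simp: \<kappa>_def)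
    then show ?thesis using g by simp
  qed
  have l2: "2 * C * (\<kappa> * g)\<^sup>2 \<le> \<kappa> * \<eta> / 8"
  proof -
    have "\<kappa> * ((1 + C) * g\<^sup>2) \<le> \<eta> / (16 * (1 + C) * g\<^sup>2) * ((1 + C) * g\<^sup>2)"
      using C(1) by (intro mult_right_mono) (auto simp: \<kappa>_def)
    also have "\<dots> = \<eta> / 16"
    proof -
      have cancel: "x / (16 * c * d) * (c * d) = x / 16" if "c \<noteq> 0" "d \<noteq> 0" for x c d :: real using that by simp
      show ?thesis by (rule cancel) (use C(1) g in auto)
    qed
    finally have *: "\<kappa> * ((1 + C) * g\<^sup>2) \<le> \<eta> / 16" .
    have "2 * C * (\<kappa> * g)\<^sup>2 = 2 * \<kappa> * (\<kappa> * (C * g\<^sup>2))" by (simp add: power2_eq_square mult_ac)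
    also have "\<dots> \<le> 2 * \<kappa> * (\<kappa> * ((1 + C) * g\<^sup>2))" using l by (intro mult_left_mono mult_right_mono) auto
    also have "\<dots> \<le> 2 * \<kappa> * (\<eta> / 16)" using l * by (intro mult_left_mono) auto
    finally show ?thesis by (simp add: mult_ac)
  qed
  have d1: "\<delta> \<le> 1 / 16" unfolding \<delta>_def by (rule min.cobounded1)
  have d2: "\<delta> * C + 2 * C * \<delta>\<^sup>2 \<le> \<kappa> * \<eta> / 8"
  proof -
    have "2 * C * \<delta>\<^sup>2 = (2 * C * \<delta>) * \<delta>" by (simp add: power2_eq_square)
    also have "\<dots> \<le> (2 * C * \<delta>) * 1" using d1 d C(1) by (intro mult_left_mono) auto
    finally have "\<delta> * C + 2 * C * \<delta>\<^sup>2 \<le> 3 * (\<delta> * C)" by simp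
    also have "\<dots> \<le> 3 * (\<delta> * (1 + C))" using d by simp
    also have "\<delta> * (1 + C) \<le> \<kappa> * \<eta> / (24 * (1 + C)) * (1 + C)" using C(1) by (intro mult_right_mono) (auto simp: \<delta>_def)
    also have "\<dots> = \<kappa> * \<eta> / 24" using C(1) by (simp add: field_simps)
    finally show ?thesis by (simp add: mult_ac)
  qed
  have e1: "\<forall>\<^sub>F n in sequentially. \<bar>real n * b n - \<gamma>\<bar> * (pot_const * (1 + R)) < \<eta> / 8" using \<eta> by (intro ev_mult_small) auto
  have "\<forall>\<^sub>F n in sequentially. \<forall>I C s z \<sigma>. admissible C n I s \<and> norm z \<le> R \<and> \<bar>\<sigma>\<bar> = 1 \<longrightarrow>
     (\<integral>\<^sup>+X. ennreal (exp (weight n I s X + real n * \<kappa> * (\<sigma> * cross (b n) \<gamma> I X z - \<eta>))) \<partial>iid I) \<le> ennreal (exp (- (\<kappa> * \<eta> / 2) * real n))"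
    using e1 ev_nb_le gibbs_log_le[OF d]
  proof eventually_elim
    case (elim n)
    show ?case
    proof (intro allI impI, elim conjE)
      fix I C' s and z :: 'a and \<sigma> :: real assume adm: "admissible C' n I s" and z: "norm z \<le> R" and \<sigma>: "\<bar>\<sigma>\<bar> = 1"
      note fI = admissibleD(1,2)[OF adm]
      let ?n = "real n"
      define c where "c = ?n * \<kappa> * \<sigma> * b n"
      have ca: "\<bar>c\<bar> = \<kappa> * (?n * b n)" using l \<sigma> b_nonneg[of n] by (simp add: c_def abs_mult)
      have cl: "\<bar>c\<bar> \<le> \<kappa> * g" unfolding ca using elim(2) l by (simp add: g_def mult_left_mono)
      define h where "h u = \<delta> * (1 + log_weight u) + c * log_dist z u" for u
      have [measurable]: "h \<in> borel_measurable borel" unfolding h_def by measurable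
      \<comment> \<open>The part of the exponent that does not involve the points. Its term in
        \<open>pot z\<close> is the mean-field value, which cancels the linear term of the moment
        bound up to a multiple of n b - gamma.\<close>
      define k where "k = - (?n * \<kappa> * \<sigma> * \<gamma> * pot z) - ?n * \<kappa> * \<eta>"
      have "(\<integral>\<^sup>+X. ennreal (exp (weight n I s X + ?n * \<kappa> * (\<sigma> * cross (b n) \<gamma> I X z - \<eta>))) \<partial>iid I)
         \<le> (\<integral>\<^sup>+X. ennreal (exp k) * ennreal (exp (\<Sum>i\<in>I. h (X i))) \<partial>iid I)"
      proof (rule nn_integral_mono_AE)
        show "AE X in iid I. ennreal (exp (weight n I s X + ?n * \<kappa> * (\<sigma> * cross (b n) \<gamma> I X z - \<eta>)))
            \<le> ennreal (exp k) * ennreal (exp (\<Sum>i\<in>I. h (X i)))"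
          using AE_iid_inj[OF fI(1)]
        proof eventually_elim
          case (elim X)
          have "weight n I s X \<le> (\<Sum>i\<in>I. \<delta> * (1 + log_weight (X i)))"
            using weight_le[OF adm, of X] \<open>\<forall>I X. finite I \<and> card I = n \<and> inj_on X I \<longrightarrow> _\<close>[rule_format, of I X] fI elim
            by (meson order_trans)
          then have "weight n I s X + ?n * \<kappa> * (\<sigma> * cross (b n) \<gamma> I X z - \<eta>)
             \<le> (\<Sum>i\<in>I. \<delta> * (1 + log_weight (X i))) + ?n * \<kappa> * (\<sigma> * cross (b n) \<gamma> I X z - \<eta>)" by simp
          also have "\<dots> = k + (\<Sum>i\<in>I. h (X i))"
            unfolding h_def k_def cross_def c_def sum.distrib sum_distrib_left[symmetric] by (simp add: algebra_simps)
          finally show ?case by (simp add: ennreal_mult[symmetric] exp_add[symmetric])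
        qed
      qed
      also have "\<dots> = ennreal (exp k) * (\<integral>\<^sup>+u. ennreal (exp (h u)) \<partial>M) ^ n"
        using fI by (subst nn_integral_cmult) (auto simp: nn_integral_iid_exp_sum)
      also have "\<dots> \<le> ennreal (exp k) * ennreal (exp (\<delta> * C + c * pot z + C * (\<delta> + \<bar>c\<bar>)\<^sup>2)) ^ n"
        unfolding h_def using C(2)[OF z, of \<delta> c] d d1 cl l1 by (intro mult_left_mono power_mono) auto
      also have "\<dots> = ennreal (exp (k + ?n * (\<delta> * C + c * pot z + C * (\<delta> + \<bar>c\<bar>)\<^sup>2)))"
        by (simp add: ennreal_power exp_of_nat_mult[symmetric] ennreal_mult[symmetric] exp_add[symmetric])
      also have "\<dots> \<le> ennreal (exp (- (\<kappa> * \<eta> / 2) * ?n))"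
      proof (intro ennreal_leI, unfold exp_le_cancel_iff)
        have 1: "C * (\<delta> + \<bar>c\<bar>)\<^sup>2 \<le> 2 * C * \<delta>\<^sup>2 + 2 * C * (\<kappa> * g)\<^sup>2"
        proof -
          have "(\<delta> + \<bar>c\<bar>)\<^sup>2 \<le> (\<delta> + \<kappa> * g)\<^sup>2" using cl d by (intro power_mono) auto
          also have "\<dots> \<le> 2 * \<delta>\<^sup>2 + 2 * (\<kappa> * g)\<^sup>2" using sum_squares_bound[of \<delta> "\<kappa> * g"] by (simp add: power2_sum)
          finally have "C * (\<delta> + \<bar>c\<bar>)\<^sup>2 \<le> C * (2 * \<delta>\<^sup>2 + 2 * (\<kappa> * g)\<^sup>2)" using C(1) by (intro mult_left_mono)
          then show ?thesis by (simp add: distrib_left mult_ac)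
        qed
        have 2: "\<sigma> * (?n * b n - \<gamma>) * pot z \<le> \<eta> / 8"
        proof -
          have "\<bar>\<sigma> * (?n * b n - \<gamma>) * pot z\<bar> = \<bar>?n * b n - \<gamma>\<bar> * \<bar>pot z\<bar>" using \<sigma> by (simp add: abs_mult)
          also have "\<dots> \<le> \<bar>?n * b n - \<gamma>\<bar> * (pot_const * (1 + R))"
            using log_weight_le[of z] z pot_const_ge_1 by (intro mult_left_mono order_trans[OF abs_pot_le]) auto
          finally show ?thesis using elim(1) by linarith
        qed
        have 3: "\<kappa> * (\<sigma> * (?n * b n - \<gamma>) * pot z) \<le> \<kappa> * (\<eta> / 8)" using 2 l by (intro mult_left_mono) auto
        have "k + ?n * (\<delta> * C + c * pot z + C * (\<delta> + \<bar>c\<bar>)\<^sup>2)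
           = ?n * (\<kappa> * (\<sigma> * (?n * b n - \<gamma>) * pot z) - \<kappa> * \<eta> + \<delta> * C + C * (\<delta> + \<bar>c\<bar>)\<^sup>2)"
          unfolding k_def c_def by (simp add: algebra_simps)
        also have "\<dots> \<le> ?n * (- (\<kappa> * \<eta> / 2))"
        proof (rule mult_left_mono)
          have "0 < \<kappa> * \<eta>" "\<kappa> * (\<eta> / 8) = \<kappa> * \<eta> / 8" using l \<eta> by simp_all
          then show "\<kappa> * (\<sigma> * (?n * b n - \<gamma>) * pot z) - \<kappa> * \<eta> + \<delta> * C + C * (\<delta> + \<bar>c\<bar>)\<^sup>2 \<le> - (\<kappa> * \<eta> / 2)"
            using 1 3 l2 d2 by linarith
        qed simp
        finally show "k + ?n * (\<delta> * C + c * pot z + C * (\<delta> + \<bar>c\<bar>)\<^sup>2) \<le> - (\<kappa> * \<eta> / 2) * ?n" by (simp add: mult_ac)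
      qed
      finally show "(\<integral>\<^sup>+X. ennreal (exp (weight n I s X + ?n * \<kappa> * (\<sigma> * cross (b n) \<gamma> I X z - \<eta>))) \<partial>iid I) \<le> ennreal (exp (- (\<kappa> * \<eta> / 2) * ?n))" .
    qed
  qed
  then show ?thesis using l that by blast
qed

lemma ev_large: "0 < c \<Longrightarrow> \<forall>\<^sub>F n in sequentially. a \<le> c * real n" for a c :: real
proof -
  assume "0 < c"
  then have "filterlim (\<lambda>n. c * real n) at_top sequentially"
    by (intro filterlim_tendsto_pos_mult_at_top[OF tendsto_const] filterlim_real_sequentially)
  then show ?thesis by (simp add: filterlim_at_top)
qed

lemma ev_exp_small: "0 < c \<Longrightarrow> 0 < e \<Longrightarrow> \<forall>\<^sub>F n in sequentially. a * exp (- c * real n) < e" for a c e :: real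
proof -
  assume c: "0 < c" "0 < e"
  have "filterlim (\<lambda>n. - (c * real n)) at_bot sequentially"
    using c by (intro filterlim_uminus_at_bot_at_top[THEN filterlim_compose] filterlim_tendsto_pos_mult_at_top[OF tendsto_const] filterlim_real_sequentially)
  then have "(\<lambda>n. exp (- (c * real n))) \<longlonglongrightarrow> 0" by (rule filterlim_compose[OF exp_at_bot])
  then have "(\<lambda>n. a * exp (- (c * real n))) \<longlonglongrightarrow> a * 0" by (intro tendsto_intros)
  then show ?thesis using c by (auto dest: order_tendstoD)
qed

text \<open>Where the field at \<open>z\<close> is within \<open>\<eta>\<close> of its mean, placing
  a point there changes the weight by a factor close to 1. The remaining configurations contribute
  at most a multiple of exp (- 2 c n), negligible against a mass of at least exp (- c n). The
  resulting estimate is relative to the mass, whatever its size.\<close>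

lemma tilted_mass_near:
  assumes R: "0 \<le> R" and \<epsilon>: "0 < \<epsilon>"
  shows "\<forall>\<^sub>F n in sequentially. \<forall>I s z. admissible C n I s \<and> norm z \<le> R \<longrightarrow>
     tilted_mass n I s z \<le> ennreal (1 + \<epsilon>) * mass n I s \<and> mass n I s \<le> tilted_mass n I s z + ennreal \<epsilon> * mass n I s"
proof -
  \<comment> \<open>\<open>exp \<eta> - 1\<close> is half of \<open>\<epsilon>\<close>; the other
    half is left for the deviations.\<close>
  define \<eta> where "\<eta> = ln (1 + \<epsilon> / 2)"
  have \<eta>: "0 < \<eta>" and e\<eta>: "exp \<eta> = 1 + \<epsilon> / 2" using \<epsilon> by (simp_all add: \<eta>_def)
  obtain \<kappa> where \<kappa>: "0 < \<kappa>" and small: "\<forall>\<^sub>F n in sequentially. \<forall>I C s z \<sigma>. admissible C n I s \<and> norm z \<le> R \<and> \<bar>\<sigma>\<bar> = 1 \<longrightarrow>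
     (\<integral>\<^sup>+X. ennreal (exp (weight n I s X + real n * \<kappa> * (\<sigma> * cross (b n) \<gamma> I X z - \<eta>))) \<partial>iid I) \<le> ennreal (exp (- (\<kappa> * \<eta> / 2) * real n))"
    by (rule tilt_exp_small[OF R \<eta>], rule that, assumption, blast)
  \<comment> \<open>Half of the decay rate \<open>\<kappa> * \<eta> / 2\<close> of the deviation
    bound. With q = exp (- c n) the bound is \<open>q * q\<close>, hence at most q times the mass as
    soon as the mass is at least q.\<close>
  define c where "c = \<kappa> * \<eta> / 4"
  have c: "0 < c" using \<kappa> \<eta> by (simp add: c_def)
  have half: "0 < \<epsilon> / 2" using \<epsilon> by simp
  show ?thesis
    using small mass_ge[OF c, of C] ev_large[OF \<kappa>, of 1] ev_exp_small[OF c half, of "exp \<eta> + 1"]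
  proof eventually_elim
    case (elim n)
    show ?case
    proof (intro allI impI, elim conjE)
      fix I s and z :: 'a assume adm: "admissible C n I s" and z: "norm z \<le> R"
      note [measurable] = admissibleD(1)[OF adm] weight_measurable[OF adm]
      define p where "p = real n * \<kappa>"
      have p: "1 \<le> p" using elim by (simp add: p_def mult.commute)
      let ?S = "\<lambda>X. cross (b n) \<gamma> I X z" and ?w = "weight n I s"
      define q where "q = exp (- c * real n)"
      have mg: "ennreal q \<le> mass n I s" using elim adm by (simp add: q_def)
      define T where "T \<sigma> = (\<integral>\<^sup>+X. ennreal (exp (?w X + p * (\<sigma> * ?S X - \<eta>))) \<partial>iid I)" for \<sigma>
      have T: "T \<sigma> \<le> ennreal q * mass n I s" if "\<bar>\<sigma>\<bar> = 1" for \<sigma>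
      proof -
        have "T \<sigma> \<le> ennreal (exp (- (\<kappa> * \<eta> / 2) * real n))" unfolding T_def p_def using elim(1) adm z that by blast
        also have "exp (- (\<kappa> * \<eta> / 2) * real n) = q * q" by (simp add: q_def c_def exp_add[symmetric] field_simps)
        also have "ennreal (q * q) = ennreal q * ennreal q" by (simp add: q_def ennreal_mult)
        also have "\<dots> \<le> ennreal q * mass n I s" by (intro mult_left_mono mg) simp
        finally show ?thesis .
      qed
      define err where "err X = (exp \<eta> - 1) + exp \<eta> * exp (p * (?S X - \<eta>)) + exp (p * (- ?S X - \<eta>))" for X
      have [measurable]: "err \<in> borel_measurable (iid I)" unfolding err_def by measurable
      have err0: "0 \<le> err X" for X unfolding err_def using \<eta> by simp
      have "(\<integral>\<^sup>+X. ennreal (exp (?w X) * err X) \<partial>iid I)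
          = (\<integral>\<^sup>+X. ennreal (exp \<eta> - 1) * ennreal (exp (?w X)) + ennreal (exp \<eta>) * ennreal (exp (?w X + p * (1 * ?S X - \<eta>)))
              + ennreal (exp (?w X + p * ((-1) * ?S X - \<eta>))) \<partial>iid I)"
      proof (rule nn_integral_cong)
        fix X
        have "exp (?w X) * err X = (exp \<eta> - 1) * exp (?w X) + exp \<eta> * exp (?w X + p * (1 * ?S X - \<eta>)) + exp (?w X + p * ((-1) * ?S X - \<eta>))"
          unfolding err_def exp_add by (simp add: algebra_simps)
        then show "ennreal (exp (?w X) * err X) = ennreal (exp \<eta> - 1) * ennreal (exp (?w X)) + ennreal (exp \<eta>) * ennreal (exp (?w X + p * (1 * ?S X - \<eta>)))
              + ennreal (exp (?w X + p * ((-1) * ?S X - \<eta>)))"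
          using \<eta> by (simp add: ennreal_mult[symmetric] ennreal_plus[symmetric] del: ennreal_plus)
      qed
      also have "\<dots> = ennreal (exp \<eta> - 1) * mass n I s + ennreal (exp \<eta>) * T 1 + T (-1)"
        unfolding T_def mass_def by (simp add: nn_integral_add nn_integral_cmult)
      also have "\<dots> \<le> ennreal (exp \<eta> - 1) * mass n I s + ennreal (exp \<eta>) * (ennreal q * mass n I s) + ennreal q * mass n I s"
        by (intro add_mono mult_left_mono T) auto
      also have "\<dots> = (ennreal (exp \<eta> - 1) + (ennreal (exp \<eta>) * ennreal q + ennreal q)) * mass n I s"
        by (simp only: distrib_right add.assoc mult.assoc)
      also have "ennreal (exp \<eta> - 1) + (ennreal (exp \<eta>) * ennreal q + ennreal q) = ennreal (exp \<eta> - 1 + (exp \<eta> + 1) * q)"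
        using \<eta> by (simp add: q_def ennreal_mult[symmetric] ennreal_plus[symmetric] algebra_simps del: ennreal_plus)
      also have "ennreal (exp \<eta> - 1 + (exp \<eta> + 1) * q) \<le> ennreal \<epsilon>"
        using elim(4) e\<eta> by (intro ennreal_leI) (simp add: q_def)
      finally have E: "(\<integral>\<^sup>+X. ennreal (exp (?w X) * err X) \<partial>iid I) \<le> ennreal \<epsilon> * mass n I s"
        by (simp add: mult_right_mono)
      have bd: "exp (?w X + ?S X) \<le> exp (?w X) + exp (?w X) * err X" "exp (?w X) \<le> exp (?w X + ?S X) + exp (?w X) * err X" for X
      proof -
        have "\<bar>exp (?S X) - 1\<bar> \<le> err X" unfolding err_def by (rule abs_exp_minus_one_le[OF \<eta> p])
        then have "exp (?S X) \<le> 1 + err X" "1 \<le> exp (?S X) + err X" by linarith+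
        then have "exp (?w X) * exp (?S X) \<le> exp (?w X) * (1 + err X)" "exp (?w X) * 1 \<le> exp (?w X) * (exp (?S X) + err X)"
          by (simp_all only: mult_le_cancel_left_pos exp_gt_zero)
        then show "exp (?w X + ?S X) \<le> exp (?w X) + exp (?w X) * err X" "exp (?w X) \<le> exp (?w X + ?S X) + exp (?w X) * err X"
          by (simp_all add: exp_add distrib_left)
      qed
      have "tilted_mass n I s z \<le> (\<integral>\<^sup>+X. ennreal (exp (?w X)) + ennreal (exp (?w X) * err X) \<partial>iid I)"
        unfolding tilted_mass_def using bd(1) err0
        by (intro nn_integral_mono) (simp add: ennreal_plus[symmetric] ennreal_leI del: ennreal_plus)
      also have "\<dots> \<le> mass n I s + ennreal \<epsilon> * mass n I s"
        unfolding mass_def[symmetric] using E by (subst nn_integral_add) (auto simp: mass_def[symmetric] add_left_mono)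
      also have "\<dots> = ennreal (1 + \<epsilon>) * mass n I s" using \<epsilon> by (simp add: distrib_right)
      finally have 1: "tilted_mass n I s z \<le> ennreal (1 + \<epsilon>) * mass n I s" .
      have "mass n I s \<le> (\<integral>\<^sup>+X. ennreal (exp (?w X + ?S X)) + ennreal (exp (?w X) * err X) \<partial>iid I)"
        unfolding mass_def using bd(2) err0
        by (intro nn_integral_mono) (simp add: ennreal_plus[symmetric] ennreal_leI del: ennreal_plus)
      also have "\<dots> \<le> tilted_mass n I s z + ennreal \<epsilon> * mass n I s"
        using E by (subst nn_integral_add) (auto simp: tilted_mass_def[symmetric] add_left_mono)
      finally show "tilted_mass n I s z \<le> ennreal (1 + \<epsilon>) * mass n I s \<and> mass n I s \<le> tilted_mass n I s z + ennreal \<epsilon> * mass n I s"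
        using 1 by simp
    qed
  qed
qed

text \<open>A bound for the mean, at a single point, of the product of two factors: the pointwise
  bound on the weight with \<open>\<delta> = 1\<close>, and the growth of the field, for which n b
  is at most \<open>\<gamma> + 1\<close>.\<close>

definition weight_moment :: real where
  "weight_moment = exp 1 * tame_const (\<gamma> + 2)"

lemma weight_moment:
  "(\<integral>\<^sup>+u. ennreal (exp ((1 + log_weight u) + (\<gamma> + 1) * log_weight u)) \<partial>M) \<le> ennreal weight_moment" "0 < weight_moment"
proof -
  have "(\<integral>\<^sup>+u. ennreal (exp ((1 + log_weight u) + (\<gamma> + 1) * log_weight u)) \<partial>M)
     \<le> (\<integral>\<^sup>+u. ennreal (exp 1) * ennreal ((1 + sing 0 u) * (1 + norm u) powr (\<gamma> + 2)) \<partial>M)"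
  proof (rule nn_integral_mono)
    fix u
    have "exp ((1 + log_weight u) + (\<gamma> + 1) * log_weight u) = exp (1 + (\<gamma> + 2) * log_weight u)"
      by (rule arg_cong[where f=exp]) (simp add: algebra_simps)
    also have "\<dots> = exp 1 * (1 + norm u) powr (\<gamma> + 2)" by (simp only: exp_add exp_log_weight)
    also have "\<dots> \<le> exp 1 * ((1 + sing 0 u) * (1 + norm u) powr (\<gamma> + 2))"
      using sing_nonneg[of 0 u] mult_right_mono[of 1 "1 + sing 0 u" "(1 + norm u) powr (\<gamma> + 2)"] by simp
    finally show "ennreal (exp ((1 + log_weight u) + (\<gamma> + 1) * log_weight u)) \<le> ennreal (exp 1) * ennreal ((1 + sing 0 u) * (1 + norm u) powr (\<gamma> + 2))"
      using sing_nonneg[of 0 u] by (simp add: ennreal_mult[symmetric] ennreal_leI)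
  qed
  also have "\<dots> = ennreal (exp 1) * (\<integral>\<^sup>+u. ennreal ((1 + sing 0 u) * (1 + norm u) powr (\<gamma> + 2)) \<partial>M)"
    by (rule nn_integral_cmult) auto
  also have "\<dots> \<le> ennreal (exp 1) * ennreal (tame_const (\<gamma> + 2))"
    using \<gamma>_nonneg by (intro mult_left_mono tame_const) auto
  also have "\<dots> = ennreal weight_moment" by (simp add: weight_moment_def ennreal_mult')
  finally show *: "(\<integral>\<^sup>+u. ennreal (exp ((1 + log_weight u) + (\<gamma> + 1) * log_weight u)) \<partial>M) \<le> ennreal weight_moment" .
  have "(1::ennreal) = (\<integral>\<^sup>+u. 1 \<partial>M)" by (simp add: emeasure_space_1[simplified])
  also have "\<dots> \<le> (\<integral>\<^sup>+u. ennreal (exp ((1 + log_weight u) + (\<gamma> + 1) * log_weight u)) \<partial>M)"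
  proof (rule nn_integral_mono)
    fix u
    have "0 \<le> (1 + log_weight u) + (\<gamma> + 1) * log_weight u" using log_weight_nonneg[of u] \<gamma>_nonneg by simp
    then show "1 \<le> ennreal (exp ((1 + log_weight u) + (\<gamma> + 1) * log_weight u))" by simp
  qed
  also note *
  finally show "0 < weight_moment" by (metis ennreal_neg leI not_one_le_zero)
qed

lemma mass_finite: "\<forall>\<^sub>F n in sequentially. \<forall>I C s. admissible C n I s \<longrightarrow> mass n I s < \<infinity>"
  using gibbs_log_le[of 1, simplified]
proof eventually_elim
  case (elim n)
  show ?case
  proof (intro allI impI)
    fix I C s assume adm: "admissible C n I s"
    note fI = admissibleD(1,2)[OF adm]
    have "mass n I s \<le> (\<integral>\<^sup>+X. ennreal (exp (\<Sum>i\<in>I. (1 + log_weight (X i)) + (\<gamma> + 1) * log_weight (X i))) \<partial>iid I)"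
      unfolding mass_def
    proof (rule nn_integral_mono_AE)
      show "AE X in iid I. ennreal (exp (weight n I s X)) \<le> ennreal (exp (\<Sum>i\<in>I. (1 + log_weight (X i)) + (\<gamma> + 1) * log_weight (X i)))"
        using AE_iid_inj[OF fI(1)]
      proof eventually_elim
        case inj: (elim X)
        have "weight n I s X \<le> (\<Sum>i\<in>I. 1 + log_weight (X i))"
          using weight_le[OF adm, of X] elim[rule_format, of I X] inj fI by fastforce
        also have "\<dots> \<le> (\<Sum>i\<in>I. (1 + log_weight (X i)) + (\<gamma> + 1) * log_weight (X i))"
        proof (rule sum_mono)
          fix i
          have "0 \<le> (\<gamma> + 1) * log_weight (X i)" using log_weight_nonneg[of "X i"] \<gamma>_nonneg by simp
          then show "1 + log_weight (X i) \<le> (1 + log_weight (X i)) + (\<gamma> + 1) * log_weight (X i)" by simp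
        qed
        finally show ?case by (simp add: ennreal_leI)
      qed
    qed
    also have "\<dots> = (\<integral>\<^sup>+u. ennreal (exp ((1 + log_weight u) + (\<gamma> + 1) * log_weight u)) \<partial>M) ^ n"
      using nn_integral_iid_exp_sum[OF fI(1), of "\<lambda>u. (1 + log_weight u) + (\<gamma> + 1) * log_weight u"] fI(2) by simp
    also have "\<dots> \<le> ennreal weight_moment ^ n" using weight_moment(1) by (intro power_mono) auto
    also have "\<dots> < \<infinity>" using weight_moment(2) by (simp add: ennreal_power)
    finally show "mass n I s < \<infinity>" .
  qed
qed

text \<open>The concentration estimate is uniform only for \<open>z\<close> in a ball. For general
  \<open>z\<close>, \<open>log_dist_le\<close> splits the field into a part in \<open>z\<close>, the
  source of the power \<open>\<gamma> + 1\<close>, and a sum \<open>T\<close> of logarithmic weights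
  of the other points, whose exponential costs only a constant factor of the mass.\<close>

lemma tilted_mass_le:
  obtains K where "0 \<le> K" "\<And>C. \<forall>\<^sub>F n in sequentially. \<forall>I s z. admissible C n I s \<longrightarrow>
     tilted_mass n I s z \<le> ennreal (K * (1 + norm z) powr (\<gamma> + 1)) * mass n I s"
proof -
  \<comment> \<open>One more than the logarithm of the moment, so that the exponential bound for
    \<open>T\<close> exceeding \<open>m\<close> integrates to at most exp (- n). By
    \<open>mass_ge\<close> with \<open>\<delta> = 1\<close> this is at most the mass.\<close>
  define m where "m = ln weight_moment + 1"
  define D where "D = exp (\<gamma> * (2 * tame_const 0))"
  define K where "K = D * (2 * exp m)"
  have K: "0 \<le> K" by (simp add: K_def D_def)
  have "\<forall>\<^sub>F n in sequentially. \<forall>I s z. admissible C n I s \<longrightarrow>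
     tilted_mass n I s z \<le> ennreal (K * (1 + norm z) powr (\<gamma> + 1)) * mass n I s" for C
    using gibbs_log_le[of 1, simplified] mass_ge[of 1 C, simplified] ev_nb_le eventually_ge_at_top[of 1]
  proof eventually_elim
    case (elim n)
    show ?case
    proof (intro allI impI)
      fix I s z assume adm: "admissible C n I s"
      note fI = admissibleD(1,2)[OF adm]
      note [measurable] = admissibleD(1)[OF adm] weight_measurable[OF adm]
      let ?n = "real n" and ?w = "weight n I s"
      define T where "T X = b n * (\<Sum>j\<in>I. log_weight (X j))" for X :: "nat \<Rightarrow> 'a"
      have [measurable]: "T \<in> borel_measurable (iid I)" unfolding T_def by measurable
      have cr: "cross (b n) \<gamma> I X z \<le> \<gamma> * (2 * tame_const 0) + (\<gamma> + 1) * log_weight z + T X" for X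
      proof -
        have "b n * (\<Sum>j\<in>I. log_dist z (X j)) \<le> b n * (\<Sum>j\<in>I. log_weight z + log_weight (X j))"
          using b_nonneg[of n] by (intro mult_left_mono sum_mono log_dist_le)
        also have "\<dots> = (?n * b n) * log_weight z + T X"
          using fI by (simp add: T_def sum.distrib distrib_left mult_ac)
        also have "(?n * b n) * log_weight z \<le> (\<gamma> + 1) * log_weight z"
          using elim(3) log_weight_nonneg[of z] by (intro mult_right_mono)
        finally have 1: "b n * (\<Sum>j\<in>I. log_dist z (X j)) \<le> (\<gamma> + 1) * log_weight z + T X" by simp
        have "\<gamma> * (- 2 * tame_const 0) \<le> \<gamma> * pot z" using pot_ge[of z] \<gamma>_nonneg by (intro mult_left_mono)
        then show ?thesis unfolding cross_def using 1 by simp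
      qed
      have eT: "exp (T X) \<le> exp m + exp m * exp (?n * (T X - m))" for X
      proof (cases "T X \<le> m")
        case False
        then have "T X - m \<le> ?n * (T X - m)" using elim(4) mult_right_mono[of 1 ?n "T X - m"] by simp
        then have "exp m * exp (T X - m) \<le> exp m * exp (?n * (T X - m))" by simp
        then show ?thesis by (simp add: exp_add[symmetric] add_increasing)
      qed (simp add: add_increasing2)
      have "(\<integral>\<^sup>+X. ennreal (exp (?w X + ?n * (T X - m))) \<partial>iid I)
         \<le> (\<integral>\<^sup>+X. ennreal (exp (- ?n * m)) * ennreal (exp (\<Sum>i\<in>I. (1 + log_weight (X i)) + (\<gamma> + 1) * log_weight (X i))) \<partial>iid I)"
      proof (rule nn_integral_mono_AE)
        show "AE X in iid I. ennreal (exp (?w X + ?n * (T X - m)))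
            \<le> ennreal (exp (- ?n * m)) * ennreal (exp (\<Sum>i\<in>I. (1 + log_weight (X i)) + (\<gamma> + 1) * log_weight (X i)))"
          using AE_iid_inj[OF fI(1)]
        proof eventually_elim
          case inj: (elim X)
          have "?w X \<le> (\<Sum>i\<in>I. 1 + log_weight (X i))"
            using weight_le[OF adm, of X] elim(1)[rule_format, of I X] inj fI by fastforce
          moreover have "?n * T X \<le> (\<Sum>i\<in>I. (\<gamma> + 1) * log_weight (X i))"
            unfolding T_def sum_distrib_left mult.assoc[symmetric] using elim(3) log_weight_nonneg
            by (intro sum_mono mult_right_mono) auto
          ultimately have "?w X + ?n * (T X - m) \<le> - ?n * m + (\<Sum>i\<in>I. (1 + log_weight (X i)) + (\<gamma> + 1) * log_weight (X i))"
            by (simp only: sum.distrib right_diff_distrib)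
          then show ?case by (simp add: ennreal_mult[symmetric] exp_add[symmetric])
        qed
      qed
      also have "\<dots> = ennreal (exp (- ?n * m)) * (\<integral>\<^sup>+u. ennreal (exp ((1 + log_weight u) + (\<gamma> + 1) * log_weight u)) \<partial>M) ^ n"
        using nn_integral_iid_exp_sum[OF fI(1), of "\<lambda>u. (1 + log_weight u) + (\<gamma> + 1) * log_weight u"] fI(2)
        by (subst nn_integral_cmult) auto
      also have "\<dots> \<le> ennreal (exp (- ?n * m)) * ennreal weight_moment ^ n"
        using weight_moment(1) by (intro mult_left_mono power_mono) auto
      also have "\<dots> = ennreal (exp (- ?n))"
      proof -
        have "exp (- ?n * m) * weight_moment ^ n = exp (- ?n * m) * exp (?n * ln weight_moment)"
          using weight_moment(2) by (simp add: exp_of_nat_mult)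
        also have "\<dots> = exp (- ?n)" by (simp add: m_def exp_add[symmetric] algebra_simps)
        finally show ?thesis using weight_moment(2) by (simp add: ennreal_power ennreal_mult[symmetric])
      qed
      also have "\<dots> \<le> mass n I s" using elim(2) adm by simp
      finally have bad: "(\<integral>\<^sup>+X. ennreal (exp (?w X + ?n * (T X - m))) \<partial>iid I) \<le> mass n I s" .
      define A where "A = D * (1 + norm z) powr (\<gamma> + 1)"
      have A: "0 \<le> A" by (simp add: A_def D_def)
      have "tilted_mass n I s z \<le> (\<integral>\<^sup>+X. ennreal (A * exp m) * (ennreal (exp (?w X)) + ennreal (exp (?w X + ?n * (T X - m)))) \<partial>iid I)"
        unfolding tilted_mass_def
      proof (rule nn_integral_mono)
        fix X
        have "exp (?w X + cross (b n) \<gamma> I X z) \<le> exp (?w X + (\<gamma> * (2 * tame_const 0) + (\<gamma> + 1) * log_weight z + T X))"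
          using cr[of X] by simp
        also have "\<dots> = exp (?w X) * (A * exp (T X))" unfolding exp_add exp_log_weight A_def D_def by (simp only: mult_ac)
        also have "\<dots> \<le> exp (?w X) * (A * (exp m + exp m * exp (?n * (T X - m))))"
          using A by (intro mult_left_mono eT) auto
        also have "\<dots> = A * exp m * (exp (?w X) + exp (?w X + ?n * (T X - m)))"
          unfolding exp_add[of "?w X"] by (simp only: distrib_left mult_ac)
        finally show "ennreal (exp (?w X + cross (b n) \<gamma> I X z)) \<le> ennreal (A * exp m) * (ennreal (exp (?w X)) + ennreal (exp (?w X + ?n * (T X - m))))"
          using A by (simp add: ennreal_plus[symmetric] ennreal_mult[symmetric] ennreal_leI del: ennreal_plus)
      qed
      also have "\<dots> = ennreal (A * exp m) * (mass n I s + (\<integral>\<^sup>+X. ennreal (exp (?w X + ?n * (T X - m))) \<partial>iid I))"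
        unfolding mass_def by (simp add: nn_integral_cmult nn_integral_add)
      also have "\<dots> \<le> ennreal (A * exp m) * (mass n I s + mass n I s)" by (intro mult_left_mono add_left_mono bad) simp
      also have "\<dots> = ennreal (A * exp m) * (2 * mass n I s)" by (simp add: mult_2)
      also have "\<dots> = ennreal (A * exp m * 2) * mass n I s"
        using A by (subst ennreal_mult) (auto simp: mult.assoc)
      also have "A * exp m * 2 = K * (1 + norm z) powr (\<gamma> + 1)" by (simp add: A_def K_def)
      finally show "tilted_mass n I s z \<le> ennreal (K * (1 + norm z) powr (\<gamma> + 1)) * mass n I s" .
    qed
  qed
  then show ?thesis using K that by blast
qed

end

section \<open>Switching on the test function point by point\<close>

lemma prod_tendsto_exp:
  fixes m :: "nat \<Rightarrow> real" and a :: "nat \<Rightarrow> nat \<Rightarrow> real"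
  assumes m0: "\<And>n. 0 \<le> m n" and lim: "(\<lambda>n. real (Suc n) * m n) \<longlonglongrightarrow> c"
    and a: "\<And>\<epsilon>. 0 < \<epsilon> \<Longrightarrow> \<epsilon> < 1 \<Longrightarrow> \<forall>\<^sub>F n in sequentially. \<forall>k\<in>{1..Suc n}. (1 - \<epsilon>) * m n \<le> a n k \<and> a n k \<le> (1 + \<epsilon>) * m n"
  shows "(\<lambda>n. \<Prod>k=1..Suc n. 1 - a n k) \<longlonglongrightarrow> exp (- c)"
proof -
  have mlim: "m \<longlonglongrightarrow> 0"
  proof -
    have "(\<lambda>n. (real (Suc n) * m n) * (1 / real (Suc n))) \<longlonglongrightarrow> c * 0"
      by (intro tendsto_mult lim LIMSEQ_Suc[OF lim_1_over_n])
    then show ?thesis by simp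
  qed
  have small: "\<forall>\<^sub>F n in sequentially. m n < 1/4" using mlim by (rule order_tendstoD) simp
  show ?thesis
  proof (rule order_tendstoI)
    fix t assume t: "exp (- c) < t"
    \<comment> \<open>The relative error \<open>\<epsilon>\<close> is fixed before n: the enclosure
      of \<open>a n k\<close> holds only from an index depending on \<open>\<epsilon>\<close>.
      Continuity of the enclosing limits at \<open>\<epsilon> = 0\<close> makes this
      sufficient.\<close>
    have "((\<lambda>\<epsilon>. exp (- (1 - \<epsilon>) * c)) \<longlongrightarrow> exp (- (1 - 0) * c)) (at_right (0::real))" by (intro tendsto_intros)
    then have "\<forall>\<^sub>F \<epsilon> in at_right 0. exp (- (1 - \<epsilon>) * c) < t" using t by (intro order_tendstoD) auto
    moreover have "\<forall>\<^sub>F \<epsilon> in at_right (0::real). \<epsilon> \<in> {0<..<1}" by (rule eventually_at_right_real) simp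
    ultimately have "\<forall>\<^sub>F \<epsilon> in at_right 0. exp (- (1 - \<epsilon>) * c) < t \<and> 0 < \<epsilon> \<and> \<epsilon> < 1" by eventually_elim auto
    then obtain \<epsilon> where e: "exp (- (1 - \<epsilon>) * c) < t" "0 < \<epsilon>" "\<epsilon> < 1"
      using eventually_happens[of _ "at_right (0::real)"] by auto
    have "(\<lambda>n. exp (- (1 - \<epsilon>) * (real (Suc n) * m n))) \<longlonglongrightarrow> exp (- (1 - \<epsilon>) * c)" by (intro tendsto_intros lim)
    then have "\<forall>\<^sub>F n in sequentially. exp (- (1 - \<epsilon>) * (real (Suc n) * m n)) < t" using e(1) by (rule order_tendstoD)
    then show "\<forall>\<^sub>F n in sequentially. (\<Prod>k=1..Suc n. 1 - a n k) < t"
      using a[OF e(2,3)] small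
    proof eventually_elim
      case (elim n)
      have "(\<Prod>k=1..Suc n. 1 - a n k) \<le> (\<Prod>k=1..Suc n. exp (- ((1 - \<epsilon>) * m n)))"
      proof (rule prod_mono)
        fix k assume k: "k \<in> {1..Suc n}"
        have "a n k \<le> (1 + \<epsilon>) * m n" using elim(2) k by blast
        also have "\<dots> \<le> 2 * m n" using e m0[of n] by (intro mult_right_mono) auto
        finally have 1: "0 \<le> 1 - a n k" using elim(3) by linarith
        have "1 - a n k \<le> 1 + - ((1 - \<epsilon>) * m n)" using elim(2) k by auto
        also have "\<dots> \<le> exp (- ((1 - \<epsilon>) * m n))" by (rule exp_ge_add_one_self)
        finally show "0 \<le> 1 - a n k \<and> 1 - a n k \<le> exp (- ((1 - \<epsilon>) * m n))" using 1 by simp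
      qed
      also have "\<dots> = exp (real (Suc n) * (- ((1 - \<epsilon>) * m n)))" unfolding exp_of_nat_mult by simp
      also have "real (Suc n) * (- ((1 - \<epsilon>) * m n)) = - (1 - \<epsilon>) * (real (Suc n) * m n)" by (simp add: algebra_simps)
      finally show ?case using elim(1) by linarith
    qed
  next
    fix t assume t: "t < exp (- c)"
    have "((\<lambda>\<epsilon>. exp (- (1 + \<epsilon>) * c)) \<longlongrightarrow> exp (- (1 + 0) * c)) (at_right (0::real))" by (intro tendsto_intros)
    then have "\<forall>\<^sub>F \<epsilon> in at_right 0. t < exp (- (1 + \<epsilon>) * c)" using t by (intro order_tendstoD) auto
    moreover have "\<forall>\<^sub>F \<epsilon> in at_right (0::real). \<epsilon> \<in> {0<..<1}" by (rule eventually_at_right_real) simp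
    ultimately have "\<forall>\<^sub>F \<epsilon> in at_right 0. t < exp (- (1 + \<epsilon>) * c) \<and> 0 < \<epsilon> \<and> \<epsilon> < 1" by eventually_elim auto
    then obtain \<epsilon> where e: "t < exp (- (1 + \<epsilon>) * c)" "0 < \<epsilon>" "\<epsilon> < 1"
      using eventually_happens[of _ "at_right (0::real)"] by auto
    define x where "x n = (1 + \<epsilon>) * m n" for n
    have x0: "0 \<le> x n" for n using m0 e by (simp add: x_def)
    have xl: "(\<lambda>n. real (Suc n) * x n) \<longlonglongrightarrow> (1 + \<epsilon>) * c"
    proof -
      have "(\<lambda>n. (1 + \<epsilon>) * (real (Suc n) * m n)) \<longlonglongrightarrow> (1 + \<epsilon>) * c" by (intro tendsto_intros lim)
      then show ?thesis by (simp add: x_def mult_ac)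
    qed
    have "(\<lambda>n. exp (- (real (Suc n) * x n) - 2 * (real (Suc n) * x n) * ((1 + \<epsilon>) * m n))) \<longlonglongrightarrow> exp (- ((1 + \<epsilon>) * c) - 2 * ((1 + \<epsilon>) * c) * ((1 + \<epsilon>) * 0))"
      by (intro tendsto_intros xl mlim)
    then have "\<forall>\<^sub>F n in sequentially. t < exp (- (real (Suc n) * x n) - 2 * (real (Suc n) * x n) * ((1 + \<epsilon>) * m n))"
    proof (rule order_tendstoD)
      have "- (1 + \<epsilon>) * c = - ((1 + \<epsilon>) * c) - 2 * ((1 + \<epsilon>) * c) * ((1 + \<epsilon>) * 0)" by (simp add: algebra_simps)
      then show "t < exp (- ((1 + \<epsilon>) * c) - 2 * ((1 + \<epsilon>) * c) * ((1 + \<epsilon>) * 0))" using e(1) by metis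
    qed
    then show "\<forall>\<^sub>F n in sequentially. t < (\<Prod>k=1..Suc n. 1 - a n k)"
      using a[OF e(2,3)] small
    proof eventually_elim
      case (elim n)
      have "x n \<le> 2 * m n" unfolding x_def using e m0[of n] by (intro mult_right_mono) auto
      then have x1: "x n \<le> 1/2" using elim(3) by linarith
      have "exp (- (real (Suc n) * x n) - 2 * (real (Suc n) * x n) * ((1 + \<epsilon>) * m n)) = exp (real (Suc n) * (- x n - 2 * (x n)\<^sup>2))"
        by (rule arg_cong[where f=exp]) (simp add: x_def power2_eq_square algebra_simps)
      also have "\<dots> = (\<Prod>k=1..Suc n. exp (- x n - 2 * (x n)\<^sup>2))" unfolding exp_of_nat_mult by simp
      also have "\<dots> \<le> (\<Prod>k=1..Suc n. 1 - a n k)"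
      proof (rule prod_mono)
        fix k assume k: "k \<in> {1..Suc n}"
        have "- x n - 2 * (x n)\<^sup>2 \<le> ln (1 - x n)" using x0 x1 by (rule ln_one_minus_pos_lower_bound)
        then have "exp (- x n - 2 * (x n)\<^sup>2) \<le> 1 - x n" using x1
          by (subst (asm) ln_ge_iff) auto
        also have "\<dots> \<le> 1 - a n k" using elim(2) k by (auto simp: x_def)
        finally show "0 \<le> exp (- x n - 2 * (x n)\<^sup>2) \<and> exp (- x n - 2 * (x n)\<^sup>2) \<le> 1 - a n k" by simp
      qed
      finally show ?case using elim(1) by linarith
    qed
  qed
qed

context gibbs_limit
begin

lemma tilted_mass_measurable:
  assumes adm: "admissible C n I s"
  shows "tilted_mass n I s \<in> borel_measurable borel"
proof -
  interpret I: prob_space "iid I" by (rule prob_space_iid)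
  note [measurable] = admissibleD(1)[OF adm] weight_measurable[OF adm]
  show ?thesis unfolding tilted_mass_def[abs_def] by measurable
qed

lemma nn_integral_tilted_mass_near:
  assumes R: "0 \<le> R" and \<epsilon>: "0 < \<epsilon>"
  shows "\<forall>\<^sub>F n in sequentially. \<forall>I s \<phi>. admissible C n I s \<and> \<phi> \<in> borel_measurable borel \<and> (\<forall>z. \<phi> z \<noteq> 0 \<longrightarrow> norm z \<le> R) \<longrightarrow>
     (\<integral>\<^sup>+z. \<phi> z * tilted_mass n I s z \<partial>M) \<le> ennreal (1 + \<epsilon>) * (\<integral>\<^sup>+z. \<phi> z \<partial>M) * mass n I s \<and>
     (\<integral>\<^sup>+z. \<phi> z \<partial>M) * mass n I s \<le> (\<integral>\<^sup>+z. \<phi> z * tilted_mass n I s z \<partial>M) + ennreal \<epsilon> * (\<integral>\<^sup>+z. \<phi> z \<partial>M) * mass n I s"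
  using tilted_mass_near[OF R \<epsilon>, of C]
proof eventually_elim
  case (elim n)
  show ?case
  proof (intro allI impI, elim conjE)
    fix I s \<phi> assume adm: "admissible C n I s" and [measurable]: "\<phi> \<in> borel_measurable borel" and sup: "\<forall>z. \<phi> z \<noteq> (0::ennreal) \<longrightarrow> norm (z::'a) \<le> R"
    note [measurable] = tilted_mass_measurable[OF adm]
    let ?B = "mass n I s" and ?T = "tilted_mass n I s"
    have near: "?T z \<le> ennreal (1 + \<epsilon>) * ?B" "?B \<le> ?T z + ennreal \<epsilon> * ?B" if "\<phi> z \<noteq> 0" for z
      using elim adm sup that by blast+
    have "(\<integral>\<^sup>+z. \<phi> z * ?T z \<partial>M) \<le> (\<integral>\<^sup>+z. (ennreal (1 + \<epsilon>) * ?B) * \<phi> z \<partial>M)"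
    proof (rule nn_integral_mono)
      fix z show "\<phi> z * ?T z \<le> (ennreal (1 + \<epsilon>) * ?B) * \<phi> z"
        using near(1)[of z] by (cases "\<phi> z = 0") (auto simp: mult.commute[of "\<phi> z"] intro!: mult_right_mono)
    qed
    also have "\<dots> = ennreal (1 + \<epsilon>) * (\<integral>\<^sup>+z. \<phi> z \<partial>M) * ?B" by (subst nn_integral_cmult) (auto simp: mult_ac)
    finally have 1: "(\<integral>\<^sup>+z. \<phi> z * ?T z \<partial>M) \<le> ennreal (1 + \<epsilon>) * (\<integral>\<^sup>+z. \<phi> z \<partial>M) * ?B" .
    have "(\<integral>\<^sup>+z. \<phi> z \<partial>M) * ?B = (\<integral>\<^sup>+z. \<phi> z * ?B \<partial>M)" by (rule nn_integral_multc[symmetric]) auto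
    also have "\<dots> \<le> (\<integral>\<^sup>+z. \<phi> z * ?T z + \<phi> z * (ennreal \<epsilon> * ?B) \<partial>M)"
    proof (rule nn_integral_mono)
      fix z show "\<phi> z * ?B \<le> \<phi> z * ?T z + \<phi> z * (ennreal \<epsilon> * ?B)"
        unfolding distrib_left[symmetric] using near(2)[of z] by (cases "\<phi> z = 0") (auto intro!: mult_left_mono)
    qed
    also have "\<dots> = (\<integral>\<^sup>+z. \<phi> z * ?T z \<partial>M) + (\<integral>\<^sup>+z. \<phi> z \<partial>M) * (ennreal \<epsilon> * ?B)"
      by (subst nn_integral_add) (auto simp: nn_integral_multc)
    finally show "(\<integral>\<^sup>+z. \<phi> z * ?T z \<partial>M) \<le> ennreal (1 + \<epsilon>) * (\<integral>\<^sup>+z. \<phi> z \<partial>M) * ?B \<and>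
      (\<integral>\<^sup>+z. \<phi> z \<partial>M) * ?B \<le> (\<integral>\<^sup>+z. \<phi> z * ?T z \<partial>M) + ennreal \<epsilon> * (\<integral>\<^sup>+z. \<phi> z \<partial>M) * ?B"
      using 1 by (simp add: mult_ac)
  qed
qed

text \<open>Inside a large ball the concentration estimate applies; outside, both the tilted mass
  and the mass itself are controlled by the polynomial domination, whose integral over the
  complement of the ball is small.\<close>

lemma nn_integral_tilted_mass:
  assumes \<epsilon>: "0 < \<epsilon>"
  shows "\<forall>\<^sub>F n in sequentially. \<forall>I s. admissible C n I s \<longrightarrow>
     (\<integral>\<^sup>+z. tilted_mass n I s z \<partial>M) \<le> ennreal (1 + \<epsilon>) * mass n I s \<and>
     mass n I s \<le> (\<integral>\<^sup>+z. tilted_mass n I s z \<partial>M) + ennreal \<epsilon> * mass n I s"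
proof -
  obtain K where K: "0 \<le> K" and dom: "\<And>C. \<forall>\<^sub>F n in sequentially. \<forall>I s z. admissible C n I s \<longrightarrow>
     tilted_mass n I s z \<le> ennreal (K * (1 + norm z) powr (\<gamma> + 1)) * mass n I s"
    by (rule tilted_mass_le, rule that, assumption, blast)
  \<comment> \<open>\<open>K + 1\<close> in place of \<open>K\<close> lets the domination cover the
    constant function equal to the mass as well. One more power of 1 + |z| than in the domination
    pays for the factor 1 / (1 + R) gained outside the ball.\<close>
  define D where "D = (K + 1) * tame_const (\<gamma> + 2)"
  have D: "0 \<le> D" using K tame_const(1)[of "\<gamma> + 2"] \<gamma>_nonneg by (simp add: D_def)
  define R where "R = 2 * D / \<epsilon>"
  have R: "0 \<le> R" using D \<epsilon> by (simp add: R_def)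
  have DR: "D / (1 + R) \<le> \<epsilon> / 2"
  proof -
    have "D = \<epsilon> / 2 * R" using \<epsilon> by (simp add: R_def)
    also have "\<dots> \<le> \<epsilon> / 2 * (1 + R)" using \<epsilon> by simp
    finally show ?thesis using R by (simp add: divide_le_eq)
  qed
  let ?in = "indicator (cball 0 R) :: 'a \<Rightarrow> ennreal" and ?out = "indicator (- cball 0 R) :: 'a \<Rightarrow> ennreal"
  have tail: "(\<integral>\<^sup>+z. ?out z * ennreal ((K + 1) * (1 + norm z) powr (\<gamma> + 1)) \<partial>M) \<le> ennreal (\<epsilon> / 2)"
  proof -
    have "(\<integral>\<^sup>+z. ?out z * ennreal ((K + 1) * (1 + norm z) powr (\<gamma> + 1)) \<partial>M)
      \<le> (\<integral>\<^sup>+z. ennreal ((K + 1) / (1 + R)) * ennreal ((1 + sing 0 z) * (1 + norm z) powr (\<gamma> + 2)) \<partial>M)"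
    proof (rule nn_integral_mono)
      fix z :: 'a
      have "?out z * ennreal ((K + 1) * (1 + norm z) powr (\<gamma> + 1)) \<le> ennreal ((K + 1) / (1 + R) * ((1 + sing 0 z) * (1 + norm z) powr (\<gamma> + 2)))"
      proof (cases "norm z \<le> R")
        case False
        have "1 + R \<le> (1 + norm z) * (1 + sing 0 z)"
          using False R sing_nonneg[of 0 z] mult_mono[of "1 + R" "1 + norm z" 1 "1 + sing 0 z"] by simp
        then have "(K + 1) * (1 + norm z) powr (\<gamma> + 1) * (1 + R) \<le> (K + 1) * (1 + norm z) powr (\<gamma> + 1) * ((1 + norm z) * (1 + sing 0 z))"
          using K by (intro mult_left_mono) auto
        also have "\<dots> = (K + 1) * ((1 + sing 0 z) * (1 + norm z) powr (\<gamma> + 2))"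
        proof -
          have "(1 + norm z) powr (\<gamma> + 2) = (1 + norm z) powr (\<gamma> + 1) * (1 + norm z) powr 1" by (simp only: powr_add[symmetric]) (simp add: add.assoc)
          then show ?thesis by (simp add: mult_ac)
        qed
        finally have "(K + 1) * (1 + norm z) powr (\<gamma> + 1) \<le> (K + 1) * ((1 + sing 0 z) * (1 + norm z) powr (\<gamma> + 2)) / (1 + R)"
          using R by (simp add: pos_le_divide_eq)
        then show ?thesis using False by (simp add: ennreal_leI)
      qed simp
      also have "\<dots> = ennreal ((K + 1) / (1 + R)) * ennreal ((1 + sing 0 z) * (1 + norm z) powr (\<gamma> + 2))"
        using K R sing_nonneg[of 0 z] by (intro ennreal_mult) auto
      finally show "?out z * ennreal ((K + 1) * (1 + norm z) powr (\<gamma> + 1)) \<le> ennreal ((K + 1) / (1 + R)) * ennreal ((1 + sing 0 z) * (1 + norm z) powr (\<gamma> + 2))" .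
    qed
    also have "\<dots> = ennreal ((K + 1) / (1 + R)) * (\<integral>\<^sup>+z. ennreal ((1 + sing 0 z) * (1 + norm z) powr (\<gamma> + 2)) \<partial>M)"
      by (rule nn_integral_cmult) auto
    also have "\<dots> \<le> ennreal ((K + 1) / (1 + R)) * ennreal (tame_const (\<gamma> + 2))"
      using \<gamma>_nonneg by (intro mult_left_mono tame_const) auto
    also have "\<dots> = ennreal (D / (1 + R))"
      using K R tame_const(1)[of "\<gamma> + 2"] \<gamma>_nonneg by (simp add: D_def ennreal_mult[symmetric])
    also have "\<dots> \<le> ennreal (\<epsilon> / 2)" by (intro ennreal_leI DR)
    finally show ?thesis .
  qed
  have half: "0 < \<epsilon> / 2" using \<epsilon> by simp
  show ?thesis
    using dom[of C] nn_integral_tilted_mass_near[OF R half, of C]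
  proof eventually_elim
    case (elim n)
    show ?case
    proof (intro allI impI)
      fix I s assume adm: "admissible C n I s"
      note [measurable] = tilted_mass_measurable[OF adm]
      let ?B = "mass n I s" and ?T = "tilted_mass n I s"
      have meas[measurable]: "?in \<in> borel_measurable borel" "?out \<in> borel_measurable borel"
        by (intro borel_measurable_indicator; simp)+
      have "\<forall>z. ?in z \<noteq> 0 \<longrightarrow> norm z \<le> R" by (auto split: split_indicator_asm)
      with meas(1) have in0: "admissible C n I s \<and> ?in \<in> borel_measurable borel \<and> (\<forall>z. ?in z \<noteq> 0 \<longrightarrow> norm z \<le> R)"
        using adm by blast
      note near = elim(2)[rule_format, OF in0]
      have in1: "(\<integral>\<^sup>+z. ?in z \<partial>M) \<le> 1" using measure_le_1[of "cball 0 R"] by (simp add: sets_M emeasure_eq_measure)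
      have split: "(\<integral>\<^sup>+z. g z \<partial>M) = (\<integral>\<^sup>+z. ?in z * g z \<partial>M) + (\<integral>\<^sup>+z. ?out z * g z \<partial>M)"
        if [measurable]: "g \<in> borel_measurable borel" for g
        by (subst nn_integral_add[symmetric]) (auto intro!: nn_integral_cong split: split_indicator)
      have out: "(\<integral>\<^sup>+z. ?out z * g z \<partial>M) \<le> ennreal (\<epsilon> / 2) * ?B"
        if [measurable]: "g \<in> borel_measurable borel" and g: "\<And>z. g z \<le> ennreal ((K + 1) * (1 + norm z) powr (\<gamma> + 1)) * ?B" for g
      proof -
        have "(\<integral>\<^sup>+z. ?out z * g z \<partial>M) \<le> (\<integral>\<^sup>+z. ?out z * ennreal ((K + 1) * (1 + norm z) powr (\<gamma> + 1)) * ?B \<partial>M)"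
          unfolding mult.assoc by (intro nn_integral_mono mult_left_mono g) auto
        also have "\<dots> = (\<integral>\<^sup>+z. ?out z * ennreal ((K + 1) * (1 + norm z) powr (\<gamma> + 1)) \<partial>M) * ?B"
          by (rule nn_integral_multc) auto
        also have "\<dots> \<le> ennreal (\<epsilon> / 2) * ?B" by (intro mult_right_mono tail) simp
        finally show ?thesis .
      qed
      have g1: "?T z \<le> ennreal ((K + 1) * (1 + norm z) powr (\<gamma> + 1)) * ?B" for z
      proof -
        have "?T z \<le> ennreal (K * (1 + norm z) powr (\<gamma> + 1)) * ?B" using elim(1) adm by blast
        also have "\<dots> \<le> ennreal ((K + 1) * (1 + norm z) powr (\<gamma> + 1)) * ?B"
          by (intro mult_right_mono ennreal_leI) auto
        finally show ?thesis .
      qed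
      have g2: "?B \<le> ennreal ((K + 1) * (1 + norm z) powr (\<gamma> + 1)) * ?B" for z :: 'a
      proof -
        have "1 \<le> (1 + norm z) powr (\<gamma> + 1)" using \<gamma>_nonneg by (intro ge_one_powr_ge_zero) auto
        then have "1 * 1 \<le> (K + 1) * (1 + norm z) powr (\<gamma> + 1)" using K by (intro mult_mono) auto
        then have "1 \<le> ennreal ((K + 1) * (1 + norm z) powr (\<gamma> + 1))" by (simp add: ennreal_1[symmetric] ennreal_leI del: ennreal_1)
        then show ?thesis using mult_right_mono[of 1 _ ?B] by simp
      qed
      have half2: "ennreal (\<epsilon> / 2) * ?B + ennreal (\<epsilon> / 2) * ?B = ennreal \<epsilon> * ?B"
        using \<epsilon> by (simp add: distrib_right[symmetric] ennreal_plus[symmetric] del: ennreal_plus)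
      have "(\<integral>\<^sup>+z. ?T z \<partial>M) \<le> ennreal (1 + \<epsilon> / 2) * (\<integral>\<^sup>+z. ?in z \<partial>M) * ?B + ennreal (\<epsilon> / 2) * ?B"
        using near split[of ?T] out[of ?T] g1 by (simp add: add_mono)
      also have "\<dots> \<le> ennreal (1 + \<epsilon> / 2) * 1 * ?B + ennreal (\<epsilon> / 2) * ?B"
        by (intro add_right_mono mult_right_mono mult_left_mono in1) auto
      also have "\<dots> = ?B + (ennreal (\<epsilon> / 2) * ?B + ennreal (\<epsilon> / 2) * ?B)"
        using \<epsilon> by (simp add: distrib_right add.assoc)
      also have "\<dots> = ennreal (1 + \<epsilon>) * ?B" unfolding half2 using \<epsilon> by (simp add: distrib_right)
      finally have 1: "(\<integral>\<^sup>+z. ?T z \<partial>M) \<le> ennreal (1 + \<epsilon>) * ?B" .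
      have "?B = (\<integral>\<^sup>+z. ?B \<partial>M)" by (simp add: emeasure_space_1[simplified])
      also have "\<dots> = (\<integral>\<^sup>+z. ?in z \<partial>M) * ?B + (\<integral>\<^sup>+z. ?out z * ?B \<partial>M)"
        by (subst split) (auto simp: nn_integral_multc)
      also have "\<dots> \<le> ((\<integral>\<^sup>+z. ?in z * ?T z \<partial>M) + ennreal (\<epsilon> / 2) * (\<integral>\<^sup>+z. ?in z \<partial>M) * ?B) + ennreal (\<epsilon> / 2) * ?B"
        using near out[of "\<lambda>_. ?B"] g2 by (intro add_mono) auto
      also have "\<dots> \<le> ((\<integral>\<^sup>+z. ?T z \<partial>M) + ennreal (\<epsilon> / 2) * 1 * ?B) + ennreal (\<epsilon> / 2) * ?B"
        using in1 by (intro add_mono order_refl mult_right_mono mult_left_mono nn_integral_mono) (auto split: split_indicator)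
      also have "\<dots> = (\<integral>\<^sup>+z. ?T z \<partial>M) + ennreal \<epsilon> * ?B" using half2 by (simp add: add.assoc)
      finally show "(\<integral>\<^sup>+z. ?T z \<partial>M) \<le> ennreal (1 + \<epsilon>) * ?B \<and> ?B \<le> (\<integral>\<^sup>+z. ?T z \<partial>M) + ennreal \<epsilon> * ?B" using 1 by simp
    qed
  qed
qed

text \<open>Numerator and denominator are compared with the same \<open>mass n I s\<close>, which
  cancels. The law of the added point is thus close to \<open>M\<close> on the ball, uniformly in
  \<open>I\<close>, \<open>s\<close> and \<open>\<phi>\<close>, although the mass itself is not
  estimated sharply.\<close>

lemma tilted_ratio:
  assumes R: "0 \<le> R" and \<epsilon>: "0 < \<epsilon>" "\<epsilon> < 1"
  shows "\<forall>\<^sub>F n in sequentially. \<forall>I s \<phi>. admissible C n I s \<and> \<phi> \<in> borel_measurable borel \<and> (\<forall>z. 0 \<le> \<phi> z \<and> \<phi> z \<le> 1) \<and>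
       (\<forall>z. \<phi> z \<noteq> 0 \<longrightarrow> norm z \<le> R) \<longrightarrow>
     0 < (\<integral>\<^sup>+z. tilted_mass n I s z \<partial>M) \<and> (\<integral>\<^sup>+z. tilted_mass n I s z \<partial>M) < \<infinity> \<and>
     (1 - \<epsilon>) * (\<integral>z. \<phi> z \<partial>M) \<le> enn2real (\<integral>\<^sup>+z. ennreal (\<phi> z) * tilted_mass n I s z \<partial>M) / enn2real (\<integral>\<^sup>+z. tilted_mass n I s z \<partial>M) \<and>
     enn2real (\<integral>\<^sup>+z. ennreal (\<phi> z) * tilted_mass n I s z \<partial>M) / enn2real (\<integral>\<^sup>+z. tilted_mass n I s z \<partial>M) \<le> (1 + \<epsilon>) * (\<integral>z. \<phi> z \<partial>M)"
proof -
  \<comment> \<open>With a quarter of \<open>\<epsilon>\<close>, the quotients (1 + e) / (1 - e) and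
    (1 - e) / (1 + e) stay between 1 - 4 e and 1 + 4 e.\<close>
  define e where "e = \<epsilon> / 4"
  have e: "0 < e" "e < 1/4" "\<epsilon> = 4 * e" using \<epsilon> by (auto simp: e_def)
  have one: "(0::real) < 1" by simp
  show ?thesis
    using nn_integral_tilted_mass[OF e(1), of C] nn_integral_tilted_mass_near[OF R e(1), of C] mass_ge[OF one, of C] mass_finite
  proof eventually_elim
    case (elim n)
    show ?case
    proof (intro allI impI, elim conjE)
      fix I s and \<phi> :: "'a \<Rightarrow> real"
      assume adm: "admissible C n I s" and [measurable]: "\<phi> \<in> borel_measurable borel"
        and \<phi>: "\<forall>z. 0 \<le> \<phi> z \<and> \<phi> z \<le> 1" and sup: "\<forall>z. \<phi> z \<noteq> 0 \<longrightarrow> norm z \<le> R"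
      let ?B = "mass n I s" and ?T = "\<integral>\<^sup>+z. tilted_mass n I s z \<partial>M" and ?J = "\<integral>\<^sup>+z. ennreal (\<phi> z) * tilted_mass n I s z \<partial>M"
      let ?m = "\<integral>z. \<phi> z \<partial>M"
      have im: "integrable M \<phi>" by (rule integrable_const_bound[of _ 1]) (use \<phi> in auto)
      have m: "(\<integral>\<^sup>+z. ennreal (\<phi> z) \<partial>M) = ennreal ?m" using im \<phi> by (intro nn_integral_eq_integral) auto
      have m0: "0 \<le> ?m" using \<phi> by (intro Bochner_Integration.integral_nonneg) auto
      have T: "?T \<le> ennreal (1 + e) * ?B" "?B \<le> ?T + ennreal e * ?B" using elim(1) adm by blast+
      have "\<forall>z. ennreal (\<phi> z) \<noteq> 0 \<longrightarrow> norm z \<le> R" using sup \<phi> by auto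
      then have J: "?J \<le> ennreal (1 + e) * ennreal ?m * ?B" "ennreal ?m * ?B \<le> ?J + ennreal e * ennreal ?m * ?B"
        using elim(2)[rule_format, of I s "\<lambda>z. ennreal (\<phi> z)"] adm unfolding m by auto
      have Bfin: "?B < \<infinity>" using elim(4) adm by blast
      have "0 < ennreal (exp (- 1 * real n))" by simp
      also have "\<dots> \<le> ?B" using elim(3) adm by blast
      finally have Bpos: "0 < ?B" .
      obtain \<beta> where B: "?B = ennreal \<beta>" "0 < \<beta>"
        using Bfin Bpos by (cases ?B) (auto simp: less_top[symmetric])
      have "?T < \<infinity>" using T(1) Bfin by (simp add: ennreal_mult_less_top le_less_trans)
      then obtain \<tau> where \<tau>: "?T = ennreal \<tau>" "0 \<le> \<tau>" by (cases ?T) auto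
      have "?J < \<infinity>" using J(1) Bfin by (simp add: ennreal_mult_less_top le_less_trans)
      then obtain \<iota> where \<iota>: "?J = ennreal \<iota>" "0 \<le> \<iota>" by (cases ?J) auto
      have r: "\<tau> \<le> (1 + e) * \<beta>" "\<beta> \<le> \<tau> + e * \<beta>" "\<iota> \<le> (1 + e) * ?m * \<beta>" "?m * \<beta> \<le> \<iota> + e * ?m * \<beta>"
        using T J B(2) \<tau>(2) \<iota>(2) e m0 unfolding B(1) \<tau>(1) \<iota>(1)
        by (simp_all add: ennreal_mult[symmetric] ennreal_plus[symmetric] mult_nonneg_nonneg del: ennreal_plus)
      have tp: "(1 - e) * \<beta> \<le> \<tau>" using r(2) by (simp add: algebra_simps)
      have "0 < (1 - e) * \<beta>" using e B(2) by simp
      with tp have \<tau>0: "0 < \<tau>" by linarith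
      have up: "\<iota> / \<tau> \<le> (1 + \<epsilon>) * ?m"
      proof -
        have "(1 + e) * \<beta> \<le> (1 + 4 * e) * ((1 - e) * \<beta>)"
        proof -
          have "e * e \<le> e * (1/4)" using e by (intro mult_left_mono) auto
          then have "1 + e \<le> (1 + 4 * e) * (1 - e)" using e by (simp add: algebra_simps)
          then show ?thesis using B(2) mult_right_mono[of "1 + e" "(1 + 4 * e) * (1 - e)" \<beta>] by (simp add: mult.assoc)
        qed
        also have "\<dots> \<le> (1 + 4 * e) * \<tau>" using tp e by (intro mult_left_mono) auto
        finally have "?m * ((1 + e) * \<beta>) \<le> ?m * ((1 + 4 * e) * \<tau>)" using m0 by (intro mult_left_mono)
        then have "\<iota> \<le> (1 + \<epsilon>) * ?m * \<tau>" using r(3) e(3) by (simp add: mult_ac)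
        then show ?thesis using \<tau>0 by (simp add: divide_le_eq)
      qed
      have low: "(1 - \<epsilon>) * ?m \<le> \<iota> / \<tau>"
      proof -
        have "(1 - 4 * e) * \<tau> \<le> (1 - 4 * e) * ((1 + e) * \<beta>)" using r(1) e by (intro mult_left_mono) auto
        also have "\<dots> \<le> (1 - e) * \<beta>"
        proof -
          have "(1 - 4 * e) * (1 + e) \<le> 1 - e" using e by (simp add: algebra_simps)
          then show ?thesis using B(2) mult_right_mono[of "(1 - 4 * e) * (1 + e)" "1 - e" \<beta>] by (simp add: mult.assoc)
        qed
        finally have "?m * ((1 - 4 * e) * \<tau>) \<le> ?m * ((1 - e) * \<beta>)" using m0 by (intro mult_left_mono)
        also have "\<dots> \<le> \<iota>" using r(4) by (simp add: algebra_simps)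
        finally have "(1 - \<epsilon>) * ?m * \<tau> \<le> \<iota>" using e(3) by (simp add: mult_ac)
        then show ?thesis using \<tau>0 by (simp add: pos_le_divide_eq)
      qed
      show "0 < ?T \<and> ?T < \<infinity> \<and> (1 - \<epsilon>) * ?m \<le> enn2real ?J / enn2real ?T \<and> enn2real ?J / enn2real ?T \<le> (1 + \<epsilon>) * ?m"
        using up low \<tau>0 \<iota>(2) unfolding \<tau>(1) \<iota>(1) by simp
    qed
  qed
qed

text \<open>\<open>b n\<close> is the coupling in a system of n + 1 points: n counts the points that
  a given one interacts with, in agreement with n b tending to \<open>\<gamma>\<close>.\<close>

definition gibbs_mass :: "nat \<Rightarrow> (nat \<Rightarrow> 'a \<Rightarrow> real) \<Rightarrow> ennreal" where
  "gibbs_mass n s = (\<integral>\<^sup>+X. ennreal (exp (gibbs_log (b n) \<gamma> {1..Suc n} X - (\<Sum>j\<in>{1..Suc n}. s j (X j)))) \<partial>iid {1..Suc n})"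

lemma gibbs_mass_split:
  assumes k: "k \<in> {1..Suc n}" and s: "\<And>j. s j \<in> borel_measurable borel"
    and adm: "admissible C n ({1..Suc n} - {k}) s"
  shows "gibbs_mass n s = ennreal (exp (\<gamma> * pot_energy / 2)) * (\<integral>\<^sup>+z. ennreal (exp (- s k z)) * tilted_mass n ({1..Suc n} - {k}) s z \<partial>M)"
proof -
  interpret PS: product_sigma_finite "\<lambda>_::nat. M" by (rule product_sigma_finite_M)
  let ?I = "{1..Suc n} - {k}"
  interpret I: prob_space "iid ?I" by (rule prob_space_iid)
  have I: "finite ?I" "k \<notin> ?I" "insert k ?I = {1..Suc n}" using k by auto
  note [measurable] = s weight_measurable[OF adm] tilted_mass_measurable[OF adm]
  define F where "F X = ennreal (exp (gibbs_log (b n) \<gamma> {1..Suc n} X - (\<Sum>j\<in>{1..Suc n}. s j (X j))))" for X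
  have [measurable]: "F \<in> borel_measurable (iid {1..Suc n})" unfolding F_def[abs_def] by measurable
  have "gibbs_mass n s = integral\<^sup>N (iid (insert k ?I)) F" unfolding I(3) gibbs_mass_def F_def ..
  also have "\<dots> = (\<integral>\<^sup>+z. (\<integral>\<^sup>+X. F (X(k := z)) \<partial>iid ?I) \<partial>M)"
    by (rule PS.product_nn_integral_insert_rev[OF I(1,2)]) (simp only: I(3), measurable)
  also have "\<dots> = (\<integral>\<^sup>+z. ennreal (exp (\<gamma> * pot_energy / 2)) * (ennreal (exp (- s k z)) * tilted_mass n ?I s z) \<partial>M)"
  proof (rule nn_integral_cong)
    fix z :: 'a
    have [measurable]: "(\<lambda>X. cross (b n) \<gamma> ?I X z) \<in> borel_measurable (iid ?I)" using I(1) by measurable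
    have eq: "F (X(k := z)) = ennreal (exp (\<gamma> * pot_energy / 2) * exp (- s k z)) * ennreal (exp (weight n ?I s X + cross (b n) \<gamma> ?I X z))" for X
    proof -
      have "(\<Sum>j\<in>{1..Suc n}. s j ((X(k := z)) j)) = s k z + (\<Sum>j\<in>?I. s j (X j))"
      proof -
        have "(\<Sum>j\<in>insert k ?I. s j ((X(k := z)) j)) = s k z + (\<Sum>j\<in>?I. s j ((X(k := z)) j))"
          using I by (subst sum.insert) auto
        also have "(\<Sum>j\<in>?I. s j ((X(k := z)) j)) = (\<Sum>j\<in>?I. s j (X j))" by (intro sum.cong) auto
        finally show ?thesis by (simp only: I(3))
      qed
      moreover have "gibbs_log (b n) \<gamma> {1..Suc n} (X(k := z)) = gibbs_log (b n) \<gamma> ?I X + cross (b n) \<gamma> ?I X z + \<gamma> * pot_energy / 2"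
        using gibbs_log_insert[OF I(1,2)] by (simp only: I(3))
      ultimately have "F (X(k := z)) = ennreal (exp (\<gamma> * pot_energy / 2 + (- s k z) + (weight n ?I s X + cross (b n) \<gamma> ?I X z)))"
        unfolding F_def weight_def by (simp add: algebra_simps)
      also have "\<dots> = ennreal (exp (\<gamma> * pot_energy / 2) * exp (- s k z) * exp (weight n ?I s X + cross (b n) \<gamma> ?I X z))"
        by (simp only: exp_add[of "_ + _" "weight n ?I s X + _"] exp_add[of _ "- s k z"])
      finally show ?thesis by (simp only: ennreal_mult'' exp_ge_zero)
    qed
    show "(\<integral>\<^sup>+X. F (X(k := z)) \<partial>iid ?I) = ennreal (exp (\<gamma> * pot_energy / 2)) * (ennreal (exp (- s k z)) * tilted_mass n ?I s z)"
    proof -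
      have "(\<lambda>X. ennreal (exp (weight n ?I s X + cross (b n) \<gamma> ?I X z))) \<in> borel_measurable (iid ?I)" by measurable
      then show ?thesis unfolding eq tilted_mass_def by (subst nn_integral_cmult) (simp_all only: ennreal_mult exp_ge_zero mult.assoc)
    qed
  qed
  also have "\<dots> = ennreal (exp (\<gamma> * pot_energy / 2)) * (\<integral>\<^sup>+z. ennreal (exp (- s k z)) * tilted_mass n ?I s z \<partial>M)"
    by (rule nn_integral_cmult) measurable
  finally show ?thesis .
qed

theorem gibbs_mass_ratio_tendsto:
  fixes f :: "nat \<Rightarrow> 'a \<Rightarrow> real"
  assumes f: "\<And>n. f n \<in> borel_measurable borel" "\<And>n z. 0 \<le> f n z" "\<And>n. integrable M (f n)"
    and R: "0 \<le> R" "\<And>n z. f n z \<noteq> 0 \<Longrightarrow> norm z \<le> R"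
    and C: "\<And>n. real (Suc n) * (\<integral>z. f n z \<partial>M) \<le> C"
    and lim: "(\<lambda>n. real (Suc n) * (\<integral>z. 1 - exp (- f n z) \<partial>M)) \<longlonglongrightarrow> c"
  shows "(\<lambda>n. enn2real (gibbs_mass n (\<lambda>_. f n)) / enn2real (gibbs_mass n (\<lambda>_ _. 0))) \<longlonglongrightarrow> exp (- c)"
proof -
  \<comment> \<open>The points up to \<open>k\<close> carry \<open>f n\<close>. Hence
    \<open>S n (k - 1)\<close> and \<open>S n k\<close> agree away from \<open>k\<close>, and two
    successive masses share the same \<open>tilted_mass\<close> of the other points.\<close>
  define S where "S n k j = (if j \<le> k then f n else (\<lambda>_. 0))" for n k j :: nat
  define \<phi> where "\<phi> n z = 1 - exp (- f n z)" for n z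
  define T where "T n k = (\<integral>\<^sup>+z. tilted_mass n ({1..Suc n} - {k}) (S n k) z \<partial>M)" for n k
  define J where "J n k = (\<integral>\<^sup>+z. ennreal (\<phi> n z) * tilted_mass n ({1..Suc n} - {k}) (S n k) z \<partial>M)" for n k
  \<comment> \<open>The fraction of the mass that is lost when \<open>f n\<close> is switched on at
    the point \<open>k\<close>, the points before it carrying \<open>f n\<close> already.\<close>
  define a where "a n k = enn2real (J n k) / enn2real (T n k)" for n k
  have S_meas: "S n k j \<in> borel_measurable borel" for n k j using f(1) by (simp add: S_def)
  have if0: "0 \<le> (\<integral>z. f n z \<partial>M)" for n using f(2) by (intro Bochner_Integration.integral_nonneg)
  have adm: "admissible C n ({1..Suc n} - {k}) (S n k')" if "k \<in> {1..Suc n}" for n k k'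
    unfolding admissible_def
  proof (intro conjI ballI allI)
    show "card ({1..Suc n} - {k}) = n" using that by simp
    have "(\<Sum>j\<in>{1..Suc n} - {k}. \<integral>x. S n k' j x \<partial>M) \<le> (\<Sum>j\<in>{1..Suc n} - {k}. \<integral>x. f n x \<partial>M)"
      by (intro sum_mono) (auto simp: S_def if0)
    also have "\<dots> = real n * (\<integral>x. f n x \<partial>M)" using that by simp
    also have "\<dots> \<le> real (Suc n) * (\<integral>x. f n x \<partial>M)" using if0[of n] by (intro mult_right_mono) auto
    also have "\<dots> \<le> C" by (rule C)
    finally show "(\<Sum>j\<in>{1..Suc n} - {k}. \<integral>x. S n k' j x \<partial>M) \<le> C" .
  qed (use S_meas f in \<open>auto simp: S_def\<close>)
  have \<phi>_meas[measurable]: "\<phi> n \<in> borel_measurable borel" for n using f(1)[of n] unfolding \<phi>_def by measurable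
  have \<phi>01: "0 \<le> \<phi> n z \<and> \<phi> n z \<le> 1" for n z using f(2)[of n z] by (simp add: \<phi>_def)
  have \<phi>R: "\<phi> n z \<noteq> 0 \<Longrightarrow> norm z \<le> R" for n z using R(2)[of n z] by (auto simp: \<phi>_def)
  \<comment> \<open>\<open>tilted_ratio\<close> quantifies over sets and functions after n, so one
    threshold in n serves all n + 1 steps of the telescoping product.\<close>
  have ev: "\<forall>\<^sub>F n in sequentially. \<forall>k\<in>{1..Suc n}. 0 < T n k \<and> T n k < \<infinity> \<and>
      (1 - \<epsilon>) * (\<integral>z. \<phi> n z \<partial>M) \<le> a n k \<and> a n k \<le> (1 + \<epsilon>) * (\<integral>z. \<phi> n z \<partial>M)" if "0 < \<epsilon>" "\<epsilon> < 1" for \<epsilon>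
    using tilted_ratio[OF R(1) that, of C]
  proof eventually_elim
    case (elim n)
    show ?case
      unfolding T_def J_def a_def
      by (intro ballI elim[rule_format]) (use adm \<phi>_meas \<phi>01 \<phi>R in blast)
  qed
  have "(\<lambda>n. \<Prod>k=1..Suc n. 1 - a n k) \<longlonglongrightarrow> exp (- c)"
  proof (rule prod_tendsto_exp[where m="\<lambda>n. \<integral>z. \<phi> n z \<partial>M"])
    show "0 \<le> (\<integral>z. \<phi> n z \<partial>M)" for n using \<phi>01 by (intro Bochner_Integration.integral_nonneg) auto
    show "(\<lambda>n. real (Suc n) * (\<integral>z. \<phi> n z \<partial>M)) \<longlonglongrightarrow> c" using lim by (simp add: \<phi>_def)
    show "\<forall>\<^sub>F n in sequentially. \<forall>k\<in>{1..Suc n}. (1 - \<epsilon>) * (\<integral>z. \<phi> n z \<partial>M) \<le> a n k \<and> a n k \<le> (1 + \<epsilon>) * (\<integral>z. \<phi> n z \<partial>M)"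
      if "0 < \<epsilon>" "\<epsilon> < 1" for \<epsilon> using ev[OF that] by eventually_elim auto
  qed
  moreover have "\<forall>\<^sub>F n in sequentially. (\<Prod>k=1..Suc n. 1 - a n k) = enn2real (gibbs_mass n (\<lambda>_. f n)) / enn2real (gibbs_mass n (\<lambda>_ _. 0))"
    using ev[of "1/2", simplified]
  proof eventually_elim
    case (elim n)
    define e where "e = exp (\<gamma> * pot_energy / 2)"
    have complement: "y = x * (1 - z / x)" if "x = y + z" "0 < x" for x y z :: real using that by (simp add: field_simps)
    have e: "0 < e" by (simp add: e_def)
    have step: "enn2real (gibbs_mass n (S n k)) = enn2real (gibbs_mass n (S n (k - 1))) * (1 - a n k) \<and> 0 < enn2real (gibbs_mass n (S n (k - 1)))"
      if k: "k \<in> {1..Suc n}" for k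
    proof -
      let ?I = "{1..Suc n} - {k}"
      let ?t = "tilted_mass n ?I (S n k)"
      note [measurable] = tilted_mass_measurable[OF adm[OF k]] f(1)[of n]
      have same: "tilted_mass n ?I (S n (k - 1)) = ?t"
      proof -
        have "(\<Sum>j\<in>?I. S n (k - 1) j (X j)) = (\<Sum>j\<in>?I. S n k j (X j))" for X
          using k by (intro sum.cong refl) (auto simp: S_def)
        then show ?thesis unfolding tilted_mass_def[abs_def] weight_def by simp
      qed
      have p0: "gibbs_mass n (S n (k - 1)) = ennreal e * T n k"
      proof -
        have z: "S n (k - 1) k = (\<lambda>_. 0)" using k by (auto simp: S_def)
        show ?thesis using gibbs_mass_split[OF k S_meas adm[OF k, of "k - 1"]] unfolding same z T_def e_def by simp
      qed
      define A where "A = (\<integral>\<^sup>+z. ennreal (exp (- f n z)) * ?t z \<partial>M)"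
      have p1: "gibbs_mass n (S n k) = ennreal e * A"
        using gibbs_mass_split[OF k S_meas adm[OF k, of k]] unfolding A_def e_def by (simp add: S_def[of n k k])
      have "T n k = (\<integral>\<^sup>+z. ennreal (exp (- f n z)) * ?t z + ennreal (\<phi> n z) * ?t z \<partial>M)"
        unfolding T_def
      proof (rule nn_integral_cong)
        fix z
        have "ennreal (exp (- f n z)) * ?t z + ennreal (\<phi> n z) * ?t z = ennreal (exp (- f n z) + \<phi> n z) * ?t z"
          using \<phi>01[of n z] by (simp add: distrib_right[symmetric])
        then show "?t z = ennreal (exp (- f n z)) * ?t z + ennreal (\<phi> n z) * ?t z" by (simp add: \<phi>_def)
      qed
      also have "\<dots> = A + J n k" unfolding A_def J_def by (rule nn_integral_add; measurable)
      finally have TAJ: "T n k = A + J n k" .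
      have Tf: "0 < T n k" "T n k < \<infinity>" using elim k by auto
      have fin: "A < \<infinity>" "J n k < \<infinity>" using Tf(2) unfolding TAJ by (auto simp: less_top)
      have T0: "0 < enn2real (T n k)" using Tf by (simp add: enn2real_positive_iff)
      have "enn2real (T n k) = enn2real A + enn2real (J n k)"
        unfolding TAJ using fin by (intro enn2real_plus) auto
      from complement[OF this T0] have "enn2real A = enn2real (T n k) * (1 - a n k)" unfolding a_def .
      then show ?thesis unfolding p0 p1 using e T0 by (simp add: enn2real_mult)
    qed
    have tele: "m \<le> Suc n \<Longrightarrow> enn2real (gibbs_mass n (S n m)) = enn2real (gibbs_mass n (S n 0)) * (\<Prod>k=1..m. 1 - a n k)" for m
    proof (induction m)
      case (Suc m)
      then show ?case using step[of "Suc m"] by simp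
    qed simp
    have pS: "gibbs_mass n (S n (Suc n)) = gibbs_mass n (\<lambda>_. f n)"
      unfolding gibbs_mass_def by (intro nn_integral_cong arg_cong[where f=ennreal] arg_cong[where f=exp] arg_cong2[where f="(-)"] sum.cong refl) (auto simp: S_def)
    have p0: "gibbs_mass n (S n 0) = gibbs_mass n (\<lambda>_ _. 0)"
      unfolding gibbs_mass_def by (intro nn_integral_cong arg_cong[where f=ennreal] arg_cong[where f=exp] arg_cong2[where f="(-)"] sum.cong refl) (auto simp: S_def)
    show ?case using tele[of "Suc n"] step[of 1] unfolding pS p0 by (simp add: p0)
  qed
  ultimately show ?thesis by (rule Lim_transform_eventually)
qed

end

section \<open>Existence of an equilibrium density\<close>

text \<open>\<open>ln t \<le> t - 1\<close> at the square root of m / a. It is the pointwise form of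
  the bound of the squared Hellinger distance by the relative entropy, and the source of the
  convexity of t ln t as well as of the identification of the minimiser.\<close>

lemma entropy_diff_ge:
  fixes a m :: real
  assumes "0 \<le> a" "0 < m"
  shows "a - m + (sqrt a - sqrt m)\<^sup>2 \<le> a * ln a - a * ln m"
proof (cases "a = 0")
  case False
  then have a: "0 < a" using assms by simp
  have "ln (sqrt (m / a)) \<le> sqrt (m / a) - 1" using a assms by (intro ln_le_minus_one) simp
  then have "ln m - ln a \<le> 2 * (sqrt (m / a) - 1)" using a assms by (simp add: ln_sqrt ln_div)
  then have "a * (ln m - ln a) \<le> a * (2 * (sqrt (m / a) - 1))" using a by (intro mult_left_mono) auto
  also have "\<dots> = 2 * (sqrt a * sqrt m) - 2 * a"
  proof -
    have "a * sqrt (m / a) = sqrt a * sqrt m"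
      using a real_sqrt_mult_self[of a] by (simp add: real_sqrt_divide field_simps)
    then show ?thesis by (simp add: algebra_simps)
  qed
  also have "\<dots> = - (a - m + (sqrt a - sqrt m)\<^sup>2)" using assms by (simp add: power2_diff)
  finally show ?thesis by (simp add: algebra_simps)
qed (use assms in simp)

lemma xlnx_ge: "0 \<le> a \<Longrightarrow> a - 1 \<le> a * ln a" for a :: real
proof -
  assume "0 \<le> a"
  then have "a - 1 + (sqrt a - 1)\<^sup>2 \<le> a * ln a" using entropy_diff_ge[of a 1] by simp
  moreover have "0 \<le> (sqrt a - 1)\<^sup>2" by simp
  ultimately show ?thesis by linarith
qed

lemma xlnx_convex:
  fixes a b' t :: real
  assumes "0 \<le> a" "0 \<le> b'" "0 \<le> t" "t \<le> 1"
  defines "m \<equiv> (1 - t) * a + t * b'"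
  shows "m * ln m \<le> (1 - t) * (a * ln a) + t * (b' * ln b')"
proof (cases "m = 0")
  case True
  then have "(1 - t) * a = 0" "t * b' = 0"
    using assms by (simp_all add: add_nonneg_eq_0_iff del: mult_eq_0_iff)
  then show ?thesis using True by auto
next
  case False
  then have m: "0 < m" using assms by (simp add: less_le)
  have "a - m \<le> a * ln a - a * ln m" using entropy_diff_ge[OF assms(1) m] zero_le_power2[of "sqrt a - sqrt m"] by linarith
  then have 1: "(1 - t) * (a - m) \<le> (1 - t) * (a * ln a - a * ln m)" using assms by (intro mult_left_mono) auto
  have "b' - m \<le> b' * ln b' - b' * ln m" using entropy_diff_ge[OF assms(2) m] zero_le_power2[of "sqrt b' - sqrt m"] by linarith
  then have 2: "t * (b' - m) \<le> t * (b' * ln b' - b' * ln m)" using assms by (intro mult_left_mono) auto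
  have "(1 - t) * (a - m) + t * (b' - m) = 0" by (simp add: m_def algebra_simps)
  moreover have "(1 - t) * (a * ln a - a * ln m) + t * (b' * ln b' - b' * ln m) = (1 - t) * (a * ln a) + t * (b' * ln b') - m * ln m"
    unfolding m_def by (simp add: algebra_simps)
  ultimately show ?thesis using 1 2 by linarith
qed

text \<open>\<open>entropy_diff_ge\<close> at both endpoints, relative to the midpoint, yields
  squared differences of square roots. Below the level \<open>e\<close> these control squared
  differences of the values themselves; \<open>e\<close> will be the envelope at each point.\<close>

lemma xlnx_uniformly_convex:
  fixes a c e :: real
  assumes "0 \<le> a" "0 \<le> c" "a \<le> e" "c \<le> e" "0 < e"
  defines "m \<equiv> (a + c) / 2"
  shows "(a - c)\<^sup>2 / (8 * e) \<le> a * ln a + c * ln c - 2 * (m * ln m)"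
proof (cases "m = 0")
  case True
  then show ?thesis using assms by (simp add: add_nonneg_eq_0_iff)
next
  case False
  then have m: "0 < m" using assms by (simp add: less_le)
  have me: "m \<le> e" using assms by simp
  have sq: "(x - m)\<^sup>2 \<le> 4 * e * (sqrt x - sqrt m)\<^sup>2" if "0 \<le> x" "x \<le> e" for x
  proof -
    have "x - m = (sqrt x - sqrt m) * (sqrt x + sqrt m)" using that m by (simp add: algebra_simps)
    then have "(x - m)\<^sup>2 = (sqrt x - sqrt m)\<^sup>2 * (sqrt x + sqrt m)\<^sup>2" by (simp add: power_mult_distrib)
    also have "\<dots> \<le> (sqrt x - sqrt m)\<^sup>2 * (2 * sqrt e)\<^sup>2"
    proof (intro mult_left_mono power_mono)
      have "sqrt x \<le> sqrt e" "sqrt m \<le> sqrt e" using that me by simp_all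
      then show "sqrt x + sqrt m \<le> 2 * sqrt e" by linarith
    qed (use that m in auto)
    also have "\<dots> = 4 * e * (sqrt x - sqrt m)\<^sup>2" using assms by (simp add: power_mult_distrib)
    finally show ?thesis .
  qed
  have "(a - c)\<^sup>2 * 2 = 4 * (a - m)\<^sup>2 + 4 * (c - m)\<^sup>2" by (simp add: m_def power2_eq_square field_simps)
  also have "\<dots> \<le> 16 * e * ((sqrt a - sqrt m)\<^sup>2 + (sqrt c - sqrt m)\<^sup>2)"
    using sq[of a] sq[of c] assms by (simp add: distrib_left)
  finally have le: "(a - c)\<^sup>2 * 2 \<le> 16 * e * ((sqrt a - sqrt m)\<^sup>2 + (sqrt c - sqrt m)\<^sup>2)" .
  have "(a - c)\<^sup>2 / (8 * e) \<le> (sqrt a - sqrt m)\<^sup>2 + (sqrt c - sqrt m)\<^sup>2"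
  proof -
    have "16 * e * ((sqrt a - sqrt m)\<^sup>2 + (sqrt c - sqrt m)\<^sup>2) = 2 * (((sqrt a - sqrt m)\<^sup>2 + (sqrt c - sqrt m)\<^sup>2) * (8 * e))"
      by simp
    then have "(a - c)\<^sup>2 \<le> ((sqrt a - sqrt m)\<^sup>2 + (sqrt c - sqrt m)\<^sup>2) * (8 * e)"
      using le by linarith
    then show ?thesis using assms(5) by (subst pos_divide_le_eq) auto
  qed
  also have "\<dots> \<le> (a * ln a - a * ln m) + (c * ln c - c * ln m)"
  proof -
    have "a + c = 2 * m" by (simp add: m_def)
    then show ?thesis using entropy_diff_ge[OF assms(1) m] entropy_diff_ge[OF assms(2) m] by linarith
  qed
  also have "\<dots> = a * ln a + c * ln c - 2 * (m * ln m)"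
  proof -
    have "a * ln m + c * ln m = 2 * (m * ln m)" by (simp add: m_def distrib_right[symmetric])
    then show ?thesis by linarith
  qed
  finally show ?thesis .
qed

lemma abs_xlnx_le:
  fixes a e :: real
  assumes "0 \<le> a" "a \<le> e"
  shows "\<bar>a * ln a\<bar> \<le> 1 + e\<^sup>2"
proof -
  have 1: "a - 1 \<le> a * ln a" using assms(1) by (rule xlnx_ge)
  have "a * ln a \<le> a * a"
  proof (cases "a = 0")
    case False
    then have "ln a \<le> a" using ln_le_minus_one[of a] assms by simp
    then show ?thesis using assms by (intro mult_left_mono)
  qed simp
  also have "\<dots> \<le> e\<^sup>2" unfolding power2_eq_square using assms by (intro mult_mono) auto
  finally show ?thesis using 1 assms zero_le_power2[of e] by linarith
qed

section \<open>The free energy and its minimiser\<close>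

locale mean_field = tame_measure M for M :: "'a::euclidean_space measure" +
  fixes \<gamma> :: real
  assumes \<gamma>_nonneg: "0 \<le> \<gamma>"
begin

text \<open>\<open>env\<close> dominates every value of the map \<open>f \<mapsto> exp (\<gamma> * field f) / Z\<close> whose fixed point is sought.\<close>

definition env_const :: real where
  "env_const = exp (\<gamma> * ((\<integral>u. log_weight u \<partial>M) + 2 * tame_const 0))"

definition env :: "'a \<Rightarrow> real" where "env x = env_const * (1 + norm x) powr \<gamma>"

text \<open>The bound by \<open>env\<close> supplies the majorants for dominated convergence. It
  does not spoil the Euler-Lagrange equation, because the only direction in which the minimiser is
  varied points to its image under the fixed-point map, and that image obeys the same bound.\<close>

definition densities :: "('a \<Rightarrow> real) set" where
  "densities = {f. f \<in> borel_measurable borel \<and> (\<forall>x. 0 \<le> f x \<and> f x \<le> env x) \<and> (\<integral>x. f x \<partial>M) = 1}"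

definition field :: "('a \<Rightarrow> real) \<Rightarrow> 'a \<Rightarrow> real" where
  "field f x = (\<integral>u. log_dist x u * f u \<partial>M)"

definition interaction :: "('a \<Rightarrow> real) \<Rightarrow> ('a \<Rightarrow> real) \<Rightarrow> real" where
  "interaction f g = (\<integral>x. f x * field g x \<partial>M)"

definition ent :: "('a \<Rightarrow> real) \<Rightarrow> real" where "ent f = (\<integral>x. f x * ln (f x) \<partial>M)"

text \<open>Relative entropy plus \<open>\<gamma> / 2\<close> times the energy of the kernel -log |x
  - u|; the minus sign is that of \<open>log_dist\<close>.\<close>

definition free_energy :: "('a \<Rightarrow> real) \<Rightarrow> real" where
  "free_energy f = ent f - \<gamma> / 2 * interaction f f"

lemma env_ge_1: "1 \<le> env_const" "1 \<le> env x"
proof -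
  have "0 \<le> (\<integral>u. log_weight u \<partial>M)" using log_weight_nonneg by (rule Bochner_Integration.integral_nonneg)
  then show 1: "1 \<le> env_const" using \<gamma>_nonneg tame_const(1)[of 0] by (simp add: env_const_def)
  have "1 \<le> (1 + norm x) powr \<gamma>" using \<gamma>_nonneg by (intro ge_one_powr_ge_zero) auto
  then show "1 \<le> env x" using 1 mult_mono[of 1 env_const 1 "(1 + norm x) powr \<gamma>"] by (simp add: env_def)
qed

lemma env_measurable[measurable]: "env \<in> borel_measurable borel"
  unfolding env_def[abs_def] by measurable

lemma integrable_env_powr:
  assumes "0 \<le> \<kappa>" shows "integrable M (\<lambda>x. env x * (1 + norm x) powr \<kappa>)"
  using integrable_powr[of "\<gamma> + \<kappa>"] \<gamma>_nonneg assms by (simp add: env_def powr_add mult.assoc)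

lemma integrable_env: "integrable M env"
  using integrable_powr[of \<gamma>] \<gamma>_nonneg by (simp add: env_def[abs_def])

lemma integrable_env_sq: "integrable M (\<lambda>x. 1 + (env x)\<^sup>2)"
proof -
  have "integrable M (\<lambda>x. 1 + env_const\<^sup>2 * (1 + norm x) powr (\<gamma> + \<gamma>))" using integrable_powr[of "\<gamma> + \<gamma>"] \<gamma>_nonneg by simp
  moreover have "1 + env_const\<^sup>2 * (1 + norm x) powr (\<gamma> + \<gamma>) = 1 + (env x)\<^sup>2" for x :: 'a
    unfolding powr_add by (simp add: env_def power2_eq_square)
  ultimately show ?thesis by simp
qed

lemma densitiesD:
  assumes "f \<in> densities"
  shows "f \<in> borel_measurable borel" "0 \<le> f x" "f x \<le> env x" "(\<integral>x. f x \<partial>M) = 1" "integrable M f"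
proof -
  show *: "f \<in> borel_measurable borel" "0 \<le> f x" "f x \<le> env x" "(\<integral>x. f x \<partial>M) = 1" for x using assms by (auto simp: densities_def)
  have [measurable]: "f \<in> borel_measurable borel" by fact
  show "integrable M f"
    by (rule Bochner_Integration.integrable_bound[OF integrable_env]) (use * in \<open>auto intro!: AE_I2 intro: order_trans[OF _ abs_ge_self]\<close>)
qed

definition field_const :: real where
  "field_const = 3 * env_const * tame_const (\<gamma> + 1)"

lemma field_const_nonneg: "0 \<le> field_const"
  using env_ge_1(1) tame_const(1)[of "\<gamma> + 1"] \<gamma>_nonneg by (simp add: field_const_def)

lemma log_dist_env_bound:
  "\<bar>log_dist x u\<bar> * env u \<le> (3 * env_const * (1 + log_weight x)) * ((1 + sing x u) * (1 + norm u) powr (\<gamma> + 1))"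
proof -
  have p1: "1 \<le> (1 + norm u)" by simp
  have "\<bar>log_dist x u\<bar> \<le> log_weight x + log_weight u + 2 * sing x u" by (rule abs_log_dist_le)
  also have "\<dots> \<le> 3 * (1 + log_weight x) * ((1 + sing x u) * (1 + norm u))"
  proof -
    have "log_weight x + log_weight u + 2 * sing x u \<le> 3 * ((1 + log_weight x) * (1 + norm u + sing x u))"
    proof -
      have "(1 + log_weight x) * (1 + norm u + sing x u) = 1 + norm u + sing x u + log_weight x * (1 + norm u + sing x u)" by (simp add: algebra_simps)
      moreover have "log_weight x * 1 \<le> log_weight x * (1 + norm u + sing x u)"
        using log_weight_nonneg[of x] sing_nonneg[of x u] by (intro mult_left_mono) auto
      ultimately show ?thesis using log_weight_le[of u] sing_nonneg[of x u] log_weight_nonneg[of x] norm_ge_zero[of u] by linarith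
    qed
    also have "\<dots> \<le> 3 * ((1 + log_weight x) * ((1 + sing x u) * (1 + norm u)))"
    proof -
      have "1 + norm u + sing x u \<le> (1 + sing x u) * (1 + norm u)"
        using mult_nonneg_nonneg[OF sing_nonneg[of x u] norm_ge_zero[of u]] by (simp add: algebra_simps)
      then show ?thesis using log_weight_nonneg[of x] by (intro mult_left_mono) auto
    qed
    finally show ?thesis by (simp only: mult.assoc)
  qed
  finally have "\<bar>log_dist x u\<bar> * env u \<le> 3 * (1 + log_weight x) * ((1 + sing x u) * (1 + norm u)) * env u"
    using env_ge_1(2)[of u] by (intro mult_right_mono) auto
  also have "\<dots> = (3 * env_const * (1 + log_weight x)) * ((1 + sing x u) * (1 + norm u) powr (\<gamma> + 1))"
    by (simp add: env_def powr_add mult_ac)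
  finally show ?thesis .
qed

lemma integrable_log_dist_env: "integrable M (\<lambda>u. \<bar>log_dist x u\<bar> * env u)" "(\<integral>u. \<bar>log_dist x u\<bar> * env u \<partial>M) \<le> field_const * (1 + log_weight x)"
proof -
  have m: "(\<lambda>u. \<bar>log_dist x u\<bar> * env u) \<in> borel_measurable borel" by measurable
  have b: "\<bar>\<bar>log_dist x u\<bar> * env u\<bar> \<le> (3 * env_const * (1 + log_weight x)) * ((1 + sing x u) * (1 + norm u) powr (\<gamma> + 1))" for u
    using log_dist_env_bound[of x u] env_ge_1(2)[of u] by (simp add: abs_mult)
  have "0 \<le> \<gamma> + 1" using \<gamma>_nonneg by simp
  from tame_integrable[OF this m b]
  show "integrable M (\<lambda>u. \<bar>log_dist x u\<bar> * env u)" "(\<integral>u. \<bar>log_dist x u\<bar> * env u \<partial>M) \<le> field_const * (1 + log_weight x)"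
    by (auto simp: field_const_def mult_ac)
qed

lemma integrable_field:
  assumes "f \<in> densities"
  shows "integrable M (\<lambda>u. log_dist x u * f u)"
proof (rule Bochner_Integration.integrable_bound[OF integrable_log_dist_env(1)[of x]])
  have [measurable]: "f \<in> borel_measurable borel" using densitiesD assms by blast
  show "(\<lambda>u. log_dist x u * f u) \<in> borel_measurable M" by measurable
  show "AE u in M. norm (log_dist x u * f u) \<le> norm (\<bar>log_dist x u\<bar> * env u)"
    using densitiesD(2,3)[OF assms] env_ge_1(2) by (intro AE_I2) (simp add: abs_mult, intro mult_left_mono, auto intro: order_trans[OF _ abs_ge_self])
qed

lemma abs_field_le:
  assumes "f \<in> densities"
  shows "\<bar>field f x\<bar> \<le> field_const * (1 + log_weight x)"
proof -
  have "\<bar>field f x\<bar> \<le> (\<integral>u. \<bar>log_dist x u * f u\<bar> \<partial>M)" unfolding field_def using integral_norm_bound[of M "\<lambda>u. log_dist x u * f u"] by simp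
  also have "\<dots> \<le> (\<integral>u. \<bar>log_dist x u\<bar> * env u \<partial>M)"
  proof (rule integral_mono)
    show "integrable M (\<lambda>u. \<bar>log_dist x u * f u\<bar>)" using integrable_field[OF assms] by (rule integrable_abs)
    show "\<bar>log_dist x u * f u\<bar> \<le> \<bar>log_dist x u\<bar> * env u" for u
      using densitiesD(2,3)[OF assms, of u] by (simp add: abs_mult mult_left_mono)
  qed (rule integrable_log_dist_env(1))
  also note integrable_log_dist_env(2)
  finally show ?thesis .
qed

lemma field_measurable[measurable]:
  assumes "f \<in> borel_measurable borel" shows "field f \<in> borel_measurable borel"
proof -
  note [measurable] = assms
  show ?thesis unfolding field_def[abs_def] by measurable
qed

lemma integrable_env_log: "integrable M (\<lambda>x. env x * (field_const * (1 + log_weight x)))"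
proof (rule Bochner_Integration.integrable_bound)
  show "integrable M (\<lambda>x. field_const * (env x * (1 + norm x) powr 1))" using integrable_env_powr[of 1] by simp
  show "AE x in M. norm (env x * (field_const * (1 + log_weight x))) \<le> norm (field_const * (env x * (1 + norm x) powr 1))"
  proof (rule AE_I2)
    fix x
    have "field_const * (env x * (1 + log_weight x)) \<le> field_const * (env x * (1 + norm x))"
      using field_const_nonneg env_ge_1(2)[of x] log_weight_le[of x] by (intro mult_left_mono) auto
    moreover have "0 \<le> env x * (field_const * (1 + log_weight x))" using field_const_nonneg env_ge_1(2)[of x] log_weight_nonneg[of x] by simp
    ultimately show "norm (env x * (field_const * (1 + log_weight x))) \<le> norm (field_const * (env x * (1 + norm x) powr 1))" by (simp add: mult_ac)
  qed
qed measurable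

lemma abs_mult_field_le:
  assumes "f \<in> densities" "g \<in> densities"
  shows "\<bar>f x * field g x\<bar> \<le> env x * (field_const * (1 + log_weight x))"
  unfolding abs_mult using densitiesD(2,3)[OF assms(1)] abs_field_le[OF assms(2)] env_ge_1(2)[of x]
  by (intro mult_mono) auto

lemma integrable_interaction:
  assumes "f \<in> densities" "g \<in> densities"
  shows "integrable M (\<lambda>x. f x * field g x)"
proof (rule Bochner_Integration.integrable_bound[OF integrable_env_log])
  note [measurable] = densitiesD(1)[OF assms(1)] densitiesD(1)[OF assms(2)]
  show "(\<lambda>x. f x * field g x) \<in> borel_measurable M" by measurable
qed (use abs_mult_field_le[OF assms] in \<open>auto intro!: AE_I2 intro: order_trans[OF _ abs_ge_self]\<close>)

lemma interaction_commute:
  assumes "f \<in> densities" "g \<in> densities"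
  shows "interaction f g = interaction g f"
proof -
  interpret MM: pair_prob_space M M ..
  note [measurable] = densitiesD(1)[OF assms(1)] densitiesD(1)[OF assms(2)]
  have "integrable (M \<Otimes>\<^sub>M M) (\<lambda>(x, u). f x * (log_dist x u * g u))"
  proof (rule MM.Fubini_integrable)
    show "integrable M (\<lambda>x. \<integral>u. norm (case (x, u) of (x, u) \<Rightarrow> f x * (log_dist x u * g u)) \<partial>M)"
    proof (rule Bochner_Integration.integrable_bound[OF integrable_env_log])
      show "AE x in M. norm (\<integral>u. norm (case (x, u) of (x, u) \<Rightarrow> f x * (log_dist x u * g u)) \<partial>M) \<le> norm (env x * (field_const * (1 + log_weight x)))"
      proof (rule AE_I2)
        fix x
        have i: "integrable M (\<lambda>u. \<bar>log_dist x u * g u\<bar>)" using integrable_field[OF assms(2)] by simp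
        have "(\<integral>u. \<bar>log_dist x u * g u\<bar> \<partial>M) \<le> (\<integral>u. \<bar>log_dist x u\<bar> * env u \<partial>M)"
        proof (rule integral_mono[OF i integrable_log_dist_env(1)])
          show "\<bar>log_dist x u * g u\<bar> \<le> \<bar>log_dist x u\<bar> * env u" for u
            using densitiesD(2,3)[OF assms(2), of u] by (simp add: abs_mult mult_left_mono)
        qed
        also note integrable_log_dist_env(2)
        finally have "f x * (\<integral>u. \<bar>log_dist x u * g u\<bar> \<partial>M) \<le> env x * (field_const * (1 + log_weight x))"
          using densitiesD(2,3)[OF assms(1), of x] env_ge_1(2)[of x] by (intro mult_mono) (auto intro!: Bochner_Integration.integral_nonneg)
        moreover have "(\<integral>u. norm (case (x, u) of (x, u) \<Rightarrow> f x * (log_dist x u * g u)) \<partial>M) = f x * (\<integral>u. \<bar>log_dist x u * g u\<bar> \<partial>M)"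
          using densitiesD(2)[OF assms(1), of x] by (simp add: abs_mult)
        moreover have "0 \<le> f x * (\<integral>u. \<bar>log_dist x u * g u\<bar> \<partial>M)"
          using densitiesD(2)[OF assms(1), of x] by (auto intro!: mult_nonneg_nonneg Bochner_Integration.integral_nonneg)
        ultimately show "norm (\<integral>u. norm (case (x, u) of (x, u) \<Rightarrow> f x * (log_dist x u * g u)) \<partial>M) \<le> norm (env x * (field_const * (1 + log_weight x)))"
          by simp
      qed
    qed measurable
    show "AE x in M. integrable M (\<lambda>u. case (x, u) of (x, u) \<Rightarrow> f x * (log_dist x u * g u))"
      using integrable_field[OF assms(2)] by simp
  qed measurable
  from MM.Fubini_integral[OF this]
  have "(\<integral>y. (\<integral>x. f x * (log_dist x y * g y) \<partial>M) \<partial>M) = (\<integral>x. (\<integral>y. f x * (log_dist x y * g y) \<partial>M) \<partial>M)" .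
  moreover have "(\<lambda>y. \<integral>x. f x * (log_dist x y * g y) \<partial>M) = (\<lambda>y. \<integral>x. g y * (log_dist y x * f x) \<partial>M)"
    by (intro ext Bochner_Integration.integral_cong) (simp_all add: log_dist_commute)
  ultimately have "(\<integral>y. (\<integral>x. g y * (log_dist y x * f x) \<partial>M) \<partial>M) = (\<integral>x. (\<integral>y. f x * (log_dist x y * g y) \<partial>M) \<partial>M)" by simp
  then show ?thesis unfolding interaction_def field_def by simp
qed

lemma one_density: "(\<lambda>_. 1) \<in> densities"
  using env_ge_1(2) by (simp add: densities_def)

lemma density_integral:
  assumes "f \<in> densities" and [measurable]: "h \<in> borel_measurable borel"
  shows "(\<integral>x. h x \<partial>density M (\<lambda>u. ennreal (f u))) = (\<integral>x. f x * h x \<partial>M)"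
proof -
  note [measurable] = densitiesD(1)[OF assms(1)]
  show ?thesis using densitiesD(2)[OF assms(1)] by (subst integral_density) auto
qed

lemma tame_densities:
  assumes "f \<in> densities"
  shows "tame_measure (density M (\<lambda>u. ennreal (f u)))"
  using densitiesD[OF assms] \<gamma>_nonneg by (intro tame_density[where C=env_const and \<kappa>=\<gamma>]) (auto simp: env_def)

text \<open>Conditional negative definiteness for the measures with densities \<open>f\<close> and
  \<open>g\<close>. Along segments in \<open>densities\<close> the interaction is therefore concave,
  and its contribution to the free energy convex.\<close>

lemma interaction_cond_neg:
  assumes "f \<in> densities" "g \<in> densities"
  shows "interaction f f + interaction g g \<le> 2 * interaction f g"
proof -
  note [measurable] = densitiesD(1)[OF assms(1)] densitiesD(1)[OF assms(2)]
  have inner: "(\<integral>y. log_dist x y \<partial>density M (\<lambda>u. ennreal (g u))) = field g x" if "g \<in> densities" for g x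
    using density_integral[OF that, of "log_dist x"] by (simp add: field_def mult.commute)
  show ?thesis
    using log_dist_cond_neg_def[OF tame_densities[OF assms(1)] tame_densities[OF assms(2)]]
    unfolding inner[OF assms(1)] inner[OF assms(2)] interaction_def
    using density_integral[OF assms(1), of "field f"] density_integral[OF assms(2), of "field g"] density_integral[OF assms(1), of "field g"]
    by simp
qed

lemma densities_convex:
  assumes f: "f \<in> densities" and g: "g \<in> densities" and t: "0 \<le> t" "t \<le> 1"
  shows "(\<lambda>x. (1 - t) * f x + t * g x) \<in> densities"
proof -
  note [measurable] = densitiesD(1)[OF f] densitiesD(1)[OF g]
  have "(1 - t) * f x + t * g x \<le> env x" for x
  proof -
    have "(1 - t) * f x + t * g x \<le> (1 - t) * env x + t * env x"
      using densitiesD(3)[OF f] densitiesD(3)[OF g] t by (intro add_mono mult_left_mono) auto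
    then show ?thesis by (simp add: algebra_simps)
  qed
  moreover have "(\<integral>x. (1 - t) * f x + t * g x \<partial>M) = 1"
    using densitiesD(4,5)[OF f] densitiesD(4,5)[OF g] by simp
  ultimately show ?thesis using densitiesD(2)[OF f] densitiesD(2)[OF g] t unfolding densities_def by auto
qed

lemma interaction_mix:
  assumes f: "f \<in> densities" and g: "g \<in> densities" and t: "0 \<le> t" "t \<le> 1"
  defines "h \<equiv> \<lambda>x. (1 - t) * f x + t * g x"
  shows "interaction h h = (1 - t)\<^sup>2 * interaction f f + 2 * t * (1 - t) * interaction f g + t\<^sup>2 * interaction g g"
proof -
  have fld: "field h x = (1 - t) * field f x + t * field g x" for x
  proof -
    have "field h x = (\<integral>u. (1 - t) * (log_dist x u * f u) + t * (log_dist x u * g u) \<partial>M)"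
      unfolding field_def h_def by (intro Bochner_Integration.integral_cong) (auto simp: algebra_simps)
    then show ?thesis using integrable_field[OF f] integrable_field[OF g] by (simp add: field_def)
  qed
  have "interaction h h = (\<integral>x. ((1 - t) * (1 - t)) * (f x * field f x) + ((1 - t) * t) * (f x * field g x)
     + (t * (1 - t)) * (g x * field f x) + (t * t) * (g x * field g x) \<partial>M)"
    unfolding interaction_def fld unfolding h_def by (intro Bochner_Integration.integral_cong) (auto simp: algebra_simps)
  also have "\<dots> = ((1 - t) * (1 - t)) * interaction f f + ((1 - t) * t) * interaction f g
     + (t * (1 - t)) * interaction g f + (t * t) * interaction g g"
    unfolding interaction_def using integrable_interaction[OF f f] integrable_interaction[OF f g] integrable_interaction[OF g f] integrable_interaction[OF g g] by simp
  finally show ?thesis unfolding interaction_commute[OF g f] power2_eq_square by (simp add: algebra_simps)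
qed

lemma integrable_entropy:
  assumes "f \<in> densities" shows "integrable M (\<lambda>x. f x * ln (f x))"
proof (rule Bochner_Integration.integrable_bound[OF integrable_env_sq])
  note [measurable] = densitiesD(1)[OF assms(1)]
  show "(\<lambda>x. f x * ln (f x)) \<in> borel_measurable M" by measurable
qed (use abs_xlnx_le densitiesD(2,3)[OF assms] in \<open>auto intro!: AE_I2 intro: order_trans[OF _ abs_ge_self]\<close>)

lemma free_energy_ge: "f \<in> densities \<Longrightarrow> - \<gamma> / 2 * (\<integral>x. env x * (field_const * (1 + log_weight x)) \<partial>M) \<le> free_energy f"
proof -
  assume f: "f \<in> densities"
  have "(\<integral>x. f x - 1 \<partial>M) \<le> ent f"
    unfolding ent_def
  proof (rule integral_mono)
    fix x show "f x - 1 \<le> f x * ln (f x)"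
      using densitiesD(2)[OF f] by (rule xlnx_ge)
  qed (use integrable_entropy[OF f] densitiesD(5)[OF f] in auto)
  then have e: "0 \<le> ent f" using densitiesD(4,5)[OF f] by simp
  have "interaction f f \<le> (\<integral>x. env x * (field_const * (1 + log_weight x)) \<partial>M)"
    unfolding interaction_def using integrable_interaction[OF f f] integrable_env_log abs_mult_field_le[OF f f]
    by (intro integral_mono) (auto simp: abs_le_iff)
  then have "\<gamma> / 2 * interaction f f \<le> \<gamma> / 2 * (\<integral>x. env x * (field_const * (1 + log_weight x)) \<partial>M)"
    using \<gamma>_nonneg by (intro mult_left_mono) auto
  then show ?thesis using e unfolding free_energy_def by simp
qed

text \<open>Strong convexity of the entropy, combined with concavity of the interaction term,
  makes every minimising sequence Cauchy.\<close>

lemma free_energy_midpoint: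
  assumes f: "f \<in> densities" and g: "g \<in> densities"
  defines "h \<equiv> \<lambda>x. (1 - 1/2) * f x + 1/2 * g x"
  shows "integrable M (\<lambda>x. (f x - g x)\<^sup>2 / (8 * env x))"
    "(\<integral>x. (f x - g x)\<^sup>2 / (8 * env x) \<partial>M) \<le> free_energy f + free_energy g - 2 * free_energy h"
proof -
  have h: "h \<in> densities" unfolding h_def by (rule densities_convex[OF f g]) auto
  note [measurable] = densitiesD(1)[OF f] densitiesD(1)[OF g]
  have pw: "(f x - g x)\<^sup>2 / (8 * env x) \<le> f x * ln (f x) + g x * ln (g x) - 2 * (h x * ln (h x))" for x
    using xlnx_uniformly_convex[of "f x" "g x" "env x"] densitiesD(2,3)[OF f, of x] densitiesD(2,3)[OF g, of x] env_ge_1(2)[of x]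
    by (simp add: h_def add_divide_distrib)
  have i: "integrable M (\<lambda>x. f x * ln (f x) + g x * ln (g x) - 2 * (h x * ln (h x)))"
    using integrable_entropy[OF f] integrable_entropy[OF g] integrable_entropy[OF h] by simp
  have pos: "0 \<le> (f x - g x)\<^sup>2 / (8 * env x)" for x using env_ge_1(2)[of x] by simp
  show j: "integrable M (\<lambda>x. (f x - g x)\<^sup>2 / (8 * env x))"
  proof (rule Bochner_Integration.integrable_bound[OF i])
    show "AE x in M. norm ((f x - g x)\<^sup>2 / (8 * env x)) \<le> norm (f x * ln (f x) + g x * ln (g x) - 2 * (h x * ln (h x)))"
    proof (rule AE_I2)
      fix x show "norm ((f x - g x)\<^sup>2 / (8 * env x)) \<le> norm (f x * ln (f x) + g x * ln (g x) - 2 * (h x * ln (h x)))"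
        using pw[of x] pos[of x] unfolding real_norm_def by linarith
    qed
  qed measurable
  have "(\<integral>x. (f x - g x)\<^sup>2 / (8 * env x) \<partial>M) \<le> (\<integral>x. f x * ln (f x) + g x * ln (g x) - 2 * (h x * ln (h x)) \<partial>M)"
    using i j pw by (intro integral_mono) auto
  also have "\<dots> = ent f + ent g - 2 * ent h"
    unfolding ent_def using integrable_entropy[OF f] integrable_entropy[OF g] integrable_entropy[OF h] by simp
  finally have 1: "(\<integral>x. (f x - g x)\<^sup>2 / (8 * env x) \<partial>M) \<le> ent f + ent g - 2 * ent h" .
  have "interaction h h = (1/2)\<^sup>2 * interaction f f + 2 * (1/2) * (1/2) * interaction f g + (1/2)\<^sup>2 * interaction g g"
    unfolding h_def using interaction_mix[OF f g, of "1/2"] by simp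
  then have "interaction f f + interaction g g \<le> 2 * interaction h h"
    using interaction_cond_neg[OF f g] by (simp add: power2_eq_square)
  then have "\<gamma> / 2 * (interaction f f + interaction g g) \<le> \<gamma> / 2 * (2 * interaction h h)"
    using \<gamma>_nonneg by (intro mult_left_mono) auto
  then show "(\<integral>x. (f x - g x)\<^sup>2 / (8 * env x) \<partial>M) \<le> free_energy f + free_energy g - 2 * free_energy h"
    using 1 unfolding free_energy_def by (simp add: algebra_simps)
qed


text \<open>Dominated convergence throughout, with majorants built from \<open>env\<close>. Almost
  everywhere convergence under a fixed envelope gives genuine continuity of the free energy, entropy
  included.\<close>

lemma free_energy_tendsto:
  assumes f: "\<And>k. f k \<in> densities" and [measurable]: "g \<in> borel_measurable borel"
    and g: "\<And>x. 0 \<le> g x \<and> g x \<le> env x" and lim: "AE x in M. (\<lambda>k. f k x) \<longlonglongrightarrow> g x"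
  shows "g \<in> densities" "(\<lambda>k. free_energy (f k)) \<longlonglongrightarrow> free_energy g"
proof -
  have [measurable]: "f k \<in> borel_measurable borel" for k using densitiesD(1)[OF f] .
  have "(\<lambda>k. \<integral>x. f k x \<partial>M) \<longlonglongrightarrow> (\<integral>x. g x \<partial>M)"
    by (rule integral_dominated_convergence[OF _ _ integrable_env lim]) (use densitiesD(2,3)[OF f] in auto)
  then have "(\<integral>x. g x \<partial>M) = 1" unfolding densitiesD(4)[OF f] by (simp add: LIMSEQ_const_iff)
  then show gd: "g \<in> densities" using g by (simp add: densities_def)
  have fld: "(\<lambda>k. field (f k) x) \<longlonglongrightarrow> field g x" for x
    unfolding field_def
  proof (rule integral_dominated_convergence[OF _ _ integrable_log_dist_env(1)[of x]])
    show "AE u in M. (\<lambda>k. log_dist x u * f k u) \<longlonglongrightarrow> log_dist x u * g u"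
      using lim by eventually_elim (intro tendsto_intros)
    show "AE u in M. norm (log_dist x u * f k u) \<le> \<bar>log_dist x u\<bar> * env u" for k
      using densitiesD(2,3)[OF f] by (intro AE_I2) (auto simp: abs_mult intro!: mult_left_mono)
  qed measurable
  have inter: "(\<lambda>k. interaction (f k) (f k)) \<longlonglongrightarrow> interaction g g"
    unfolding interaction_def
  proof (rule integral_dominated_convergence[OF _ _ integrable_env_log])
    show "AE x in M. (\<lambda>k. f k x * field (f k) x) \<longlonglongrightarrow> g x * field g x"
      using lim by eventually_elim (intro tendsto_intros fld)
    show "AE x in M. norm (f k x * field (f k) x) \<le> env x * (field_const * (1 + log_weight x))" for k
      using abs_mult_field_le[OF f f] by simp
  qed measurable
  have xlnx: "isCont (\<lambda>t. t * ln t) a" if "0 < a" for a :: real using that by (intro continuous_intros) auto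
  \<comment> \<open>Continuity of t ln t on the closed half-line; at 0 it follows from the bound 2
    sqrt t + t^2.\<close>
  have xlnx0: "((\<lambda>k. a k * ln (a k)) \<longlonglongrightarrow> b * ln b)" if a: "\<And>k. 0 \<le> a k" and "a \<longlonglongrightarrow> b" for a and b :: real
  proof (cases "b = 0")
    case False
    then have "0 < b" using LIMSEQ_le_const[OF that(2), of 0] a by force
    then show ?thesis using isCont_tendsto_compose[OF xlnx that(2)] by simp
  next
    case True
    have bd: "\<bar>a k * ln (a k)\<bar> \<le> 2 * sqrt (a k) + (a k)\<^sup>2" for k
    proof (cases "a k = 0")
      case False
      then have p: "0 < a k" using a[of k] by simp
      have "ln (1 / sqrt (a k)) \<le> 1 / sqrt (a k) - 1" using p by (intro ln_le_minus_one) simp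
      then have "- ln (a k) \<le> 2 * (1 / sqrt (a k))" using p by (simp add: ln_div ln_sqrt)
      then have "a k * (- ln (a k)) \<le> a k * (2 * (1 / sqrt (a k)))" using p by (intro mult_left_mono) auto
      also have "\<dots> = 2 * (a k / sqrt (a k))" by simp
      also have "a k / sqrt (a k) = sqrt (a k)" using p by (simp add: real_div_sqrt)
      finally have 1: "- (a k * ln (a k)) \<le> 2 * sqrt (a k)" by simp
      have "a k * ln (a k) \<le> a k * a k" using p ln_le_minus_one[OF p] by (intro mult_left_mono) auto
      then show ?thesis using 1 p real_sqrt_ge_zero[of "a k"] zero_le_power2[of "a k"] unfolding power2_eq_square abs_le_iff
        by (smt (verit) zero_le_square)
    qed simp
    have "(\<lambda>k. 2 * sqrt (a k) + (a k)\<^sup>2) \<longlonglongrightarrow> 2 * sqrt b + b\<^sup>2" using that(2) by (intro tendsto_intros)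
    then have "(\<lambda>k. 2 * sqrt (a k) + (a k)\<^sup>2) \<longlonglongrightarrow> 0" using True by simp
    then have "(\<lambda>k. a k * ln (a k)) \<longlonglongrightarrow> 0"
      by (rule Lim_null_comparison[rotated]) (simp add: bd)
    then show ?thesis using True by simp
  qed
  have "(\<lambda>k. ent (f k)) \<longlonglongrightarrow> ent g"
    unfolding ent_def
  proof (rule integral_dominated_convergence[OF _ _ integrable_env_sq])
    show "AE x in M. (\<lambda>k. f k x * ln (f k x)) \<longlonglongrightarrow> g x * ln (g x)"
      using lim by eventually_elim (intro xlnx0 densitiesD(2)[OF f])
    show "AE x in M. norm (f k x * ln (f k x)) \<le> 1 + (env x)\<^sup>2" for k
      using abs_xlnx_le densitiesD(2,3)[OF f] by (intro AE_I2) auto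
  qed measurable
  then show "(\<lambda>k. free_energy (f k)) \<longlonglongrightarrow> free_energy g"
    unfolding free_energy_def using inter by (intro tendsto_intros)
qed

text \<open>For a minimising sequence the midpoint inequality controls the squared differences
  divided by \<open>env\<close>. Since \<open>env\<close> is integrable this gives an L1 Cauchy
  sequence, and a subsequence converges almost everywhere, as \<open>free_energy_tendsto\<close>
  requires.\<close>

lemma minimizer_exists:
  obtains f where "f \<in> densities" "\<And>g. g \<in> densities \<Longrightarrow> free_energy f \<le> free_energy g"
proof -
  define m where "m = Inf (free_energy ` densities)"
  have bdd: "bdd_below (free_energy ` densities)" using free_energy_ge by (auto intro!: bdd_belowI)
  have m_le: "m \<le> free_energy g" if "g \<in> densities" for g
    unfolding m_def using bdd that by (intro cInf_lower) auto
  have "\<exists>f\<in>densities. free_energy f < m + 1 / real (Suc k)" for k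
  proof -
    have "\<exists>y\<in>free_energy ` densities. y < m + 1 / real (Suc k)"
      unfolding m_def using one_density bdd by (intro cInf_lessD) (auto simp: m_def[symmetric])
    then show ?thesis by auto
  qed
  then obtain F where F: "\<And>k. F k \<in> densities" "\<And>k. free_energy (F k) < m + 1 / real (Suc k)" by metis
  have Fm[measurable]: "F k \<in> borel_measurable borel" for k using densitiesD(1)[OF F(1)] .
  have iF: "integrable M (F k)" for k using densitiesD(5)[OF F(1)] .
  have L1: "\<exists>N. \<forall>i\<ge>N. \<forall>j\<ge>N. (\<integral>x. norm (F i x - F j x) \<partial>M) < e" if e: "0 < e" for e
  proof -
    define A where "A = (\<integral>x. env x \<partial>M)"
    have A: "0 \<le> A" unfolding A_def using env_ge_1(2) by (intro Bochner_Integration.integral_nonneg) (auto intro: order_trans[OF zero_le_one])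
    \<comment> \<open>The parameter in d \<le> d^2 / (4 c) + c, used with c equal to 2 eta times
      \<open>env\<close>; the second term then integrates to at most e / 4.\<close>
    define \<eta> where "\<eta> = e / (8 * (1 + A))"
    have \<eta>: "0 < \<eta>" using e A by (simp add: \<eta>_def)
    have \<eta>A: "2 * \<eta> * A \<le> e / 4"
    proof -
      have "2 * \<eta> * A \<le> 2 * \<eta> * (1 + A)" using \<eta> by simp
      also have "\<dots> = e / 4" using A by (simp add: \<eta>_def field_simps)
      finally show ?thesis .
    qed
    obtain N where N: "1 / real (Suc N) < e * \<eta> / 4" using nat_approx_posE[of "e * \<eta> / 4"] e \<eta> by auto
    have "(\<integral>x. norm (F i x - F j x) \<partial>M) < e" if ij: "N \<le> i" "N \<le> j" for i j
    proof -
      let ?h = "\<lambda>x. (1 - 1/2) * F i x + 1/2 * F j x"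
      have h: "?h \<in> densities" using densities_convex[OF F(1)[of i] F(1)[of j], of "1/2"] by simp
      note mid = free_energy_midpoint[OF F(1)[of i] F(1)[of j]]
      have r: "1 / real (Suc i) \<le> 1 / real (Suc N)" "1 / real (Suc j) \<le> 1 / real (Suc N)"
        using ij by (intro divide_left_mono; simp)+
      \<comment> \<open>The midpoint has free energy at least \<open>m\<close>, so the midpoint
        inequality leaves only the two excesses over \<open>m\<close>, each below 1 / (N +
        1).\<close>
      have D: "(\<integral>x. (F i x - F j x)\<^sup>2 / (8 * env x) \<partial>M) \<le> e * \<eta> / 2"
        using mid(2) F(2)[of i] F(2)[of j] m_le[OF h] r N by linarith
      have "(\<integral>x. norm (F i x - F j x) \<partial>M) \<le> (\<integral>x. (1 / \<eta>) * ((F i x - F j x)\<^sup>2 / (8 * env x)) + (2 * \<eta>) * env x \<partial>M)"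
      proof (rule integral_mono)
        fix x
        define d c where "d = \<bar>F i x - F j x\<bar>" and "c = 2 * \<eta> * env x"
        have c: "0 < c" using \<eta> env_ge_1(2)[of x] by (simp add: c_def)
        have "4 * (d * c) \<le> d\<^sup>2 + 4 * c\<^sup>2" using sum_squares_bound[of d "2 * c"] by (simp add: power2_eq_square)
        then have "d \<le> (d\<^sup>2 + 4 * c\<^sup>2) / (4 * c)" using c by (simp add: pos_le_divide_eq mult_ac)
        also have "\<dots> = d\<^sup>2 / (4 * c) + c" using c by (simp add: add_divide_distrib power2_eq_square)
        finally show "norm (F i x - F j x) \<le> (1 / \<eta>) * ((F i x - F j x)\<^sup>2 / (8 * env x)) + (2 * \<eta>) * env x"
          by (simp add: d_def c_def mult_ac)
      next
        show "integrable M (\<lambda>x. norm (F i x - F j x))" using iF[of i] iF[of j] by simp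
        show "integrable M (\<lambda>x. (1 / \<eta>) * ((F i x - F j x)\<^sup>2 / (8 * env x)) + (2 * \<eta>) * env x)"
          by (intro Bochner_Integration.integrable_add integrable_mult_right mid(1) integrable_env)
      qed
      also have "\<dots> = (1 / \<eta>) * (\<integral>x. (F i x - F j x)\<^sup>2 / (8 * env x) \<partial>M) + (2 * \<eta>) * A"
        unfolding A_def
        by (subst Bochner_Integration.integral_add) (intro integrable_mult_right mid(1) integrable_env | simp only: integral_mult_right_zero)+
      also have "(1 / \<eta>) * (\<integral>x. (F i x - F j x)\<^sup>2 / (8 * env x) \<partial>M) \<le> (1 / \<eta>) * (e * \<eta> / 2)"
        using D \<eta> by (intro mult_left_mono) auto
      also have "(1 / \<eta>) * (e * \<eta> / 2) = e / 2" using \<eta> by simp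
      finally show ?thesis using \<eta>A e by linarith
    qed
    then show ?thesis by blast
  qed
  obtain r where r: "strict_mono r" "AE x in M. Cauchy (\<lambda>i. F (r i) x)"
    by (rule cauchy_L1_AE_cauchy_subseq[OF iF L1])
  \<comment> \<open>Clamping keeps \<open>g\<close> within the bounds also where the subsequence
    does not converge and \<open>lim\<close> is unspecified.\<close>
  define g where "g x = max 0 (min (env x) (lim (\<lambda>i. F (r i) x)))" for x
  have [measurable]: "g \<in> borel_measurable borel" unfolding g_def by measurable
  have gb: "0 \<le> g x \<and> g x \<le> env x" for x
    using env_ge_1(2)[of x] by (auto simp: g_def)
  have gl: "AE x in M. (\<lambda>k. F (r k) x) \<longlonglongrightarrow> g x"
    using r(2)
  proof eventually_elim
    case (elim x)
    then have l: "(\<lambda>k. F (r k) x) \<longlonglongrightarrow> lim (\<lambda>i. F (r i) x)" by (simp add: Cauchy_convergent_iff convergent_LIMSEQ_iff)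
    have "0 \<le> lim (\<lambda>i. F (r i) x)" using densitiesD(2)[OF F(1)] by (intro LIMSEQ_le_const[OF l]) auto
    moreover have "lim (\<lambda>i. F (r i) x) \<le> env x" using densitiesD(3)[OF F(1)] by (intro LIMSEQ_le_const2[OF l]) auto
    ultimately show ?case using l by (simp add: g_def)
  qed
  note conv = free_energy_tendsto[of "\<lambda>k. F (r k)" g, OF F(1) _ gb gl]
  have "(\<lambda>k. m + 1 / real (Suc (r k))) \<longlonglongrightarrow> m + 0"
    using LIMSEQ_subseq_LIMSEQ[OF LIMSEQ_Suc[OF lim_1_over_n] r(1)] by (intro tendsto_intros) (simp add: o_def)
  then have "free_energy g \<le> m"
    using conv(2) F(2) by (intro LIMSEQ_le[OF conv(2)]) (auto intro: less_imp_le)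
  then show ?thesis using conv(1) m_le that[of g] by fastforce
qed

section \<open>The fixed-point equation\<close>

definition gibbs_norm :: "('a \<Rightarrow> real) \<Rightarrow> real" where
  "gibbs_norm f = (\<integral>x. exp (\<gamma> * field f x) \<partial>M)"

text \<open>The constant \<open>w\<close> cancels in the quotient by \<open>gibbs_norm\<close>. Once
  it is subtracted, the upper bound has no constant, and the lower bound on the mean involves
  neither \<open>f\<close> nor \<open>env\<close>; this is how \<open>env_const\<close> can be fixed
  in advance without circularity. For the lower bound the two integrations are exchanged, and
  \<open>pot u - log_weight u\<close> is bounded from below.\<close>

lemma field_shift_bounds:
  assumes f: "f \<in> densities"
  defines "w \<equiv> (\<integral>u. log_weight u * f u \<partial>M)"
  shows "field f x - w \<le> log_weight x" "- ((\<integral>u. log_weight u \<partial>M) + 2 * tame_const 0) \<le> (\<integral>x. field f x - w \<partial>M)"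
    "integrable M (\<lambda>x. field f x - w)"
proof -
  note [measurable] = densitiesD(1)[OF f]
  have iw: "integrable M (\<lambda>u. log_weight u * f u)"
  proof (rule Bochner_Integration.integrable_bound[OF integrable_env_powr[of 1]])
    show "AE u in M. norm (log_weight u * f u) \<le> norm (env u * (1 + norm u) powr 1)"
    proof (rule AE_I2)
      fix u
      have "log_weight u * f u \<le> (1 + norm u) * env u"
        using log_weight_le[of u] log_weight_nonneg[of u] densitiesD(2,3)[OF f, of u] norm_ge_zero[of u] by (intro mult_mono) linarith+
      then show "norm (log_weight u * f u) \<le> norm (env u * (1 + norm u) powr 1)"
        using log_weight_nonneg[of u] densitiesD(2)[OF f, of u] env_ge_1(2)[of u] by (simp add: mult_ac)
    qed
  qed auto
  have "field f x \<le> (\<integral>u. log_weight x * f u + log_weight u * f u \<partial>M)"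
    unfolding field_def
  proof (rule integral_mono)
    fix u show "log_dist x u * f u \<le> log_weight x * f u + log_weight u * f u"
      using log_dist_le[of x u] densitiesD(2)[OF f, of u] unfolding distrib_right[symmetric] by (intro mult_right_mono)
  qed (use iw integrable_field[OF f] densitiesD(5)[OF f] in auto)
  also have "\<dots> = log_weight x + w" using iw densitiesD(4,5)[OF f] by (simp add: w_def)
  finally show "field f x - w \<le> log_weight x" by simp
  have ifl: "integrable M (field f)" using integrable_interaction[OF one_density f] by simp
  then show "integrable M (\<lambda>x. field f x - w)" by simp
  have potf: "field (\<lambda>_. 1) u = pot u" for u by (simp add: field_def pot_def)
  have "(\<integral>x. field f x \<partial>M) = (\<integral>u. f u * pot u \<partial>M)"
    using interaction_commute[OF one_density f] by (simp add: interaction_def potf)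
  moreover have ipf: "integrable M (\<lambda>u. f u * pot u)" using integrable_interaction[OF f one_density] by (simp add: potf)
  moreover have "(\<integral>u. (f u * pot u - log_weight u * f u) \<partial>M) \<ge> (\<integral>u. - ((\<integral>x. log_weight x \<partial>M) + 2 * tame_const 0) * f u \<partial>M)"
  proof (rule integral_mono)
    fix u
    \<comment> \<open>With r = |u - x|, 1 + |u| is at most (1 + |x|) (1 + r), and passing from ln (1
      + r) to ln r costs ln (1 + 1 / r), at most 2 r^(-1/2).\<close>
    have "log_weight u - log_weight x - 2 * sing u x \<le> log_dist u x" for x :: 'a
    proof (cases "u = x")
      case False
      then have r: "0 < norm (u - x)" by simp
      have "1 + norm u \<le> (1 + norm x) * (norm (u - x) * (1 + 1 / norm (u - x)))"
      proof -
        have "(1 + norm x) * (norm (u - x) * (1 + 1 / norm (u - x))) = (1 + norm x) * (norm (u - x) + 1)" using r by (simp add: field_simps)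
        moreover have "norm u \<le> norm x + norm (u - x)" using norm_triangle_sub[of u x] .
        moreover have "0 \<le> norm x * norm (u - x)" by simp
        ultimately show ?thesis unfolding distrib_left distrib_right by linarith
      qed
      then have "log_weight u \<le> ln ((1 + norm x) * (norm (u - x) * (1 + 1 / norm (u - x))))"
        unfolding log_weight_def using r by (subst ln_le_cancel_iff) (auto intro!: mult_pos_pos add_pos_nonneg)
      also have "\<dots> = log_weight x + (log_dist u x + ln (1 + 1 / norm (u - x)))"
      proof -
        have "0 < 1 + 1 / norm (u - x)" using r by (simp add: add_pos_pos)
        then show ?thesis using r by (simp add: ln_mult log_weight_def log_dist_def)
      qed
      also have "ln (1 + 1 / norm (u - x)) \<le> 2 * sqrt (1 / norm (u - x))" using r by (intro ln_add_one_le_sqrt) simp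
      also have "sqrt (1 / norm (u - x)) = sing u x" by (simp add: sing_eq real_sqrt_divide)
      finally show ?thesis by simp
    next
      case True
      then show ?thesis using sing_nonneg[of u x] by (simp add: log_dist_def)
    qed
    then have "(\<integral>x. log_weight u - log_weight x - 2 * sing u x \<partial>M) \<le> pot u"
      unfolding pot_def using integrable_log_weight integrable_sing(1)[of u] integrable_log_dist[of u] by (intro integral_mono) auto
    then have "log_weight u - (\<integral>x. log_weight x \<partial>M) - 2 * (\<integral>x. sing u x \<partial>M) \<le> pot u"
      using integrable_log_weight integrable_sing(1)[of u] by simp
    then have "- ((\<integral>x. log_weight x \<partial>M) + 2 * tame_const 0) \<le> pot u - log_weight u" using integrable_sing(2)[of u] by linarith
    then have "- ((\<integral>x. log_weight x \<partial>M) + 2 * tame_const 0) * f u \<le> (pot u - log_weight u) * f u"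
      using densitiesD(2)[OF f, of u] by (intro mult_right_mono)
    then show "- ((\<integral>x. log_weight x \<partial>M) + 2 * tame_const 0) * f u \<le> f u * pot u - log_weight u * f u"
      by (simp add: algebra_simps)
  qed (use ipf iw densitiesD(5)[OF f] in auto)
  ultimately show "- ((\<integral>u. log_weight u \<partial>M) + 2 * tame_const 0) \<le> (\<integral>x. field f x - w \<partial>M)"
    using iw ifl densitiesD(4,5)[OF f] by (simp add: w_def)
qed

text \<open>The first shifted bound controls the numerator. Jensen's inequality and the second one
  bound the denominator from below by \<open>1 / env_const\<close>; the quotient of the two bounds
  is \<open>env\<close>.\<close>

lemma gibbs_map_density:
  assumes f: "f \<in> densities"
  shows "0 < gibbs_norm f" "(\<lambda>x. exp (\<gamma> * field f x) / gibbs_norm f) \<in> densities"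
proof -
  note [measurable] = densitiesD(1)[OF f]
  define w where "w = (\<integral>u. log_weight u * f u \<partial>M)"
  define G where "G x = exp (\<gamma> * (field f x - w))" for x
  note sh = field_shift_bounds[OF f, folded w_def]
  have G_le: "G x \<le> (1 + norm x) powr \<gamma>" for x
    unfolding G_def exp_log_weight[symmetric] using sh(1)[of x] \<gamma>_nonneg by (simp add: mult_left_mono)
  have iG: "integrable M G"
  proof (rule Bochner_Integration.integrable_bound[OF integrable_powr[OF \<gamma>_nonneg]])
    show "G \<in> borel_measurable M" unfolding G_def by measurable
  qed (use G_le in \<open>auto intro!: AE_I2 simp: G_def\<close>)
  have G0: "0 \<le> G x" for x by (simp add: G_def)
  have "ennreal (exp (\<integral>x. \<gamma> * (field f x - w) \<partial>M)) \<le> (\<integral>\<^sup>+x. ennreal (G x) \<partial>M)"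
    unfolding G_def by (rule exp_expectation_le) (use sh(3) in simp)
  also have "\<dots> = ennreal (\<integral>x. G x \<partial>M)" using iG G0 by (intro nn_integral_eq_integral) auto
  finally have J: "exp (\<integral>x. \<gamma> * (field f x - w) \<partial>M) \<le> (\<integral>x. G x \<partial>M)"
    by (simp add: Bochner_Integration.integral_nonneg G_def)
  have "1 / env_const = exp (\<gamma> * (- ((\<integral>u. log_weight u \<partial>M) + 2 * tame_const 0)))"
    unfolding env_const_def mult_minus_right exp_minus by (simp add: inverse_eq_divide)
  also have "\<dots> \<le> exp (\<gamma> * (\<integral>x. field f x - w \<partial>M))" using sh(2) \<gamma>_nonneg by (simp add: mult_left_mono)
  also have "\<gamma> * (\<integral>x. field f x - w \<partial>M) = (\<integral>x. \<gamma> * (field f x - w) \<partial>M)" by simp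
  also note J
  finally have low: "1 / env_const \<le> (\<integral>x. G x \<partial>M)" .
  have Gp: "0 < (\<integral>x. G x \<partial>M)" using low env_ge_1(1) by (smt (verit) divide_pos_pos)
  have eG: "exp (\<gamma> * field f x) = exp (\<gamma> * w) * G x" for x
    by (simp add: G_def exp_add[symmetric] algebra_simps)
  have gn: "gibbs_norm f = exp (\<gamma> * w) * (\<integral>x. G x \<partial>M)" unfolding gibbs_norm_def eG by simp
  show "0 < gibbs_norm f" unfolding gn using Gp by simp
  have quot: "exp (\<gamma> * field f x) / gibbs_norm f = G x / (\<integral>x. G x \<partial>M)" for x unfolding eG gn by simp
  show "(\<lambda>x. exp (\<gamma> * field f x) / gibbs_norm f) \<in> densities"
    unfolding densities_def
  proof (intro CollectI conjI allI)
    show "(\<lambda>x. exp (\<gamma> * field f x) / gibbs_norm f) \<in> borel_measurable borel" by measurable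
    show "(\<integral>x. exp (\<gamma> * field f x) / gibbs_norm f \<partial>M) = 1" unfolding quot using Gp by simp
    fix x
    show "0 \<le> exp (\<gamma> * field f x) / gibbs_norm f" unfolding quot using Gp by (simp add: G_def)
    have "G x / (\<integral>x. G x \<partial>M) \<le> (1 + norm x) powr \<gamma> / (1 / env_const)"
      using G_le low env_ge_1(1) by (intro frac_le) auto
    then show "exp (\<gamma> * field f x) / gibbs_norm f \<le> env x" unfolding quot by (simp add: env_def mult_ac)
  qed
qed

text \<open>Moving the minimiser \<open>f\<close> a distance t towards its image \<open>h\<close>
  and using convexity of the entropy bounds the relative entropy \<open>KL\<close> of
  \<open>f\<close> with respect to \<open>h\<close> by a multiple of t, so no derivative of t ln t
  at 0 enters. Then \<open>KL\<close> is at most 0 and \<open>f = h\<close> almost everywhere. The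
  solution returned is \<open>h\<close>: the field does not see null sets, so \<open>h\<close>
  satisfies the equation at every point.\<close>

theorem equilibrium_exists:
  obtains g Z where "g \<in> densities" "0 < Z" "\<And>x. g x = exp (\<gamma> * field g x) / Z"
proof -
  obtain f where f: "f \<in> densities" and min: "\<And>g. g \<in> densities \<Longrightarrow> free_energy f \<le> free_energy g"
    using minimizer_exists by metis
  define Z where "Z = gibbs_norm f"
  define h where "h x = exp (\<gamma> * field f x) / Z" for x
  have Z: "0 < Z" and h: "h \<in> densities" using gibbs_map_density[OF f] unfolding Z_def h_def by auto
  note [measurable] = densitiesD(1)[OF f] densitiesD(1)[OF h]
  have hp: "0 < h x" for x using Z by (simp add: h_def)
  have lnh: "ln (h x) = \<gamma> * field f x - ln Z" for x using Z by (simp add: h_def ln_div)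
  define KL where "KL = (\<integral>x. f x * ln (f x) - f x * ln (h x) \<partial>M)"
  have ifh: "integrable M (\<lambda>x. f x * ln (h x))"
    unfolding lnh using integrable_interaction[OF f f] densitiesD(5)[OF f] by (simp add: right_diff_distrib mult.left_commute[of _ \<gamma>])
  have KL: "KL = ent f - \<gamma> * interaction f f + ln Z"
  proof -
    have "(\<integral>x. f x * ln (h x) \<partial>M) = (\<integral>x. \<gamma> * (f x * field f x) - ln Z * f x \<partial>M)"
      unfolding lnh by (intro Bochner_Integration.integral_cong) (auto simp: algebra_simps)
    also have "\<dots> = \<gamma> * interaction f f - ln Z"
      using integrable_interaction[OF f f] densitiesD(4,5)[OF f] by (simp add: interaction_def)
    finally show ?thesis unfolding KL_def using integrable_entropy[OF f] ifh by (simp add: ent_def)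
  qed
  have enth: "ent h = \<gamma> * interaction f h - ln Z"
  proof -
    have "ent h = (\<integral>x. \<gamma> * (h x * field f x) - ln Z * h x \<partial>M)"
      unfolding ent_def lnh by (intro Bochner_Integration.integral_cong) (auto simp: algebra_simps)
    also have "\<dots> = \<gamma> * interaction h f - ln Z"
      using integrable_interaction[OF h f] densitiesD(4,5)[OF h] by (simp add: interaction_def)
    finally show ?thesis by (simp add: interaction_commute[OF h f])
  qed
  \<comment> \<open>Minus the second-order coefficient of the interaction along the segment from
    \<open>f\<close> to \<open>h\<close>; it is all that remains besides \<open>KL\<close> when the
    minimiser is compared with the mixture.\<close>
  define D where "D = 2 * interaction f h - interaction f f - interaction h h"
  have D: "0 \<le> D" using interaction_cond_neg[OF f h] by (simp add: D_def)
  have step: "KL \<le> t * (\<gamma> / 2 * D)" if t: "0 < t" "t \<le> 1" for t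
  proof -
    let ?g = "\<lambda>x. (1 - t) * f x + t * h x"
    have g: "?g \<in> densities" using t by (intro densities_convex f h) auto
    have "ent ?g \<le> (\<integral>x. (1 - t) * (f x * ln (f x)) + t * (h x * ln (h x)) \<partial>M)"
      unfolding ent_def
    proof (rule integral_mono)
      fix x show "?g x * ln (?g x) \<le> (1 - t) * (f x * ln (f x)) + t * (h x * ln (h x))"
        using xlnx_convex[of "f x" "h x" t] densitiesD(2)[OF f, of x] hp[of x] t by simp
    qed (use integrable_entropy[OF f] integrable_entropy[OF h] integrable_entropy[OF g] in auto)
    also have "\<dots> = (1 - t) * ent f + t * ent h"
      unfolding ent_def using integrable_entropy[OF f] integrable_entropy[OF h] by simp
    finally have 1: "ent ?g \<le> (1 - t) * ent f + t * ent h" .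
    have 2: "interaction ?g ?g = (1 - t)\<^sup>2 * interaction f f + 2 * t * (1 - t) * interaction f h + t\<^sup>2 * interaction h h"
      using t by (intro interaction_mix f h) auto
    have "free_energy f \<le> free_energy ?g" by (rule min[OF g])
    then have "ent f - \<gamma> / 2 * interaction f f \<le> (1 - t) * ent f + t * ent h - \<gamma> / 2 * interaction ?g ?g"
      using 1 unfolding free_energy_def by linarith
    then have "t * KL \<le> t * (t * (\<gamma> / 2 * D))"
      unfolding KL 2 enth D_def by (simp add: power2_eq_square algebra_simps)
    then show ?thesis using t by simp
  qed
  have "KL \<le> 0"
  proof (rule tendsto_lowerbound)
    show "((\<lambda>t. t * (\<gamma> / 2 * D)) \<longlongrightarrow> 0) (at_right 0)" by (auto intro!: tendsto_eq_intros)
    have "\<forall>\<^sub>F t in at_right (0::real). t \<in> {0<..<1}" by (rule eventually_at_right_real) simp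
    then show "\<forall>\<^sub>F t in at_right 0. KL \<le> t * (\<gamma> / 2 * D)" by eventually_elim (rule step, auto)
  qed simp
  have sqb: "f x - h x + (sqrt (f x) - sqrt (h x))\<^sup>2 \<le> f x * ln (f x) - f x * ln (h x)" for x
    by (rule entropy_diff_ge[OF densitiesD(2)[OF f] hp])
  have isq: "integrable M (\<lambda>x. (sqrt (f x) - sqrt (h x))\<^sup>2)"
  proof (rule Bochner_Integration.integrable_bound)
    show "integrable M (\<lambda>x. (f x * ln (f x) - f x * ln (h x)) - (f x - h x))"
      using integrable_entropy[OF f] ifh densitiesD(5)[OF f] densitiesD(5)[OF h] by simp
    show "AE x in M. norm ((sqrt (f x) - sqrt (h x))\<^sup>2) \<le> norm ((f x * ln (f x) - f x * ln (h x)) - (f x - h x))"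
    proof (rule AE_I2)
      fix x show "norm ((sqrt (f x) - sqrt (h x))\<^sup>2) \<le> norm ((f x * ln (f x) - f x * ln (h x)) - (f x - h x))"
        using sqb[of x] zero_le_power2[of "sqrt (f x) - sqrt (h x)"] unfolding real_norm_def by linarith
    qed
  qed measurable
  have "(\<integral>x. (sqrt (f x) - sqrt (h x))\<^sup>2 \<partial>M) \<le> (\<integral>x. (f x * ln (f x) - f x * ln (h x)) - (f x - h x) \<partial>M)"
    using isq integrable_entropy[OF f] ifh densitiesD(5)[OF f] densitiesD(5)[OF h] sqb
    by (intro integral_mono) (auto simp: algebra_simps)
  also have "\<dots> = KL"
    unfolding KL_def using integrable_entropy[OF f] ifh densitiesD(4,5)[OF f] densitiesD(4,5)[OF h] by simp
  finally have "(\<integral>x. (sqrt (f x) - sqrt (h x))\<^sup>2 \<partial>M) \<le> 0" using \<open>KL \<le> 0\<close> by linarith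
  moreover have "0 \<le> (\<integral>x. (sqrt (f x) - sqrt (h x))\<^sup>2 \<partial>M)" by (rule Bochner_Integration.integral_nonneg) simp
  ultimately have "(\<integral>x. (sqrt (f x) - sqrt (h x))\<^sup>2 \<partial>M) = 0" by linarith
  then have "AE x in M. (sqrt (f x) - sqrt (h x))\<^sup>2 = 0"
    using integral_nonneg_eq_0_iff_AE[OF isq] by simp
  then have "AE x in M. f x = h x" by eventually_elim simp
  then have "field f x = field h x" for x
    unfolding field_def by (intro integral_cong_AE) (auto elim!: eventually_mono)
  then show ?thesis using that[OF h Z] by (simp add: h_def)
qed

end

section \<open>Existence of homogeneous Poisson processes\<close>

lemma integral_uniform_measure:
  fixes A :: "'a::euclidean_space set" and h :: "'a \<Rightarrow> real"
  assumes [measurable]: "A \<in> sets borel" "h \<in> borel_measurable borel"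
    and pos: "emeasure lborel A \<noteq> 0" and fin: "emeasure lborel A < \<infinity>"
  shows "(\<integral>x. indicator A x * h x \<partial>lborel) = measure lborel A * (\<integral>x. h x \<partial>uniform_measure lborel A)"
proof -
  have m: "measure lborel A \<noteq> 0" using pos fin by (simp add: measure_def enn2real_eq_0_iff)
  have "uniform_measure lborel A = density lborel (\<lambda>x. ennreal (indicator A x / measure lborel A))"
    unfolding uniform_measure_def
  proof (rule density_cong)
    have e: "emeasure lborel A = ennreal (measure lborel A)" using fin by (simp add: emeasure_eq_ennreal_measure less_top)
    show "AE x in lborel. indicator A x / emeasure lborel A = ennreal (indicator A x / measure lborel A)"
      unfolding e using m by (intro AE_I2) (simp add: divide_ennreal[symmetric] zero_less_measure_iff measure_nonneg less_le ennreal_indicator)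
  qed auto
  then have "(\<integral>x. h x \<partial>uniform_measure lborel A) = (\<integral>x. (indicator A x / measure lborel A) * h x \<partial>lborel)"
    by (simp add: integral_density)
  also have "\<dots> = (\<integral>x. (indicator A x * h x) / measure lborel A \<partial>lborel)" by (intro Bochner_Integration.integral_cong) auto
  also have "\<dots> = (\<integral>x. indicator A x * h x \<partial>lborel) / measure lborel A" by simp
  finally show ?thesis using m by simp
qed

lemma poisson_generating_function:
  assumes "0 < r" "0 \<le> q"
  shows "(\<integral>\<^sup>+k. ennreal (q ^ k) \<partial>measure_pmf (poisson_pmf r)) = ennreal (exp (r * (q - 1)))"
proof -
  have "(\<integral>\<^sup>+k. ennreal (q ^ k) \<partial>measure_pmf (poisson_pmf r)) = (\<Sum>k. ennreal (pmf (poisson_pmf r) k) * ennreal (q ^ k))"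
    by (simp add: nn_integral_measure_pmf nn_integral_count_space_nat)
  also have "\<dots> = (\<Sum>k. ennreal (exp (- r) * ((r * q) ^ k /\<^sub>R fact k)))"
    using assms by (intro suminf_cong)
      (simp add: pmf_poisson[OF assms(1)] ennreal_mult[symmetric] power_mult_distrib field_simps scaleR_conv_of_real)
  also have "\<dots> = ennreal (\<Sum>k. exp (- r) * ((r * q) ^ k /\<^sub>R fact k))"
    using assms by (intro suminf_ennreal2 summable_mult summable_exp_generic) auto
  also have "(\<Sum>k. exp (- r) * ((r * q) ^ k /\<^sub>R fact k)) = exp (- r) * exp (r * q)"
    unfolding exp_def by (rule suminf_mult[OF summable_exp_generic])
  also have "\<dots> = exp (r * (q - 1))" by (simp add: exp_add[symmetric] algebra_simps)
  finally show ?thesis .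
qed

section \<open>Points scattered over annuli\<close>

definition annulus :: "nat \<Rightarrow> 'a::euclidean_space set" where
  "annulus i = {x. real i \<le> norm x \<and> norm x < real (Suc i)}"

lemma annulus_borel[measurable]: "annulus i \<in> sets borel"
  unfolding annulus_def by measurable

lemma annulus_unique: "x \<in> annulus i \<longleftrightarrow> i = nat \<lfloor>norm x\<rfloor>"
proof -
  have "x \<in> annulus i \<longleftrightarrow> \<lfloor>norm x\<rfloor> = int i" unfolding annulus_def by (auto simp: floor_eq_iff)
  then show ?thesis by auto
qed

text \<open>Independently for each annulus \<open>i\<close>, \<open>\<omega> i\<close> is a number of points and their positions; the points that
  miss the annulus are discarded.\<close>

definition scattered_points :: "(nat \<Rightarrow> nat \<times> (nat \<Rightarrow> 'a::euclidean_space)) \<Rightarrow> (nat \<times> nat) set" where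
  "scattered_points \<omega> = {(i, j). j < fst (\<omega> i) \<and> snd (\<omega> i) j \<in> annulus i}"

definition scattered :: "(nat \<Rightarrow> nat \<times> (nat \<Rightarrow> 'a::euclidean_space)) \<Rightarrow> 'a measure" where
  "scattered \<omega> = distr (count_space (scattered_points \<omega>)) borel (\<lambda>(i, j). snd (\<omega> i) j)"

text \<open>A bounded set meets finitely many annuli. This holds for every \<open>\<omega>\<close>
  and not just almost surely, as \<open>point_process\<close> demands, because points outside their
  annulus are discarded.\<close>

lemma finite_scattered_points:
  assumes "bounded B"
  shows "finite {p \<in> scattered_points \<omega>. (case p of (i, j) \<Rightarrow> snd (\<omega> i) j) \<in> B}"
proof -
  obtain N :: nat where N: "\<And>x. x \<in> B \<Longrightarrow> norm x \<le> real N"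
    using assms unfolding bounded_iff by (meson order_trans real_arch_simple)
  have "{p \<in> scattered_points \<omega>. (case p of (i, j) \<Rightarrow> snd (\<omega> i) j) \<in> B} \<subseteq> (SIGMA i:{..N}. {..<fst (\<omega> i)})"
    using N by (fastforce simp: scattered_points_def annulus_def)
  then show ?thesis by (rule finite_subset) auto
qed

lemma emeasure_scattered:
  assumes [measurable]: "B \<in> sets borel"
  shows "emeasure (scattered \<omega>) B = emeasure (count_space (scattered_points \<omega>)) {p \<in> scattered_points \<omega>. (case p of (i, j) \<Rightarrow> snd (\<omega> i) j) \<in> B}"
  unfolding scattered_def by (subst emeasure_distr) (auto intro!: arg_cong[where f="emeasure _"])

text \<open>Measurability in \<open>\<omega>\<close> is read off from this form, each summand
  depending on one number of points and one position.\<close>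

lemma emeasure_scattered_suminf:
  assumes [measurable]: "B \<in> sets borel"
  shows "emeasure (scattered \<omega>) B = (\<Sum>i. \<Sum>j. if j < fst (\<omega> i) \<and> snd (\<omega> i) j \<in> annulus i \<inter> B then 1 else 0)"
proof -
  define T where "T = {p \<in> scattered_points \<omega>. (case p of (i, j) \<Rightarrow> snd (\<omega> i) j) \<in> B}"
  have "emeasure (scattered \<omega>) B = emeasure (count_space (scattered_points \<omega>)) T"
    unfolding T_def by (rule emeasure_scattered[OF assms])
  also have "\<dots> = emeasure (count_space UNIV) T"
  proof -
    have "T \<subseteq> scattered_points \<omega>" by (auto simp: T_def)
    then show ?thesis by (cases "finite T") (simp_all add: emeasure_count_space)
  qed
  also have "\<dots> = (\<integral>\<^sup>+p. indicator T p \<partial>count_space UNIV)" by simp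
  also have "\<dots> = (\<integral>\<^sup>+i. \<integral>\<^sup>+j. indicator T (i, j) \<partial>count_space UNIV \<partial>count_space UNIV)"
    by (rule nn_integral_fst_count_space[symmetric])
  also have "\<dots> = (\<Sum>i. \<Sum>j. indicator T (i, j))" by (simp add: nn_integral_count_space_nat)
  also have "\<dots> = (\<Sum>i. \<Sum>j. if j < fst (\<omega> i) \<and> snd (\<omega> i) j \<in> annulus i \<inter> B then 1 else 0)"
    by (intro suminf_cong) (auto simp: T_def scattered_points_def indicator_def)
  finally show ?thesis .
qed

lemma integral_scattered:
  fixes f :: "'a::euclidean_space \<Rightarrow> real"
  assumes [measurable]: "f \<in> borel_measurable borel" and N: "\<And>x. f x \<noteq> 0 \<Longrightarrow> norm x < real N"
  shows "(\<integral>x. f x \<partial>scattered \<omega>) = (\<Sum>i<N. \<Sum>j<fst (\<omega> i). indicator (annulus i) (snd (\<omega> i) j) * f (snd (\<omega> i) j))"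
proof -
  let ?p = "\<lambda>(i, j). snd (\<omega> i) j"
  let ?S = "SIGMA i:{..<N}. {..<fst (\<omega> i)}"
  have "(\<integral>x. f x \<partial>scattered \<omega>) = (\<integral>p. f (?p p) \<partial>count_space (scattered_points \<omega>))"
    unfolding scattered_def by (rule integral_distr) auto
  also have "\<dots> = (\<Sum>p | p \<in> scattered_points \<omega> \<and> f (?p p) \<noteq> 0. f (?p p))"
  proof (rule lebesgue_integral_count_space_finite_support)
    have "bounded {x. f x \<noteq> 0}" unfolding bounded_iff using N by (meson less_imp_le mem_Collect_eq)
    from finite_scattered_points[OF this, of \<omega>] show "finite {p \<in> scattered_points \<omega>. f (?p p) \<noteq> 0}" by simp
  qed
  also have "\<dots> = (\<Sum>p\<in>?S. indicator (annulus (fst p)) (?p p) * f (?p p))"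
  proof (rule sum.mono_neutral_cong_left)
    have "p \<in> ?S" if "p \<in> scattered_points \<omega>" "f (?p p) \<noteq> 0" for p
      using that N[of "?p p"] by (cases p) (auto simp: scattered_points_def annulus_def)
    then show "{p \<in> scattered_points \<omega>. f (?p p) \<noteq> 0} \<subseteq> ?S" by blast
    show "\<forall>p\<in>?S - {p \<in> scattered_points \<omega>. f (?p p) \<noteq> 0}. indicator (annulus (fst p)) (?p p) * f (?p p) = 0"
      by (auto simp: scattered_points_def split: split_indicator)
  qed (auto simp: scattered_points_def)
  also have "\<dots> = (\<Sum>i<N. \<Sum>j<fst (\<omega> i). indicator (annulus i) (snd (\<omega> i) j) * f (snd (\<omega> i) j))"
    by (subst sum.Sigma) (auto simp: case_prod_beta')
  finally show ?thesis .
qed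

section \<open>The Laplace functional of the scattered points\<close>

lemma prob_space_poisson_seq:
  assumes "prob_space U"
  shows "prob_space (measure_pmf (poisson_pmf r) \<Otimes>\<^sub>M PiM UNIV (\<lambda>_::nat. U))"
proof -
  interpret A: prob_space "measure_pmf (poisson_pmf r)" by (rule prob_space_measure_pmf)
  interpret B: prob_space "PiM UNIV (\<lambda>_::nat. U)" by (intro prob_space_PiM assms)
  interpret pair_prob_space "measure_pmf (poisson_pmf r)" "PiM UNIV (\<lambda>_::nat. U)" ..
  show ?thesis by (rule P.prob_space_axioms)
qed

lemma nn_integral_PiM_finite_prod:
  assumes P: "\<And>i::nat. prob_space (N i)" and J: "finite J" and g[measurable]: "\<And>i. g i \<in> borel_measurable (N i)"
  shows "(\<integral>\<^sup>+\<omega>. (\<Prod>i\<in>J. g i (\<omega> i)) \<partial>PiM UNIV N) = (\<Prod>i\<in>J. \<integral>\<^sup>+x. g i x \<partial>N i)"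
proof -
  interpret product_prob_space N UNIV
    by (intro product_prob_spaceI P)
  have "(\<Prod>i\<in>J. \<integral>\<^sup>+x. g i x \<partial>N i) = (\<integral>\<^sup>+\<omega>. (\<Prod>i\<in>J. g i (\<omega> i)) \<partial>PiM J N)"
    by (rule product_nn_integral_prod[symmetric, OF J]) simp
  also have "\<dots> = (\<integral>\<^sup>+\<omega>. (\<Prod>i\<in>J. g i (\<omega> i)) \<partial>distr (PiM UNIV N) (PiM J N) (\<lambda>x. restrict x J))"
    using J by (subst distr_PiM_restrict_finite) auto
  also have "\<dots> = (\<integral>\<^sup>+\<omega>. (\<Prod>i\<in>J. g i (restrict \<omega> J i)) \<partial>PiM UNIV N)"
    using J by (subst nn_integral_distr) (auto intro!: measurable_restrict_subset borel_measurable_prod_ennreal)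
  also have "\<dots> = (\<integral>\<^sup>+\<omega>. (\<Prod>i\<in>J. g i (\<omega> i)) \<partial>PiM UNIV N)"
    by (intro nn_integral_cong prod.cong) auto
  finally show ?thesis ..
qed

text \<open>Given the number k of points the mean is q^k, with q the mean of exp (- f) under
  \<open>U\<close>; the generating function of the Poisson law does the rest.\<close>

lemma poisson_seq_laplace:
  fixes U :: "'a::euclidean_space measure"
  assumes U: "prob_space U" "sets U = sets borel" and r: "0 < r"
    and f[measurable]: "f \<in> borel_measurable borel" and f0: "\<And>x. 0 \<le> f x"
  shows "(\<integral>\<^sup>+\<omega>. ennreal (exp (- (\<Sum>j<fst \<omega>. f (snd \<omega> j)))) \<partial>(measure_pmf (poisson_pmf r) \<Otimes>\<^sub>M PiM UNIV (\<lambda>_::nat. U)))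
    = ennreal (exp (r * (\<integral>x. exp (- f x) - 1 \<partial>U)))"
proof -
  interpret U: prob_space U by fact
  note [measurable_cong] = U(2)
  interpret B: prob_space "PiM UNIV (\<lambda>_::nat. U)" by (intro prob_space_PiM U)
  have m: "(\<lambda>\<omega>. ennreal (exp (- (\<Sum>j<fst \<omega>. f (snd \<omega> j))))) \<in> borel_measurable (measure_pmf (poisson_pmf r) \<Otimes>\<^sub>M PiM UNIV (\<lambda>_::nat. U))"
  proof -
    \<comment> \<open>The number of summands is random; it is frozen at k first, and it takes only
      countably many values.\<close>
    have "(\<lambda>\<omega>. ennreal (exp (- (\<Sum>j<k. f (snd \<omega> j))))) \<in> borel_measurable (measure_pmf (poisson_pmf r) \<Otimes>\<^sub>M PiM UNIV (\<lambda>_::nat. U))" for k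
      by measurable
    then show ?thesis by (rule measurable_compose_countable) simp
  qed
  have iq: "integrable U (\<lambda>x. exp (- f x))" by (rule U.integrable_const_bound[of _ 1]) (use f0 in auto)
  define q where "q = (\<integral>x. exp (- f x) \<partial>U)"
  have q0: "0 \<le> q" unfolding q_def by (rule Bochner_Integration.integral_nonneg) simp
  have "(\<integral>\<^sup>+\<omega>. ennreal (exp (- (\<Sum>j<fst \<omega>. f (snd \<omega> j)))) \<partial>(measure_pmf (poisson_pmf r) \<Otimes>\<^sub>M PiM UNIV (\<lambda>_::nat. U)))
    = (\<integral>\<^sup>+k. \<integral>\<^sup>+x. ennreal (exp (- (\<Sum>j<k. f (x j)))) \<partial>PiM UNIV (\<lambda>_::nat. U) \<partial>measure_pmf (poisson_pmf r))"
    by (subst B.nn_integral_fst[symmetric, OF m]) simp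
  also have "\<dots> = (\<integral>\<^sup>+k. ennreal (q ^ k) \<partial>measure_pmf (poisson_pmf r))"
  proof (rule nn_integral_cong)
    fix k :: nat
    have "(\<integral>\<^sup>+x. ennreal (exp (- (\<Sum>j<k. f (x j)))) \<partial>PiM UNIV (\<lambda>_::nat. U)) = (\<integral>\<^sup>+x. (\<Prod>j\<in>{..<k}. ennreal (exp (- f (x j)))) \<partial>PiM UNIV (\<lambda>_::nat. U))"
      by (simp add: sum_negf[symmetric] exp_sum prod_ennreal)
    also have "\<dots> = (\<Prod>j\<in>{..<k}. \<integral>\<^sup>+x. ennreal (exp (- f x)) \<partial>U)"
      by (rule nn_integral_PiM_finite_prod) (use U in auto)
    also have "(\<integral>\<^sup>+x. ennreal (exp (- f x)) \<partial>U) = ennreal q"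
      unfolding q_def using iq by (intro nn_integral_eq_integral) auto
    finally show "(\<integral>\<^sup>+x. ennreal (exp (- (\<Sum>j<k. f (x j)))) \<partial>PiM UNIV (\<lambda>_::nat. U)) = ennreal (q ^ k)"
      using q0 by (simp add: ennreal_power)
  qed
  also have "\<dots> = ennreal (exp (r * (q - 1)))" by (rule poisson_generating_function[OF r q0])
  also have "q - 1 = (\<integral>x. exp (- f x) - 1 \<partial>U)" using iq by (simp add: q_def U.prob_space)
  finally show ?thesis .
qed

text \<open>On each annulus an independent Poisson number of uniform points. The means are
  \<open>\<theta>\<close> times the volumes, so the exponents of the annuli add up to a single
  integral over the space; a test function meets only finitely many annuli.\<close>

lemma poisson_process_exists_aux:
  assumes \<theta>: "0 < \<theta>"
  obtains P :: "(nat \<Rightarrow> nat \<times> (nat \<Rightarrow> 'a::euclidean_space)) measure"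
  where "prob_space P" "\<And>B::'a set. B \<in> sets borel \<Longrightarrow> (\<lambda>\<omega>. emeasure (scattered \<omega>) B) \<in> borel_measurable P"
    "\<And>f :: 'a \<Rightarrow> real. f \<in> test_functions \<Longrightarrow> (\<lambda>\<omega>. \<integral>x. f x \<partial>scattered \<omega>) \<in> borel_measurable P"
    "\<And>f :: 'a \<Rightarrow> real. f \<in> test_functions \<Longrightarrow> laplace_functional P scattered f = exp (\<theta> * (\<integral>x. (exp (- f x) - 1) \<partial>lborel))"
proof -
  have fin: "emeasure lborel (annulus i :: 'a set) < \<infinity>" for i
  proof -
    have "(annulus i :: 'a set) \<subseteq> ball 0 (real (Suc i))" by (auto simp: annulus_def)
    then have "bounded (annulus i :: 'a set)" using bounded_ball bounded_subset by blast
    then show ?thesis by (rule emeasure_bounded_finite)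
  qed
  have pos: "0 < measure lborel (annulus i :: 'a set)" for i
  proof -
    obtain v :: 'a where v: "norm v = real i + 1/2" using vector_choose_size[of "real i + 1/2"] by auto
    have "ball v (1/2) \<subseteq> annulus i"
    proof
      fix x assume "x \<in> ball v (1/2)"
      then have "norm (v - x) < 1/2" by (simp add: dist_norm)
      then show "x \<in> annulus i" using v norm_triangle_ineq2[of v x] norm_triangle_sub[of x v]
        by (simp add: annulus_def norm_minus_commute)
    qed
    then have "measure lborel (ball v (1/2)) \<le> measure lborel (annulus i :: 'a set)"
      using fin[of i] by (intro measure_mono_fmeasurable) (auto intro!: fmeasurableI)
    moreover have "0 < measure lborel (ball v (1/2))" by (rule content_ball_pos) simp
    ultimately show ?thesis by linarith
  qed
  define U where "U i = uniform_measure lborel (annulus i :: 'a set)" for i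
  have nz: "emeasure lborel (annulus i :: 'a set) \<noteq> 0" for i
    using pos[of i] by (auto simp: measure_def)
  have U: "prob_space (U i)" for i unfolding U_def using fin[of i] nz[of i] by (intro prob_space_uniform_measure) auto
  have sU[measurable_cong]: "sets (U i) = sets borel" for i by (simp add: U_def)
  have hU: "(\<integral>x. indicator (annulus i) x * h x \<partial>lborel) = measure lborel (annulus i :: 'a set) * (\<integral>x. h x \<partial>U i)"
    if "h \<in> borel_measurable borel" for i and h :: "'a \<Rightarrow> real"
    unfolding U_def by (rule integral_uniform_measure[OF annulus_borel that nz fin])
  define r where "r i = \<theta> * measure lborel (annulus i :: 'a set)" for i
  have r: "0 < r i" for i using \<theta> pos[of i] by (simp add: r_def)
  define Q where "Q i = measure_pmf (poisson_pmf (r i)) \<Otimes>\<^sub>M PiM UNIV (\<lambda>_::nat. U i)" for i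
  have Q: "prob_space (Q i)" for i unfolding Q_def by (rule prob_space_poisson_seq[OF U])
  define P where "P = PiM UNIV Q"
  have comp[measurable]: "(\<lambda>\<omega>. \<omega> i) \<in> measurable P (Q i)" for i unfolding P_def by measurable
  have fstm: "(\<lambda>\<omega>. fst (\<omega> i)) \<in> measurable P (count_space UNIV)" for i
    using measurable_compose[OF comp[of i], of fst "count_space UNIV"] unfolding Q_def
    by (simp add: measurable_cong_sets[OF refl sets_measure_pmf_count_space]) measurable
  have sndm: "(\<lambda>\<omega>. snd (\<omega> i) j) \<in> measurable P borel" for i j
  proof -
    have "(\<lambda>p. snd p j) \<in> measurable (Q i) borel" unfolding Q_def by measurable
    from measurable_compose[OF comp this] show ?thesis .
  qed
  note [measurable] = fstm sndm
  show ?thesis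
  proof
    show "prob_space P" unfolding P_def by (intro prob_space_PiM Q)
    show "(\<lambda>\<omega>. emeasure (scattered \<omega>) B) \<in> borel_measurable P" if [measurable]: "B \<in> sets borel" for B
      unfolding emeasure_scattered_suminf[OF that] by measurable
    fix f :: "'a \<Rightarrow> real" assume f: "f \<in> test_functions"
    have [measurable]: "f \<in> borel_measurable borel" using f unfolding test_functions_def by (auto intro: borel_measurable_continuous_onI)
    have f0: "0 \<le> f x" for x using f by (simp add: test_functions_def)
    obtain N :: nat where N: "\<And>x. f x \<noteq> 0 \<Longrightarrow> norm x < real N"
    proof -
      have "bounded {x. f x \<noteq> 0}" using f compact_imp_bounded bounded_subset[OF _ closure_subset] by (auto simp: test_functions_def)
      then obtain b where b: "\<And>x. f x \<noteq> 0 \<Longrightarrow> norm x \<le> b" unfolding bounded_iff by auto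
      obtain N :: nat where "b < real N" using reals_Archimedean2 by blast
      then show ?thesis using b by (intro that[of N]) (auto intro: le_less_trans)
    qed
    define fi where "fi i x = indicator (annulus i) x * f x" for i x
    have [measurable]: "fi i \<in> borel_measurable borel" for i unfolding fi_def by measurable
    have fi0: "0 \<le> fi i x" for i x using f0 by (simp add: fi_def)
    have int: "(\<integral>x. f x \<partial>scattered \<omega>) = (\<Sum>i<N. \<Sum>j<fst (\<omega> i). fi i (snd (\<omega> i) j))" for \<omega>
      unfolding fi_def by (rule integral_scattered[OF _ N]) auto
    have gm: "(\<lambda>p. \<Sum>j<fst p. fi i (snd p j)) \<in> borel_measurable (Q i)" for i
    proof -
      have "(\<lambda>p. \<Sum>j<k. fi i (snd p j)) \<in> borel_measurable (Q i)" for k unfolding Q_def by measurable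
      moreover have "fst \<in> measurable (Q i) (count_space UNIV)" unfolding Q_def
        by (rule measurable_compose[OF measurable_fst]) simp
      ultimately show ?thesis by (rule measurable_compose_countable)
    qed
    show im: "(\<lambda>\<omega>. \<integral>x. f x \<partial>scattered \<omega>) \<in> borel_measurable P"
      unfolding int by (intro borel_measurable_sum measurable_compose[OF comp gm])
    have "(\<integral>\<^sup>+\<omega>. ennreal (exp (- (\<integral>x. f x \<partial>scattered \<omega>))) \<partial>P) = (\<integral>\<^sup>+\<omega>. (\<Prod>i\<in>{..<N}. ennreal (exp (- (\<Sum>j<fst (\<omega> i). fi i (snd (\<omega> i) j))))) \<partial>P)"
      unfolding int by (subst prod_ennreal) (auto simp: sum_negf[symmetric] exp_sum intro!: prod_nonneg)
    also have "\<dots> = (\<Prod>i<N. \<integral>\<^sup>+p. ennreal (exp (- (\<Sum>j<fst p. fi i (snd p j)))) \<partial>Q i)"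
      unfolding P_def using gm by (intro nn_integral_PiM_finite_prod Q) auto
    also have "\<dots> = (\<Prod>i<N. ennreal (exp (r i * (\<integral>x. exp (- fi i x) - 1 \<partial>U i))))"
      unfolding Q_def using poisson_seq_laplace[OF U sU r, of "fi _"] fi0 by (intro prod.cong refl) auto
    also have "\<dots> = ennreal (exp (\<Sum>i<N. r i * (\<integral>x. exp (- fi i x) - 1 \<partial>U i)))" by (simp add: exp_sum prod_ennreal)
    also have "(\<Sum>i<N. r i * (\<integral>x. exp (- fi i x) - 1 \<partial>U i)) = \<theta> * (\<integral>x. (exp (- f x) - 1) \<partial>lborel)"
    proof -
      have "r i * (\<integral>x. exp (- fi i x) - 1 \<partial>U i) = \<theta> * (\<integral>x. indicator (annulus i) x * (exp (- f x) - 1) \<partial>lborel)" for i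
      proof -
        have "(\<integral>x. indicator (annulus i) x * (exp (- fi i x) - 1) \<partial>lborel) = measure lborel (annulus i :: 'a set) * (\<integral>x. exp (- fi i x) - 1 \<partial>U i)"
          by (rule hU) measurable
        moreover have "indicator (annulus i) x * (exp (- fi i x) - 1) = indicator (annulus i) x * (exp (- f x) - 1)" for x
          by (simp add: fi_def indicator_def)
        ultimately show ?thesis by (simp add: r_def)
      qed
      then have "(\<Sum>i<N. r i * (\<integral>x. exp (- fi i x) - 1 \<partial>U i)) = \<theta> * (\<Sum>i<N. \<integral>x. indicator (annulus i) x * (exp (- f x) - 1) \<partial>lborel)"
        by (simp add: sum_distrib_left)
      also have "(\<Sum>i<N. \<integral>x. indicator (annulus i) x * (exp (- f x) - 1) \<partial>lborel) = (\<integral>x. (\<Sum>i<N. indicator (annulus i) x * (exp (- f x) - 1)) \<partial>lborel)"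
      proof (rule Bochner_Integration.integral_sum[symmetric])
        fix i
        have "integrable lborel (indicator (annulus i) :: 'a \<Rightarrow> real)" using fin by (simp add: integrable_indicator_iff)
        then show "integrable lborel (\<lambda>x. indicator (annulus i) x * (exp (- f x) - 1))"
          by (rule Bochner_Integration.integrable_bound) (use f0 in \<open>auto intro!: AE_I2 simp: indicator_def\<close>)
      qed
      also have "(\<lambda>x. \<Sum>i<N. indicator (annulus i) x * (exp (- f x) - 1)) = (\<lambda>x. exp (- f x) - 1)"
      proof
        fix x
        show "(\<Sum>i<N. indicator (annulus i) x * (exp (- f x) - 1)) = exp (- f x) - 1"
        proof (cases "f x = 0")
          case False
          have "nat \<lfloor>norm x\<rfloor> < N" using N[OF False] by (simp add: nat_less_iff floor_less_iff)
          then show ?thesis by (simp add: indicator_def annulus_unique sum.delta if_distrib[where f="\<lambda>a. a * _"] cong: if_cong)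
        qed simp
      qed
      finally show ?thesis .
    qed
    finally have nn: "(\<integral>\<^sup>+\<omega>. ennreal (exp (- (\<integral>x. f x \<partial>scattered \<omega>))) \<partial>P) = ennreal (exp (\<theta> * (\<integral>x. (exp (- f x) - 1) \<partial>lborel)))" .
    have "(\<lambda>\<omega>. exp (- (\<integral>x. f x \<partial>scattered \<omega>))) \<in> borel_measurable P" using im by measurable
    then show "laplace_functional P scattered f = exp (\<theta> * (\<integral>x. (exp (- f x) - 1) \<partial>lborel))"
      unfolding laplace_functional_def using nn by (subst integral_eq_nn_integral) auto
  qed
qed

text \<open>The process is transported to the prescribed sample space by equipping the set of its
  values with the final \<sigma>-algebra.\<close>

theorem homogeneous_poisson_process_exists:
  assumes \<theta>: "0 < \<theta>"
  obtains M :: "'a::euclidean_space measure measure" where "homogeneous_poisson_process M (\<lambda>m. m)"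
    "\<And>f :: 'a \<Rightarrow> real. f \<in> test_functions \<Longrightarrow> laplace_functional M (\<lambda>m. m) f = exp (\<theta> * (\<integral>x. (exp (- f x) - 1) \<partial>lborel))"
proof -
  obtain P :: "(nat \<Rightarrow> nat \<times> (nat \<Rightarrow> 'a)) measure" where P: "prob_space P"
    "\<And>B::'a set. B \<in> sets borel \<Longrightarrow> (\<lambda>\<omega>. emeasure (scattered \<omega>) B) \<in> borel_measurable P"
    "\<And>f :: 'a \<Rightarrow> real. f \<in> test_functions \<Longrightarrow> (\<lambda>\<omega>. \<integral>x. f x \<partial>scattered \<omega>) \<in> borel_measurable P"
    "\<And>f :: 'a \<Rightarrow> real. f \<in> test_functions \<Longrightarrow> laplace_functional P scattered f = exp (\<theta> * (\<integral>x. (exp (- f x) - 1) \<partial>lborel))"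
    using poisson_process_exists_aux[OF \<theta>] by metis
  interpret P: prob_space P by fact
  let ?V = "scattered ` space P"
  let ?G = "{A. A \<subseteq> ?V \<and> scattered -` A \<inter> space P \<in> sets P}"
  define N where "N = sigma ?V ?G"
  have GV: "?G \<subseteq> Pow ?V" by auto
  have spN: "space N = ?V" unfolding N_def using GV by (rule space_measure_of)
  have GN: "A \<in> ?G \<Longrightarrow> A \<in> sets N" for A unfolding N_def using GV by (simp add: sets_measure_of sigma_sets.Basic)
  have XN: "scattered \<in> measurable P N"
    unfolding N_def by (rule measurable_measure_of[OF GV]) auto
  \<comment> \<open>For the final sigma-algebra a function of the value is measurable as soon as its
    composite with \<open>scattered\<close> is, so no generating class has to be identified.\<close>
  have FN: "F \<in> measurable N borel" if F: "(\<lambda>\<omega>. F (scattered \<omega>)) \<in> measurable P borel" for F :: "'a measure \<Rightarrow> 'b::topological_space"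
  proof (rule measurableI)
    fix A :: "'b set" assume A: "A \<in> sets borel"
    have "scattered -` (F -` A \<inter> ?V) \<inter> space P = (\<lambda>\<omega>. F (scattered \<omega>)) -` A \<inter> space P" by auto
    also have "\<dots> \<in> sets P" using F A by (rule measurable_sets)
    finally show "F -` A \<inter> space N \<in> sets N" unfolding spN by (intro GN) auto
  qed simp
  define M where "M = distr P N scattered"
  have lap: "laplace_functional M (\<lambda>m. m) f = exp (\<theta> * (\<integral>x. (exp (- f x) - 1) \<partial>lborel))" if f: "f \<in> test_functions" for f
  proof -
    have "(\<lambda>\<omega>. exp (- (\<integral>x. f x \<partial>scattered \<omega>))) \<in> borel_measurable P" using P(3)[OF f] by measurable
    then have "(\<lambda>m. exp (- (\<integral>x. f x \<partial>m))) \<in> borel_measurable N" by (rule FN)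
    then have "laplace_functional M (\<lambda>m. m) f = laplace_functional P scattered f"
      unfolding laplace_functional_def M_def by (rule integral_distr[OF XN])
    then show ?thesis using P(4)[OF f] by simp
  qed
  have pp: "point_process M (\<lambda>m. m)"
    unfolding point_process_def
  proof (intro conjI ballI impI)
    show "prob_space M" unfolding M_def by (rule P.prob_space_distr[OF XN])
    fix m assume "m \<in> space M"
    then obtain \<omega> where m: "m = scattered \<omega>" by (auto simp: M_def spN)
    show "sets m = sets borel" by (simp add: m scattered_def)
    fix B :: "'a set" assume B: "B \<in> sets borel" "bounded B"
    have "emeasure m B = of_nat (card {p \<in> scattered_points \<omega>. (case p of (i, j) \<Rightarrow> snd (\<omega> i) j) \<in> B})"
      unfolding m emeasure_scattered[OF B(1)] using finite_scattered_points[OF B(2), of \<omega>] by (subst emeasure_count_space) auto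
    then show "\<exists>k::nat. emeasure m B = of_nat k" by blast
  next
    fix B :: "'a set" assume "B \<in> sets borel"
    from FN[OF P(2)[OF this]] show "(\<lambda>m. emeasure m B) \<in> borel_measurable M" by (simp add: M_def)
  qed
  show ?thesis
    by (rule that[of M]) (use pp lap \<theta> in \<open>auto simp: homogeneous_poisson_process_def\<close>)
qed

section \<open>Gibbs measures of confining potentials\<close>

text \<open>On the shell where the distance r lies between 4^-(k+1) and 4^-k, r^(-1/2) is at most
  2^(k+1). So the singularity is dominated by the sum of 2^(k+1) times the indicator of the ball of
  radius 4^-k. In every dimension the volume of that ball is at most v 4^-k, and the series sums to
  4 v whatever the centre.\<close>

lemma nn_integral_sing_cball:
  shows "\<exists>A :: real. \<forall>x :: 'a::euclidean_space. (\<integral>\<^sup>+u. ennreal (sing x u * indicator (cball x 1) u) \<partial>lborel) \<le> ennreal A"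
proof -
  define v where "v = unit_ball_vol (real DIM('a))"
  have v: "0 \<le> v" by (simp add: v_def unit_ball_vol_nonneg)
  have "(\<integral>\<^sup>+u. ennreal (sing x u * indicator (cball x 1) u) \<partial>lborel) \<le> ennreal (4 * v)" for x :: 'a
  proof -
    have pt: "ennreal (sing x u * indicator (cball x 1) u) \<le> (\<Sum>k. ennreal (2 ^ Suc k) * indicator (cball x ((1/4) ^ k)) u)" for u
    proof (cases "x \<noteq> u \<and> u \<in> cball x 1")
      case True
      define r where "r = norm (x - u)"
      have r: "0 < r" "r \<le> 1" using True by (auto simp: r_def dist_norm)
      have ex: "\<exists>k. (1/4) ^ Suc k < r"
      proof -
        obtain n where "(1/4) ^ n < r" using real_arch_pow_inv[OF r(1), of "1/4"] by auto
        moreover have "(1/4::real) ^ Suc n \<le> (1/4) ^ n" by simp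
        ultimately show ?thesis by (intro exI[of _ n]) linarith
      qed
      define k where "k = (LEAST k. (1/4) ^ Suc k < r)"
      have k1: "(1/4) ^ Suc k < r" unfolding k_def by (rule LeastI_ex[OF ex])
      have k2: "r \<le> (1/4) ^ k"
      proof (cases k)
        case (Suc j)
        then have "\<not> (1/4) ^ Suc j < r" using not_less_Least[of j "\<lambda>k. (1/4) ^ Suc k < r"] by (simp add: k_def)
        then show ?thesis using Suc by simp
      qed (use r in simp)
      have "sing x u = 1 / sqrt r" by (simp add: sing_eq r_def)
      also have "\<dots> \<le> 2 ^ Suc k"
      proof -
        have le: "sqrt ((1/4) ^ Suc k) \<le> sqrt r" using k1 by (simp del: power_Suc)
        have eq: "sqrt ((1/4) ^ Suc k) = (1/2) ^ Suc k" by (simp only: real_sqrt_power) (simp add: real_sqrt_divide)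
        have "(1/2) ^ Suc k \<le> sqrt r" using le unfolding eq .
        then have "1 / sqrt r \<le> 1 / (1/2) ^ Suc k" using r by (intro divide_left_mono) auto
        then show ?thesis by (simp add: power_one_over)
      qed
      finally have "ennreal (sing x u * indicator (cball x 1) u) \<le> ennreal (2 ^ Suc k) * indicator (cball x ((1/4) ^ k)) u"
        using True k2 by (simp add: r_def dist_norm ennreal_leI)
      also have "\<dots> \<le> (\<Sum>k. ennreal (2 ^ Suc k) * indicator (cball x ((1/4) ^ k)) u)"
      proof -
        have single: "g k \<le> (\<Sum>k. g k)" for g :: "nat \<Rightarrow> ennreal" using sum_le_suminf[of g "{k}"] by simp
        show ?thesis by (rule single)
      qed
      finally show ?thesis .
    qed (auto simp: sing_def)
    have "(\<integral>\<^sup>+u. ennreal (sing x u * indicator (cball x 1) u) \<partial>lborel) \<le> (\<integral>\<^sup>+u. (\<Sum>k. ennreal (2 ^ Suc k) * indicator (cball x ((1/4) ^ k)) u) \<partial>lborel)"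
      by (intro nn_integral_mono pt)
    also have "\<dots> = (\<Sum>k. \<integral>\<^sup>+u. ennreal (2 ^ Suc k) * indicator (cball x ((1/4) ^ k)) u \<partial>lborel)"
      by (rule nn_integral_suminf) (intro borel_measurable_times_ennreal borel_measurable_const borel_measurable_indicator, simp)
    also have "\<dots> = (\<Sum>k. ennreal (2 ^ Suc k) * emeasure lborel (cball x ((1/4) ^ k)))"
      by (intro suminf_cong) (simp add: nn_integral_cmult_indicator)
    also have "\<dots> \<le> (\<Sum>k. ennreal (2 * v * (1/2) ^ k))"
    proof (rule suminf_le)
      fix k
      have "emeasure lborel (cball x ((1/4) ^ k)) = ennreal (v * ((1/4) ^ k) ^ DIM('a))"
        unfolding v_def by (rule emeasure_cball) simp
      also have "\<dots> \<le> ennreal (v * (1/4) ^ k)"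
      proof (intro ennreal_leI mult_left_mono[OF _ v])
        have "((1/4::real) ^ k) ^ DIM('a) \<le> ((1/4) ^ k) ^ 1" using DIM_positive[where 'a='a] by (intro power_decreasing) (auto simp: power_le_one Suc_le_eq)
        then show "((1/4::real) ^ k) ^ DIM('a) \<le> (1/4) ^ k" by simp
      qed
      finally have "ennreal (2 ^ Suc k) * emeasure lborel (cball x ((1/4) ^ k)) \<le> ennreal (2 ^ Suc k) * ennreal (v * (1/4) ^ k)"
        by (rule mult_left_mono) simp
      also have "\<dots> = ennreal (2 * v * (1/2) ^ k)"
      proof -
        have "(2::real) ^ Suc k * (v * (1/4) ^ k) = 2 * v * (2 * (1/4)) ^ k" unfolding power_mult_distrib by simp
        then show ?thesis using v by (simp add: ennreal_mult[symmetric])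
      qed
      finally show "ennreal (2 ^ Suc k) * emeasure lborel (cball x ((1/4) ^ k)) \<le> ennreal (2 * v * (1/2) ^ k)" .
    qed auto
    also have "\<dots> = ennreal (\<Sum>k. 2 * v * (1/2) ^ k)"
      using v by (intro suminf_ennreal2 summable_mult summable_geometric) auto
    also have "(\<Sum>k. 2 * v * (1/2::real) ^ k) = 4 * v"
      by (subst suminf_mult) (auto simp: suminf_geometric)
    finally show ?thesis .
  qed
  then show ?thesis by blast
qed

text \<open>Within distance 1 of \<open>x\<close> the weighted density is bounded and the
  singularity is integrable uniformly in \<open>x\<close>; farther away \<open>sing\<close> is at
  most 1 and the moments suffice.\<close>

lemma tame_measure_density_lborel:
  fixes \<rho> :: "'a::euclidean_space \<Rightarrow> real"
  assumes [measurable]: "\<rho> \<in> borel_measurable borel" and \<rho>0: "\<And>u. 0 \<le> \<rho> u"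
    and mass: "(\<integral>\<^sup>+u. ennreal (\<rho> u) \<partial>lborel) = 1"
    and bd: "\<And>\<kappa>. 0 \<le> \<kappa> \<Longrightarrow> \<exists>C. \<forall>u. \<rho> u * (1 + norm u) powr \<kappa> \<le> C"
    and mom: "\<And>\<kappa>. 0 \<le> \<kappa> \<Longrightarrow> (\<integral>\<^sup>+u. ennreal (\<rho> u * (1 + norm u) powr \<kappa>) \<partial>lborel) < \<infinity>"
  shows "tame_measure (density lborel (\<lambda>u. ennreal (\<rho> u)))"
proof (intro tame_measure.intro tame_measure_axioms.intro prob_spaceI)
  show "emeasure (density lborel (\<lambda>u. ennreal (\<rho> u))) (space (density lborel (\<lambda>u. ennreal (\<rho> u)))) = 1"
    using mass by (subst emeasure_density) auto
  show "sets (density lborel (\<lambda>u. ennreal (\<rho> u))) = sets borel" by simp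
  fix x :: 'a
  have "emeasure (density lborel (\<lambda>u. ennreal (\<rho> u))) {x} = (\<integral>\<^sup>+u. ennreal (\<rho> u) * indicator {x} u \<partial>lborel)"
    by (rule emeasure_density) auto
  also have "\<dots> = 0"
  proof (subst nn_integral_0_iff_AE)
    show "AE u in lborel. ennreal (\<rho> u) * indicator {x} u = 0"
      using AE_lborel_singleton[of x] by eventually_elim auto
  qed auto
  finally show "emeasure (density lborel (\<lambda>u. ennreal (\<rho> u))) {x} = 0" .
next
  fix \<kappa> :: real assume \<kappa>: "0 \<le> \<kappa>"
  obtain C where C: "\<And>u. \<rho> u * (1 + norm u) powr \<kappa> \<le> C" using bd[OF \<kappa>] by blast
  have C0: "0 \<le> C" using order_trans[OF mult_nonneg_nonneg[OF \<rho>0[of 0]] C[of 0]] by simp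
  obtain A where A: "\<And>x :: 'a. (\<integral>\<^sup>+u. ennreal (sing x u * indicator (cball x 1) u) \<partial>lborel) \<le> ennreal A"
    using nn_integral_sing_cball by blast
  have [measurable]: "cball x 1 \<in> sets borel" for x :: 'a by simp
  let ?m = "\<integral>\<^sup>+u. ennreal (\<rho> u * (1 + norm u) powr \<kappa>) \<partial>lborel"
  show "\<exists>A. \<forall>x. (\<integral>\<^sup>+u. ennreal ((1 + sing x u) * (1 + norm u) powr \<kappa>) \<partial>density lborel (\<lambda>u. ennreal (\<rho> u))) \<le> ennreal A"
  proof (intro exI allI)
    fix x :: 'a
    have "(\<integral>\<^sup>+u. ennreal ((1 + sing x u) * (1 + norm u) powr \<kappa>) \<partial>density lborel (\<lambda>u. ennreal (\<rho> u)))
       = (\<integral>\<^sup>+u. ennreal (\<rho> u) * ennreal ((1 + sing x u) * (1 + norm u) powr \<kappa>) \<partial>lborel)"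
      by (rule nn_integral_density) auto
    also have "\<dots> \<le> (\<integral>\<^sup>+u. ennreal 2 * ennreal (\<rho> u * (1 + norm u) powr \<kappa>) + ennreal C * ennreal (sing x u * indicator (cball x 1) u) \<partial>lborel)"
    proof (rule nn_integral_mono)
      fix u
      define p where "p = \<rho> u * (1 + norm u) powr \<kappa>"
      have p: "0 \<le> p" "p \<le> C" using \<rho>0[of u] C[of u] by (auto simp: p_def)
      have s: "sing x u \<le> 1 + sing x u * indicator (cball x 1) u"
      proof (cases "u \<in> cball x 1")
        case False
        then have "1 \<le> sqrt (norm (x - u))" by (simp add: dist_norm)
        then have "sing x u \<le> 1" unfolding sing_eq divide_le_eq_1 by linarith
        then show ?thesis using False by simp
      qed simp
      have "p * (1 + sing x u) \<le> p * (2 + sing x u * indicator (cball x 1) u)" using s p by (intro mult_left_mono) auto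
      also have "\<dots> = 2 * p + p * (sing x u * indicator (cball x 1) u)" by (simp add: algebra_simps)
      also have "\<dots> \<le> 2 * p + C * (sing x u * indicator (cball x 1) u)" using p sing_nonneg[of x u] by (intro add_left_mono mult_right_mono) auto
      finally have le: "\<rho> u * ((1 + sing x u) * (1 + norm u) powr \<kappa>) \<le> 2 * p + C * (sing x u * indicator (cball x 1) u)"
        by (simp add: p_def mult_ac)
      have "ennreal (\<rho> u) * ennreal ((1 + sing x u) * (1 + norm u) powr \<kappa>) = ennreal (\<rho> u * ((1 + sing x u) * (1 + norm u) powr \<kappa>))"
        using \<rho>0[of u] sing_nonneg[of x u] by (simp add: ennreal_mult)
      also have "\<dots> \<le> ennreal (2 * p + C * (sing x u * indicator (cball x 1) u))" by (rule ennreal_leI[OF le])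
      also have "\<dots> = ennreal 2 * ennreal p + ennreal C * ennreal (sing x u * indicator (cball x 1) u)"
        using p C0 sing_nonneg[of x u] by (subst ennreal_plus) (auto simp: ennreal_mult'')
      finally show "ennreal (\<rho> u) * ennreal ((1 + sing x u) * (1 + norm u) powr \<kappa>)
          \<le> ennreal 2 * ennreal (\<rho> u * (1 + norm u) powr \<kappa>) + ennreal C * ennreal (sing x u * indicator (cball x 1) u)"
        by (simp add: p_def)
    qed
    also have "\<dots> = ennreal 2 * ?m + ennreal C * (\<integral>\<^sup>+u. ennreal (sing x u * indicator (cball x 1) u) \<partial>lborel)"
      by (subst nn_integral_add) (auto simp: nn_integral_cmult)
    also have "\<dots> \<le> ennreal 2 * ?m + ennreal C * ennreal A" by (intro add_left_mono mult_left_mono A) simp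
    also have "\<dots> = ennreal (enn2real (ennreal 2 * ?m + ennreal C * ennreal A))"
      using mom[OF \<kappa>] by (intro ennreal_enn2real[symmetric]) (simp add: ennreal_mult_less_top)
    finally show "(\<integral>\<^sup>+u. ennreal ((1 + sing x u) * (1 + norm u) powr \<kappa>) \<partial>density lborel (\<lambda>u. ennreal (\<rho> u))) \<le> ennreal (enn2real (ennreal 2 * ?m + ennreal C * ennreal A))" .
  qed
qed

lemma PiM_density_lborel:
  fixes \<rho> :: "'a::euclidean_space \<Rightarrow> real"
  assumes [measurable]: "\<rho> \<in> borel_measurable borel" and "prob_space (density lborel (\<lambda>u. ennreal (\<rho> u)))" and I: "finite I"
  shows "PiM I (\<lambda>_. density lborel (\<lambda>u. ennreal (\<rho> u))) = density (PiM I (\<lambda>_. lborel)) (\<lambda>X. \<Prod>i\<in>I. ennreal (\<rho> (X i)))"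
proof -
  let ?D = "density lborel (\<lambda>u. ennreal (\<rho> u))"
  interpret D: prob_space ?D by fact
  interpret D: product_sigma_finite "\<lambda>_. ?D" by (simp add: product_sigma_finite_def D.sigma_finite_measure_axioms)
  interpret L: product_sigma_finite "\<lambda>_. lborel :: 'a measure" by (simp add: product_sigma_finite_def lborel.sigma_finite_measure_axioms)
  show ?thesis
  proof (rule D.PiM_eqI[symmetric, OF I])
    show "sets (density (PiM I (\<lambda>_. lborel)) (\<lambda>X. \<Prod>i\<in>I. ennreal (\<rho> (X i)))) = sets (PiM I (\<lambda>_. ?D))"
      by (simp, intro sets_PiM_cong) auto
    fix A assume A: "\<And>i. i \<in> I \<Longrightarrow> A i \<in> sets ?D"
    then have [measurable]: "\<And>i. i \<in> I \<Longrightarrow> A i \<in> sets borel" by simp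
    have "emeasure (density (PiM I (\<lambda>_. lborel)) (\<lambda>X. \<Prod>i\<in>I. ennreal (\<rho> (X i)))) (Pi\<^sub>E I A)
       = (\<integral>\<^sup>+X. (\<Prod>i\<in>I. ennreal (\<rho> (X i))) * indicator (Pi\<^sub>E I A) X \<partial>PiM I (\<lambda>_. lborel))"
      using I A by (intro emeasure_density sets_PiM_I_finite) auto
    also have "\<dots> = (\<integral>\<^sup>+X. (\<Prod>i\<in>I. ennreal (\<rho> (X i)) * indicator (A i) (X i)) \<partial>PiM I (\<lambda>_. lborel))"
    proof (rule nn_integral_cong)
      fix X assume X: "X \<in> space (PiM I (\<lambda>_. lborel :: 'a measure))"
      have "indicator (Pi\<^sub>E I A) X = (\<Prod>i\<in>I. indicator (A i) (X i) :: ennreal)"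
      proof (cases "X \<in> Pi\<^sub>E I A")
        case True
        then show ?thesis by (simp add: prod.neutral PiE_mem)
      next
        case False
        then obtain i where "i \<in> I" "X i \<notin> A i" using X by (auto simp: space_PiM PiE_iff)
        then show ?thesis using False I by (auto intro!: bexI[of _ i])
      qed
      then show "(\<Prod>i\<in>I. ennreal (\<rho> (X i))) * indicator (Pi\<^sub>E I A) X = (\<Prod>i\<in>I. ennreal (\<rho> (X i)) * indicator (A i) (X i))"
        by (simp add: prod.distrib)
    qed
    also have "\<dots> = (\<Prod>i\<in>I. \<integral>\<^sup>+u. ennreal (\<rho> u) * indicator (A i) u \<partial>lborel)"
      using I by (intro L.product_nn_integral_prod) auto
    also have "\<dots> = (\<Prod>i\<in>I. emeasure ?D (A i))"
      by (intro prod.cong refl emeasure_density[symmetric]) auto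
    finally show "emeasure (density (PiM I (\<lambda>_. lborel)) (\<lambda>X. \<Prod>i\<in>I. ennreal (\<rho> (X i)))) (Pi\<^sub>E I A) = (\<Prod>i\<in>I. emeasure ?D (A i))" .
  qed
qed

text \<open>Change of variables \<open>x = E + N\<^sup>-\<^sup>1\<^sup>/\<^sup>n z\<close>.\<close>

lemma scaled_integral_tendsto:
  fixes h \<rho> :: "'a::euclidean_space \<Rightarrow> real"
  assumes h: "continuous_on UNIV h" "compact (closure {x. h x \<noteq> 0})"
    and \<rho>[measurable]: "\<rho> \<in> borel_measurable borel" and bd: "\<And>x. \<bar>\<rho> x\<bar> \<le> C" and cont: "isCont \<rho> E"
  shows "(\<lambda>n. real (Suc n) * (\<integral>x. \<rho> x * h (real (Suc n) powr (1 / real DIM('a)) *\<^sub>R (x - E)) \<partial>lborel))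
     \<longlonglongrightarrow> \<rho> E * (\<integral>x. h x \<partial>lborel)"
proof -
  have hm[measurable]: "h \<in> borel_measurable borel" using h(1) by (rule borel_measurable_continuous_onI)
  have ih: "integrable lborel h"
  proof -
    have bK: "bounded (h ` closure {x. h x \<noteq> 0})" using h by (intro compact_imp_bounded compact_continuous_image) (auto intro: continuous_on_subset)
    then obtain B where B: "\<And>x. x \<in> closure {x. h x \<noteq> 0} \<Longrightarrow> \<bar>h x\<bar> \<le> B" unfolding bounded_iff by auto
    have fin: "emeasure lborel (closure {x. h x \<noteq> 0}) < \<infinity>" using h(2) by (intro emeasure_bounded_finite compact_imp_bounded)
    have "integrable lborel (\<lambda>x. B * indicator (closure {x. h x \<noteq> 0}) x)" using fin by (simp add: integrable_indicator_iff)
    then show ?thesis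
    proof (rule Bochner_Integration.integrable_bound)
      show "AE x in lborel. norm (h x) \<le> norm (B * indicator (closure {x. h x \<noteq> 0}) x)"
      proof (rule AE_I2)
        fix x show "norm (h x) \<le> norm (B * indicator (closure {x. h x \<noteq> 0}) x)"
          using B[of x] closure_subset[of "{x. h x \<noteq> 0}"] by (cases "h x = 0") auto
      qed
    qed simp
  qed
  define c where "c n = real (Suc n) powr (- 1 / real DIM('a))" for n
  have c: "0 < c n" for n by (simp add: c_def)
  have cinv: "real (Suc n) powr (1 / real DIM('a)) * c n = 1" for n by (simp add: c_def powr_add[symmetric])
  \<comment> \<open>The prefactor exactly cancels the Jacobian of the scaling; this singles out the
    scale at which the limit is nontrivial.\<close>
  have cd: "real (Suc n) * c n ^ DIM('a) = 1" for n
  proof -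
    have "c n ^ DIM('a) = c n powr real DIM('a)" using c[of n] by (simp add: powr_realpow)
    also have "\<dots> = real (Suc n) powr (- 1)" by (simp add: c_def powr_powr)
    finally show ?thesis by (simp add: powr_minus)
  qed
  have clim: "c \<longlonglongrightarrow> 0"
  proof -
    have "((\<lambda>x. x powr (- 1 / real DIM('a))) \<longlongrightarrow> 0) at_top"
      using DIM_positive[where 'a='a] by (intro tendsto_neg_powr filterlim_ident) auto
    then have "(\<lambda>n. real n powr (- 1 / real DIM('a))) \<longlonglongrightarrow> 0" by (rule filterlim_compose[OF _ filterlim_real_sequentially])
    then show ?thesis unfolding c_def by (rule LIMSEQ_Suc)
  qed
  have eq: "real (Suc n) * (\<integral>x. \<rho> x * h (real (Suc n) powr (1 / real DIM('a)) *\<^sub>R (x - E)) \<partial>lborel) = (\<integral>z. \<rho> (E + c n *\<^sub>R z) * h z \<partial>lborel)" for n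
  proof -
    let ?F = "\<lambda>x. \<rho> x * h (real (Suc n) powr (1 / real DIM('a)) *\<^sub>R (x - E))"
    have "(\<integral>x. ?F x \<partial>lborel) = (\<integral>x. ?F x \<partial>density (distr lborel borel (\<lambda>x. E + c n *\<^sub>R x)) (\<lambda>_. ennreal (\<bar>c n\<bar> ^ DIM('a))))"
      using lborel_affine[of "c n" E] c[of n] by simp
    also have "\<dots> = (\<integral>x. \<bar>c n\<bar> ^ DIM('a) * ?F x \<partial>distr lborel borel (\<lambda>x. E + c n *\<^sub>R x))"
      by (subst integral_density) auto
    also have "\<dots> = (\<integral>z. \<bar>c n\<bar> ^ DIM('a) * ?F (E + c n *\<^sub>R z) \<partial>lborel)"
      by (subst integral_distr) auto
    also have "\<dots> = c n ^ DIM('a) * (\<integral>z. \<rho> (E + c n *\<^sub>R z) * h z \<partial>lborel)"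
      using c[of n] cinv[of n] by simp
    finally show ?thesis using cd[of n] by (simp add: mult.assoc[symmetric])
  qed
  have "(\<lambda>n. \<integral>z. \<rho> (E + c n *\<^sub>R z) * h z \<partial>lborel) \<longlonglongrightarrow> (\<integral>z. \<rho> E * h z \<partial>lborel)"
  proof (rule integral_dominated_convergence)
    show "integrable lborel (\<lambda>z. C * \<bar>h z\<bar>)" using ih by simp
    show "AE z in lborel. (\<lambda>n. \<rho> (E + c n *\<^sub>R z) * h z) \<longlonglongrightarrow> \<rho> E * h z"
    proof (rule AE_I2)
      fix z
      have "(\<lambda>n. E + c n *\<^sub>R z) \<longlonglongrightarrow> E + 0 *\<^sub>R z" by (intro tendsto_intros clim)
      then have "(\<lambda>n. E + c n *\<^sub>R z) \<longlonglongrightarrow> E" by simp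
      from isCont_tendsto_compose[OF cont this] show "(\<lambda>n. \<rho> (E + c n *\<^sub>R z) * h z) \<longlonglongrightarrow> \<rho> E * h z" by (intro tendsto_intros)
    qed
    show "AE z in lborel. norm (\<rho> (E + c n *\<^sub>R z) * h z) \<le> C * \<bar>h z\<bar>" for n
      using bd by (intro AE_I2) (simp add: abs_mult mult_right_mono)
  qed auto
  then show ?thesis unfolding eq by simp
qed

section \<open>Pair sums and Boltzmann factors of extended real energies\<close>

lemma sum_pairs_eq:
  fixes a :: "nat \<Rightarrow> nat \<Rightarrow> real"
  assumes "\<And>i j. a i j = a j i"
  shows "(\<Sum>i\<in>{1..N}. \<Sum>j\<in>{1..N} - {i}. a i j) = 2 * (\<Sum>j\<in>{1..N}. \<Sum>i\<in>{1..<j}. a i j)"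
proof (induction N)
  case (Suc N)
  have s: "{1..Suc N} = insert (Suc N) {1..N}" by auto
  have 1: "(\<Sum>j\<in>{1..Suc N} - {i}. a i j) = a i (Suc N) + (\<Sum>j\<in>{1..N} - {i}. a i j)" if "i \<in> {1..N}" for i
  proof -
    have "{1..Suc N} - {i} = insert (Suc N) ({1..N} - {i})" using that by auto
    then show ?thesis by simp
  qed
  have 2: "{1..Suc N} - {Suc N} = {1..N}" by auto
  have 3: "{1..<Suc N} = {1..N}" by auto
  have "(\<Sum>i\<in>{1..Suc N}. \<Sum>j\<in>{1..Suc N} - {i}. a i j) = (\<Sum>j\<in>{1..N}. a (Suc N) j) + (\<Sum>i\<in>{1..N}. \<Sum>j\<in>{1..Suc N} - {i}. a i j)"
    unfolding s by (subst sum.insert) (auto simp: 2 s[symmetric])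
  also have "(\<Sum>i\<in>{1..N}. \<Sum>j\<in>{1..Suc N} - {i}. a i j) = (\<Sum>i\<in>{1..N}. a i (Suc N)) + (\<Sum>i\<in>{1..N}. \<Sum>j\<in>{1..N} - {i}. a i j)"
    using 1 by (simp add: sum.distrib)
  also have "(\<Sum>j\<in>{1..N}. a (Suc N) j) = (\<Sum>i\<in>{1..N}. a i (Suc N))" using assms by simp
  finally have "(\<Sum>i\<in>{1..Suc N}. \<Sum>j\<in>{1..Suc N} - {i}. a i j) = 2 * (\<Sum>i\<in>{1..N}. a i (Suc N)) + 2 * (\<Sum>j\<in>{1..N}. \<Sum>i\<in>{1..<j}. a i j)"
    using Suc.IH by linarith
  moreover have "(\<Sum>j\<in>{1..Suc N}. \<Sum>i\<in>{1..<j}. a i j) = (\<Sum>i\<in>{1..N}. a i (Suc N)) + (\<Sum>j\<in>{1..N}. \<Sum>i\<in>{1..<j}. a i j)"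
    unfolding s by (subst sum.insert) (simp_all only: 3, auto)
  ultimately show ?case by simp
qed simp

text \<open>The excluded value would meet \<open>\<infinity>\<close> in an undefined sum on the left
  and in a product with 0 on the right.\<close>

lemma exp_neg_add:
  assumes "a \<noteq> -\<infinity>" "b \<noteq> -\<infinity>"
  shows "exp_neg (a + b) = exp_neg a * exp_neg b"
  using assms by (cases a; cases b) (auto simp: exp_neg_def exp_add exp_diff exp_minus ennreal_mult[symmetric] field_simps)

lemma sum_ereal_neq_MInf:
  fixes f :: "'i \<Rightarrow> ereal"
  assumes "\<And>i. i \<in> I \<Longrightarrow> f i \<noteq> -\<infinity>"
  shows "(\<Sum>i\<in>I. f i) \<noteq> -\<infinity>"
  using assms by (induction I rule: infinite_finite_induct) auto

lemma exp_neg_sum: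
  assumes "finite I" "\<And>i. i \<in> I \<Longrightarrow> f i \<noteq> -\<infinity>"
  shows "exp_neg (\<Sum>i\<in>I. f i) = (\<Prod>i\<in>I. exp_neg (f i))"
  using assms
proof (induction I rule: finite_induct)
  case (insert i I)
  have "(\<Sum>i\<in>I. f i) \<noteq> -\<infinity>" using insert by (intro sum_ereal_neq_MInf) auto
  then show ?case using insert by (simp add: exp_neg_add)
qed (simp add: exp_neg_def zero_ereal_def)

lemma continuous_on_real_of_ereal_comp:
  fixes V :: "'a::topological_space \<Rightarrow> ereal"
  assumes "continuous_on S V" "\<And>x. x \<in> S \<Longrightarrow> \<bar>V x\<bar> \<noteq> \<infinity>"
  shows "continuous_on S (\<lambda>x. real_of_ereal (V x))"
  by (rule continuous_on_compose2[OF continuous_on_real assms(1)]) (use assms(2) in force)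

section \<open>Confining potentials and their equilibrium measures\<close>

locale confining_potential =
  fixes V :: "'a::euclidean_space \<Rightarrow> ereal"
  assumes V_not_MInf: "\<And>x. V x \<noteq> -\<infinity>"
    and region_open: "open (finite_region V)"
    and region_nonempty: "finite_region V \<noteq> {}"
    and V_cont: "continuous_on (finite_region V) V"
    and V_growth: "\<And>\<kappa>::real. \<kappa> \<ge> 0 \<Longrightarrow>
          (INF x\<in>finite_region V. V x - ereal (\<kappa> * log_weight x)) > -\<infinity>"
    and V_moments: "\<And>\<kappa>::real. \<kappa> \<ge> 0 \<Longrightarrow>
          (\<integral>\<^sup>+x. ennreal (norm x powr \<kappa>) * exp_neg (V x) \<partial>lborel) < \<infinity>"
begin

definition boltzmann :: "'a \<Rightarrow> real" where
  "boltzmann x = (if x \<in> finite_region V then exp (- real_of_ereal (V x)) else 0)"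

lemma region_finite: "x \<in> finite_region V \<Longrightarrow> \<bar>V x\<bar> \<noteq> \<infinity>"
  using V_not_MInf[of x] by (auto simp: finite_region_def)

lemma exp_neg_V: "exp_neg (V x) = ennreal (boltzmann x)"
  using V_not_MInf[of x] by (cases "V x") (auto simp: exp_neg_def boltzmann_def finite_region_def)

lemma boltzmann_nonneg: "0 \<le> boltzmann x"
  by (simp add: boltzmann_def)

lemma continuous_boltzmann: "continuous_on (finite_region V) boltzmann"
proof -
  have "continuous_on (finite_region V) (\<lambda>x. exp (- real_of_ereal (V x)))"
    using V_cont region_finite by (intro continuous_intros continuous_on_real_of_ereal_comp) auto
  then show ?thesis by (rule continuous_on_eq) (simp add: boltzmann_def)
qed

text \<open>The Boltzmann factor is continuous on an open set and zero off it. All measurability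
  concerning the potential comes from here.\<close>

lemma boltzmann_measurable[measurable]: "boltzmann \<in> borel_measurable borel"
proof -
  have "(\<lambda>x. if x \<in> finite_region V then boltzmann x else 0) \<in> borel_measurable borel"
    using region_open continuous_boltzmann by (intro borel_measurable_continuous_on_if) auto
  moreover have "(\<lambda>x. if x \<in> finite_region V then boltzmann x else 0) = boltzmann" by (auto simp: boltzmann_def)
  ultimately show ?thesis by simp
qed

text \<open>The growth condition in exponentiated form, with \<open>c\<close> any real number below
  the infimum.\<close>

lemma boltzmann_bounded:
  assumes "0 \<le> \<kappa>"
  obtains C where "\<And>x. boltzmann x * (1 + norm x) powr \<kappa> \<le> C"
proof -
  obtain c where c: "ereal c < (INF x\<in>finite_region V. V x - ereal (\<kappa> * log_weight x))"
    using V_growth[OF assms] ereal_dense2 by blast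
  have "boltzmann x * (1 + norm x) powr \<kappa> \<le> exp (- c)" for x
  proof (cases "x \<in> finite_region V")
    case True
    then have "ereal c < V x - ereal (\<kappa> * log_weight x)" using c by (auto intro: less_le_trans INF_lower)
    moreover obtain v where v: "V x = ereal v" using region_finite[OF True] by (cases "V x") auto
    ultimately have "\<kappa> * log_weight x - v \<le> - c" by simp
    then have "exp (\<kappa> * log_weight x - v) \<le> exp (- c)" by simp
    then show ?thesis using True v by (simp add: boltzmann_def exp_log_weight[symmetric] exp_diff exp_minus field_simps)
  qed (simp add: boltzmann_def)
  then show ?thesis by (rule that)
qed

text \<open>The assumed moments control powers of |x|, which are weak near the origin; there the
  boundedness of the Boltzmann factor is used, and for |x| > 1 the inequality 1 + |x| \<le> 2
  |x|.\<close>

lemma boltzmann_moments: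
  assumes "0 \<le> \<kappa>"
  shows "(\<integral>\<^sup>+x. ennreal (boltzmann x * (1 + norm x) powr \<kappa>) \<partial>lborel) < \<infinity>"
proof -
  obtain C where C: "\<And>x. boltzmann x * (1 + norm x) powr 0 \<le> C" by (rule boltzmann_bounded[of 0]) auto
  have bC: "boltzmann x \<le> C" for x using C[of x] by simp
  have C0: "0 \<le> C" using order_trans[OF boltzmann_nonneg bC] .
  have m: "cball 0 1 \<in> sets (lborel :: 'a measure)" by simp
  have "(\<integral>\<^sup>+x. ennreal (boltzmann x * (1 + norm x) powr \<kappa>) \<partial>lborel)
     \<le> (\<integral>\<^sup>+x. ennreal (2 powr \<kappa> * C) * indicator (cball 0 1) x + ennreal (2 powr \<kappa>) * (ennreal (norm x powr \<kappa>) * exp_neg (V x)) \<partial>lborel)"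
  proof (rule nn_integral_mono)
    fix x :: 'a
    show "ennreal (boltzmann x * (1 + norm x) powr \<kappa>)
      \<le> ennreal (2 powr \<kappa> * C) * indicator (cball 0 1) x + ennreal (2 powr \<kappa>) * (ennreal (norm x powr \<kappa>) * exp_neg (V x))"
    proof (cases "norm x \<le> 1")
      case True
      have "boltzmann x * (1 + norm x) powr \<kappa> \<le> C * 2 powr \<kappa>"
        using True assms C0 by (intro mult_mono bC powr_mono2) auto
      then have "ennreal (boltzmann x * (1 + norm x) powr \<kappa>) \<le> ennreal (2 powr \<kappa> * C) * indicator (cball 0 1) x"
        using True by (simp add: ennreal_leI mult.commute)
      then show ?thesis by (rule order_trans) simp
    next
      case False
      have "(1 + norm x) powr \<kappa> \<le> (2 * norm x) powr \<kappa>" using False assms by (intro powr_mono2) auto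
      also have "\<dots> = 2 powr \<kappa> * norm x powr \<kappa>" by (simp add: powr_mult)
      finally have "boltzmann x * (1 + norm x) powr \<kappa> \<le> boltzmann x * (2 powr \<kappa> * norm x powr \<kappa>)"
        using boltzmann_nonneg by (intro mult_left_mono)
      then have "ennreal (boltzmann x * (1 + norm x) powr \<kappa>) \<le> ennreal (boltzmann x * (2 powr \<kappa> * norm x powr \<kappa>))" by (rule ennreal_leI)
      also have "\<dots> = ennreal (2 powr \<kappa>) * (ennreal (norm x powr \<kappa>) * exp_neg (V x))"
        unfolding exp_neg_V using boltzmann_nonneg[of x] by (simp add: ennreal_mult[symmetric] mult_ac)
      finally show ?thesis by (rule order_trans) simp
    qed
  qed
  also have "\<dots> = ennreal (2 powr \<kappa> * C) * emeasure lborel (cball 0 1 :: 'a set) + ennreal (2 powr \<kappa>) * (\<integral>\<^sup>+x. ennreal (norm x powr \<kappa>) * exp_neg (V x) \<partial>lborel)"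
  proof -
    have m1: "(\<lambda>x. ennreal (2 powr \<kappa> * C) * indicator (cball 0 1) x) \<in> borel_measurable (lborel :: 'a measure)"
      using m by (intro borel_measurable_times_ennreal borel_measurable_const borel_measurable_indicator)
    have m2: "(\<lambda>x. ennreal (norm x powr \<kappa>) * exp_neg (V x)) \<in> borel_measurable lborel" unfolding exp_neg_V by measurable
    show ?thesis
      unfolding nn_integral_add[OF m1 borel_measurable_times_ennreal[OF borel_measurable_const m2]]
        nn_integral_cmult_indicator[OF m] nn_integral_cmult[OF m2] ..
  qed
  also have "\<dots> < \<infinity>"
    using V_moments[OF assms] emeasure_bounded_finite[of "cball 0 1 :: 'a set"] by (simp add: ennreal_mult_less_top)
  finally show ?thesis .
qed

definition total_mass :: real where "total_mass = enn2real (\<integral>\<^sup>+x. ennreal (boltzmann x) \<partial>lborel)"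

lemma total_mass: "(\<integral>\<^sup>+x. ennreal (boltzmann x) \<partial>lborel) = ennreal total_mass" "0 < total_mass"
proof -
  have fin: "(\<integral>\<^sup>+x. ennreal (boltzmann x) \<partial>lborel) < \<infinity>" using boltzmann_moments[of 0] by simp
  then show eq: "(\<integral>\<^sup>+x. ennreal (boltzmann x) \<partial>lborel) = ennreal total_mass" by (simp add: total_mass_def less_top)
  have "(\<integral>\<^sup>+x. ennreal (boltzmann x) \<partial>lborel) \<noteq> 0"
  proof
    assume "(\<integral>\<^sup>+x. ennreal (boltzmann x) \<partial>lborel) = 0"
    then have "AE x in lborel. ennreal (boltzmann x) = 0" by (subst (asm) nn_integral_0_iff_AE) auto
    then have ae: "AE x in lborel. x \<notin> finite_region V" by eventually_elim (auto simp: boltzmann_def)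
    obtain x e where x: "0 < e" "ball x e \<subseteq> finite_region V" using region_open region_nonempty by (meson ex_in_conv openE)
    have "AE y in lborel. y \<notin> ball x e" using ae by eventually_elim (use x in auto)
    then have "emeasure lborel (ball x e) = 0" by (subst (asm) AE_iff_measurable[OF _ refl]) (auto simp: ball_def)
    then have "measure lborel (ball x e) = 0" by (simp add: measure_def)
    then show False using content_ball_pos[OF x(1), of x] by simp
  qed
  then show "0 < total_mass" using eq by (metis ennreal_neg leI)
qed

text \<open>The reference measure is the normalised Boltzmann factor \<open>w\<close>, tame by the
  growth and moment conditions. With \<open>g\<close> the solution of the fixed-point equation
  relative to it, \<open>w * g\<close> is the density with respect to Lebesgue measure; it is
  bounded because \<open>w\<close> decays faster than the envelope of \<open>g\<close> grows. The
  normalisations of \<open>w\<close> and \<open>g\<close> merge into one constant.\<close>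

lemma equilibrium_measure_exists:
  assumes \<gamma>: "0 \<le> \<gamma>"
  obtains \<rho> Z C where "\<rho> \<in> borel_measurable borel" "\<And>x. 0 \<le> \<rho> x" "\<And>x. \<rho> x \<le> C" "0 < Z"
    "tame_measure (density lborel (\<lambda>u. ennreal (\<rho> u)))"
    "\<And>x. \<rho> x = boltzmann x * exp (\<gamma> * tame_measure.pot (density lborel (\<lambda>u. ennreal (\<rho> u))) x) / Z"
proof -
  define w where "w x = boltzmann x / total_mass" for x
  have w0: "0 \<le> w x" for x using total_mass(2) boltzmann_nonneg[of x] by (simp add: w_def)
  have [measurable]: "w \<in> borel_measurable borel" unfolding w_def by measurable
  let ?N = "density lborel (\<lambda>u. ennreal (w u))"
  have wint: "(\<integral>\<^sup>+u. ennreal (w u * g u) \<partial>lborel) = (\<integral>\<^sup>+u. ennreal (boltzmann u * g u) \<partial>lborel) / ennreal total_mass"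
    if [measurable]: "g \<in> borel_measurable borel" and "\<And>u. 0 \<le> g u" for g
  proof -
    have "(\<integral>\<^sup>+u. ennreal (w u * g u) \<partial>lborel) = (\<integral>\<^sup>+u. ennreal (boltzmann u * g u) / ennreal total_mass \<partial>lborel)"
      using total_mass(2) boltzmann_nonneg that(2) by (intro nn_integral_cong) (simp add: w_def divide_ennreal)
    then show ?thesis by (simp add: nn_integral_divide)
  qed
  have "tame_measure ?N"
  proof (rule tame_measure_density_lborel)
    show "(\<integral>\<^sup>+u. ennreal (w u) \<partial>lborel) = 1"
      using wint[of "\<lambda>_. 1"] total_mass by (simp add: ennreal_divide_self)
    show "\<exists>C. \<forall>u. w u * (1 + norm u) powr \<kappa> \<le> C" if \<kappa>: "0 \<le> \<kappa>" for \<kappa>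
    proof -
      obtain C where "\<And>x. boltzmann x * (1 + norm x) powr \<kappa> \<le> C" using boltzmann_bounded[OF \<kappa>] by blast
      then have "w u * (1 + norm u) powr \<kappa> \<le> C / total_mass" for u
        using total_mass(2) by (simp add: w_def divide_right_mono)
      then show ?thesis by blast
    qed
    show "(\<integral>\<^sup>+u. ennreal (w u * (1 + norm u) powr \<kappa>) \<partial>lborel) < \<infinity>" if \<kappa>: "0 \<le> \<kappa>" for \<kappa>
      using wint[of "\<lambda>u. (1 + norm u) powr \<kappa>"] boltzmann_moments[OF \<kappa>] total_mass(2)
      by (simp add: ennreal_divide_eq_top_iff less_top[symmetric])
  qed (use w0 in auto)
  then interpret N: mean_field ?N \<gamma> by (intro mean_field.intro mean_field_axioms.intro \<gamma>)
  obtain g Z where g: "g \<in> N.densities" "0 < Z" "\<And>x. g x = exp (\<gamma> * N.field g x) / Z"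
    using N.equilibrium_exists by blast
  note gD = N.densitiesD[OF g(1)]
  note [measurable] = gD(1)
  define \<rho> where "\<rho> x = w x * g x" for x
  have meas: "\<rho> \<in> borel_measurable borel" unfolding \<rho>_def by measurable
  have dens: "density ?N (\<lambda>u. ennreal (g u)) = density lborel (\<lambda>u. ennreal (\<rho> u))"
    unfolding \<rho>_def using w0 gD(2) by (subst density_density_eq) (auto simp: ennreal_mult)
  have tame: "tame_measure (density lborel (\<lambda>u. ennreal (\<rho> u)))" using N.tame_densities[OF g(1)] unfolding dens .
  interpret M: tame_measure "density lborel (\<lambda>u. ennreal (\<rho> u))" by (rule tame)
  have pot: "M.pot x = N.field g x" for x
    unfolding M.pot_def N.field_def using N.density_integral[OF g(1), of "log_dist x"] by (simp add: dens mult.commute)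
  obtain C where C: "\<And>x. boltzmann x * (1 + norm x) powr \<gamma> \<le> C" using boltzmann_bounded[OF \<gamma>] by blast
  have bd: "\<rho> x \<le> N.env_const * (C / total_mass)" for x
  proof -
    have "\<rho> x \<le> w x * N.env x" unfolding \<rho>_def using gD(3) w0 by (intro mult_left_mono)
    also have "\<dots> = N.env_const * (boltzmann x * (1 + norm x) powr \<gamma> / total_mass)" unfolding N.env_def by (simp add: w_def)
    also have "\<dots> \<le> N.env_const * (C / total_mass)"
      using C[of x] total_mass(2) N.env_ge_1(1) by (intro mult_left_mono divide_right_mono) auto
    finally show ?thesis .
  qed
  show ?thesis
  proof (rule that[OF meas _ bd _ tame])
    show "0 \<le> \<rho> x" for x using w0 gD(2) by (simp add: \<rho>_def)
    show "0 < total_mass * Z" using total_mass(2) g(2) by simp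
    show "\<rho> x = boltzmann x * exp (\<gamma> * M.pot x) / (total_mass * Z)" for x
    proof -
      have "g x = exp (\<gamma> * M.pot x) / Z" unfolding pot by (rule g(3))
      moreover have "\<rho> x = boltzmann x / total_mass * g x" by (simp add: \<rho>_def w_def)
      ultimately show ?thesis by simp
    qed
  qed
qed

text \<open>If two points coincide both sides vanish: the energy is infinite since
  \<open>\<beta> > 0\<close>, and \<open>0 powr \<beta> = 0\<close>. The product formula thus has no
  exceptional set, and it makes the Gibbs weight visibly measurable.\<close>

lemma exp_neg_gibbs_energy:
  assumes \<beta>: "0 < \<beta>"
  shows "exp_neg (gibbs_energy V \<beta> N X)
    = ennreal ((\<Prod>j\<in>{1..N}. boltzmann (X j)) * (\<Prod>j\<in>{1..N}. \<Prod>i\<in>{1..<j}. norm (X i - X j) powr \<beta>))"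
proof -
  let ?S = "\<Sum>j\<in>{1..N}. \<Sum>i\<in>{1..<j}. log_kernel (X i) (X j)"
  have sV: "(\<Sum>j\<in>{1..N}. V (X j)) \<noteq> -\<infinity>" using V_not_MInf by (rule sum_ereal_neq_MInf)
  have eV: "exp_neg (\<Sum>j\<in>{1..N}. V (X j)) = ennreal (\<Prod>j\<in>{1..N}. boltzmann (X j))"
    using V_not_MInf by (simp add: exp_neg_sum exp_neg_V prod_ennreal boltzmann_nonneg)
  have S: "ereal \<beta> * ?S \<noteq> -\<infinity> \<and> exp_neg (ereal \<beta> * ?S) = ennreal (\<Prod>j\<in>{1..N}. \<Prod>i\<in>{1..<j}. norm (X i - X j) powr \<beta>)"
  proof (cases "\<exists>j\<in>{1..N}. \<exists>i\<in>{1..<j}. X i = X j")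
    case True
    then obtain i j where ij: "j \<in> {1..N}" "i \<in> {1..<j}" "X i = X j" by blast
    have "(\<Sum>i\<in>{1..<j}. log_kernel (X i) (X j)) = \<infinity>"
      using ij by (subst sum_Pinfty) (auto simp: log_kernel_def)
    then have Sinf: "?S = \<infinity>" using ij(1) by (subst sum_Pinfty) auto
    have P0: "(\<Prod>j\<in>{1..N}. \<Prod>i\<in>{1..<j}. norm (X i - X j) powr \<beta>) = 0"
    proof -
      have z: "norm (X i - X j) powr \<beta> = 0" using ij(3) by simp
      then have "\<exists>i\<in>{1..<j}. norm (X i - X j) powr \<beta> = 0" using ij(2) by blast
      then have "(\<Prod>i\<in>{1..<j}. norm (X i - X j) powr \<beta>) = 0" by (rule prod_zero[OF finite_atLeastLessThan])
      then have "\<exists>j\<in>{1..N}. (\<Prod>i\<in>{1..<j}. norm (X i - X j) powr \<beta>) = 0" using ij(1) by blast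
      then show ?thesis by (rule prod_zero[OF finite_atLeastAtMost])
    qed
    show ?thesis unfolding Sinf P0 using \<beta> by (simp add: exp_neg_def)
  next
    case False
    have "?S = (\<Sum>j\<in>{1..N}. \<Sum>i\<in>{1..<j}. ereal (ln (inverse (norm (X i - X j)))))"
      using False by (intro sum.cong refl) (auto simp: log_kernel_def)
    also have "\<dots> = ereal (\<Sum>j\<in>{1..N}. \<Sum>i\<in>{1..<j}. ln (inverse (norm (X i - X j))))" by simp
    finally have S: "?S = ereal (\<Sum>j\<in>{1..N}. \<Sum>i\<in>{1..<j}. ln (inverse (norm (X i - X j))))" .
    have "exp (- (\<beta> * (\<Sum>j\<in>{1..N}. \<Sum>i\<in>{1..<j}. ln (inverse (norm (X i - X j)))))) = (\<Prod>j\<in>{1..N}. \<Prod>i\<in>{1..<j}. exp (- (\<beta> * ln (inverse (norm (X i - X j))))))"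
      by (simp add: sum_distrib_left sum_negf[symmetric] exp_sum)
    also have "\<dots> = (\<Prod>j\<in>{1..N}. \<Prod>i\<in>{1..<j}. norm (X i - X j) powr \<beta>)"
    proof (intro prod.cong refl)
      fix j i assume "j \<in> {1..N}" "i \<in> {1..<j}"
      then have "0 < norm (X i - X j)" using False by auto
      then show "exp (- (\<beta> * ln (inverse (norm (X i - X j))))) = norm (X i - X j) powr \<beta>"
        by (simp add: powr_def ln_inverse)
    qed
    finally show ?thesis unfolding S by (simp add: exp_neg_def)
  qed
  show ?thesis
    unfolding gibbs_energy_def using S sV eV
    by (subst exp_neg_add) (auto simp: ennreal_mult[symmetric] prod_nonneg boltzmann_nonneg mult.commute)
qed

end

context gibbs_limit
begin

text \<open>Needed for every n, because each Gibbs measure has to be a probability measure, while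
  \<open>mass_ge\<close> and \<open>mass_finite\<close> hold only eventually. Positivity is Jensen's
  inequality; for finiteness the crude bound \<open>log_dist_le\<close> in each pair is enough, as
  \<open>M\<close> has moments of every order.\<close>

lemma gibbs_mass_pos_finite: "0 < gibbs_mass n (\<lambda>_ _. 0)" "gibbs_mass n (\<lambda>_ _. 0) < \<infinity>"
proof -
  let ?I = "{1..Suc n}"
  interpret I: prob_space "iid ?I" by (rule prob_space_iid)
  have "0 < ennreal (exp (\<integral>X. gibbs_log (b n) \<gamma> ?I X \<partial>iid ?I))" by simp
  also have "\<dots> \<le> gibbs_mass n (\<lambda>_ _. 0)"
    unfolding gibbs_mass_def using I.exp_expectation_le[OF integral_gibbs_log(1)[of ?I]] by simp
  finally show "0 < gibbs_mass n (\<lambda>_ _. 0)" .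
  define c where "c = real n * b n"
  define k where "k = \<gamma> * \<bar>pot_energy\<bar> / 2 + \<gamma> * (2 * tame_const 0)"
  have c: "0 \<le> c" using b_nonneg[of n] by (simp add: c_def)
  have le: "gibbs_log (b n) \<gamma> ?I X \<le> (\<Sum>i\<in>?I. k + c * log_weight (X i))" for X
  proof -
    have "(\<Sum>i\<in>?I. \<Sum>j\<in>?I - {i}. log_dist (X i) (X j)) \<le> (\<Sum>i\<in>?I. \<Sum>j\<in>?I - {i}. log_weight (X i) + log_weight (X j))"
      by (intro sum_mono log_dist_le)
    also have "\<dots> = (\<Sum>i\<in>?I. 2 * real n * log_weight (X i))"
    proof -
      have "(\<Sum>j\<in>?I - {i}. log_weight (X i) + log_weight (X j)) = (real n - 1) * log_weight (X i) + (\<Sum>j\<in>?I. log_weight (X j))" if "i \<in> ?I" for i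
        using that by (simp add: sum.distrib sum_diff1 algebra_simps)
      then have "(\<Sum>i\<in>?I. \<Sum>j\<in>?I - {i}. log_weight (X i) + log_weight (X j))
         = (\<Sum>i\<in>?I. (real n - 1) * log_weight (X i) + (\<Sum>j\<in>?I. log_weight (X j)))" by (rule sum.cong[OF refl])
      also have "\<dots> = (\<Sum>i\<in>?I. 2 * real n * log_weight (X i))"
        unfolding sum.distrib sum_distrib_left[symmetric] sum_constant by (simp add: algebra_simps)
      finally show ?thesis .
    qed
    finally have "b n / 2 * (\<Sum>i\<in>?I. \<Sum>j\<in>?I - {i}. log_dist (X i) (X j)) \<le> b n / 2 * (\<Sum>i\<in>?I. 2 * real n * log_weight (X i))"
      using b_nonneg[of n] by (intro mult_left_mono) auto
    also have "\<dots> = (\<Sum>i\<in>?I. c * log_weight (X i))" by (simp only: sum_distrib_left) (simp add: c_def mult_ac)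
    finally have 1: "b n / 2 * (\<Sum>i\<in>?I. \<Sum>j\<in>?I - {i}. log_dist (X i) (X j)) \<le> (\<Sum>i\<in>?I. c * log_weight (X i))" .
    have 2: "(\<Sum>i\<in>?I. \<gamma> * pot_energy / 2 - \<gamma> * pot (X i)) \<le> (\<Sum>i\<in>?I. k)"
    proof (rule sum_mono)
      fix i
      have "\<gamma> * pot_energy \<le> \<gamma> * \<bar>pot_energy\<bar>" "\<gamma> * (- 2 * tame_const 0) \<le> \<gamma> * pot (X i)"
        using \<gamma>_nonneg pot_ge[of "X i"] by (intro mult_left_mono; simp)+
      then show "\<gamma> * pot_energy / 2 - \<gamma> * pot (X i) \<le> k" by (simp add: k_def)
    qed
    show ?thesis unfolding gibbs_log_def sum.distrib using 1 2 by linarith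
  qed
  have "gibbs_mass n (\<lambda>_ _. 0) \<le> (\<integral>\<^sup>+X. ennreal (exp (\<Sum>i\<in>?I. k + c * log_weight (X i))) \<partial>iid ?I)"
    unfolding gibbs_mass_def using le by (intro nn_integral_mono ennreal_leI) simp
  also have "\<dots> = (\<integral>\<^sup>+u. ennreal (exp (k + c * log_weight u)) \<partial>M) ^ card ?I"
    by (rule nn_integral_iid_exp_sum) auto
  also have "(\<integral>\<^sup>+u. ennreal (exp (k + c * log_weight u)) \<partial>M) = ennreal (exp k * (\<integral>u. (1 + norm u) powr c \<partial>M))"
  proof -
    have "exp (k + c * log_weight u) = exp k * (1 + norm u) powr c" for u :: 'a unfolding exp_add exp_log_weight ..
    then have "(\<integral>\<^sup>+u. ennreal (exp (k + c * log_weight u)) \<partial>M) = (\<integral>\<^sup>+u. ennreal (exp k * (1 + norm u) powr c) \<partial>M)" by simp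
    also have "\<dots> = ennreal (\<integral>u. exp k * (1 + norm u) powr c \<partial>M)"
      using integrable_powr[OF c] by (intro nn_integral_eq_integral) auto
    finally show ?thesis by simp
  qed
  also have "ennreal (exp k * (\<integral>u. (1 + norm u) powr c \<partial>M)) ^ card ?I < \<infinity>"
    by (subst ennreal_power) (auto intro!: mult_nonneg_nonneg Bochner_Integration.integral_nonneg)
  finally show "gibbs_mass n (\<lambda>_ _. 0) < \<infinity>" .
qed

end

section \<open>The rescaled process under the Gibbs measure\<close>

lemma emeasure_rescaled_process:
  fixes X :: "nat \<Rightarrow> 'a::euclidean_space"
  assumes "B \<in> sets borel"
  shows "emeasure (rescaled_process E N X) B = (\<Sum>j\<in>{1..N}. indicator B ((real N powr (1 / real DIM('a))) *\<^sub>R (X j - E)))"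
    "\<exists>k::nat. emeasure (rescaled_process E N X) B = of_nat k"
proof -
  let ?g = "\<lambda>j. (real N powr (1 / real DIM('a))) *\<^sub>R (X j - E)"
  have e: "emeasure (rescaled_process E N X) B = of_nat (card {j \<in> {1..N}. ?g j \<in> B})"
  proof -
    have "emeasure (rescaled_process E N X) B = emeasure (count_space {1..N}) (?g -` B \<inter> space (count_space {1..N}))"
      unfolding rescaled_process_def using assms by (subst emeasure_distr) auto
    also have "?g -` B \<inter> space (count_space {1..N}) = {j \<in> {1..N}. ?g j \<in> B}" by auto
    also have "emeasure (count_space {1..N}) {j \<in> {1..N}. ?g j \<in> B} = of_nat (card {j \<in> {1..N}. ?g j \<in> B})"
      by (subst emeasure_count_space) auto
    finally show ?thesis .
  qed
  then show "\<exists>k::nat. emeasure (rescaled_process E N X) B = of_nat k" by blast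
  show "emeasure (rescaled_process E N X) B = (\<Sum>j\<in>{1..N}. indicator B (?g j))"
    unfolding e by (simp add: indicator_def sum.If_cases Int_def)
qed

lemma integral_rescaled_process:
  fixes f :: "'a::euclidean_space \<Rightarrow> real"
  assumes "f \<in> borel_measurable borel"
  shows "(\<integral>x. f x \<partial>rescaled_process E N X) = (\<Sum>j\<in>{1..N}. f ((real N powr (1 / real DIM('a))) *\<^sub>R (X j - E)))"
  unfolding rescaled_process_def using assms
  by (subst integral_distr) (auto simp: lebesgue_integral_count_space_finite)

text \<open>The equation for \<open>\<rho>\<close> is required at every point and not just almost
  everywhere, because the value and the continuity of \<open>\<rho>\<close> at the single point
  \<open>E\<close> matter in the end.\<close>

locale gibbs_equilibrium = confining_potential V for V :: "'a::euclidean_space \<Rightarrow> ereal" +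
  fixes \<beta> :: "nat \<Rightarrow> real" and \<gamma> :: real and \<rho> :: "'a \<Rightarrow> real" and Z C :: real
  assumes \<beta>_pos: "\<And>N. N \<ge> 1 \<Longrightarrow> \<beta> N > 0" and \<gamma>_ge_0: "\<gamma> \<ge> 0"
    and \<beta>_lim: "(\<lambda>N. real N * \<beta> N) \<longlonglongrightarrow> \<gamma>"
    and \<rho>_meas[measurable]: "\<rho> \<in> borel_measurable borel" and \<rho>_nonneg: "\<And>x. 0 \<le> \<rho> x" and \<rho>_le: "\<And>x. \<rho> x \<le> C"
    and Z_pos: "0 < Z" and tame_\<rho>: "tame_measure (density lborel (\<lambda>u. ennreal (\<rho> u)))"
    and \<rho>_eq: "\<And>x. \<rho> x = boltzmann x * exp (\<gamma> * tame_measure.pot (density lborel (\<lambda>u. ennreal (\<rho> u))) x) / Z"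
begin

abbreviation "\<mu> \<equiv> density lborel (\<lambda>u. ennreal (\<rho> u))"

text \<open>A shift of index: in a system of n + 1 points with coupling
  \<open>\<beta> (Suc n)\<close> each point sees n others. The difference between the factors n and
  n + 1 is a single \<open>\<beta> (Suc n)\<close>, which tends to 0.\<close>

sublocale mu: gibbs_limit \<mu> "\<lambda>n. \<beta> (Suc n)" \<gamma>
proof (intro gibbs_limit.intro tame_\<rho> gibbs_limit_axioms.intro \<gamma>_ge_0)
  show "0 \<le> \<beta> (Suc n)" for n using \<beta>_pos[of "Suc n"] by simp
  have 1: "(\<lambda>n. real (Suc n) * \<beta> (Suc n)) \<longlonglongrightarrow> \<gamma>" by (rule LIMSEQ_Suc[OF \<beta>_lim])
  have "(\<lambda>n. (real (Suc n) * \<beta> (Suc n)) * (1 / real (Suc n))) \<longlonglongrightarrow> \<gamma> * 0"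
    by (intro tendsto_mult 1 LIMSEQ_Suc[OF lim_1_over_n])
  then have 2: "(\<lambda>n. \<beta> (Suc n)) \<longlonglongrightarrow> 0" by simp
  have "(\<lambda>n. real (Suc n) * \<beta> (Suc n) - \<beta> (Suc n)) \<longlonglongrightarrow> \<gamma> - 0" by (intro tendsto_diff 1 2)
  then show "(\<lambda>n. real n * \<beta> (Suc n)) \<longlonglongrightarrow> \<gamma>" by (simp add: algebra_simps)
qed

text \<open>The constant between the Gibbs weight and the exponential of \<open>gibbs_log\<close>
  relative to independent points. Each point contributes \<open>Z\<close>, from the equation for
  \<open>\<rho>\<close>, and the exponential that undoes the constant term of the centring in
  \<open>gibbs_log\<close>. It cancels in all ratios.\<close>

definition gibbs_factor :: "nat \<Rightarrow> real" where
  "gibbs_factor n = (Z * exp (- (\<gamma> * mu.pot_energy / 2))) ^ Suc n"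

lemma gibbs_factor_pos: "0 < gibbs_factor n"
  using Z_pos by (simp add: gibbs_factor_def)

text \<open>The change of reference measure. By the equation for \<open>\<rho>\<close> the potential
  V is absorbed entirely into the law of the independent points, and only the centred pair
  interaction is left.\<close>

lemma gibbs_integral:
  assumes [measurable]: "h \<in> borel_measurable borel"
  shows "(\<integral>\<^sup>+X. exp_neg (gibbs_energy V (\<beta> (Suc n)) (Suc n) X) * ennreal (exp (- (\<Sum>j\<in>{1..Suc n}. h (X j)))) \<partial>(\<Pi>\<^sub>M j\<in>{1..Suc n}. lborel))
    = ennreal (gibbs_factor n) * mu.gibbs_mass n (\<lambda>_. h)"
proof -
  let ?I = "{1..Suc n}" and ?b = "\<beta> (Suc n)"
  have b: "0 < ?b" by (rule \<beta>_pos) simp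
  define W where "W X = (\<Prod>j\<in>?I. \<Prod>i\<in>{1..<j}. norm (X i - X j) powr ?b)" for X :: "nat \<Rightarrow> 'a"
  define q where "q x = exp (\<gamma> * mu.pot_energy / 2 - \<gamma> * mu.pot x)" for x
  define e where "e X = exp (- (\<Sum>j\<in>?I. h (X j)))" for X :: "nat \<Rightarrow> 'a"
  define G where "G X = ennreal (W X * (\<Prod>j\<in>?I. q (X j)) * e X)" for X
  have W0: "0 \<le> W X" for X unfolding W_def by (intro prod_nonneg ballI) simp
  have q0: "0 \<le> q x" for x by (simp add: q_def)
  have Gm: "G \<in> borel_measurable (\<Pi>\<^sub>M j\<in>?I. lborel)"
    unfolding G_def W_def q_def e_def by measurable
  have "mu.gibbs_mass n (\<lambda>_. h) = (\<integral>\<^sup>+X. G X \<partial>mu.iid ?I)"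
    unfolding mu.gibbs_mass_def
  proof (rule nn_integral_cong_AE)
    \<comment> \<open>For coinciding points the exponential of \<open>log_dist\<close> would give a
      factor 1 where the power of the norm gives 0; this concerns a null set only.\<close>
    have "AE X in mu.iid ?I. inj_on X ?I" by (rule mu.AE_iid_inj) simp
    then show "AE X in mu.iid ?I. ennreal (exp (mu.gibbs_log ?b \<gamma> ?I X - (\<Sum>j\<in>?I. h (X j)))) = G X"
    proof eventually_elim
      case (elim X)
      have "?b / 2 * (\<Sum>i\<in>?I. \<Sum>j\<in>?I - {i}. log_dist (X i) (X j)) = ?b * (\<Sum>j\<in>?I. \<Sum>i\<in>{1..<j}. log_dist (X i) (X j))"
        by (subst sum_pairs_eq, rule log_dist_commute, simp only: times_divide_eq_left mult.left_commute[of _ 2])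
      also have "\<dots> = (\<Sum>j\<in>?I. \<Sum>i\<in>{1..<j}. ?b * log_dist (X i) (X j))" by (simp only: sum_distrib_left)
      finally have pairs: "?b / 2 * (\<Sum>i\<in>?I. \<Sum>j\<in>?I - {i}. log_dist (X i) (X j)) = (\<Sum>j\<in>?I. \<Sum>i\<in>{1..<j}. ?b * log_dist (X i) (X j))" .
      have "exp (mu.gibbs_log ?b \<gamma> ?I X) = (\<Prod>j\<in>?I. \<Prod>i\<in>{1..<j}. exp (?b * log_dist (X i) (X j))) * (\<Prod>j\<in>?I. q (X j))"
        unfolding mu.gibbs_log_def q_def pairs by (simp only: exp_add exp_sum finite_atLeastAtMost finite_atLeastLessThan)
      also have "(\<Prod>j\<in>?I. \<Prod>i\<in>{1..<j}. exp (?b * log_dist (X i) (X j))) = W X"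
        unfolding W_def
      proof (intro prod.cong refl)
        fix j i assume "j \<in> ?I" "i \<in> {1..<j}"
        then have "X i \<noteq> X j" using elim inj_onD[OF elim, of i j] by auto
        then show "exp (?b * log_dist (X i) (X j)) = norm (X i - X j) powr ?b" by (simp add: powr_def log_dist_def)
      qed
      finally show ?case unfolding G_def e_def by (simp only: diff_conv_add_uminus exp_add)
    qed
  qed
  also have "\<dots> = (\<integral>\<^sup>+X. G X \<partial>density (\<Pi>\<^sub>M j\<in>?I. lborel) (\<lambda>X. \<Prod>i\<in>?I. ennreal (\<rho> (X i))))"
    by (subst PiM_density_lborel[OF \<rho>_meas mu.prob_space_axioms]) auto
  also have "\<dots> = (\<integral>\<^sup>+X. (\<Prod>i\<in>?I. ennreal (\<rho> (X i))) * G X \<partial>(\<Pi>\<^sub>M j\<in>?I. lborel))"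
    by (rule nn_integral_density[OF _ Gm]) measurable
  finally have gm: "mu.gibbs_mass n (\<lambda>_. h) = (\<integral>\<^sup>+X. (\<Prod>i\<in>?I. ennreal (\<rho> (X i))) * G X \<partial>(\<Pi>\<^sub>M j\<in>?I. lborel))" .
  have rm: "(\<lambda>X. \<Prod>i\<in>?I. ennreal (\<rho> (X i))) \<in> borel_measurable (\<Pi>\<^sub>M j\<in>?I. lborel)" by measurable
  have "ennreal (gibbs_factor n) * mu.gibbs_mass n (\<lambda>_. h) = (\<integral>\<^sup>+X. ennreal (gibbs_factor n) * ((\<Prod>i\<in>?I. ennreal (\<rho> (X i))) * G X) \<partial>(\<Pi>\<^sub>M j\<in>?I. lborel))"
    unfolding gm by (rule nn_integral_cmult[symmetric]) (intro borel_measurable_times_ennreal rm Gm)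
  also have "\<dots> = (\<integral>\<^sup>+X. exp_neg (gibbs_energy V ?b (Suc n) X) * ennreal (e X) \<partial>(\<Pi>\<^sub>M j\<in>?I. lborel))"
  proof (rule nn_integral_cong)
    fix X :: "nat \<Rightarrow> 'a"
    \<comment> \<open>The share of a single point: \<open>q\<close> undoes the factor exp (gamma
      \<open>pot\<close>) contained in \<open>\<rho>\<close>.\<close>
    have one: "Z * exp (- (\<gamma> * mu.pot_energy / 2)) * \<rho> x * q x = boltzmann x" for x
    proof -
      have "exp (- (\<gamma> * mu.pot_energy / 2)) * exp (\<gamma> * mu.pot x) * q x = 1"
        unfolding q_def exp_add[symmetric] by simp
      then have 1: "boltzmann x * (exp (- (\<gamma> * mu.pot_energy / 2)) * exp (\<gamma> * mu.pot x) * q x) = boltzmann x" by simp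
      have 2: "Z * \<rho> x = boltzmann x * exp (\<gamma> * mu.pot x)" by (subst \<rho>_eq) (use Z_pos in simp)
      have "Z * exp (- (\<gamma> * mu.pot_energy / 2)) * \<rho> x * q x = (Z * \<rho> x) * (exp (- (\<gamma> * mu.pot_energy / 2)) * q x)"
        by (simp only: mult_ac)
      also have "\<dots> = boltzmann x * (exp (- (\<gamma> * mu.pot_energy / 2)) * exp (\<gamma> * mu.pot x) * q x)"
        unfolding 2 by (simp only: mult_ac)
      also note 1
      finally show ?thesis .
    qed
    have "gibbs_factor n * (\<Prod>i\<in>?I. \<rho> (X i)) * (\<Prod>j\<in>?I. q (X j)) = (\<Prod>j\<in>?I. Z * exp (- (\<gamma> * mu.pot_energy / 2)) * \<rho> (X j) * q (X j))"
      by (simp only: prod.distrib prod_constant gibbs_factor_def power_mult_distrib card_atLeastAtMost diff_Suc_1)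
    also have "\<dots> = (\<Prod>j\<in>?I. boltzmann (X j))" unfolding one ..
    finally have prodeq: "gibbs_factor n * (\<Prod>i\<in>?I. \<rho> (X i)) * (\<Prod>j\<in>?I. q (X j)) = (\<Prod>j\<in>?I. boltzmann (X j))" .
    have "ennreal (gibbs_factor n) * ((\<Prod>i\<in>?I. ennreal (\<rho> (X i))) * G X)
      = ennreal (gibbs_factor n * ((\<Prod>i\<in>?I. \<rho> (X i)) * (W X * (\<Prod>j\<in>?I. q (X j)) * e X)))"
    proof -
      have "(\<Prod>i\<in>?I. ennreal (\<rho> (X i))) = ennreal (\<Prod>i\<in>?I. \<rho> (X i))" by (rule prod_ennreal) (rule \<rho>_nonneg)
      moreover have "ennreal a * (ennreal c * ennreal d) = ennreal (a * (c * d))" if "0 \<le> a" "0 \<le> c" "0 \<le> d" for a c d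
        using that by (simp add: ennreal_mult)
      moreover have "0 \<le> (\<Prod>i\<in>?I. \<rho> (X i))" by (intro prod_nonneg ballI \<rho>_nonneg)
      moreover have "0 \<le> W X * (\<Prod>j\<in>?I. q (X j)) * e X"
        using W0[of X] q0 by (intro mult_nonneg_nonneg prod_nonneg ballI) (simp_all only: e_def exp_ge_zero)
      ultimately show ?thesis unfolding G_def using gibbs_factor_pos[of n] less_imp_le by metis
    qed
    also have "gibbs_factor n * ((\<Prod>i\<in>?I. \<rho> (X i)) * (W X * (\<Prod>j\<in>?I. q (X j)) * e X))
      = (gibbs_factor n * (\<Prod>i\<in>?I. \<rho> (X i)) * (\<Prod>j\<in>?I. q (X j))) * W X * e X" by (simp only: mult_ac)
    also have "\<dots> = (\<Prod>j\<in>?I. boltzmann (X j)) * W X * e X" unfolding prodeq ..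
    also have "ennreal \<dots> = exp_neg (gibbs_energy V ?b (Suc n) X) * ennreal (e X)"
      unfolding exp_neg_gibbs_energy[OF b] W_def[symmetric] by (rule ennreal_mult'') (simp add: e_def)
    finally show "ennreal (gibbs_factor n) * ((\<Prod>i\<in>?I. ennreal (\<rho> (X i))) * G X) = exp_neg (gibbs_energy V ?b (Suc n) X) * ennreal (e X)" .
  qed
  finally show ?thesis by (simp only: e_def)
qed

lemma exp_neg_gibbs_energy_measurable:
  "(\<lambda>X. exp_neg (gibbs_energy V (\<beta> N) N X)) \<in> borel_measurable (\<Pi>\<^sub>M j\<in>{1..N}. lborel)"
proof (cases N)
  \<comment> \<open>The sign of \<open>\<beta> 0\<close> is unknown, but the energy of the empty
    configuration is 0 for any value of it.\<close>
  case 0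
  then show ?thesis by (simp add: gibbs_energy_def)
next
  case (Suc n)
  then have b: "0 < \<beta> N" by (intro \<beta>_pos) simp
  show ?thesis unfolding exp_neg_gibbs_energy[OF b] by measurable
qed

lemma gibbs_partition_eq: "gibbs_partition V (\<beta> (Suc n)) (Suc n) = ennreal (gibbs_factor n) * mu.gibbs_mass n (\<lambda>_ _. 0)"
  using gibbs_integral[of "\<lambda>_. 0" n] by (simp add: gibbs_partition_def)

lemma gibbs_partition_pos_finite: "0 < gibbs_partition V (\<beta> N) N" "gibbs_partition V (\<beta> N) N < \<infinity>"
proof -
  have "0 < gibbs_partition V (\<beta> N) N \<and> gibbs_partition V (\<beta> N) N < \<infinity>"
  proof (cases N)
    case 0
    have "gibbs_partition V (\<beta> N) N = 1"
      unfolding 0 gibbs_partition_def gibbs_energy_def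
      by (simp add: exp_neg_def zero_ereal_def[symmetric] PiM_empty) (simp add: exp_neg_def zero_ereal_def)
    then show ?thesis by simp
  next
    case (Suc n)
    then show ?thesis
      using mu.gibbs_mass_pos_finite[of n] gibbs_factor_pos[of n]
      by (simp add: gibbs_partition_eq ennreal_zero_less_mult_iff ennreal_mult_less_top)
  qed
  then show "0 < gibbs_partition V (\<beta> N) N" "gibbs_partition V (\<beta> N) N < \<infinity>" by auto
qed

lemma gibbs_density_measurable[measurable]:
  "(\<lambda>X. exp_neg (gibbs_energy V (\<beta> N) N X) / gibbs_partition V (\<beta> N) N) \<in> borel_measurable (\<Pi>\<^sub>M j\<in>{1..N}. lborel)"
  unfolding divide_ennreal_def
  by (intro borel_measurable_times_ennreal exp_neg_gibbs_energy_measurable borel_measurable_const)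

lemma point_process_rescaled: "point_process (gibbs_measure V (\<beta> N) N) (rescaled_process E N)"
  unfolding point_process_def
proof (intro conjI ballI impI)
  show "prob_space (gibbs_measure V (\<beta> N) N)"
  proof (rule prob_spaceI)
    have "emeasure (gibbs_measure V (\<beta> N) N) (space (gibbs_measure V (\<beta> N) N))
       = (\<integral>\<^sup>+X. exp_neg (gibbs_energy V (\<beta> N) N X) / gibbs_partition V (\<beta> N) N \<partial>(\<Pi>\<^sub>M j\<in>{1..N}. lborel))"
    proof -
      have "emeasure (gibbs_measure V (\<beta> N) N) (space (gibbs_measure V (\<beta> N) N))
        = (\<integral>\<^sup>+X. exp_neg (gibbs_energy V (\<beta> N) N X) / gibbs_partition V (\<beta> N) N * indicator (space (\<Pi>\<^sub>M j\<in>{1..N}. lborel)) X \<partial>(\<Pi>\<^sub>M j\<in>{1..N}. lborel))"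
        unfolding gibbs_measure_def space_density by (rule emeasure_density[OF gibbs_density_measurable sets.top])
      also have "\<dots> = (\<integral>\<^sup>+X. exp_neg (gibbs_energy V (\<beta> N) N X) / gibbs_partition V (\<beta> N) N \<partial>(\<Pi>\<^sub>M j\<in>{1..N}. lborel))"
        by (rule nn_integral_cong) (simp only: indicator_simps mult_1_right)
      finally show ?thesis .
    qed
    also have "\<dots> = gibbs_partition V (\<beta> N) N / gibbs_partition V (\<beta> N) N"
      unfolding gibbs_partition_def by (rule nn_integral_divide[OF exp_neg_gibbs_energy_measurable])
    also have "\<dots> = 1" using gibbs_partition_pos_finite[of N] by (simp add: ennreal_divide_self)
    finally show "emeasure (gibbs_measure V (\<beta> N) N) (space (gibbs_measure V (\<beta> N) N)) = 1" .
  qed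
  show "sets (rescaled_process E N X) = sets borel" for X by (simp add: rescaled_process_def)
  fix B :: "'a set" assume B[measurable]: "B \<in> sets borel"
  show "\<exists>k::nat. emeasure (rescaled_process E N X) B = of_nat k" for X by (rule emeasure_rescaled_process(2)[OF B])
  show "(\<lambda>X. emeasure (rescaled_process E N X) B) \<in> borel_measurable (gibbs_measure V (\<beta> N) N)"
    unfolding emeasure_rescaled_process(1)[OF B] gibbs_measure_def by measurable
qed

lemma laplace_functional_gibbs:
  fixes f :: "'a \<Rightarrow> real" and E :: 'a
  assumes f[measurable]: "f \<in> borel_measurable borel"
  defines "h \<equiv> \<lambda>n x. f (real (Suc n) powr (1 / real DIM('a)) *\<^sub>R (x - E))"
  shows "laplace_functional (gibbs_measure V (\<beta> (Suc n)) (Suc n)) (rescaled_process E (Suc n)) f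
    = enn2real (mu.gibbs_mass n (\<lambda>_. h n)) / enn2real (mu.gibbs_mass n (\<lambda>_ _. 0))"
proof -
  let ?I = "{1..Suc n}" and ?N = "Suc n"
  let ?Z = "gibbs_partition V (\<beta> ?N) ?N"
  have [measurable]: "h n \<in> borel_measurable borel" unfolding h_def by measurable
  have int: "(\<integral>x. f x \<partial>rescaled_process E ?N X) = (\<Sum>j\<in>?I. h n (X j))" for X
    unfolding h_def by (rule integral_rescaled_process[OF f])
  have em: "(\<lambda>X. ennreal (exp (- (\<Sum>j\<in>?I. h n (X j))))) \<in> borel_measurable (\<Pi>\<^sub>M j\<in>?I. lborel)" by measurable
  have "(\<integral>\<^sup>+X. ennreal (exp (- (\<Sum>j\<in>?I. h n (X j)))) \<partial>gibbs_measure V (\<beta> ?N) ?N)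
     = (\<integral>\<^sup>+X. exp_neg (gibbs_energy V (\<beta> ?N) ?N X) / ?Z * ennreal (exp (- (\<Sum>j\<in>?I. h n (X j)))) \<partial>(\<Pi>\<^sub>M j\<in>?I. lborel))"
    unfolding gibbs_measure_def by (rule nn_integral_density[OF gibbs_density_measurable em])
  also have "\<dots> = (\<integral>\<^sup>+X. exp_neg (gibbs_energy V (\<beta> ?N) ?N X) * ennreal (exp (- (\<Sum>j\<in>?I. h n (X j)))) / ?Z \<partial>(\<Pi>\<^sub>M j\<in>?I. lborel))"
    by (intro nn_integral_cong) (simp add: divide_ennreal_def mult_ac)
  also have "\<dots> = (\<integral>\<^sup>+X. exp_neg (gibbs_energy V (\<beta> ?N) ?N X) * ennreal (exp (- (\<Sum>j\<in>?I. h n (X j)))) \<partial>(\<Pi>\<^sub>M j\<in>?I. lborel)) / ?Z"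
    by (rule nn_integral_divide) (intro borel_measurable_times_ennreal em exp_neg_gibbs_energy_measurable)
  also have "\<dots> = ennreal (gibbs_factor n) * mu.gibbs_mass n (\<lambda>_. h n) / ?Z"
    by (subst gibbs_integral) auto
  finally have nn: "(\<integral>\<^sup>+X. ennreal (exp (- (\<Sum>j\<in>?I. h n (X j)))) \<partial>gibbs_measure V (\<beta> ?N) ?N) = ennreal (gibbs_factor n) * mu.gibbs_mass n (\<lambda>_. h n) / ?Z" .
  have "laplace_functional (gibbs_measure V (\<beta> ?N) ?N) (rescaled_process E ?N) f
     = enn2real (\<integral>\<^sup>+X. ennreal (exp (- (\<Sum>j\<in>?I. h n (X j)))) \<partial>gibbs_measure V (\<beta> ?N) ?N)"
  proof -
    have "(\<lambda>X. exp (- (\<Sum>j\<in>?I. h n (X j)))) \<in> borel_measurable (gibbs_measure V (\<beta> ?N) ?N)" unfolding gibbs_measure_def by measurable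
    then show ?thesis unfolding laplace_functional_def int by (intro integral_eq_nn_integral) auto
  qed
  also have "\<dots> = enn2real (mu.gibbs_mass n (\<lambda>_. h n)) / enn2real (mu.gibbs_mass n (\<lambda>_ _. 0))"
  proof -
    obtain m where m: "mu.gibbs_mass n (\<lambda>_ _. 0) = ennreal m" "0 < m"
      using mu.gibbs_mass_pos_finite[of n] by (cases "mu.gibbs_mass n (\<lambda>_ _. 0)") auto
    define k where "k = gibbs_factor n"
    have k: "0 < k" using gibbs_factor_pos[of n] by (simp add: k_def)
    have "enn2real (ennreal k * a / (ennreal k * ennreal m)) = enn2real a / m" for a
      using k m(2) by (cases a) (simp_all add: ennreal_mult[symmetric] divide_ennreal ennreal_mult_top ennreal_top_divide)
    then show ?thesis unfolding nn gibbs_partition_eq m(1) k_def[symmetric] using m(2) by simp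
  qed
  finally show ?thesis .
qed

text \<open>The Boltzmann factor is continuous and positive on the open region, and the potential of
  a tame measure is continuous everywhere.\<close>

lemma isCont_density:
  assumes "E \<in> finite_region V" shows "isCont \<rho> E" "0 < \<rho> E"
proof -
  have "isCont boltzmann E" using continuous_boltzmann region_open assms by (simp add: continuous_on_eq_continuous_at)
  then have "isCont (\<lambda>x. boltzmann x * exp (\<gamma> * mu.pot x) / Z) E" using Z_pos mu.isCont_pot[of E] by (intro continuous_intros) auto
  moreover have "(\<lambda>x. boltzmann x * exp (\<gamma> * mu.pot x) / Z) = \<rho>" by (rule ext) (rule \<rho>_eq[symmetric])
  ultimately show "isCont \<rho> E" by simp
  show "0 < \<rho> E" by (subst \<rho>_eq) (use Z_pos assms in \<open>simp add: boltzmann_def\<close>)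
qed

lemma laplace_functional_tendsto:
  fixes f :: "'a \<Rightarrow> real"
  assumes E: "E \<in> finite_region V" and f: "f \<in> test_functions"
  shows "(\<lambda>N. laplace_functional (gibbs_measure V (\<beta> N) N) (rescaled_process E N) f)
    \<longlonglongrightarrow> exp (\<rho> E * (\<integral>x. (exp (- f x) - 1) \<partial>lborel))"
proof -
  have fc: "continuous_on UNIV f" and f0: "\<And>x. 0 \<le> f x" and fK: "compact (closure {x. f x \<noteq> 0})"
    using f by (auto simp: test_functions_def)
  have [measurable]: "f \<in> borel_measurable borel" using fc by (rule borel_measurable_continuous_onI)
  define h where "h n x = f (real (Suc n) powr (1 / real DIM('a)) *\<^sub>R (x - E))" for n x
  have [measurable]: "h n \<in> borel_measurable borel" for n unfolding h_def by measurable
  have h0: "0 \<le> h n x" for n x by (simp add: h_def f0)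
  have \<rho>_bd: "\<bar>\<rho> x\<bar> \<le> C" for x using \<rho>_nonneg[of x] \<rho>_le[of x] by simp
  have intmu: "(\<integral>x. g x \<partial>\<mu>) = (\<integral>x. \<rho> x * g x \<partial>lborel)" if [measurable]: "g \<in> borel_measurable borel" for g :: "'a \<Rightarrow> real"
    using \<rho>_nonneg by (subst integral_density) auto
  obtain K where K: "\<And>x. f x \<noteq> 0 \<Longrightarrow> norm x \<le> K"
  proof -
    have "bounded {x. f x \<noteq> 0}" using fK compact_imp_bounded bounded_subset[OF _ closure_subset] by blast
    then show ?thesis using that unfolding bounded_iff by auto
  qed
  obtain B where B: "\<And>x. f x \<le> B"
  proof -
    have "bounded (f ` closure {x. f x \<noteq> 0})" using fc fK by (intro compact_imp_bounded compact_continuous_image) (auto intro: continuous_on_subset)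
    then obtain B where B: "\<And>x. x \<in> closure {x. f x \<noteq> 0} \<Longrightarrow> \<bar>f x\<bar> \<le> B" unfolding bounded_iff by auto
    have "f x \<le> max 0 B" for x
      using B[of x] closure_subset[of "{x. f x \<noteq> 0}"] by (cases "f x = 0") (auto simp: le_max_iff_disj)
    then show ?thesis by (rule that)
  qed
  \<comment> \<open>The scaling factor is at least 1, so the supports of all rescaled functions lie
    in one ball, as the estimates for bounded \<open>z\<close> require.\<close>
  have supp: "norm x \<le> norm E + \<bar>K\<bar>" if "h n x \<noteq> 0" for n x
  proof -
    let ?s = "real (Suc n) powr (1 / real DIM('a))"
    have s: "1 \<le> ?s" by (intro ge_one_powr_ge_zero) auto
    have "norm (?s *\<^sub>R (x - E)) \<le> K" using K[of "?s *\<^sub>R (x - E)"] that by (simp add: h_def)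
    then have "?s * norm (x - E) \<le> K" by simp
    moreover have "1 * norm (x - E) \<le> ?s * norm (x - E)" using s by (intro mult_right_mono) auto
    ultimately show ?thesis using norm_triangle_sub[of x E] by linarith
  qed
  have ih: "integrable \<mu> (h n)" for n
    by (rule mu.integrable_const_bound[of _ B]) (use B h0 in \<open>auto simp: h_def f0\<close>)
  note cont = isCont_density[OF E]
  have limf: "(\<lambda>n. real (Suc n) * (\<integral>x. h n x \<partial>\<mu>)) \<longlonglongrightarrow> \<rho> E * (\<integral>x. f x \<partial>lborel)"
    using scaled_integral_tendsto[OF fc fK \<rho>_meas \<rho>_bd cont(1)] by (simp add: intmu h_def)
  have limphi: "(\<lambda>n. real (Suc n) * (\<integral>x. 1 - exp (- h n x) \<partial>\<mu>)) \<longlonglongrightarrow> \<rho> E * (\<integral>x. 1 - exp (- f x) \<partial>lborel)"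
  proof -
    have c: "continuous_on UNIV (\<lambda>x. 1 - exp (- f x))" using fc by (intro continuous_intros)
    have "{x. 1 - exp (- f x) \<noteq> 0} = {x. f x \<noteq> 0}" by auto
    then have k: "compact (closure {x. 1 - exp (- f x) \<noteq> 0})" using fK by simp
    show ?thesis using scaled_integral_tendsto[OF c k \<rho>_meas \<rho>_bd cont(1)] by (simp add: intmu h_def)
  qed
  \<comment> \<open>A convergent sequence is bounded; \<open>D\<close> is the bound, independent of
    n, on the total mean of the functions switched on.\<close>
  obtain D where D: "\<And>n. real (Suc n) * (\<integral>x. h n x \<partial>\<mu>) \<le> D"
  proof -
    have "Bseq (\<lambda>n. real (Suc n) * (\<integral>x. h n x \<partial>\<mu>))" using limf by (intro convergent_imp_Bseq convergentI)
    then show ?thesis unfolding Bseq_def using that by (auto simp: abs_le_iff)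
  qed
  have lim: "(\<lambda>n. enn2real (mu.gibbs_mass n (\<lambda>_. h n)) / enn2real (mu.gibbs_mass n (\<lambda>_ _. 0)))
     \<longlonglongrightarrow> exp (- (\<rho> E * (\<integral>x. 1 - exp (- f x) \<partial>lborel)))"
    by (rule mu.gibbs_mass_ratio_tendsto[where R="norm E + \<bar>K\<bar>" and C=D]) (use h0 ih supp D limphi in auto)
  have neg: "- (\<rho> E * (\<integral>x. 1 - exp (- f x) \<partial>lborel)) = \<rho> E * (\<integral>x. (exp (- f x) - 1) \<partial>lborel)"
  proof -
    have "(\<integral>x. 1 - exp (- f x) \<partial>lborel) = (\<integral>x. - (exp (- f x) - 1) \<partial>lborel)" by simp
    also have "\<dots> = - (\<integral>x. (exp (- f x) - 1) \<partial>lborel)" by (rule Bochner_Integration.integral_minus)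
    finally show ?thesis by simp
  qed
  have "(\<lambda>n. laplace_functional (gibbs_measure V (\<beta> (Suc n)) (Suc n)) (rescaled_process E (Suc n)) f)
     \<longlonglongrightarrow> exp (\<rho> E * (\<integral>x. (exp (- f x) - 1) \<partial>lborel))"
  proof -
    have "h n = (\<lambda>x. f (real (Suc n) powr (1 / real DIM('a)) *\<^sub>R (x - E)))" for n by (simp add: h_def fun_eq_iff)
    then have "laplace_functional (gibbs_measure V (\<beta> (Suc n)) (Suc n)) (rescaled_process E (Suc n)) f
       = enn2real (mu.gibbs_mass n (\<lambda>_. h n)) / enn2real (mu.gibbs_mass n (\<lambda>_ _. 0))" for n
      using laplace_functional_gibbs[of f n E] by simp
    then have "(\<lambda>n. laplace_functional (gibbs_measure V (\<beta> (Suc n)) (Suc n)) (rescaled_process E (Suc n)) f)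
       = (\<lambda>n. enn2real (mu.gibbs_mass n (\<lambda>_. h n)) / enn2real (mu.gibbs_mass n (\<lambda>_ _. 0)))" by (rule ext)
    then show ?thesis using lim by (simp only: neg)
  qed
  then show ?thesis by (rule LIMSEQ_imp_Suc)
qed

end

theorem corollary1p6:
  fixes V :: "real ^ 'n::finite \<Rightarrow> ereal"
    and \<beta> :: "nat \<Rightarrow> real" and \<gamma> :: real and E :: "real ^ 'n"
  assumes dim: "CARD('n) \<in> {1, 2}"
    and V_not_MInf: "\<And>x. V x \<noteq> -\<infinity>"
    and region_open: "open (finite_region V)"
    and region_nonempty: "finite_region V \<noteq> {}"
    and V_cont: "continuous_on (finite_region V) V"
    and V_growth: "\<And>\<kappa>::real. \<kappa> \<ge> 0 \<Longrightarrow>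
          (INF x\<in>finite_region V. V x - ereal (\<kappa> * log_weight x)) > -\<infinity>"
    and V_moments: "\<And>\<kappa>::real. \<kappa> \<ge> 0 \<Longrightarrow>
          (\<integral>\<^sup>+x. ennreal (norm x powr \<kappa>) * exp_neg (V x) \<partial>lborel) < \<infinity>"
    and \<beta>_pos: "\<And>N. N \<ge> 1 \<Longrightarrow> \<beta> N > 0"
    and \<gamma>_nonneg: "\<gamma> \<ge> 0"
    and \<beta>_lim: "(\<lambda>N. real N * \<beta> N) \<longlonglongrightarrow> \<gamma>"
    and E_in: "E \<in> finite_region V"
  shows "\<exists>(M :: (real ^ 'n) measure measure) \<Xi> :: (real ^ 'n) measure \<Rightarrow> (real ^ 'n) measure.
           homogeneous_poisson_process M \<Xi> \<and>
           converges_in_distribution (\<lambda>N. gibbs_measure V (\<beta> N) N) (rescaled_process E) M \<Xi>"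
proof -
  interpret confining_potential V
    by (rule confining_potential.intro) fact+
  obtain \<rho> Z C where \<rho>: "\<rho> \<in> borel_measurable borel" "\<And>x. 0 \<le> \<rho> x" "\<And>x. \<rho> x \<le> C" "0 < Z"
    "tame_measure (density lborel (\<lambda>u. ennreal (\<rho> u)))"
    "\<And>x. \<rho> x = boltzmann x * exp (\<gamma> * tame_measure.pot (density lborel (\<lambda>u. ennreal (\<rho> u))) x) / Z"
    by (rule equilibrium_measure_exists[OF \<gamma>_nonneg]) blast
  interpret gibbs_equilibrium V \<beta> \<gamma> \<rho> Z C
    by (intro gibbs_equilibrium.intro gibbs_equilibrium_axioms.intro confining_potential_axioms) fact+
  \<comment> \<open>The limit process has intensity \<open>\<rho> E\<close>, which is positive
    because \<open>E\<close> lies in the region.\<close>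
  obtain M :: "(real ^ 'n) measure measure" where M: "homogeneous_poisson_process M (\<lambda>m. m)"
    "\<And>f :: real ^ 'n \<Rightarrow> real. f \<in> test_functions \<Longrightarrow> laplace_functional M (\<lambda>m. m) f = exp (\<rho> E * (\<integral>x. (exp (- f x) - 1) \<partial>lborel))"
    using homogeneous_poisson_process_exists[OF isCont_density(2)[OF E_in]] by metis
  have "converges_in_distribution (\<lambda>N. gibbs_measure V (\<beta> N) N) (rescaled_process E) M (\<lambda>m. m)"
    unfolding converges_in_distribution_def
    using point_process_rescaled laplace_functional_tendsto[OF E_in] M by (auto simp: homogeneous_poisson_process_def)
  then show ?thesis using M(1) by blast
qed

end
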